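(* Let $\alpha\in\mathopen]0,1[$, $q\in\mathbb{D}^+_n(\mathbb{R})$, $\eta\in\mathbb{R}^n$, $k\in\mathbb{C}$. Let $\Omega$ be a bounded open connected subset of $\mathbb{R}^n$ of class $C^{1,\alpha}$ such that $\mathbb{R}^n\setminus\overline{\Omega}$ is connected. Let $p\in Q$ and let $\epsilon_0\in\mathopen]0,+\infty[$ be such that $p+\epsilon\overline{\Omega}\subseteq Q$ for all $\epsilon\in\mathopen]-\epsilon_0,\epsilon_0[$. Let $V$ be a bounded open subset of $\mathbb{R}^n$ such that $\overline{V}\cap(p+q\mathbb{Z}^n)=\emptyset$. Let $\epsilon_V\in\mathopen]0,\epsilon_0[$ be such that $\overline{V}\subseteq\mathbb{S}_q^-[\Omega_{p,\epsilon}]$ for all $\epsilon\in\mathopen]-\epsilon_V,\epsilon_V[$. Let $P$ be the map from $\mathopen]-\epsilon_V,\epsilon_V[$ to $\mathcal{L}(C^{1,\alpha}(\partial\Omega),C^2(\overline{V}))$ defined by $$P[\epsilon](\theta)(x):=-\int_{\partial\Omega}\nu_\Omega(s)\cdot\nabla G^{k}_{q,\eta}(x-p-\epsilon s)\theta(s)\,d\sigma_s\qquad\forall x\in\overline{V},$$ for all $\theta\in C^{1,\alpha}(\partial\Omega)$ and $\epsilon\in\mathopen]-\epsilon_V,\epsilon_V[$. Then $P$ is real analytic and $$\mathcal{D}^{k,-}_{q,\eta}[\partial\Omega_{p,\epsilon},\theta((\cdot-p)/\epsilon)](x)=\epsilon^{n-1}P[\epsilon](\theta)(x)\qquad\forall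 x\in\overline{V},$$ for all $\theta\in C^{1,\alpha}(\partial\Omega)$ and $\epsilon\in\mathopen]0,\epsilon_V[$.
   Context: Let $n\in\mathbb{N}$, $n\ge 2$. $\mathbb{D}^+_n(\mathbb{R})$ is the set of $n\times n$ real diagonal matrices with positive diagonal entries. For $q\in\mathbb{D}^+_n(\mathbb{R})$ with diagonal entries $q_{11},\dots,q_{nn}$, let $Q:=\prod_{j=1}^n\mathopen]0,q_{jj}[$ and $|Q|_n$ its $n$-dimensional measure. Functions are complex-valued; $C^{m,\alpha}$ are the usual Schauder spaces; $C^2(\overline V)$ is the Banach space of $C^2$ functions in $V$ whose derivatives up to order two extend continuously to $\overline V$; $\mathcal{L}(X,Y)$ is the Banach space of bounded linear operators from $X$ to $Y$. $\Omega_{p,\epsilon}:=p+\epsilon\Omega$ for $\epsilon\in\mathbb{R}$; $\nu_D$ is the outward unit normal to $\partial D$. For $D\subseteq\mathbb{R}^n$: $\mathbb{S}_q[D]:=\bigcup_{z\in\mathbb{Z}^n}(qz+D)$ and $\mathbb{S}^-_q[D]:=\mathbb{R}^n\setminus\overline{\mathbb{S}_q[D]}$. $Z_{q,\eta}(k):=\{z\in\mathbb{Z}^n:k^2=|2\pi q^{-1}z+\eta|^2\}$ and $$G^{k}_{q,\eta}:=\sum_{z\in\mathbb{Z}^n\setminus Z_{q,\eta}(k)}\frac{1}{|Q|_n(k^2-|2\pi q^{-1}z+\eta|^2)}e^{ix\cdot(2\pi q^{-1}z+\eta)}$$ (series converging in $\mathcal{S}'(\mathbb{R}^n)$), a locally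 integrable function, real analytic on $\mathbb{R}^n\setminus q\mathbb{Z}^n$. For a bounded open set $D$ of class $C^{1,\alpha}$ with $\overline D\subseteq Q$ and a density $\mu\in C^{1,\alpha}(\partial D)$, $\mathcal{D}^{k}_{q,\eta}[\partial D,\mu](x):=-\int_{\partial D}\nu_D(y)\cdot\nabla G^{k}_{q,\eta}(x-y)\mu(y)\,d\sigma_y$ for $x\in\mathbb{R}^n$, and $\mathcal{D}^{k,-}_{q,\eta}[\partial D,\mu]$ is the continuous extension to $\overline{\mathbb{S}^-_q[D]}$ of the restriction of $\mathcal{D}^{k}_{q,\eta}[\partial D,\mu]$ to $\mathbb{S}^-_q[D]$. *)

theory Defs
  imports "HOL-Analysis.Analysis"
begin

section \<open>Partial derivatives and function spaces\<close>

definition partial :: "'n::finite \<Rightarrow> (real^'n \<Rightarrow> 'b::real_normed_vector) \<Rightarrow> real^'n \<Rightarrow> 'b" where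
  "partial i f x = frechet_derivative f (at x) (axis i 1)"

definition grad :: "(real^'n::finite \<Rightarrow> real) \<Rightarrow> real^'n \<Rightarrow> real^'n" where
  "grad f x = (\<chi> i. partial i f x)"

fun iter_partial :: "'n::finite list \<Rightarrow> (real^'n \<Rightarrow> complex) \<Rightarrow> real^'n \<Rightarrow> complex" where
  "iter_partial [] f = f"
| "iter_partial (i # is) f = partial i (iter_partial is f)"

text \<open>Inserting 0 only matters for the empty index set, where the supremum of reals is unspecified.\<close>

definition sup_norm :: "'a set \<Rightarrow> ('a \<Rightarrow> 'b::real_normed_vector) \<Rightarrow> real" where
  "sup_norm S f = Sup (insert 0 ((\<lambda>x. norm (f x)) ` S))"

definition hoelder_on :: "real \<Rightarrow> 'a::metric_space set \<Rightarrow> ('a \<Rightarrow> 'b::real_normed_vector) \<Rightarrow> bool" where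
  "hoelder_on \<alpha> S f \<longleftrightarrow> (\<exists>C. \<forall>x\<in>S. \<forall>y\<in>S. norm (f x - f y) \<le> C * dist x y powr \<alpha>)"

definition hoelder_seminorm :: "real \<Rightarrow> 'a::metric_space set \<Rightarrow> ('a \<Rightarrow> 'b::real_normed_vector) \<Rightarrow> real" where
  "hoelder_seminorm \<alpha> S f =
     Sup (insert 0 {norm (f x - f y) / dist x y powr \<alpha> | x y. x \<in> S \<and> y \<in> S \<and> x \<noteq> y})"

text \<open>
  The Schauder space \<open>C\<^sup>1\<^sup>,\<^sup>\<alpha>\<close> of the closure of a bounded convex open set \<open>U\<close>, and its norm.
  Hoelder continuous first derivatives on such a \<open>U\<close> are bounded and, like the function itself, extend
  continuously to the closure, so that only values on \<open>U\<close> need to be considered.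
\<close>

definition C1a :: "real \<Rightarrow> (real^'n::finite) set \<Rightarrow> (real^'n \<Rightarrow> 'b::real_normed_vector) \<Rightarrow> bool" where
  "C1a \<alpha> U f \<longleftrightarrow> (\<forall>x\<in>U. f differentiable (at x)) \<and> (\<forall>i. hoelder_on \<alpha> U (partial i f))"

definition C1a_norm :: "real \<Rightarrow> (real^'n::finite) set \<Rightarrow> (real^'n \<Rightarrow> 'b::real_normed_vector) \<Rightarrow> real" where
  "C1a_norm \<alpha> U f = sup_norm U f + (\<Sum>i\<in>UNIV. sup_norm U (partial i f))
     + (\<Sum>i\<in>UNIV. hoelder_seminorm \<alpha> U (partial i f))"

text \<open>
  The space \<open>C\<^sup>2\<close> of the closure of \<open>V\<close>. A function on a subset of \<open>\<real>\<^sup>n\<close> is represented by its extension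
  by zero, so that a function space on that subset becomes a genuine linear space of total functions;
  the same convention is used for functions on boundaries below.
\<close>

definition extends_to_closure :: "(real^'n::finite) set \<Rightarrow> (real^'n \<Rightarrow> complex) \<Rightarrow> bool" where
  "extends_to_closure V f \<longleftrightarrow> (\<exists>h. continuous_on (closure V) h \<and> (\<forall>x\<in>V. h x = f x))"

definition C2_closure :: "(real^'n::finite) set \<Rightarrow> (real^'n \<Rightarrow> complex) set" where
  "C2_closure V = {u. (\<forall>x. x \<notin> closure V \<longrightarrow> u x = 0)
     \<and> continuous_on (closure V) u
     \<and> (\<forall>x\<in>V. u differentiable (at x))
     \<and> (\<forall>i. \<forall>x\<in>V. partial i u differentiable (at x))
     \<and> (\<forall>i. extends_to_closure V (partial i u))
     \<and> (\<forall>i j. extends_to_closure V (partial j (partial i u)))}"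

definition C2_norm :: "(real^'n::finite) set \<Rightarrow> (real^'n \<Rightarrow> complex) \<Rightarrow> real" where
  "C2_norm V u = sup_norm V u + (\<Sum>i\<in>UNIV. sup_norm V (partial i u))
     + (\<Sum>i\<in>UNIV. \<Sum>j\<in>UNIV. sup_norm V (partial j (partial i u)))"


section \<open>Domains of class \<open>C\<^sup>1\<^sup>,\<^sup>\<alpha>\<close>, and Schauder functions on their boundary\<close>

text \<open>
  \<open>D\<close> is, in a cylinder around \<open>x\<close> with axis \<open>e\<close>, the strict hypograph of \<open>\<gamma>\<close>. A function of \<open>n - 1\<close>
  variables on the disc of radius \<open>r\<close> in the hyperplane orthogonal to \<open>e\<close> is represented by a function
  on \<open>\<real>\<^sup>n\<close> that is constant in direction \<open>e\<close>. The orthogonal projection maps \<open>ball 0 r\<close> onto the disc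
  and does not increase distances, so \<open>C1a\<close> and the norms on the ball are those on the disc.
\<close>

definition hproj :: "real^'n::finite \<Rightarrow> real^'n \<Rightarrow> real^'n" where
  "hproj e v = v - (v \<bullet> e) *\<^sub>R e"

type_synonym 'n chart = "(real^'n) \<times> (real^'n) \<times> real \<times> (real^'n \<Rightarrow> real)"

definition is_chart :: "real \<Rightarrow> (real^'n::finite) set \<Rightarrow> 'n chart \<Rightarrow> bool" where
  "is_chart \<alpha> D = (\<lambda>(x, e, r, \<gamma>). norm e = 1 \<and> r > 0
     \<and> (\<forall>v. \<gamma> v = \<gamma> (hproj e v)) \<and> C1a \<alpha> (ball 0 r) \<gamma> \<and> \<gamma> 0 = 0
     \<and> (\<exists>\<delta>>0. (\<forall>v. norm (hproj e v) < r \<longrightarrow> \<bar>\<gamma> v\<bar> < \<delta>)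
          \<and> (\<forall>v. norm (hproj e v) < r \<and> \<bar>v \<bullet> e\<bar> < \<delta> \<longrightarrow> (x + v \<in> D \<longleftrightarrow> v \<bullet> e < \<gamma> v))))"

definition chart_base :: "'n::finite chart \<Rightarrow> real^'n" where
  "chart_base = (\<lambda>(x, e, r, \<gamma>). x)"

definition chart_ball :: "'n::finite chart \<Rightarrow> (real^'n) set" where
  "chart_ball = (\<lambda>(x, e, r, \<gamma>). ball 0 r)"

definition chart_map :: "'n::finite chart \<Rightarrow> real^'n \<Rightarrow> real^'n" where
  "chart_map = (\<lambda>(x, e, r, \<gamma>) v. x + hproj e v + \<gamma> v *\<^sub>R e)"

definition of_class_C1a :: "real \<Rightarrow> (real^'n::finite) set \<Rightarrow> bool" where
  "of_class_C1a \<alpha> D \<longleftrightarrow> open D \<and> (\<forall>x\<in>frontier D. \<exists>c. is_chart \<alpha> D c \<and> chart_base c = x)"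

definition C1a_boundary :: "real \<Rightarrow> (real^'n::finite) set \<Rightarrow> (real^'n \<Rightarrow> complex) set" where
  "C1a_boundary \<alpha> D = {\<theta>. (\<forall>x. x \<notin> frontier D \<longrightarrow> \<theta> x = 0)
     \<and> (\<forall>c. is_chart \<alpha> D c \<longrightarrow> C1a \<alpha> (chart_ball c) (\<theta> \<circ> chart_map c))}"

text \<open>
  The norm on \<open>C\<^sup>1\<^sup>,\<^sup>\<alpha>(\<partial>D)\<close> is taken with respect to a fixed finite atlas; such an atlas exists when the
  boundary is compact, and different choices give equivalent norms.
\<close>

definition is_atlas :: "real \<Rightarrow> (real^'n::finite) set \<Rightarrow> 'n chart set \<Rightarrow> bool" where
  "is_atlas \<alpha> D A \<longleftrightarrow> finite A \<and> (\<forall>c\<in>A. is_chart \<alpha> D c)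
     \<and> frontier D \<subseteq> (\<Union>c\<in>A. chart_map c ` chart_ball c)"

definition atlas :: "real \<Rightarrow> (real^'n::finite) set \<Rightarrow> 'n chart set" where
  "atlas \<alpha> D = (SOME A. is_atlas \<alpha> D A)"

definition C1a_boundary_norm :: "real \<Rightarrow> (real^'n::finite) set \<Rightarrow> (real^'n \<Rightarrow> complex) \<Rightarrow> real" where
  "C1a_boundary_norm \<alpha> D \<theta> = Max (insert 0 ((\<lambda>c. C1a_norm \<alpha> (chart_ball c) (\<theta> \<circ> chart_map c)) ` atlas \<alpha> D))"

text \<open>
  The outward unit normal, defined by means of a local \<open>C\<^sup>1\<close> defining function \<open>\<phi>\<close> of \<open>D\<close>
  (for instance \<open>v \<bullet> e - \<gamma> v\<close> in a chart).
\<close>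

definition outward_normal :: "(real^'n::finite) set \<Rightarrow> real^'n \<Rightarrow> real^'n" where
  "outward_normal D x = (THE \<nu>. \<exists>\<phi> r. r > 0
     \<and> (\<forall>y\<in>ball x r. \<phi> differentiable (at y)) \<and> continuous_on (ball x r) (grad \<phi>)
     \<and> \<phi> x = 0 \<and> grad \<phi> x \<noteq> 0 \<and> (\<forall>y\<in>ball x r. y \<in> D \<longleftrightarrow> \<phi> y < 0)
     \<and> \<nu> = grad \<phi> x /\<^sub>R norm (grad \<phi> x))"

text \<open>
  The surface measure \<open>d\<sigma>\<close>: the \<open>(n-1)\<close>-dimensional Hausdorff measure on \<open>\<real>\<^sup>n\<close>, normalised so that it
  coincides with Lebesgue measure on hyperplanes. It is only used for \<open>n \<ge> 2\<close>, when covering sets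
  that are empty contribute 0.
\<close>

definition surface_premeasure :: "real \<Rightarrow> (real^'n::finite) set \<Rightarrow> ennreal" where
  "surface_premeasure \<delta> A =
     (INF C \<in> {C :: nat \<Rightarrow> (real^'n) set. A \<subseteq> (\<Union>i. C i) \<and> (\<forall>i. bounded (C i) \<and> diameter (C i) \<le> \<delta>)}.
        \<Sum>i. ennreal (unit_ball_vol (real (CARD('n) - 1)) * (diameter (C i) / 2) ^ (CARD('n) - 1)))"

definition surface_measure :: "(real^'n::finite) measure" where
  "surface_measure = measure_of UNIV (sets borel) (\<lambda>A. SUP \<delta>\<in>{0<..}. surface_premeasure \<delta> A)"


section \<open>Bounded operators and real analytic maps\<close>

text \<open>
  For complex normed spaces \<open>X\<close>, \<open>Y\<close> of functions with norms \<open>nX\<close>, \<open>nY\<close>: the bounded linear operators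
  and their norm. Only the values of an operator on \<open>X\<close> are relevant.
\<close>

definition bounded_ops ::
  "('a \<Rightarrow> complex) set \<Rightarrow> (('a \<Rightarrow> complex) \<Rightarrow> real) \<Rightarrow> ('b \<Rightarrow> complex) set \<Rightarrow> (('b \<Rightarrow> complex) \<Rightarrow> real)
     \<Rightarrow> (('a \<Rightarrow> complex) \<Rightarrow> ('b \<Rightarrow> complex)) set" where
  "bounded_ops X nX Y nY = {T. (\<forall>f\<in>X. T f \<in> Y)
     \<and> (\<forall>f\<in>X. \<forall>g\<in>X. T (\<lambda>x. f x + g x) = (\<lambda>y. T f y + T g y))
     \<and> (\<forall>c. \<forall>f\<in>X. T (\<lambda>x. c * f x) = (\<lambda>y. c * T f y))
     \<and> (\<exists>C. \<forall>f\<in>X. nY (T f) \<le> C * nX f)}"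

definition op_norm ::
  "('a \<Rightarrow> complex) set \<Rightarrow> (('a \<Rightarrow> complex) \<Rightarrow> real) \<Rightarrow> (('b \<Rightarrow> complex) \<Rightarrow> real)
     \<Rightarrow> (('a \<Rightarrow> complex) \<Rightarrow> ('b \<Rightarrow> complex)) \<Rightarrow> real" where
  "op_norm X nX nY T = Sup ((\<lambda>f. nY (T f)) ` {f \<in> X. nX f \<le> 1})"

definition real_analytic_ops ::
  "('a \<Rightarrow> complex) set \<Rightarrow> (('a \<Rightarrow> complex) \<Rightarrow> real) \<Rightarrow> ('b \<Rightarrow> complex) set \<Rightarrow> (('b \<Rightarrow> complex) \<Rightarrow> real)
     \<Rightarrow> real set \<Rightarrow> (real \<Rightarrow> ('a \<Rightarrow> complex) \<Rightarrow> ('b \<Rightarrow> complex)) \<Rightarrow> bool" where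
  "real_analytic_ops X nX Y nY I P \<longleftrightarrow>
     (\<forall>t\<in>I. P t \<in> bounded_ops X nX Y nY) \<and>
     (\<forall>t0\<in>I. \<exists>r>0. \<exists>A :: nat \<Rightarrow> ('a \<Rightarrow> complex) \<Rightarrow> ('b \<Rightarrow> complex).
        (\<forall>j. A j \<in> bounded_ops X nX Y nY) \<and>
        (\<forall>t\<in>I. \<bar>t - t0\<bar> < r \<longrightarrow>
           (\<lambda>N. op_norm X nX nY (\<lambda>f y. P t f y - (\<Sum>j<N. of_real ((t - t0) ^ j) * A j f y)))
             \<longlonglongrightarrow> 0))"

definition real_analytic_on :: "(real^'n::finite \<Rightarrow> complex) \<Rightarrow> (real^'n) set \<Rightarrow> bool" where
  "real_analytic_on f U \<longleftrightarrow>
     (\<forall>a\<in>U. \<exists>r>0. \<exists>c :: ('n \<Rightarrow> nat) \<Rightarrow> complex. \<forall>x\<in>ball a r.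
        ((\<lambda>\<beta>. c \<beta> * of_real (\<Prod>i\<in>UNIV. (x $ i - a $ i) ^ \<beta> i)) has_sum f x) UNIV)"


section \<open>Periodicity\<close>

definition pos_diagonal :: "(real^'n::finite^'n) set" where
  "pos_diagonal = {q. (\<forall>i j. i \<noteq> j \<longrightarrow> q $ i $ j = 0) \<and> (\<forall>i. q $ i $ i > 0)}"

definition of_int_vec :: "int^'n::finite \<Rightarrow> real^'n" where
  "of_int_vec z = (\<chi> i. of_int (z $ i))"

definition lattice :: "real^'n::finite^'n \<Rightarrow> (real^'n) set" where
  "lattice q = range (\<lambda>z. q *v of_int_vec z)"

definition cell :: "real^'n::finite^'n \<Rightarrow> (real^'n) set" where
  "cell q = {x. \<forall>i. 0 < x $ i \<and> x $ i < q $ i $ i}"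

definition periodic_union :: "real^'n::finite^'n \<Rightarrow> (real^'n) set \<Rightarrow> (real^'n) set" where
  "periodic_union q D = (\<Union>z. (\<lambda>y. q *v of_int_vec z + y) ` D)"

definition periodic_exterior :: "real^'n::finite^'n \<Rightarrow> (real^'n) set \<Rightarrow> (real^'n) set" where
  "periodic_exterior q D = - closure (periodic_union q D)"

definition rescaled :: "(real^'n::finite) set \<Rightarrow> real^'n \<Rightarrow> real \<Rightarrow> (real^'n) set" where
  "rescaled D p \<epsilon> = (\<lambda>s. p + \<epsilon> *\<^sub>R s) ` D"


section \<open>The quasi-periodic fundamental solution\<close>

definition frequency :: "real^'n::finite^'n \<Rightarrow> real^'n \<Rightarrow> int^'n \<Rightarrow> real^'n" where
  "frequency q \<eta> z = (2 * pi) *\<^sub>R (matrix_inv q *v of_int_vec z) + \<eta>"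

definition resonant :: "real^'n::finite^'n \<Rightarrow> real^'n \<Rightarrow> complex \<Rightarrow> (int^'n) set" where
  "resonant q \<eta> k = {z. k\<^sup>2 = of_real ((norm (frequency q \<eta> z))\<^sup>2)}"

definition schwartz :: "(real^'n::finite \<Rightarrow> complex) \<Rightarrow> bool" where
  "schwartz \<phi> \<longleftrightarrow> (\<forall>is. (\<forall>x. iter_partial is \<phi> differentiable (at x))
     \<and> (\<forall>m::nat. \<exists>C. \<forall>x. (1 + norm x) ^ m * norm (iter_partial is \<phi> x) \<le> C))"

text \<open>
  \<open>g\<close> represents the tempered distribution given by the series
  \<open>\<Sum>z. exp (\<i> x \<bullet> \<xi>\<^sub>z) / (|Q| (k\<^sup>2 - |\<xi>\<^sub>z|\<^sup>2))\<close>, where \<open>\<xi>\<^sub>z\<close> is \<open>frequency q \<eta> z\<close>: tested against any Schwartz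
  function, the series converges to the pairing with \<open>g\<close>.
  Analyticity determines \<open>g\<close> uniquely off the lattice, and its values on the lattice play no role.
\<close>

definition is_green :: "real^'n::finite^'n \<Rightarrow> real^'n \<Rightarrow> complex \<Rightarrow> (real^'n \<Rightarrow> complex) \<Rightarrow> bool" where
  "is_green q \<eta> k g \<longleftrightarrow>
     (\<forall>K. compact K \<longrightarrow> set_integrable lborel K g) \<and>
     real_analytic_on g (- lattice q) \<and>
     (\<forall>\<phi>. schwartz \<phi> \<longrightarrow> integrable lborel (\<lambda>x. g x * \<phi> x) \<and>
        ((\<lambda>z. (\<integral>x. exp (\<i> * of_real (x \<bullet> frequency q \<eta> z)) * \<phi> x \<partial>lborel)
                / (of_real (measure lborel (cell q)) * (k\<^sup>2 - of_real ((norm (frequency q \<eta> z))\<^sup>2))))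
           has_sum (\<integral>x. g x * \<phi> x \<partial>lborel)) (UNIV - resonant q \<eta> k))"

definition green :: "real^'n::finite^'n \<Rightarrow> real^'n \<Rightarrow> complex \<Rightarrow> real^'n \<Rightarrow> complex" where
  "green q \<eta> k = (SOME g. is_green q \<eta> k g)"

text \<open>\<open>\<nu> \<bullet> \<nabla>f(x)\<close> for complex-valued \<open>f\<close>.\<close>

definition dot_grad :: "real^'n::finite \<Rightarrow> (real^'n \<Rightarrow> complex) \<Rightarrow> real^'n \<Rightarrow> complex" where
  "dot_grad \<nu> f x = (\<Sum>i\<in>UNIV. of_real (\<nu> $ i) * partial i f x)"


section \<open>The quasi-periodic double layer potential\<close>

definition double_layer ::
  "real^'n::finite^'n \<Rightarrow> real^'n \<Rightarrow> complex \<Rightarrow> (real^'n) set \<Rightarrow> (real^'n \<Rightarrow> complex) \<Rightarrow> real^'n \<Rightarrow> complex" where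
  "double_layer q \<eta> k D \<mu> x =
     - (LINT y:frontier D|surface_measure. dot_grad (outward_normal D y) (green q \<eta> k) (x - y) * \<mu> y)"

text \<open>
  The continuous extension to the closure of the exterior domain, where the value at each point is the
  limit from the domain; it is only meaningful on that closure.
\<close>

definition double_layer_minus ::
  "real^'n::finite^'n \<Rightarrow> real^'n \<Rightarrow> complex \<Rightarrow> (real^'n) set \<Rightarrow> (real^'n \<Rightarrow> complex) \<Rightarrow> real^'n \<Rightarrow> complex" where
  "double_layer_minus q \<eta> k D \<mu> x = Lim (at x within periodic_exterior q D) (double_layer q \<eta> k D \<mu>)"

end

theory Submission
  imports Defs "HOL-Probability.Probability"
begin

text \<open>
  The function \<open>green\<close> is chosen by \<open>SOME\<close>, so a fundamental solution has to be constructed first. With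
  \<open>\<lambda> = k\<^sup>2 - |\<xi>\<^sub>z|\<^sup>2\<close>, write \<open>1 / \<lambda> = exp \<lambda> / \<lambda> - \<integral>\<^sub>0\<^sup>1 exp (t \<lambda>) dt\<close>. The first summands give a Fourier series with
  Gaussian coefficients, which is analytic everywhere. Poisson summation turns the second ones into an
  integral over \<open>0 < t \<le> 1\<close> of quasi-periodic sums of heat kernels centred at the lattice points, which is
  locally integrable, and analytic off the lattice because each Gaussian is an entire function of \<open>x\<close>.
  For resonant \<open>z\<close>, where \<open>\<lambda> = 0\<close>, the integral is 1, and one adds 1 to the first part instead.

  For \<open>x\<close> in the closure of \<open>V\<close> and \<open>s\<close> on the boundary of \<open>\<Omega>\<close>, the points \<open>x - p - \<epsilon> s\<close> stay in a compact
  set off the lattice when \<open>\<epsilon>\<close> varies in a small interval. Cauchy estimates, uniform on that set, for all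
  derivatives of an analytic kernel make its Taylor expansion in \<open>\<epsilon>\<close> converge geometrically together with
  two derivatives in \<open>x\<close>, hence in operator norm, since the boundary has finite surface measure. The
  formula for the double layer potential is the substitution \<open>y = p + \<epsilon> s\<close>, under which \<open>d\<sigma>\<close> scales by
  \<open>\<epsilon>\<close> to the power \<open>n - 1\<close>.
\<close>

section \<open>Multivariate power series and Cauchy estimates\<close>

text \<open>The splitting of 1 / \<lambda> comes from the Laplace formula, which writes 1 /
  \<lambda> as minus the integral of exp (t \<lambda>) over t > 0. That integral converges only if
  \<lambda> has negative real part. Cut off at t = 1 the formula becomes an algebraic identity for
  every nonzero complex \<lambda>, so every complex k is covered. The times beyond 1, which would
  diverge for finitely many frequencies, turn into exp \<lambda> / \<lambda>; the times near 0 carry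
  the singularity at the lattice. For the operators, pointwise convergence of power series says too
  little. Convergence in operator norm needs bounds of size R^N N! for the derivatives of order N,
  uniform on a compact set, and at three orders beyond the Taylor order: one for the gradient in the
  kernel and two for the C^2 norm. Power series and lattice sums are written as Bochner integrals
  over \<open>count_space\<close>, so that dominated convergence, differentiation under the integral
  and Fubini apply to sums and integrals alike; they are converted from and to
  \<open>has_sum\<close> where the definitions ask for it.\<close>

lemma integral_count_space_has_sum:
  fixes f :: "'a \<Rightarrow> complex"
  assumes "integrable (count_space UNIV) f"
  shows "(f has_sum (LINT x|count_space UNIV. f x)) UNIV"
proof -
  have 1: "Infinite_Set_Sum.abs_summable_on f UNIV"
    using assms by (simp add: Infinite_Set_Sum.abs_summable_on_def)
  then have "f summable_on UNIV"
    using abs_summable_equivalent abs_summable_summable by blast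
  moreover have "infsum f UNIV = (LINT x|count_space UNIV. f x)"
    using infsetsum_infsum[OF 1] by (simp add: infsetsum_def)
  ultimately show ?thesis by (metis has_sum_infsum)
qed

text \<open>For complex terms unconditional summability is absolute summability, so a
  \<open>has_sum\<close> may be treated as the integral of an integrable function for the counting
  measure.\<close>

lemma has_sum_integrable_count_space:
  fixes f :: "'a \<Rightarrow> complex"
  assumes "(f has_sum S) UNIV"
  shows "integrable (count_space UNIV) f" "(LINT x|count_space UNIV. f x) = S"
proof -
  have "f summable_on UNIV" using assms by (rule has_sum_imp_summable)
  then show *: "integrable (count_space UNIV) f"
    using abs_summable_equivalent[of f UNIV]
    by (simp add: summable_on_iff_abs_summable_on_complex Infinite_Set_Sum.abs_summable_on_def)
  show "(LINT x|count_space UNIV. f x) = S"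
    using infsumI[OF integral_count_space_has_sum[OF *]] infsumI[OF assms] by simp
qed

text \<open>Dominated convergence for the difference quotients along an arbitrary sequence. The
  bound on \<open>F'\<close> holds on a whole ball, so the mean value inequality turns it into a
  bound for the quotients. The instances are termwise differentiation of series, with the counting
  measure, and differentiation of layer integrals.\<close>

lemma has_derivative_integral:
  fixes F :: "'a::euclidean_space \<Rightarrow> 'w \<Rightarrow> 'b::{banach, second_countable_topology}"
  assumes d: "0 < d"
    and int: "\<And>x. x \<in> ball x0 d \<Longrightarrow> integrable M (F x)"
    and der: "\<And>w x. w \<in> space M \<Longrightarrow> x \<in> ball x0 d \<Longrightarrow> ((\<lambda>x. F x w) has_derivative F' x w) (at x)"
    and bnd: "\<And>w x h. w \<in> space M \<Longrightarrow> x \<in> ball x0 d \<Longrightarrow> norm (F' x w h) \<le> B w * norm h"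
    and B: "integrable M B"
    and meas: "\<And>h. (\<lambda>w. F' x0 w h) \<in> borel_measurable M"
  shows "((\<lambda>x. LINT w|M. F x w) has_derivative (\<lambda>h. LINT w|M. F' x0 w h)) (at x0)"
proof -
  have x0: "x0 \<in> ball x0 d" using d by simp
  have intF': "integrable M (\<lambda>w. F' x0 w h)" for h
  proof (rule Bochner_Integration.integrable_bound)
    show "integrable M (\<lambda>w. B w * norm h)" using B by simp
    show "AE w in M. norm (F' x0 w h) \<le> norm (B w * norm h)"
    proof (rule AE_I2)
      fix w assume "w \<in> space M"
      from bnd[OF this x0, of h] show "norm (F' x0 w h) \<le> norm (B w * norm h)"
        by (simp add: order.trans[OF _ abs_ge_self])
    qed
  qed (rule meas)
  have lin: "bounded_linear (F' x0 w)" if "w \<in> space M" for w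
    using der[OF that x0] has_derivative_bounded_linear by blast
  have bl: "bounded_linear (\<lambda>h. LINT w|M. F' x0 w h)"
  proof (rule bounded_linear_intro[where K = "LINT w|M. B w"])
    fix h k
    have "(LINT w|M. F' x0 w (h + k)) = (LINT w|M. F' x0 w h + F' x0 w k)"
      by (intro Bochner_Integration.integral_cong refl linear_add bounded_linear.linear lin)
    then show "(LINT w|M. F' x0 w (h + k)) = (LINT w|M. F' x0 w h) + (LINT w|M. F' x0 w k)"
      by (simp add: intF')
  next
    fix r h
    have "(LINT w|M. F' x0 w (r *\<^sub>R h)) = (LINT w|M. r *\<^sub>R F' x0 w h)"
      by (intro Bochner_Integration.integral_cong refl linear_scale bounded_linear.linear lin)
    then show "(LINT w|M. F' x0 w (r *\<^sub>R h)) = r *\<^sub>R (LINT w|M. F' x0 w h)"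
      by simp
  next
    fix h
    have "norm (LINT w|M. F' x0 w h) \<le> (LINT w|M. B w * norm h)"
    proof -
      have "norm (LINT w|M. F' x0 w h) \<le> (LINT w|M. norm (F' x0 w h))" by simp
      also have "\<dots> \<le> (LINT w|M. B w * norm h)"
        by (intro integral_mono integrable_norm integrable_mult_left B bnd x0 intF')
      finally show ?thesis .
    qed
    then show "norm (LINT w|M. F' x0 w h) \<le> norm h * (LINT w|M. B w)"
      by (simp add: mult.commute)
  qed
  have "((\<lambda>y. ((LINT w|M. F y w) - (LINT w|M. F x0 w) - (LINT w|M. F' x0 w (y - x0))) /\<^sub>R norm (y - x0)) \<longlongrightarrow> 0) (at x0)"
    unfolding tendsto_at_iff_sequentially
  proof (intro allI impI)
    fix X :: "nat \<Rightarrow> 'a"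
    assume X: "\<forall>i. X i \<in> UNIV - {x0}" and lim: "X \<longlonglongrightarrow> x0"
    define q where "q y w = (F y w - F x0 w - F' x0 w (y - x0)) /\<^sub>R norm (y - x0)" for y w
    have "\<forall>\<^sub>F i in sequentially. X i \<in> ball x0 d"
      using lim d by (auto simp: tendsto_iff dist_commute)
    then obtain N where N: "\<And>i. i \<ge> N \<Longrightarrow> X i \<in> ball x0 d"
      by (auto simp: eventually_sequentially)
    have "(\<lambda>i. LINT w|M. q (X (i + N)) w) \<longlonglongrightarrow> (LINT w|M. 0)"
    \<comment> \<open>One \<open>B\<close> bounds the increment of \<open>F\<close>, by the mean
      value inequality on the convex ball, and the other bounds the linear term.\<close>
    proof (rule integral_dominated_convergence[where w = "\<lambda>w. 2 * B w"])
      show "integrable M (\<lambda>w. 2 * B w)" using B by simp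
      show "q (X (i + N)) \<in> borel_measurable M" for i
        unfolding q_def
        by (intro borel_measurable_scaleR borel_measurable_diff borel_measurable_const
            borel_measurable_integrable int N x0 meas) simp
      show "AE w in M. (\<lambda>i. q (X (i + N)) w) \<longlonglongrightarrow> 0"
      proof (rule AE_I2)
        fix w assume w: "w \<in> space M"
        have "((\<lambda>y. q y w) \<longlongrightarrow> 0) (at x0)"
          using der[OF w x0] unfolding q_def has_derivative_def by simp
        then have "(\<lambda>i. q (X i) w) \<longlonglongrightarrow> 0"
          unfolding tendsto_at_iff_sequentially comp_def using X lim by blast
        then show "(\<lambda>i. q (X (i + N)) w) \<longlonglongrightarrow> 0" by (rule LIMSEQ_ignore_initial_segment)
      qed
      show "AE w in M. norm (q (X (i + N)) w) \<le> 2 * B w" for i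
      proof (rule AE_I2)
        fix w assume w: "w \<in> space M"
        let ?y = "X (i + N)"
        have y: "?y \<in> ball x0 d" using N by simp
        have ne: "norm (?y - x0) > 0" using X by auto
        have B0: "0 \<le> B w"
          using order.trans[OF norm_ge_zero bnd[OF w x0, of "?y - x0"]] ne by (simp add: zero_le_mult_iff)
        have "norm (F ?y w - F x0 w) \<le> B w * norm (?y - x0)"
        proof (rule differentiable_bound[where S = "ball x0 d" and f' = "\<lambda>x. F' x w"])
          show "((\<lambda>x. F x w) has_derivative F' x w) (at x within ball x0 d)" if "x \<in> ball x0 d" for x
            using der[OF w that] has_derivative_at_withinI by blast
          show "onorm (F' x w) \<le> B w" if "x \<in> ball x0 d" for x
            using bnd[OF w that] B0 by (intro onorm_le) auto
        qed (use y x0 in auto)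
        moreover have "norm (F' x0 w (?y - x0)) \<le> B w * norm (?y - x0)"
          by (rule bnd[OF w x0])
        ultimately have "norm (F ?y w - F x0 w - F' x0 w (?y - x0)) \<le> 2 * B w * norm (?y - x0)"
          by (intro order.trans[OF norm_triangle_ineq4]) (simp add: algebra_simps)
        then show "norm (q ?y w) \<le> 2 * B w"
          using ne unfolding q_def by (simp add: divide_simps mult.commute)
      qed
    qed auto
    then have *: "(\<lambda>i. LINT w|M. q (X i) w) \<longlonglongrightarrow> 0"
      by (simp add: LIMSEQ_offset[where k = N])
    have "LINT w|M. q (X i) w = ((LINT w|M. F (X i) w) - (LINT w|M. F x0 w) - (LINT w|M. F' x0 w (X i - x0))) /\<^sub>R norm (X i - x0)"
      if "i \<ge> N" for i
      unfolding q_def using int[OF N[OF that]] int[OF x0] intF' by simp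
    then show "((\<lambda>y. ((LINT w|M. F y w) - (LINT w|M. F x0 w) - (LINT w|M. F' x0 w (y - x0))) /\<^sub>R norm (y - x0)) \<circ> X) \<longlonglongrightarrow> 0"
      using * by (elim Lim_transform_eventually) (auto simp: eventually_sequentially)
  qed
  with bl show ?thesis unfolding has_derivative_def by simp
qed

lemma integral_count_space_inj:
  fixes f :: "'b \<Rightarrow> 'c::{banach, second_countable_topology}"
  assumes h: "inj h" and f: "integrable (count_space UNIV) f"
  shows "integrable (count_space UNIV) (\<lambda>x. f (h x))"
    and "(LINT x|count_space UNIV. f (h x)) = (LINT x|count_space UNIV. indicator (range h) x *\<^sub>R f x)"
proof -
  have "Infinite_Set_Sum.abs_summable_on f (range h)"
    using f Infinite_Set_Sum.abs_summable_on_subset[of f UNIV "range h"]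
    by (simp add: Infinite_Set_Sum.abs_summable_on_def)
  then show "integrable (count_space UNIV) (\<lambda>x. f (h x))"
    using Infinite_Set_Sum.abs_summable_on_reindex_iff[OF h, of f] by (simp add: Infinite_Set_Sum.abs_summable_on_def)
  have "(LINT x|count_space UNIV. f (h x)) = infsetsum (\<lambda>x. f (h x)) UNIV"
    by (simp add: infsetsum_def)
  also have "\<dots> = infsetsum f (range h)" 
    by (rule infsetsum_reindex_bij_betw[OF inj_on_imp_bij_betw[OF h]])
  finally show "(LINT x|count_space UNIV. f (h x)) = (LINT x|count_space UNIV. indicator (range h) x *\<^sub>R f x)"
    by (simp add: infsetsum_altdef set_lebesgue_integral_def)
qed

lemma integral_count_space_inj_le:
  fixes f :: "'b \<Rightarrow> real"
  assumes h: "inj h" and f: "integrable (count_space UNIV) f" and nn: "\<And>x. 0 \<le> f x"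
  shows "(LINT x|count_space UNIV. f (h x)) \<le> (LINT x|count_space UNIV. f x)"
  unfolding integral_count_space_inj(2)[OF h f]
proof (rule integral_mono)
  show "integrable (count_space UNIV) (\<lambda>x. indicator (range h) x *\<^sub>R f x)"
    by (rule integrable_mult_indicator) (use f in auto)
qed (use f nn in \<open>auto simp: indicator_def\<close>)

section \<open>Absolutely convergent power series on a closed cube\<close>

definition monomial_at :: "('n::finite \<Rightarrow> nat) \<Rightarrow> real^'n \<Rightarrow> real" where
  "monomial_at \<beta> u = (\<Prod>i\<in>UNIV. (u $ i) ^ \<beta> i)"

text \<open>A cube instead of a ball, because a monomial is at most
  \<open>r ^ sum \<beta> UNIV\<close> on it and attains this value at a corner. \<open>M\<close>
  bounds the weighted sum of the moduli of the coefficients, hence also \<open>f\<close> on the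
  cube; it is the quantity that is tracked under differentiation.\<close>

definition cube_series ::
  "real^'n::finite \<Rightarrow> real \<Rightarrow> real \<Rightarrow> (('n \<Rightarrow> nat) \<Rightarrow> complex) \<Rightarrow> (real^'n \<Rightarrow> complex) \<Rightarrow> bool" where
  "cube_series a r M c f \<longleftrightarrow> 0 < r
     \<and> integrable (count_space UNIV) (\<lambda>\<beta>. norm (c \<beta>) * r ^ sum \<beta> UNIV)
     \<and> (LINT \<beta>|count_space UNIV. norm (c \<beta>) * r ^ sum \<beta> UNIV) \<le> M
     \<and> (\<forall>u. (\<forall>i. \<bar>u $ i\<bar> \<le> r) \<longrightarrow> f (a + u) = (LINT \<beta>|count_space UNIV. c \<beta> * of_real (monomial_at \<beta> u)))"

lemma abs_monomial_at_le:
  assumes "\<And>i. \<bar>u $ i\<bar> \<le> r"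
  shows "\<bar>monomial_at \<beta> u\<bar> \<le> r ^ sum \<beta> UNIV"
proof -
  have "\<bar>monomial_at \<beta> u\<bar> = (\<Prod>i\<in>UNIV. \<bar>u $ i\<bar> ^ \<beta> i)"
    by (simp add: monomial_at_def abs_prod power_abs)
  also have "\<dots> \<le> (\<Prod>i\<in>UNIV. r ^ \<beta> i)"
    by (intro prod_mono conjI power_mono assms) auto
  finally show ?thesis by (simp add: power_sum)
qed

lemma cube_series_term_integrable:
  assumes "cube_series a r M c f" "\<And>i. \<bar>u $ i\<bar> \<le> r"
  shows "integrable (count_space UNIV) (\<lambda>\<beta>. c \<beta> * of_real (monomial_at \<beta> u))"
proof (rule Bochner_Integration.integrable_bound)
  show "integrable (count_space UNIV) (\<lambda>\<beta>. norm (c \<beta>) * r ^ sum \<beta> UNIV)"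
    using assms(1) by (simp add: cube_series_def)
  show "AE \<beta> in count_space UNIV. norm (c \<beta> * of_real (monomial_at \<beta> u)) \<le> norm (norm (c \<beta>) * r ^ sum \<beta> UNIV)"
    using abs_monomial_at_le[OF assms(2)]
    by (auto simp: AE_count_space norm_mult abs_mult intro!: mult_left_mono order.trans[OF _ abs_ge_self])
qed auto

lemma cube_series_bound:
  assumes "cube_series a r M c f" "\<And>i. \<bar>u $ i\<bar> \<le> r"
  shows "norm (f (a + u)) \<le> M"
proof -
  have "norm (f (a + u)) = norm (LINT \<beta>|count_space UNIV. c \<beta> * of_real (monomial_at \<beta> u))"
    using assms by (simp add: cube_series_def)
  also have "\<dots> \<le> (LINT \<beta>|count_space UNIV. norm (c \<beta> * of_real (monomial_at \<beta> u)))"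
    by simp
  also have "\<dots> \<le> (LINT \<beta>|count_space UNIV. norm (c \<beta>) * r ^ sum \<beta> UNIV)"
  proof (rule integral_mono)
    show "integrable (count_space UNIV) (\<lambda>\<beta>. norm (c \<beta> * of_real (monomial_at \<beta> u)))"
      using cube_series_term_integrable[OF assms] by (rule integrable_norm)
  qed (use assms abs_monomial_at_le[OF assms(2)] in \<open>auto simp: cube_series_def norm_mult intro!: mult_left_mono\<close>)
  also have "\<dots> \<le> M" using assms by (simp add: cube_series_def)
  finally show ?thesis .
qed

text \<open>The Cauchy estimate for a single monomial: a derivative at radius \<rho> instead of r
  costs the factor 1 / (r - \<rho>), whatever the degree. The induction proves the sharper bound
  with \<open>r ^ m - \<rho> ^ m\<close> on the right.\<close>

lemma power_derivative_bound:
  fixes r \<rho> :: real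
  assumes "0 \<le> \<rho>" "\<rho> \<le> r"
  shows "real m * \<rho> ^ (m - 1) * (r - \<rho>) \<le> r ^ m"
proof -
  have "real m * \<rho> ^ (m - 1) * (r - \<rho>) \<le> r ^ m - \<rho> ^ m"
  proof (induction m)
    case (Suc m)
    have "real (Suc m) * \<rho> ^ m * (r - \<rho>) = \<rho> * (real m * \<rho> ^ (m - 1) * (r - \<rho>)) + \<rho> ^ m * (r - \<rho>)"
      by (cases m) (auto simp: algebra_simps)
    also have "\<dots> \<le> \<rho> * (r ^ m - \<rho> ^ m) + r ^ m * (r - \<rho>)"
      using assms by (intro add_mono mult_left_mono mult_right_mono Suc power_mono) auto
    also have "\<dots> = r ^ Suc m - \<rho> ^ Suc m" by (simp add: algebra_simps)
    finally show ?case by simp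
  qed simp
  with assms show ?thesis by (smt (verit) zero_le_power)
qed

definition monomial_deriv :: "('n::finite \<Rightarrow> nat) \<Rightarrow> real^'n \<Rightarrow> 'n \<Rightarrow> real" where
  "monomial_deriv \<beta> u i = real (\<beta> i) * (u $ i) ^ (\<beta> i - 1) * (\<Prod>j\<in>UNIV - {i}. (u $ j) ^ \<beta> j)"

lemma monomial_at_has_derivative:
  "(monomial_at \<beta> has_derivative (\<lambda>h. \<Sum>i\<in>UNIV. h $ i * monomial_deriv \<beta> u i)) (at u)"
proof -
  have "((\<lambda>u. \<Prod>i\<in>UNIV. (u $ i) ^ \<beta> i) has_derivative
     (\<lambda>h. \<Sum>i\<in>UNIV. (of_nat (\<beta> i) * (h $ i) * (u $ i) ^ (\<beta> i - 1)) * (\<Prod>j\<in>UNIV - {i}. (u $ j) ^ \<beta> j))) (at u)"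
    by (intro has_derivative_prod has_derivative_power
      bounded_linear_imp_has_derivative bounded_linear_vec_nth)
  then show ?thesis
    by (simp add: monomial_at_def[abs_def] monomial_deriv_def algebra_simps)
qed

lemma abs_monomial_deriv_le:
  assumes "\<And>i. \<bar>u $ i\<bar> \<le> r"
  shows "\<bar>monomial_deriv \<beta> u i\<bar> \<le> real (\<beta> i) * r ^ (sum \<beta> UNIV - 1)"
proof (cases "\<beta> i")
  case (Suc m)
  have r: "0 \<le> r" using assms[of i] by linarith
  have "\<bar>monomial_deriv \<beta> u i\<bar> = real (\<beta> i) * \<bar>u $ i\<bar> ^ (\<beta> i - 1) * (\<Prod>j\<in>UNIV - {i}. \<bar>u $ j\<bar> ^ \<beta> j)"
    by (simp add: monomial_deriv_def abs_mult abs_prod power_abs)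
  also have "\<dots> \<le> real (\<beta> i) * r ^ (\<beta> i - 1) * (\<Prod>j\<in>UNIV - {i}. r ^ \<beta> j)"
    by (intro mult_mono mult_left_mono prod_mono conjI power_mono assms prod_nonneg ballI zero_le_power r)
       (auto simp: r)
  also have "\<dots> = real (\<beta> i) * (r ^ (\<beta> i - 1) * r ^ (sum \<beta> (UNIV - {i})))"
    by (simp add: power_sum)
  also have "\<beta> i - 1 + sum \<beta> (UNIV - {i}) = sum \<beta> UNIV - 1"
    using Suc by (subst (2) sum.remove[of _ i]) auto
  then have "r ^ (\<beta> i - 1) * r ^ (sum \<beta> (UNIV - {i})) = r ^ (sum \<beta> UNIV - 1)"
    by (metis power_add)
  finally show ?thesis .
qed (simp add: monomial_deriv_def)

lemma cube_interior:
  fixes u :: "real^'n::finite"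
  assumes "\<And>i. \<bar>u $ i\<bar> < r"
  obtains d \<rho> where "0 < d" "0 \<le> \<rho>" "\<rho> < r" "\<And>x i. x \<in> ball u d \<Longrightarrow> \<bar>x $ i\<bar> \<le> \<rho>"
proof -
  define m where "m = Max (range (\<lambda>i. \<bar>u $ i\<bar>))"
  have m: "\<bar>u $ i\<bar> \<le> m" for i unfolding m_def by (rule Max_ge) auto
  have "m \<in> range (\<lambda>i. \<bar>u $ i\<bar>)" unfolding m_def by (rule Max_in) auto
  then have mr: "m < r" "0 \<le> m" using assms by auto
  show ?thesis
  proof (rule that[of "(r - m) / 2" "(r + m) / 2"])
    fix x i assume "x \<in> ball u ((r - m) / 2)"
    then have "norm (x - u) < (r - m) / 2" by (simp add: dist_norm norm_minus_commute)
    then have "\<bar>(x - u) $ i\<bar> < (r - m) / 2" using component_le_norm_cart[of "x - u" i] by linarith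
    then have "\<bar>x $ i\<bar> \<le> \<bar>u $ i\<bar> + (r - m) / 2" 
      unfolding vector_minus_component by linarith
    also have "\<dots> \<le> (r + m) / 2" using m[of i] by (simp add: field_simps)
    finally show "\<bar>x $ i\<bar> \<le> (r + m) / 2" .
  qed (use mr in auto)
qed

text \<open>Termwise differentiation. On a slightly smaller cube
  \<open>power_derivative_bound\<close> dominates the differentiated terms by the original ones at
  radius r, divided by the gap between the radii.\<close>

lemma cube_series_has_derivative:
  assumes cs: "cube_series a r M c f" and u: "\<And>i. \<bar>u $ i\<bar> < r"
  shows "(f has_derivative (\<lambda>h. LINT \<beta>|count_space UNIV. c \<beta> * of_real (\<Sum>i\<in>UNIV. h $ i * monomial_deriv \<beta> u i))) (at (a + u))"
proof -
  obtain d \<rho> where d: "0 < d" and \<rho>: "0 \<le> \<rho>" "\<rho> < r"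
    and in_cube: "\<And>x i. x \<in> ball u d \<Longrightarrow> \<bar>x $ i\<bar> \<le> \<rho>"
    using cube_interior[OF u] by blast
  define B where "B \<beta> = (norm (c \<beta>) * r ^ sum \<beta> UNIV) / (r - \<rho>)" for \<beta>
  let ?M = "count_space (UNIV :: ('a \<Rightarrow> nat) set)"
  have "((\<lambda>x. LINT \<beta>|?M. c \<beta> * of_real (monomial_at \<beta> x)) has_derivative
         (\<lambda>h. LINT \<beta>|?M. c \<beta> * of_real (\<Sum>i\<in>UNIV. h $ i * monomial_deriv \<beta> u i))) (at u)"
  proof (rule has_derivative_integral[OF d, where B = B and F' = "\<lambda>x \<beta> h. c \<beta> * of_real (\<Sum>i\<in>UNIV. h $ i * monomial_deriv \<beta> x i)"])
    show "integrable ?M (\<lambda>\<beta>. c \<beta> * of_real (monomial_at \<beta> x))" if "x \<in> ball u d" for x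
      using in_cube[OF that] \<rho> by (intro cube_series_term_integrable[OF cs]) (meson le_less_trans less_imp_le)
    show "((\<lambda>x. c \<beta> * of_real (monomial_at \<beta> x)) has_derivative
            (\<lambda>h. c \<beta> * of_real (\<Sum>i\<in>UNIV. h $ i * monomial_deriv \<beta> x i))) (at x)" for \<beta> x
      by (intro has_derivative_mult_right has_derivative_of_real monomial_at_has_derivative)
    show "integrable ?M B" using cs unfolding B_def cube_series_def by simp
    show "norm (c \<beta> * complex_of_real (\<Sum>i\<in>UNIV. h $ i * monomial_deriv \<beta> x i)) \<le> B \<beta> * norm h"
      if "x \<in> ball u d" for \<beta> x h
    proof -
      have "\<bar>\<Sum>i\<in>UNIV. h $ i * monomial_deriv \<beta> x i\<bar> \<le> (\<Sum>i\<in>UNIV. \<bar>h $ i * monomial_deriv \<beta> x i\<bar>)"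
        by (rule sum_abs)
      also have "\<dots> \<le> (\<Sum>i\<in>UNIV. norm h * (real (\<beta> i) * \<rho> ^ (sum \<beta> UNIV - 1)))"
        unfolding abs_mult
        by (intro sum_mono mult_mono component_le_norm_cart abs_monomial_deriv_le in_cube that) auto
      also have "\<dots> = norm h * (real (sum \<beta> UNIV) * \<rho> ^ (sum \<beta> UNIV - 1))"
        by (simp add: sum_distrib_left sum_distrib_right)
      also have "\<dots> \<le> norm h * (r ^ sum \<beta> UNIV / (r - \<rho>))"
        using power_derivative_bound[of \<rho> r "sum \<beta> UNIV"] \<rho>
        by (intro mult_left_mono) (auto simp: field_simps)
      finally have "norm (c \<beta>) * \<bar>\<Sum>i\<in>UNIV. h $ i * monomial_deriv \<beta> x i\<bar>
            \<le> norm (c \<beta>) * (norm h * (r ^ sum \<beta> UNIV / (r - \<rho>)))"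
        by (rule mult_left_mono) simp
      then show ?thesis by (simp only: norm_mult norm_of_real B_def) (simp add: mult_ac)
    qed
  qed auto
  then have "((\<lambda>x. LINT \<beta>|?M. c \<beta> * of_real (monomial_at \<beta> (x - a))) has_derivative
         (\<lambda>h. LINT \<beta>|?M. c \<beta> * of_real (\<Sum>i\<in>UNIV. h $ i * monomial_deriv \<beta> u i))) (at (a + u))"
    using has_derivative_compose[OF has_derivative_diff[OF has_derivative_ident has_derivative_const],
        of _ "\<lambda>h. LINT \<beta>|?M. c \<beta> * of_real (\<Sum>i\<in>UNIV. h $ i * monomial_deriv \<beta> u i)" "a + u" a UNIV] by simp
  then show ?thesis
  proof (rule has_derivative_transform_within_open[where s = "ball (a + u) d"])
    fix x assume "x \<in> ball (a + u) d"
    then have "x - a \<in> ball u d" by (simp add: dist_norm algebra_simps)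
    then have "\<bar>(x - a) $ i\<bar> \<le> r" for i using in_cube \<rho> by (meson le_less_trans less_imp_le)
    with cs have "f (a + (x - a)) = (LINT \<beta>|?M. c \<beta> * of_real (monomial_at \<beta> (x - a)))"
      unfolding cube_series_def by blast
    then show "(LINT \<beta>|?M. c \<beta> * of_real (monomial_at \<beta> (x - a))) = f x" by simp
  qed (use d in auto)
qed

lemma partial_eq:
  assumes "(f has_derivative D) (at x)"
  shows "partial i f x = D (axis i 1)"
  unfolding partial_def using frechet_derivative_at[OF assms] by simp

text \<open>Coefficients of the series differentiated termwise in direction i: the new term with
  exponent \<beta> comes from the old one whose i-th exponent is larger by one.\<close>

definition shift_coeff :: "'n \<Rightarrow> (('n \<Rightarrow> nat) \<Rightarrow> complex) \<Rightarrow> ('n \<Rightarrow> nat) \<Rightarrow> complex" where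
  "shift_coeff i c \<beta> = of_nat (\<beta> i + 1) * c (\<beta>(i := \<beta> i + 1))"

lemma sum_axis_mult: "(\<Sum>j\<in>UNIV. (axis i 1 :: real^'n::finite) $ j * g j) = g i"
proof -
  have "(\<Sum>j\<in>UNIV. (axis i 1 :: real^'n) $ j * g j) = (\<Sum>j\<in>UNIV. if j = i then g j else 0)"
    by (intro sum.cong) (auto simp: axis_def)
  then show ?thesis by simp
qed

text \<open>The weighted coefficient sum of the derivative at radius \<open>r'\<close> is compared
  term by term with the old one at radius \<open>r\<close>, which turns \<open>M\<close> into
  \<open>M / (r - r')\<close>. Raising the i-th exponent is injective, so the reindexed sum is at
  most the full one.\<close>

lemma cube_series_partial:
  assumes cs: "cube_series a r M c f" and r': "0 < r'" "r' < r"
  shows "cube_series a r' (M / (r - r')) (shift_coeff i c) (partial i f)"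
proof -
  let ?h = "\<lambda>\<gamma>::'a \<Rightarrow> nat. \<gamma>(i := \<gamma> i + 1)"
  let ?M = "count_space (UNIV :: ('a \<Rightarrow> nat) set)"
  have inj: "inj ?h"
  proof (rule injI, rule ext)
    fix x y j assume "?h x = ?h y"
    then have "?h x j = ?h y j" by metis
    then show "x j = y j" by (cases "j = i") auto
  qed
  have range: "\<beta> \<in> range ?h" if "\<beta> i \<noteq> 0" for \<beta>
    by (rule range_eqI[of _ _ "\<beta>(i := \<beta> i - 1)"]) (use that in auto)
  have sum_h: "sum (?h \<gamma>) UNIV = Suc (sum \<gamma> UNIV)" for \<gamma>
  proof -
    have "sum (?h \<gamma>) UNIV = (\<gamma> i + 1) + sum \<gamma> (UNIV - {i})"
      by (subst sum.remove[of _ i]) (auto intro!: sum.cong)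
    also have "\<dots> = Suc (sum \<gamma> UNIV)" by (subst (2) sum.remove[of _ i]) auto
    finally show ?thesis .
  qed
  have int: "integrable ?M (\<lambda>\<beta>. norm (c \<beta>) * r ^ sum \<beta> UNIV)"
    and le: "(LINT \<beta>|?M. norm (c \<beta>) * r ^ sum \<beta> UNIV) \<le> M" and r: "0 < r"
    using cs by (auto simp: cube_series_def)
  have bnd: "norm (shift_coeff i c \<gamma>) * r' ^ sum \<gamma> UNIV \<le> (norm (c (?h \<gamma>)) * r ^ sum (?h \<gamma>) UNIV) / (r - r')" for \<gamma>
  proof -
    have "real (\<gamma> i + 1) * r' ^ sum \<gamma> UNIV \<le> real (Suc (sum \<gamma> UNIV)) * r' ^ (Suc (sum \<gamma> UNIV) - 1)"
      using r' member_le_sum[of i UNIV \<gamma>]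
      by (simp only: diff_Suc_1, intro mult_right_mono) (simp_all del: of_nat_sum of_nat_Suc)
    also have "\<dots> \<le> r ^ Suc (sum \<gamma> UNIV) / (r - r')"
      using power_derivative_bound[of r' r "Suc (sum \<gamma> UNIV)"] r' by (simp add: field_simps)
    finally have "norm (c (?h \<gamma>)) * (real (\<gamma> i + 1) * r' ^ sum \<gamma> UNIV) \<le> norm (c (?h \<gamma>)) * (r ^ Suc (sum \<gamma> UNIV) / (r - r'))"
      by (rule mult_left_mono) simp
    then show ?thesis
      unfolding sum_h shift_coeff_def norm_mult norm_of_nat by (simp only: mult_ac times_divide_eq_right)
  qed
  have inth: "integrable ?M (\<lambda>\<gamma>. (norm (c (?h \<gamma>)) * r ^ sum (?h \<gamma>) UNIV) / (r - r'))"
    using integral_count_space_inj(1)[OF inj int] by simp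
  have int': "integrable ?M (\<lambda>\<gamma>. norm (shift_coeff i c \<gamma>) * r' ^ sum \<gamma> UNIV)"
  proof (rule Bochner_Integration.integrable_bound[OF inth])
    show "AE \<gamma> in ?M. norm (norm (shift_coeff i c \<gamma>) * r' ^ sum \<gamma> UNIV)
        \<le> norm ((norm (c (?h \<gamma>)) * r ^ sum (?h \<gamma>) UNIV) / (r - r'))"
    proof (rule AE_I2)
      fix \<gamma>
      have "0 \<le> norm (shift_coeff i c \<gamma>) * r' ^ sum \<gamma> UNIV" using r' by simp
      then show "norm (norm (shift_coeff i c \<gamma>) * r' ^ sum \<gamma> UNIV)
          \<le> norm ((norm (c (?h \<gamma>)) * r ^ sum (?h \<gamma>) UNIV) / (r - r'))"
        using bnd[of \<gamma>] unfolding real_norm_def by linarith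
    qed
  qed auto
  have le': "(LINT \<gamma>|?M. norm (shift_coeff i c \<gamma>) * r' ^ sum \<gamma> UNIV) \<le> M / (r - r')"
  proof -
    have "(LINT \<gamma>|?M. norm (shift_coeff i c \<gamma>) * r' ^ sum \<gamma> UNIV)
       \<le> (LINT \<gamma>|?M. (norm (c (?h \<gamma>)) * r ^ sum (?h \<gamma>) UNIV) / (r - r'))"
      by (rule integral_mono[OF int' inth bnd])
    also have "\<dots> = (LINT \<gamma>|?M. norm (c (?h \<gamma>)) * r ^ sum (?h \<gamma>) UNIV) / (r - r')" by simp
    also have "\<dots> \<le> (LINT \<beta>|?M. norm (c \<beta>) * r ^ sum \<beta> UNIV) / (r - r')"
      using r' r by (intro divide_right_mono integral_count_space_inj_le[OF inj int]) auto
    also have "\<dots> \<le> M / (r - r')" using r' le by (intro divide_right_mono) auto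
    finally show ?thesis .
  qed
  have "partial i f (a + u) = (LINT \<beta>|?M. shift_coeff i c \<beta> * of_real (monomial_at \<beta> u))"
    if u: "\<forall>i. \<bar>u $ i\<bar> \<le> r'" for u
  proof -
    have u': "\<bar>u $ i\<bar> < r" for i using u r' by (meson le_less_trans)
    let ?G = "\<lambda>\<beta>. c \<beta> * of_real (monomial_deriv \<beta> u i)"
    have "partial i f (a + u) = (LINT \<beta>|?M. ?G \<beta>)"
      unfolding partial_eq[OF cube_series_has_derivative[OF cs u']] sum_axis_mult ..
    \<comment> \<open>An exponent outside the range of \<open>?h\<close> has i-th entry 0, and there
      \<open>monomial_deriv\<close> vanishes.\<close>
    also have "\<dots> = (LINT \<beta>|?M. indicator (range ?h) \<beta> *\<^sub>R ?G \<beta>)"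
    proof (rule Bochner_Integration.integral_cong)
      fix \<beta> show "?G \<beta> = indicator (range ?h) \<beta> *\<^sub>R ?G \<beta>"
        using range[of \<beta>] by (cases "\<beta> i = 0") (auto simp: monomial_deriv_def indicator_def)
    qed simp
    also have "\<dots> = (LINT \<gamma>|?M. ?G (?h \<gamma>))"
    proof (rule integral_count_space_inj(2)[OF inj, symmetric])
      show "integrable ?M ?G"
      proof (rule Bochner_Integration.integrable_bound)
        show "integrable ?M (\<lambda>\<beta>. (norm (c \<beta>) * r ^ sum \<beta> UNIV) / (r - r'))" using int by simp
        show "AE \<beta> in ?M. norm (?G \<beta>) \<le> norm ((norm (c \<beta>) * r ^ sum \<beta> UNIV) / (r - r'))"
        proof (rule AE_I2)
          fix \<beta>
          have "\<bar>monomial_deriv \<beta> u i\<bar> \<le> real (\<beta> i) * r' ^ (sum \<beta> UNIV - 1)"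
            using u by (intro abs_monomial_deriv_le) auto
          also have "\<dots> \<le> real (sum \<beta> UNIV) * r' ^ (sum \<beta> UNIV - 1)"
            using r' member_le_sum[of i UNIV \<beta>] by (intro mult_right_mono) (simp_all del: of_nat_sum)
          also have "\<dots> \<le> r ^ sum \<beta> UNIV / (r - r')"
            using power_derivative_bound[of r' r "sum \<beta> UNIV"] r' by (simp add: field_simps)
          finally have "norm (c \<beta>) * \<bar>monomial_deriv \<beta> u i\<bar> \<le> norm (c \<beta>) * (r ^ sum \<beta> UNIV / (r - r'))"
            by (rule mult_left_mono) simp
          then show "norm (?G \<beta>) \<le> norm ((norm (c \<beta>) * r ^ sum \<beta> UNIV) / (r - r'))"
            using r r' by (simp add: norm_mult)
        qed
      qed auto
    qed
    also have "\<dots> = (LINT \<beta>|?M. shift_coeff i c \<beta> * of_real (monomial_at \<beta> u))"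
    proof (rule Bochner_Integration.integral_cong)
      fix \<gamma>
      have "monomial_deriv (?h \<gamma>) u i = real (\<gamma> i + 1) * ((u $ i) ^ \<gamma> i * (\<Prod>j\<in>UNIV - {i}. (u $ j) ^ \<gamma> j))"
        by (simp add: monomial_deriv_def)
      also have "(u $ i) ^ \<gamma> i * (\<Prod>j\<in>UNIV - {i}. (u $ j) ^ \<gamma> j) = monomial_at \<gamma> u"
        unfolding monomial_at_def by (subst (2) prod.remove[of _ i]) auto
      finally have md: "monomial_deriv (?h \<gamma>) u i = real (\<gamma> i + 1) * monomial_at \<gamma> u" .
      show "?G (?h \<gamma>) = shift_coeff i c \<gamma> * of_real (monomial_at \<gamma> u)"
        unfolding md shift_coeff_def by (simp only: of_real_mult of_real_of_nat_eq mult_ac)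
    qed simp
    finally show ?thesis .
  qed
  with int' le' r' show ?thesis unfolding cube_series_def by blast
qed

lemma shift_coeff_commute: "shift_coeff i (shift_coeff j c) = shift_coeff j (shift_coeff i c)"
proof (cases "i = j")
  case False
  then show ?thesis
    unfolding shift_coeff_def by (intro ext) (simp add: fun_upd_twist[OF False])
qed simp

lemma cube_series_eq:
  assumes "cube_series a r M c f" "\<And>i. \<bar>u $ i\<bar> \<le> r"
  shows "f (a + u) = (LINT \<beta>|count_space UNIV. c \<beta> * of_real (monomial_at \<beta> u))"
  using assms by (simp add: cube_series_def)

lemma cube_series_weaken:
  assumes cs: "cube_series a r M c f" and r': "0 < r'" "r' \<le> r"
  shows "cube_series a r' M c f"
proof -
  let ?M = "count_space (UNIV :: ('a \<Rightarrow> nat) set)"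
  have int: "integrable ?M (\<lambda>\<beta>. norm (c \<beta>) * r ^ sum \<beta> UNIV)"
    and le: "(LINT \<beta>|?M. norm (c \<beta>) * r ^ sum \<beta> UNIV) \<le> M"
    using cs by (auto simp: cube_series_def)
  have bnd: "norm (c \<beta>) * r' ^ sum \<beta> UNIV \<le> norm (c \<beta>) * r ^ sum \<beta> UNIV" for \<beta>
    using r' by (intro mult_left_mono power_mono) auto
  have int': "integrable ?M (\<lambda>\<beta>. norm (c \<beta>) * r' ^ sum \<beta> UNIV)"
  proof (rule Bochner_Integration.integrable_bound[OF int])
    show "AE \<beta> in ?M. norm (norm (c \<beta>) * r' ^ sum \<beta> UNIV) \<le> norm (norm (c \<beta>) * r ^ sum \<beta> UNIV)"
      using bnd r' by (intro AE_I2) (simp add: abs_mult)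
  qed auto
  have "(LINT \<beta>|?M. norm (c \<beta>) * r' ^ sum \<beta> UNIV) \<le> M"
    using integral_mono[OF int' int bnd] le by linarith
  then show ?thesis
    using cs r' int' unfolding cube_series_def by (meson order_trans)
qed

text \<open>\<open>\<delta>\<close> is the radius given up at each differentiation, at the price of
  one factor 1 / \<delta> in the bound. The induction therefore uses the hypothesis for the shorter
  list at the larger radius \<open>r' + \<delta>\<close>.\<close>

lemma cube_series_iter_partial:
  assumes "cube_series a r M c f" "0 < r'" "0 < \<delta>" "r' + real (length L) * \<delta> \<le> r"
  shows "cube_series a r' (M / \<delta> ^ length L) (foldr shift_coeff L c) (iter_partial L f)"
  using assms(2,4)
proof (induction L arbitrary: r')
  case Nil
  then show ?case using cube_series_weaken[OF assms(1), of r'] by simp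
next
  case (Cons i L)
  have "cube_series a (r' + \<delta>) (M / \<delta> ^ length L) (foldr shift_coeff L c) (iter_partial L f)"
    using Cons.prems assms(3) by (intro Cons.IH) (auto simp: algebra_simps)
  from cube_series_partial[OF this Cons.prems(1)] assms(3) show ?case
    by (simp add: mult.commute)
qed

text \<open>Symmetry of mixed partial derivatives, read off the coefficients: the shifts commute, so
  only the multiset of indices matters.\<close>

lemma foldr_shift_coeff_cong:
  assumes "mset L = mset L'"
  shows "foldr shift_coeff L c = foldr shift_coeff L' c"
proof -
  have "List.fold shift_coeff (rev L) = List.fold shift_coeff (rev L')"
    using assms by (intro fold_multiset_equiv) (auto simp: shift_coeff_commute fun_eq_iff)
  then show ?thesis by (simp add: foldr_conv_fold)
qed

text \<open>A cube of half side \<open>r / (2 * real CARD('n))\<close> lies in the ball of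
  convergence, by the l1 bound for the norm. Absolute convergence at its corner, where all
  coordinates equal \<rho>, is the weighted summability that \<open>cube_series\<close>
  demands.\<close>

lemma cube_series_exists:
  fixes f :: "real^'n::finite \<Rightarrow> complex"
  assumes "real_analytic_on f U" "a \<in> U"
  obtains r M c where "cube_series a r M c f"
proof -
  obtain r c where r: "0 < r" and sum: "\<And>x. x \<in> ball a r \<Longrightarrow>
      ((\<lambda>\<beta>. c \<beta> * of_real (\<Prod>i\<in>UNIV. (x $ i - a $ i) ^ \<beta> i)) has_sum f x) UNIV"
    using assms unfolding real_analytic_on_def by meson
  define \<rho> where "\<rho> = r / (2 * real CARD('n))"
  have \<rho>: "0 < \<rho>" using r by (simp add: \<rho>_def)
  have in_ball: "a + u \<in> ball a r" if "\<And>i. \<bar>u $ i\<bar> \<le> \<rho>" for u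
  proof -
    have "norm u \<le> (\<Sum>i\<in>UNIV. \<bar>u $ i\<bar>)" by (rule norm_le_l1_cart)
    also have "\<dots> \<le> (\<Sum>i\<in>(UNIV::'n set). \<rho>)" by (intro sum_mono that)
    also have "\<dots> < r" using r by (simp add: \<rho>_def)
    finally show ?thesis by (simp add: dist_norm)
  qed
  have series: "((\<lambda>\<beta>. c \<beta> * of_real (monomial_at \<beta> u)) has_sum f (a + u)) UNIV"
    if "\<And>i. \<bar>u $ i\<bar> \<le> \<rho>" for u
    using sum[OF in_ball[OF that]] by (simp add: monomial_at_def)
  have mon: "monomial_at \<beta> (\<chi> i. \<rho>) = \<rho> ^ sum \<beta> UNIV" for \<beta> :: "'n \<Rightarrow> nat"
    by (simp add: monomial_at_def power_sum)
  have "integrable (count_space UNIV) (\<lambda>\<beta>. c \<beta> * of_real (monomial_at \<beta> (\<chi> i. \<rho>)))"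
    using \<rho> by (intro has_sum_integrable_count_space(1)[OF series]) simp
  then have "integrable (count_space UNIV) (\<lambda>\<beta>. norm (c \<beta> * of_real (monomial_at \<beta> (\<chi> i. \<rho>))))"
    by (rule integrable_norm)
  then have "integrable (count_space UNIV) (\<lambda>\<beta>. norm (c \<beta>) * \<rho> ^ sum \<beta> UNIV)"
    using \<rho> by (simp add: mon norm_mult norm_power)
  then have "cube_series a \<rho> (LINT \<beta>|count_space UNIV. norm (c \<beta>) * \<rho> ^ sum \<beta> UNIV) c f"
    using \<rho> has_sum_integrable_count_space(2)[OF series] by (simp add: cube_series_def)
  then show ?thesis by (rule that)
qed

lemma cube_series_local_bounds:
  assumes cs: "cube_series a r M c f"
    and x: "x \<in> ball a (r / 2)"
  shows "iter_partial L f differentiable (at x)"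
    and "norm (iter_partial L f x) \<le> M * (2 * real (length L) / r) ^ length L"
    and "mset L = mset L' \<Longrightarrow> iter_partial L f x = iter_partial L' f x"
proof -
  have r: "0 < r" using cs by (simp add: cube_series_def)
  define u where "u = x - a"
  have xu: "x = a + u" by (simp add: u_def)
  have "norm u < r / 2" using x by (simp add: u_def dist_norm norm_minus_commute)
  then have u: "\<bar>u $ i\<bar> < r / 2" for i using component_le_norm_cart[of u i] by linarith
  \<comment> \<open>All steps together use up half of the radius. For the empty list the quotient
    would be 0, so the positive value 1 stands in.\<close>
  define \<delta> where "\<delta> L = (if L = [] then 1 else r / (2 * real (length L)))" for L :: "'a list"
  have ser: "cube_series a (r/2) (M / \<delta> L ^ length L) (foldr shift_coeff L c) (iter_partial L f)" for L
    using r by (intro cube_series_iter_partial[OF cs]) (auto simp: \<delta>_def field_simps)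
  show "iter_partial L f differentiable (at x)"
    unfolding xu by (rule differentiableI[OF cube_series_has_derivative[OF ser u]])
  have "norm (iter_partial L f x) \<le> M / \<delta> L ^ length L"
    unfolding xu by (rule cube_series_bound[OF ser less_imp_le[OF u]])
  also have "\<dots> = M * (2 * real (length L) / r) ^ length L"
    by (cases "L = []") (simp_all add: \<delta>_def power_divide)
  finally show "norm (iter_partial L f x) \<le> M * (2 * real (length L) / r) ^ length L" .
  have val: "iter_partial L f x = (LINT \<beta>|count_space UNIV. foldr shift_coeff L c \<beta> * of_real (monomial_at \<beta> u))" for L
    unfolding xu by (rule cube_series_eq[OF ser less_imp_le[OF u]])
  show "iter_partial L f x = iter_partial L' f x" if "mset L = mset L'"
    unfolding val foldr_shift_coeff_cong[OF that] ..
qed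

text \<open>
  Derivatives of order \<open>N\<close> are bounded by multiples of \<open>(R N)\<^sup>N\<close>: each of the \<open>N\<close> differentiations of a power
  series gives away the \<open>N\<close>-th part of its radius. By Stirling this is as good as \<open>R\<^sup>N N!\<close>.
\<close>

definition analytic_region :: "(real^'n::finite \<Rightarrow> complex) \<Rightarrow> (real^'n) set \<Rightarrow> bool" where
  "analytic_region f W \<longleftrightarrow> open W
     \<and> (\<forall>L. \<forall>x\<in>W. iter_partial L f differentiable (at x))
     \<and> (\<forall>L L'. \<forall>x\<in>W. mset L = mset L' \<longrightarrow> iter_partial L f x = iter_partial L' f x)
     \<and> (\<forall>K. compact K \<and> K \<subseteq> W \<longrightarrow> (\<exists>M\<ge>0. \<exists>R\<ge>0. \<forall>L. \<forall>x\<in>K.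
          norm (iter_partial L f x) \<le> M * (R * real (length L)) ^ length L))"

text \<open>The local bounds hold on half of each ball of convergence, and these half balls make up
  \<open>W\<close>. A compact set meets finitely many of them; the sums of their constants serve as
  common constants, also for an empty subcover, where a maximum would be undefined.\<close>

lemma real_analytic_on_region:
  assumes "real_analytic_on f U"
  obtains W where "U \<subseteq> W" "analytic_region f W"
proof -
  have "\<forall>a\<in>U. \<exists>r M c. cube_series a r M c f"
    using cube_series_exists[OF assms] by metis
  then obtain r M c where cs: "\<And>a. a \<in> U \<Longrightarrow> cube_series a (r a) (M a) (c a) f"
    by metis
  have r: "0 < r a" and M: "0 \<le> M a" if "a \<in> U" for a
    using cs[OF that] cube_series_bound[OF cs[OF that], of 0] by (auto simp: cube_series_def intro: order.trans[OF norm_ge_zero])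
  define W where "W = (\<Union>a\<in>U. ball a (r a / 2))"
  have "analytic_region f W"
    unfolding analytic_region_def
  proof (intro conjI allI ballI impI)
    show "open W" by (auto simp: W_def)
    show "iter_partial L f differentiable (at x)" if "x \<in> W" for L x
      using that cube_series_local_bounds(1)[OF cs] unfolding W_def by blast
    show "iter_partial L f x = iter_partial L' f x" if "x \<in> W" "mset L = mset L'" for L L' x
      using that cube_series_local_bounds(3)[OF cs] unfolding W_def by blast
    fix K assume K: "compact K \<and> K \<subseteq> W"
    then obtain C where C: "C \<subseteq> U" "finite C" "K \<subseteq> (\<Union>a\<in>C. ball a (r a / 2))"
      unfolding W_def by (elim conjE compactE_image) auto
    show "\<exists>M\<ge>0. \<exists>R\<ge>0. \<forall>L. \<forall>x\<in>K. norm (iter_partial L f x) \<le> M * (R * real (length L)) ^ length L"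
    proof (intro exI conjI allI ballI)
      show "0 \<le> (\<Sum>a\<in>C. M a)" using C M by (intro sum_nonneg) auto
      show "0 \<le> (\<Sum>a\<in>C. 2 / r a)" using C r by (intro sum_nonneg) (auto intro: less_imp_le)
      have nn: "0 \<le> M b" "0 \<le> 2 / r b" if "b \<in> C" for b
        using M r C that by (auto intro: less_imp_le)
      fix L x assume "x \<in> K"
      then obtain a where a: "a \<in> C" "x \<in> ball a (r a / 2)" using C by blast
      then have aU: "a \<in> U" using C by blast
      have "norm (iter_partial L f x) \<le> M a * (2 * real (length L) / r a) ^ length L"
        by (rule cube_series_local_bounds(2)[OF cs[OF aU] a(2)])
      also have "\<dots> = M a * (2 / r a * real (length L)) ^ length L" by simp
      also have "\<dots> \<le> (\<Sum>a\<in>C. M a) * ((\<Sum>a\<in>C. 2 / r a) * real (length L)) ^ length L"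
        using a(1) C(2) nn
        by (intro mult_mono power_mono mult_right_mono member_le_sum sum_nonneg mult_nonneg_nonneg zero_le_power)
           auto
      finally show "norm (iter_partial L f x) \<le> (\<Sum>a\<in>C. M a) * ((\<Sum>a\<in>C. 2 / r a) * real (length L)) ^ length L" .
    qed
  qed
  moreover have "U \<subseteq> W" using r by (force simp: W_def)
  ultimately show ?thesis using that by blast
qed

section \<open>Partial derivatives as local data\<close>

lemma has_derivative_sum_partial_scaleR:
  fixes f :: "real^'n::finite \<Rightarrow> 'b::real_normed_vector"
  assumes "f differentiable (at x)"
  shows "(f has_derivative (\<lambda>h. \<Sum>i\<in>UNIV. (h $ i) *\<^sub>R partial i f x)) (at x)"
proof -
  have d: "(f has_derivative frechet_derivative f (at x)) (at x)"
    using assms frechet_derivative_works by blast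
  then have lin: "linear (frechet_derivative f (at x))"
    using has_derivative_linear by blast
  have "frechet_derivative f (at x) h = (\<Sum>i\<in>UNIV. (h $ i) *\<^sub>R partial i f x)" for h
  proof -
    have "frechet_derivative f (at x) h = frechet_derivative f (at x) (\<Sum>i\<in>UNIV. (h $ i) *\<^sub>R axis i 1)"
      using basis_expansion[of h] by (simp add: scalar_mult_eq_scaleR)
    also have "\<dots> = (\<Sum>i\<in>UNIV. (h $ i) *\<^sub>R partial i f x)"
      by (simp add: linear_sum[OF lin] linear_scale[OF lin] partial_def)
    finally show ?thesis .
  qed
  then have "frechet_derivative f (at x) = (\<lambda>h. \<Sum>i\<in>UNIV. (h $ i) *\<^sub>R partial i f x)" ..
  with d show ?thesis by simp
qed

lemma has_derivative_sum_partial: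
  fixes f :: "real^'n::finite \<Rightarrow> complex"
  assumes "f differentiable (at x)"
  shows "(f has_derivative (\<lambda>h. \<Sum>i\<in>UNIV. of_real (h $ i) * partial i f x)) (at x)"
  using has_derivative_sum_partial_scaleR[OF assms] by (simp add: scaleR_conv_of_real)

text \<open>\<open>frechet_derivative\<close> is a choice from the set of derivatives. Functions
  that agree near x have the same set, so the choices coincide even where that set is empty.\<close>

lemma partial_cong_open:
  assumes "open V" "x \<in> V" "\<And>y. y \<in> V \<Longrightarrow> f y = g y"
  shows "partial i f x = partial i g x"
proof -
  have "(f has_derivative D) (at x) \<longleftrightarrow> (g has_derivative D) (at x)" for D
    using has_derivative_transform_within_open[OF _ assms(1,2), of f D UNIV g]
      has_derivative_transform_within_open[OF _ assms(1,2), of g D UNIV f] assms(3) by auto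
  then show ?thesis by (simp add: partial_def frechet_derivative_def)
qed

lemma differentiable_cong_open:
  assumes "open V" "x \<in> V" "\<And>y. y \<in> V \<Longrightarrow> f y = g y" "f differentiable (at x)"
  shows "g differentiable (at x)"
  using assms has_derivative_transform_within_open[OF _ assms(1,2), of f _ UNIV g]
  unfolding differentiable_def by blast

section \<open>Integral operators with smooth kernels\<close>

text \<open>\<open>K L\<close> stands for the derivative of \<open>K []\<close> in x along the index
  list \<open>L\<close>, the latest index in front. With all derivatives given as data, sums and
  multiples of kernels are handled without computing iterated derivatives of functions that are
  smooth only on \<open>W\<close>.\<close>

definition smooth_kernel ::
  "(real^'n::finite) set \<Rightarrow> (real^'n) set \<Rightarrow> ('n list \<Rightarrow> real^'n \<Rightarrow> real^'n \<Rightarrow> complex) \<Rightarrow> bool" where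
  "smooth_kernel W S K \<longleftrightarrow>
     (\<forall>L. \<forall>s\<in>S. \<forall>x\<in>W. ((\<lambda>x. K L x s) has_derivative (\<lambda>h. \<Sum>i\<in>UNIV. of_real (h $ i) * K (i # L) x s)) (at x))
     \<and> (\<forall>L. continuous_on (W \<times> S) (\<lambda>(x, s). K L x s))"

lemma smooth_kernel_subset: "smooth_kernel W S K \<Longrightarrow> W' \<subseteq> W \<Longrightarrow> smooth_kernel W' S K"
  unfolding smooth_kernel_def by (meson Sigma_mono continuous_on_subset subset_iff subset_refl)

lemma smooth_kernel_mult:
  assumes "smooth_kernel W S K" "continuous_on S w"
  shows "smooth_kernel W S (\<lambda>L x s. w s * K L x s)"
  unfolding smooth_kernel_def
proof (intro conjI allI ballI)
  fix L s x assume "s \<in> S" "x \<in> W"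
  then have "((\<lambda>x. K L x s) has_derivative (\<lambda>h. \<Sum>i\<in>UNIV. of_real (h $ i) * K (i # L) x s)) (at x)"
    using assms(1) by (simp add: smooth_kernel_def)
  from has_derivative_mult_right[OF this, of "w s"]
  show "((\<lambda>x. w s * K L x s) has_derivative (\<lambda>h. \<Sum>i\<in>UNIV. of_real (h $ i) * (w s * K (i # L) x s))) (at x)"
    by (simp add: sum_distrib_left mult_ac)
next
  fix L
  have "continuous_on (W \<times> S) (\<lambda>z. w (snd z))"
    by (rule continuous_on_compose2[OF assms(2) continuous_on_snd]) auto
  then show "continuous_on (W \<times> S) (\<lambda>(x, s). w s * K L x s)"
    using assms(1) unfolding smooth_kernel_def case_prod_beta by (intro continuous_on_mult) auto
qed

lemma smooth_kernel_sum:
  assumes "\<And>j. j \<in> J \<Longrightarrow> smooth_kernel W S (K j)"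
  shows "smooth_kernel W S (\<lambda>L x s. \<Sum>j\<in>J. K j L x s)"
  unfolding smooth_kernel_def
proof (intro conjI allI ballI)
  fix L s x assume "s \<in> S" "x \<in> W"
  then have "((\<lambda>x. K j L x s) has_derivative (\<lambda>h. \<Sum>i\<in>UNIV. of_real (h $ i) * K j (i # L) x s)) (at x)" if "j \<in> J" for j
    using assms that by (simp add: smooth_kernel_def)
  then have "((\<lambda>x. \<Sum>j\<in>J. K j L x s) has_derivative (\<lambda>h. \<Sum>j\<in>J. \<Sum>i\<in>UNIV. of_real (h $ i) * K j (i # L) x s)) (at x)"
    by (rule has_derivative_sum)
  then show "((\<lambda>x. \<Sum>j\<in>J. K j L x s) has_derivative (\<lambda>h. \<Sum>i\<in>UNIV. of_real (h $ i) * (\<Sum>j\<in>J. K j (i # L) x s))) (at x)"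
    by (subst (asm) sum.swap) (simp add: sum_distrib_left)
next
  show "continuous_on (W \<times> S) (\<lambda>(x, s). \<Sum>j\<in>J. K j L x s)" for L
    using assms unfolding smooth_kernel_def case_prod_beta by (intro continuous_on_sum) auto
qed

lemma smooth_kernel_diff:
  assumes "smooth_kernel W S K" "smooth_kernel W S K'"
  shows "smooth_kernel W S (\<lambda>L x s. K L x s - K' L x s)"
proof -
  \<comment> \<open>A difference is a sum over two indices, the second with weight -1, so the rules
    for sums and multiples apply.\<close>
  have "smooth_kernel W S (\<lambda>L x s. \<Sum>j\<in>(UNIV::bool set). if j then K L x s else - 1 * K' L x s)"
  proof (rule smooth_kernel_sum)
    fix j :: bool
    show "smooth_kernel W S (\<lambda>L x s. if j then K L x s else - 1 * K' L x s)"
      using assms(1) smooth_kernel_mult[OF assms(2), of "\<lambda>_. -1"] by (cases j) simp_all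
  qed
  then show ?thesis by (simp add: UNIV_bool algebra_simps)
qed

definition kernel_integral ::
  "(real^'n::finite) measure \<Rightarrow> (real^'n) set \<Rightarrow> (real^'n \<Rightarrow> real^'n \<Rightarrow> complex) \<Rightarrow> (real^'n \<Rightarrow> complex) \<Rightarrow> real^'n \<Rightarrow> complex" where
  "kernel_integral M S K \<theta> x = (LINT s:S|M. K x s * \<theta> s)"

lemma set_integrable_continuous_compact:
  fixes f :: "real^'n::finite \<Rightarrow> complex"
  assumes S: "compact S" and M: "sets M = sets borel" "emeasure M S < \<infinity>" and f: "continuous_on S f"
  shows "set_integrable M S f"
proof -
  have Sb: "S \<in> sets borel" using S by (rule borel_compact)
  obtain B where B: "\<And>s. s \<in> S \<Longrightarrow> norm (f s) \<le> B"
    using compact_imp_bounded[OF compact_continuous_image[OF f S]] 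
    unfolding bounded_iff by blast
  show ?thesis unfolding set_integrable_def
  proof (rule integrableI_bounded_set[where A = S and B = B])
    have "set_borel_measurable borel S f"
      unfolding set_borel_measurable_def using borel_measurable_continuous_on_indicator[OF Sb f] by simp
    then show "(\<lambda>x. indicator S x *\<^sub>R f x) \<in> borel_measurable M"
      using M measurable_cong_sets[OF M(1) refl] by (simp add: set_borel_measurable_def)
  qed (use Sb B M in auto)
qed

lemma continuous_on_slice:
  assumes "continuous_on (A \<times> B) f" "x \<in> A"
  shows "continuous_on B (\<lambda>y. f (x, y))"
proof -
  have "continuous_on B (\<lambda>y. (x, y))" by (intro continuous_on_Pair continuous_on_const continuous_on_id)
  from continuous_on_compose2[OF assms(1) this] show ?thesis using assms(2) by auto
qed

text \<open>On a closed ball around \<open>x0\<close> times the compact \<open>S\<close> the next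
  derivatives of the kernel are bounded. A constant therefore dominates, and it is integrable since
  \<open>S\<close> has finite measure.\<close>

lemma kernel_integral_has_derivative:
  fixes K :: "'n::finite list \<Rightarrow> real^'n \<Rightarrow> real^'n \<Rightarrow> complex"
  assumes S: "compact S" and M: "sets M = sets borel" "emeasure M S < \<infinity>"
    and W: "open W" "x0 \<in> W" and K: "smooth_kernel W S K" and \<theta>: "continuous_on S \<theta>"
  shows "(kernel_integral M S (K L) \<theta> has_derivative
      (\<lambda>h. \<Sum>i\<in>UNIV. of_real (h $ i) * kernel_integral M S (K (i # L)) \<theta> x0)) (at x0)"
proof -
  have Sb: "S \<in> sets borel" using S by (rule borel_compact)
  let ?N = "restrict_space M S"
  have spM: "space M = UNIV" using sets_eq_imp_space_eq[OF M(1)] by simp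
  have spN: "space ?N = S" by (simp add: space_restrict_space spM)
  have Kcont: "continuous_on S (\<lambda>s. K L x s * \<theta> s)" if "x \<in> W" for L x
  proof (rule continuous_on_mult[OF _ \<theta>])
    have "continuous_on (W \<times> S) (\<lambda>z. K L (fst z) (snd z))"
      using K by (simp add: smooth_kernel_def case_prod_beta)
    from continuous_on_slice[OF this that] show "continuous_on S (\<lambda>s. K L x s)" by simp
  qed
  have int: "integrable ?N (\<lambda>s. K L x s * \<theta> s)" if "x \<in> W" for L x
    using set_integrable_continuous_compact[OF S M Kcont[OF that]] Sb M(1) spM
    by (simp add: integrable_restrict_space set_integrable_def)
  have val: "kernel_integral M S (K L) \<theta> x = (LINT s|?N. K L x s * \<theta> s)" for L x
    using Sb M(1) spM
    by (simp add: kernel_integral_def set_lebesgue_integral_def integral_restrict_space)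
  obtain d where d: "0 < d" "cball x0 d \<subseteq> W" using W open_contains_cball by blast
  have "\<exists>B. \<forall>x\<in>cball x0 d. \<forall>s\<in>S. norm (K (i # L) x s * \<theta> s) \<le> B" for i
  proof -
    have "continuous_on (cball x0 d \<times> S) (\<lambda>z. K (i # L) (fst z) (snd z) * \<theta> (snd z))"
    proof (rule continuous_on_mult)
      show "continuous_on (cball x0 d \<times> S) (\<lambda>z. K (i # L) (fst z) (snd z))"
        using K d(2) unfolding smooth_kernel_def case_prod_beta
        by (meson Sigma_mono continuous_on_subset subset_refl)
      show "continuous_on (cball x0 d \<times> S) (\<lambda>z. \<theta> (snd z))"
        by (rule continuous_on_compose2[OF \<theta> continuous_on_snd]) auto
    qed
    from compact_imp_bounded[OF compact_continuous_image[OF this]] S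
    have "bounded ((\<lambda>z. K (i # L) (fst z) (snd z) * \<theta> (snd z)) ` (cball x0 d \<times> S))"
      by (simp add: compact_Times)
    then show ?thesis unfolding bounded_iff by fastforce
  qed
  then obtain B where B: "\<And>i x s. x \<in> cball x0 d \<Longrightarrow> s \<in> S \<Longrightarrow> norm (K (i # L) x s * \<theta> s) \<le> B i"
    by metis
  have "((\<lambda>x. LINT s|?N. K L x s * \<theta> s) has_derivative
      (\<lambda>h. LINT s|?N. (\<Sum>i\<in>UNIV. of_real (h $ i) * (K (i # L) x0 s * \<theta> s)))) (at x0)"
  proof (rule has_derivative_integral[OF d(1), where B = "\<lambda>s. \<Sum>i\<in>UNIV. B i"
        and F' = "\<lambda>x s h. \<Sum>i\<in>UNIV. of_real (h $ i) * (K (i # L) x s * \<theta> s)"])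
    fix x assume x: "x \<in> ball x0 d"
    then have xW: "x \<in> W" using d(2) by force
    show "integrable ?N (\<lambda>s. K L x s * \<theta> s)" by (rule int[OF xW])
    fix s assume "s \<in> space ?N"
    then have s: "s \<in> S" by (simp add: spN)
    have "((\<lambda>x. K L x s) has_derivative (\<lambda>h. \<Sum>i\<in>UNIV. of_real (h $ i) * K (i # L) x s)) (at x)"
      using K xW s by (simp add: smooth_kernel_def)
    from has_derivative_mult_left[OF this, of "\<theta> s"]
    show "((\<lambda>x. K L x s * \<theta> s) has_derivative (\<lambda>h. \<Sum>i\<in>UNIV. of_real (h $ i) * (K (i # L) x s * \<theta> s))) (at x)"
      by (simp add: sum_distrib_right mult.assoc)
    fix h :: "real^'n"
    have "norm (\<Sum>i\<in>UNIV. of_real (h $ i) * (K (i # L) x s * \<theta> s))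
        \<le> (\<Sum>i\<in>UNIV. norm (of_real (h $ i) * (K (i # L) x s * \<theta> s)))"
      by (rule norm_sum)
    also have "\<dots> \<le> (\<Sum>i\<in>UNIV. norm h * B i)"
      using x s unfolding norm_mult[of "of_real _"] norm_of_real
      by (intro sum_mono mult_mono component_le_norm_cart B) auto
    finally show "norm (\<Sum>i\<in>UNIV. of_real (h $ i) * (K (i # L) x s * \<theta> s)) \<le> (\<Sum>i\<in>UNIV. B i) * norm h"
      by (simp add: sum_distrib_left mult.commute)
  next
    show "integrable ?N (\<lambda>s. \<Sum>i\<in>UNIV. B i)"
    proof (rule finite_measure.integrable_const, rule finite_measureI)
      show "emeasure ?N (space ?N) \<noteq> \<infinity>"
        using M Sb spM by (simp add: emeasure_restrict_space spN less_top)
    qed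
    show "(\<lambda>s. \<Sum>i\<in>UNIV. of_real (h $ i) * (K (i # L) x0 s * \<theta> s)) \<in> borel_measurable ?N" for h :: "real^'n"
      by (intro borel_measurable_sum borel_measurable_times[OF borel_measurable_const] borel_measurable_integrable int W)
  qed
  moreover have "(LINT s|?N. (\<Sum>i\<in>UNIV. of_real (h $ i) * (K (i # L) x0 s * \<theta> s)))
       = (\<Sum>i\<in>UNIV. of_real (h $ i) * (LINT s|?N. K (i # L) x0 s * \<theta> s))" for h :: "real^'n"
    by (subst Bochner_Integration.integral_sum) (auto intro!: int W)
  ultimately show ?thesis unfolding val[abs_def] by simp
qed

section \<open>Bounded kernel operators into the C^2 functions on a closure\<close>

definition kernel_operator ::
  "(real^'n::finite) measure \<Rightarrow> (real^'n) set \<Rightarrow> (real^'n) set \<Rightarrow> ('n list \<Rightarrow> real^'n \<Rightarrow> real^'n \<Rightarrow> complex)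
     \<Rightarrow> (real^'n \<Rightarrow> complex) \<Rightarrow> real^'n \<Rightarrow> complex" where
  "kernel_operator M S V K \<theta> x = (if x \<in> closure V then kernel_integral M S (K []) \<theta> x else 0)"

lemma sup_norm_le:
  assumes "0 \<le> b" "\<And>x. x \<in> S \<Longrightarrow> norm (f x) \<le> b"
  shows "sup_norm S f \<le> b" "0 \<le> sup_norm S f"
proof -
  show "sup_norm S f \<le> b" unfolding sup_norm_def using assms by (intro cSup_least) auto
  have "bdd_above (insert 0 ((\<lambda>x. norm (f x)) ` S))"
    using assms by (intro bdd_aboveI[of _ b]) auto
  then show "0 \<le> sup_norm S f" unfolding sup_norm_def by (rule cSup_upper[rotated]) simp
qed

text \<open>The boundary enters the operator estimates as a compact set of finite Borel
  measure.\<close>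

locale kernel_setup =
  fixes M :: "(real^'n::finite) measure" and S V :: "(real^'n) set"
  assumes S: "compact S" and M: "sets M = sets borel" "emeasure M S < \<infinity>"
    and V: "open V" "bounded V"
begin

lemma set_integrable_kernel:
  assumes "smooth_kernel W S K" "x \<in> W" "continuous_on S \<theta>"
  shows "set_integrable M S (\<lambda>s. K L x s * \<theta> s)"
proof (rule set_integrable_continuous_compact[OF S M], rule continuous_on_mult[OF _ assms(3)])
  have "continuous_on (W \<times> S) (\<lambda>z. K L (fst z) (snd z))"
    using assms by (simp add: smooth_kernel_def case_prod_beta)
  from continuous_on_slice[OF this assms(2)] show "continuous_on S (\<lambda>s. K L x s)" by simp
qed

context
  fixes W :: "(real^'n) set" and K :: "'n list \<Rightarrow> real^'n \<Rightarrow> real^'n \<Rightarrow> complex" and \<theta> :: "real^'n \<Rightarrow> complex"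
  assumes W: "open W" "closure V \<subseteq> W" and K: "smooth_kernel W S K" and \<theta>: "continuous_on S \<theta>"
begin

lemma kernel_integral_continuous: "continuous_on W (kernel_integral M S (K L) \<theta>)"
  using has_derivative_continuous[OF kernel_integral_has_derivative[OF S M W(1) _ K \<theta>]]
  by (simp add: continuous_at_imp_continuous_on)

lemma partial_kernel_integral:
  assumes "x \<in> W"
  shows "partial i (kernel_integral M S (K L) \<theta>) x = kernel_integral M S (K (i # L)) \<theta> x"
proof -
  have "partial i (kernel_integral M S (K L) \<theta>) x
      = (\<Sum>j\<in>UNIV. of_real ((axis i 1 :: real^'n) $ j) * kernel_integral M S (K (j # L)) \<theta> x)"
    by (rule partial_eq[OF kernel_integral_has_derivative[OF S M W(1) assms K \<theta>]])
  also have "\<dots> = (\<Sum>j\<in>UNIV. if j = i then kernel_integral M S (K (j # L)) \<theta> x else 0)"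
    by (intro sum.cong) (auto simp: axis_def)
  finally show ?thesis by simp
qed

lemma kernel_integral_differentiable: "x \<in> W \<Longrightarrow> kernel_integral M S (K L) \<theta> differentiable (at x)"
  by (rule differentiableI[OF kernel_integral_has_derivative[OF S M W(1) _ K \<theta>]])

lemma V_subset: "x \<in> V \<Longrightarrow> x \<in> closure V" "x \<in> V \<Longrightarrow> x \<in> W"
  using W closure_subset by auto

lemma kernel_operator_eq: "x \<in> V \<Longrightarrow> kernel_operator M S V K \<theta> x = kernel_integral M S (K []) \<theta> x"
  using V_subset(1) by (simp add: kernel_operator_def)

lemma partial_kernel_operator:
  assumes "x \<in> V"
  shows "partial i (kernel_operator M S V K \<theta>) x = kernel_integral M S (K [i]) \<theta> x"
proof -
  have "partial i (kernel_operator M S V K \<theta>) x = partial i (kernel_integral M S (K []) \<theta>) x"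
    using kernel_operator_eq by (rule partial_cong_open[OF V(1) assms])
  then show ?thesis by (simp only: partial_kernel_integral[OF V_subset(2)[OF assms]])
qed

lemma partial_partial_kernel_operator:
  assumes "x \<in> V"
  shows "partial j (partial i (kernel_operator M S V K \<theta>)) x = kernel_integral M S (K [j, i]) \<theta> x"
proof -
  have "partial j (partial i (kernel_operator M S V K \<theta>)) x = partial j (kernel_integral M S (K [i]) \<theta>) x"
    using partial_kernel_operator by (rule partial_cong_open[OF V(1) assms])
  then show ?thesis by (simp only: partial_kernel_integral[OF V_subset(2)[OF assms]])
qed

lemma extends_kernel_integral:
  assumes "\<And>x. x \<in> V \<Longrightarrow> f x = kernel_integral M S (K L) \<theta> x"
  shows "extends_to_closure V f"
  unfolding extends_to_closure_def
  using continuous_on_subset[OF kernel_integral_continuous W(2)] assms by metis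

text \<open>The kernel is smooth on an open set \<open>W\<close> that contains the closure of
  \<open>V\<close>. So every derivative extends continuously to the closure, the extension being the
  integral of the differentiated kernel.\<close>

lemma kernel_operator_C2: "kernel_operator M S V K \<theta> \<in> C2_closure V"
  unfolding C2_closure_def
proof (intro CollectI conjI allI ballI impI)
  show "kernel_operator M S V K \<theta> x = 0" if "x \<notin> closure V" for x
    using that by (simp add: kernel_operator_def)
  show "continuous_on (closure V) (kernel_operator M S V K \<theta>)"
    using continuous_on_subset[OF kernel_integral_continuous W(2), of "[]"]
    by (rule continuous_on_eq) (simp add: kernel_operator_def)
  show "kernel_operator M S V K \<theta> differentiable (at x)" if "x \<in> V" for x
    using differentiable_cong_open[OF V(1) that kernel_operator_eq[symmetric] kernel_integral_differentiable]
      V_subset(2)[OF that] by blast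
  show "partial i (kernel_operator M S V K \<theta>) differentiable (at x)" if "x \<in> V" for x i
    using differentiable_cong_open[OF V(1) that partial_kernel_operator[symmetric] kernel_integral_differentiable]
      V_subset(2)[OF that] by blast
  show "extends_to_closure V (partial i (kernel_operator M S V K \<theta>))" for i
    by (rule extends_kernel_integral[OF partial_kernel_operator])
  show "extends_to_closure V (partial j (partial i (kernel_operator M S V K \<theta>)))" for i j
    by (rule extends_kernel_integral[OF partial_partial_kernel_operator])
qed

lemma norm_kernel_integral_le:
  assumes x: "x \<in> W" and B: "\<And>s. s \<in> S \<Longrightarrow> norm (K L x s) \<le> B" and T: "\<And>s. s \<in> S \<Longrightarrow> norm (\<theta> s) \<le> T"
  shows "norm (kernel_integral M S (K L) \<theta> x) \<le> measure M S * (B * T)"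
proof -
  have Sb: "S \<in> sets M" using borel_compact[OF S] M by simp
  have int: "integrable M (\<lambda>s. indicator S s *\<^sub>R (K L x s * \<theta> s))"
    using set_integrable_kernel[OF K x \<theta>] by (simp add: set_integrable_def)
  have "norm (kernel_integral M S (K L) \<theta> x) \<le> (LINT s|M. norm (indicator S s *\<^sub>R (K L x s * \<theta> s)))"
    unfolding kernel_integral_def set_lebesgue_integral_def by (rule integral_norm_bound)
  also have "\<dots> \<le> (LINT s|M. indicator S s * (B * T))"
  proof (rule integral_mono[OF integrable_norm[OF int]])
    show "integrable M (\<lambda>s. indicator S s * (B * T))"
      using M(2) Sb by (intro integrable_mult_left integrable_real_indicator)
    show "norm (indicator S s *\<^sub>R (K L x s * \<theta> s)) \<le> indicator S s * (B * T)" for s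
      using B[of s] T[of s] order.trans[OF norm_ge_zero B[of s]]
      by (auto simp: indicator_def norm_mult intro!: mult_mono)
  qed
  also have "\<dots> = measure M S * (B * T)" using Sb M(2) by simp
  finally show ?thesis .
qed

text \<open>The factor in front counts the terms of \<open>C2_norm\<close>: the function, its n
  first and its n^2 second derivatives. Each is an integral of a differentiated kernel, at most the
  measure of \<open>S\<close> times \<open>B * T\<close>.\<close>

lemma C2_norm_kernel_operator:
  assumes B: "\<And>L x s. length L \<le> 2 \<Longrightarrow> x \<in> V \<Longrightarrow> s \<in> S \<Longrightarrow> norm (K L x s) \<le> B"
    and T: "\<And>s. s \<in> S \<Longrightarrow> norm (\<theta> s) \<le> T" and nn: "0 \<le> B" "0 \<le> T"
  shows "C2_norm V (kernel_operator M S V K \<theta>)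
           \<le> (1 + real CARD('n) + real CARD('n) * real CARD('n)) * (measure M S * (B * T))"
    and "0 \<le> C2_norm V (kernel_operator M S V K \<theta>)"
proof -
  let ?u = "kernel_operator M S V K \<theta>" and ?b = "measure M S * (B * T)"
  have b0: "0 \<le> ?b" using nn by simp
  have bnd: "norm (kernel_integral M S (K L) \<theta> x) \<le> ?b" if "length L \<le> 2" "x \<in> V" for L x
    using that V_subset(2) by (intro norm_kernel_integral_le B T) auto
  have 1: "sup_norm V ?u \<le> ?b" "0 \<le> sup_norm V ?u"
    using b0 bnd by (auto intro!: sup_norm_le[where b = ?b] simp: kernel_operator_eq)
  have 2: "sup_norm V (partial i ?u) \<le> ?b" "0 \<le> sup_norm V (partial i ?u)" for i
    using b0 bnd by (auto intro!: sup_norm_le[where b = ?b] simp: partial_kernel_operator)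
  have 3: "sup_norm V (partial j (partial i ?u)) \<le> ?b" "0 \<le> sup_norm V (partial j (partial i ?u))" for i j
    using b0 bnd by (auto intro!: sup_norm_le[where b = ?b] simp: partial_partial_kernel_operator)
  have "(\<Sum>i\<in>UNIV. sup_norm V (partial i ?u)) \<le> (\<Sum>i\<in>(UNIV::'n set). ?b)"
    by (intro sum_mono 2)
  moreover have "(\<Sum>i\<in>UNIV. \<Sum>j\<in>UNIV. sup_norm V (partial j (partial i ?u))) \<le> (\<Sum>i\<in>(UNIV::'n set). \<Sum>j\<in>(UNIV::'n set). ?b)"
    by (intro sum_mono 3)
  ultimately show "C2_norm V ?u \<le> (1 + real CARD('n) + real CARD('n) * real CARD('n)) * ?b"
    using 1 unfolding C2_norm_def by (simp add: distrib_right)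
  show "0 \<le> C2_norm V ?u" unfolding C2_norm_def using 1 2 3 by (intro add_nonneg_nonneg sum_nonneg) auto
qed

end

lemma kernel_bounded_on_V:
  assumes W: "open W" "closure V \<subseteq> W" and K: "smooth_kernel W S K"
  shows "\<exists>B\<ge>0. \<forall>L x s. length L \<le> 2 \<longrightarrow> x \<in> V \<longrightarrow> s \<in> S \<longrightarrow> norm (K L x s) \<le> B"
proof -
  have "\<exists>B. \<forall>x\<in>V. \<forall>s\<in>S. norm (K L x s) \<le> B" for L
  proof -
    have "continuous_on (closure V \<times> S) (\<lambda>z. K L (fst z) (snd z))"
      using K W(2) unfolding smooth_kernel_def case_prod_beta
      by (meson Sigma_mono continuous_on_subset subset_refl)
    moreover have "compact (closure V \<times> S)" using V S by (simp add: compact_Times)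
    ultimately have "bounded ((\<lambda>z. K L (fst z) (snd z)) ` (closure V \<times> S))"
      by (intro compact_imp_bounded compact_continuous_image)
    then obtain B where "\<And>z. z \<in> closure V \<times> S \<Longrightarrow> norm (K L (fst z) (snd z)) \<le> B"
      unfolding bounded_iff by blast
    then show ?thesis using closure_subset[of V] by fastforce
  qed
  then obtain B where B: "\<And>L x s. x \<in> V \<Longrightarrow> s \<in> S \<Longrightarrow> norm (K L x s) \<le> B L" by metis
  let ?Ls = "{L :: 'n list. set L \<subseteq> UNIV \<and> length L \<le> 2}"
  have fin: "finite ?Ls" by (rule finite_lists_length_le) simp
  show ?thesis
  proof (intro exI[of _ "\<Sum>L\<in>?Ls. \<bar>B L\<bar>"] conjI allI impI)
    fix L :: "'n list" and x s assume *: "length L \<le> 2" "x \<in> V" "s \<in> S"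
    have "norm (K L x s) \<le> \<bar>B L\<bar>" using B[OF *(2,3), of L] by linarith
    also have "\<dots> \<le> (\<Sum>L\<in>?Ls. \<bar>B L\<bar>)" using * fin by (intro member_le_sum) auto
    finally show "norm (K L x s) \<le> (\<Sum>L\<in>?Ls. \<bar>B L\<bar>)" .
  qed (simp add: sum_nonneg)
qed

lemma kernel_operator_bounded:
  assumes W: "open W" "closure V \<subseteq> W" and K: "smooth_kernel W S K"
    and X: "\<And>\<theta>. \<theta> \<in> X \<Longrightarrow> continuous_on S \<theta>" "\<And>\<theta> s. \<theta> \<in> X \<Longrightarrow> s \<in> S \<Longrightarrow> norm (\<theta> s) \<le> nX \<theta>"
      "\<And>\<theta>. \<theta> \<in> X \<Longrightarrow> 0 \<le> nX \<theta>"
  shows "kernel_operator M S V K \<in> bounded_ops X nX (C2_closure V) (C2_norm V)"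
  unfolding bounded_ops_def
proof (intro CollectI conjI ballI allI)
  show "kernel_operator M S V K f \<in> C2_closure V" if "f \<in> X" for f
    by (rule kernel_operator_C2[OF W K X(1)[OF that]])
  show "kernel_operator M S V K (\<lambda>x. f x + g x) = (\<lambda>y. kernel_operator M S V K f y + kernel_operator M S V K g y)"
    if f: "f \<in> X" and g: "g \<in> X" for f g
  proof
    fix y
    show "kernel_operator M S V K (\<lambda>x. f x + g x) y = kernel_operator M S V K f y + kernel_operator M S V K g y"
    proof (cases "y \<in> closure V")
      case True
      then have y: "y \<in> W" using W by blast
      show ?thesis
        using set_integrable_kernel[OF K y X(1)[OF f], of "[]"] set_integrable_kernel[OF K y X(1)[OF g], of "[]"]
        by (simp add: kernel_operator_def kernel_integral_def set_integral_add(2) distrib_left)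
    qed (simp add: kernel_operator_def)
  qed
  show "kernel_operator M S V K (\<lambda>x. c * f x) = (\<lambda>y. c * kernel_operator M S V K f y)" for c f
  proof
    fix y
    have "(LINT s:S|M. K [] y s * (c * f s)) = c * (LINT s:S|M. K [] y s * f s)"
      by (subst set_integral_mult_right[symmetric]) (simp add: mult_ac)
    then show "kernel_operator M S V K (\<lambda>x. c * f x) y = c * kernel_operator M S V K f y"
      by (simp add: kernel_operator_def kernel_integral_def)
  qed
  obtain B where B: "0 \<le> B" "\<And>L x s. length L \<le> 2 \<Longrightarrow> x \<in> V \<Longrightarrow> s \<in> S \<Longrightarrow> norm (K L x s) \<le> B"
    using kernel_bounded_on_V[OF W K] by blast
  show "\<exists>C. \<forall>f\<in>X. C2_norm V (kernel_operator M S V K f) \<le> C * nX f"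
  proof (intro exI ballI)
    fix f assume f: "f \<in> X"
    have "C2_norm V (kernel_operator M S V K f)
      \<le> (1 + real CARD('n) + real CARD('n) * real CARD('n)) * (measure M S * (B * nX f))"
      by (rule C2_norm_kernel_operator(1)[OF W K X(1)[OF f] B(2) X(2)[OF f] B(1) X(3)[OF f]])
    then show "C2_norm V (kernel_operator M S V K f)
      \<le> ((1 + real CARD('n) + real CARD('n) * real CARD('n)) * measure M S * B) * nX f"
      by (simp add: mult_ac)
  qed
qed

text \<open>\<open>op_norm\<close> is a supremum of reals and says something only for a nonempty set
  that is bounded above. The zero function supplies an element and the kernel bound an upper bound.
  Both inequalities are needed to squeeze the norms of the remainders to 0.\<close>

lemma kernel_operator_op_norm:
  assumes W: "open W" "closure V \<subseteq> W" and K: "smooth_kernel W S K"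
    and X: "\<And>\<theta>. \<theta> \<in> X \<Longrightarrow> continuous_on S \<theta>" "\<And>\<theta> s. \<theta> \<in> X \<Longrightarrow> s \<in> S \<Longrightarrow> norm (\<theta> s) \<le> nX \<theta>"
      "(\<lambda>_. 0) \<in> X" "nX (\<lambda>_. 0) = 0"
    and B: "0 \<le> B" "\<And>L x s. length L \<le> 2 \<Longrightarrow> x \<in> V \<Longrightarrow> s \<in> S \<Longrightarrow> norm (K L x s) \<le> B"
  shows "op_norm X nX (C2_norm V) (kernel_operator M S V K)
           \<le> (1 + real CARD('n) + real CARD('n) * real CARD('n)) * (measure M S * B)" (is "_ \<le> ?b")
    and "0 \<le> op_norm X nX (C2_norm V) (kernel_operator M S V K)"
proof -
  let ?A = "(\<lambda>f. C2_norm V (kernel_operator M S V K f)) ` {f \<in> X. nX f \<le> 1}"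
  have bnd: "y \<le> ?b \<and> 0 \<le> y" if "y \<in> ?A" for y
  proof -
    obtain f where f: "f \<in> X" "nX f \<le> 1" "y = C2_norm V (kernel_operator M S V K f)" using that \<open>y \<in> ?A\<close> by blast
    have "norm (f s) \<le> 1" if "s \<in> S" for s using X(2)[OF f(1) that] f(2) by linarith
    from C2_norm_kernel_operator[OF W K X(1)[OF f(1)] B(2) this B(1)] f(3)
    show ?thesis by simp
  qed
  have mem: "C2_norm V (kernel_operator M S V K (\<lambda>_. 0)) \<in> ?A" using X(3,4) by auto
  show "op_norm X nX (C2_norm V) (kernel_operator M S V K) \<le> ?b"
    unfolding op_norm_def using mem bnd by (intro cSup_least) blast+
  have "bdd_above ?A" using bnd by (intro bdd_aboveI[of _ ?b]) blast
  from cSup_upper[OF mem this] bnd[OF mem]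
  show "0 \<le> op_norm X nX (C2_norm V) (kernel_operator M S V K)"
    unfolding op_norm_def by linarith
qed

end

section \<open>Analytic dependence of a layer kernel on the parameter\<close>

text \<open>The j-th derivative at t = 0 of the map that sends t to the \<open>L\<close>-th partial
  derivative of g at y - t s. Each step of the recursion is one directional derivative along -s,
  whose index m is put in front of \<open>L\<close>.\<close>

fun dir_deriv :: "(real^'n::finite \<Rightarrow> complex) \<Rightarrow> nat \<Rightarrow> 'n list \<Rightarrow> real^'n \<Rightarrow> real^'n \<Rightarrow> complex" where
  "dir_deriv g 0 L y s = iter_partial L g y"
| "dir_deriv g (Suc j) L y s = (\<Sum>m\<in>UNIV. of_real (- (s $ m)) * dir_deriv g j (m # L) y s)"

lemma dir_deriv_cong:
  assumes "analytic_region g W" "y \<in> W" "mset L = mset L'"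
  shows "dir_deriv g j L y s = dir_deriv g j L' y s"
  using assms(3)
proof (induction j arbitrary: L L')
  case 0
  with assms(1)[unfolded analytic_region_def, THEN conjunct2, THEN conjunct2, THEN conjunct1] assms(2)
  show ?case unfolding dir_deriv.simps by blast
next
  case (Suc j)
  have "dir_deriv g j (m # L) y s = dir_deriv g j (m # L') y s" for m
    using Suc.prems by (intro Suc.IH) simp
  then show ?case by simp
qed

lemma dir_deriv_has_derivative:
  fixes g :: "real^'n::finite \<Rightarrow> complex"
  assumes g: "analytic_region g W" and y: "y \<in> W"
  shows "((\<lambda>y. dir_deriv g j L y s) has_derivative (\<lambda>h. \<Sum>i\<in>UNIV. of_real (h $ i) * dir_deriv g j (i # L) y s)) (at y)"
proof (induction j arbitrary: L)
  case 0
  have "iter_partial L g differentiable (at y)" using g y by (simp add: analytic_region_def)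
  from has_derivative_sum_partial[OF this] show ?case by simp
next
  case (Suc j)
  have "((\<lambda>y. \<Sum>m\<in>UNIV. of_real (- (s $ m)) * dir_deriv g j (m # L) y s) has_derivative
      (\<lambda>h. \<Sum>m\<in>UNIV. of_real (- (s $ m)) * (\<Sum>i\<in>UNIV. of_real (h $ i) * dir_deriv g j (i # m # L) y s))) (at y)"
    by (intro has_derivative_sum has_derivative_mult_right Suc)
  moreover have "(\<Sum>m\<in>UNIV. of_real (- (s $ m)) * (\<Sum>i\<in>UNIV. of_real (h $ i) * dir_deriv g j (i # m # L) y s))
      = (\<Sum>i\<in>UNIV. of_real (h $ i) * dir_deriv g (Suc j) (i # L) y s)" for h :: "real^'n"
  proof -
    have "of_real (- (s $ m)) * (\<Sum>i\<in>UNIV. of_real (h $ i) * dir_deriv g j (i # m # L) y s)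
        = (\<Sum>i\<in>UNIV. of_real (h $ i) * (of_real (- (s $ m)) * dir_deriv g j (m # i # L) y s))" for m
      unfolding sum_distrib_left
    proof (rule sum.cong[OF refl])
      fix i
      \<comment> \<open>Differentiation in y and the recursion both put their index in front;
        symmetry of mixed derivatives exchanges the two.\<close>
      have sw: "dir_deriv g j (i # m # L) y s = dir_deriv g j (m # i # L) y s"
        by (rule dir_deriv_cong[OF g y]) simp
      show "of_real (- (s $ m)) * (of_real (h $ i) * dir_deriv g j (i # m # L) y s)
          = of_real (h $ i) * (of_real (- (s $ m)) * dir_deriv g j (m # i # L) y s)"
        unfolding sw by (rule mult.left_commute)
    qed
    then show ?thesis
      by (simp only: dir_deriv.simps sum_distrib_left) (rule sum.swap)
  qed
  ultimately show ?case by simp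
qed

lemma dir_deriv_continuous:
  assumes g: "analytic_region g W"
  shows "continuous_on (W \<times> S) (\<lambda>z. dir_deriv g j L (fst z) (snd z))"
proof (induction j arbitrary: L)
  case 0
  have "continuous_on W (iter_partial L g)"
    using g unfolding analytic_region_def
    by (intro continuous_at_imp_continuous_on ballI differentiable_imp_continuous_within) simp
  then show ?case unfolding dir_deriv.simps
    by (rule continuous_on_compose2[OF _ continuous_on_fst[OF continuous_on_id]]) auto
next
  case (Suc j)
  show ?case
    unfolding dir_deriv.simps
    by (intro continuous_on_sum continuous_on_mult Suc continuous_on_of_real continuous_on_minus
        continuous_on_component continuous_on_snd continuous_on_id)
qed

text \<open>Each directional step adds up n terms with a factor of modulus at most c and raises the
  order of differentiation by one.\<close>

lemma norm_dir_deriv_le: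
  fixes g :: "real^'n::finite \<Rightarrow> complex"
  assumes B: "\<And>L. norm (iter_partial L g y) \<le> M * (R * real (length L)) ^ length L" and s: "norm s \<le> c"
  shows "norm (dir_deriv g j L y s) \<le> (real CARD('n) * c) ^ j * (M * (R * real (j + length L)) ^ (j + length L))"
proof (induction j arbitrary: L)
  case 0
  then show ?case using B by simp
next
  case (Suc j)
  have c: "0 \<le> c" using s norm_ge_zero order_trans by blast
  \<comment> \<open>The bound depends on the length of the list only; \<open>undefined\<close>
    stands for whichever index m the step puts in front.\<close>
  let ?b = "(real CARD('n) * c) ^ j * (M * (R * real (j + length (undefined # L))) ^ (j + length (undefined # L)))"
  have "norm (dir_deriv g (Suc j) L y s) \<le> (\<Sum>m\<in>UNIV. norm (of_real (- (s $ m)) * dir_deriv g j (m # L) y s))"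
    unfolding dir_deriv.simps by (rule norm_sum)
  also have "\<dots> \<le> (\<Sum>m\<in>(UNIV::'n set). c * ?b)"
  proof (rule sum_mono)
    fix m
    have "\<bar>s $ m\<bar> \<le> c" using component_le_norm_cart[of s m] s by linarith
    moreover have "norm (dir_deriv g j (m # L) y s) \<le> ?b" using Suc[of "m # L"] by simp
    ultimately show "norm (of_real (- (s $ m)) * dir_deriv g j (m # L) y s) \<le> c * ?b"
      using c unfolding norm_mult norm_of_real by (intro mult_mono) auto
  qed
  also have "\<dots> = (real CARD('n) * c) ^ Suc j * (M * (R * real (Suc j + length L)) ^ (Suc j + length L))"
    by simp
  finally show ?case .
qed

lemma dir_deriv_taylor:
  fixes g :: "real^'n::finite \<Rightarrow> complex"
  assumes g: "analytic_region g W" and seg: "\<And>\<tau>'. \<bar>\<tau>'\<bar> \<le> \<bar>\<tau>\<bar> \<Longrightarrow> y - \<tau>' *\<^sub>R s \<in> W"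
    and B: "\<And>\<tau>'. \<bar>\<tau>'\<bar> \<le> \<bar>\<tau>\<bar> \<Longrightarrow> norm (dir_deriv g (Suc N) L (y - \<tau>' *\<^sub>R s) s) \<le> B"
  shows "norm (dir_deriv g 0 L (y - \<tau> *\<^sub>R s) s - (\<Sum>j\<le>N. of_real (\<tau> ^ j / fact j) * dir_deriv g j L y s))
          \<le> B * \<bar>\<tau>\<bar> ^ Suc N / fact N"
proof -
  define R where "R = dir_deriv g 0 L (y - \<tau> *\<^sub>R s) s - (\<Sum>j\<le>N. of_real (\<tau> ^ j / fact j) * dir_deriv g j L y s)"
  \<comment> \<open>Multiplication by \<open>w\<close> turns the remainder into its modulus. The
    real Taylor formula for the real part of \<open>w\<close> times the function then bounds the
    complex remainder without losing a factor.\<close>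
  define w where "w = cnj (sgn R)"
  have nw: "norm w \<le> 1" by (simp add: w_def norm_sgn)
  define f where "f j t = Re (w * dir_deriv g j L (y - t *\<^sub>R s) s)" for j t
  have der: "(f j has_field_derivative f (Suc j) t) (at t within {-\<bar>\<tau>\<bar>..\<bar>\<tau>\<bar>})" if "t \<in> {-\<bar>\<tau>\<bar>..\<bar>\<tau>\<bar>}" for j t
  proof -
    have W: "y - t *\<^sub>R s \<in> W" using that by (intro seg) auto
    have "((\<lambda>t. y - t *\<^sub>R s) has_derivative (\<lambda>h. - (h *\<^sub>R s))) (at t within {-\<bar>\<tau>\<bar>..\<bar>\<tau>\<bar>})"
      by (auto intro!: derivative_eq_intros)
    from has_derivative_compose[OF this dir_deriv_has_derivative[OF g W, of j L s]]
    have "((\<lambda>t. dir_deriv g j L (y - t *\<^sub>R s) s) has_derivative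
       (\<lambda>h. of_real h * dir_deriv g (Suc j) L (y - t *\<^sub>R s) s)) (at t within {-\<bar>\<tau>\<bar>..\<bar>\<tau>\<bar>})"
      by (simp add: sum_distrib_left mult_ac)
    from has_derivative_Re[OF has_derivative_mult_right[OF this, of w]]
    show ?thesis unfolding has_field_derivative_def f_def
      by (rule has_derivative_eq_rhs) (auto simp: fun_eq_iff algebra_simps)
  qed
  have bnd: "norm (f (Suc N) t) \<le> B" if "t \<in> {-\<bar>\<tau>\<bar>..\<bar>\<tau>\<bar>}" for t
  proof -
    have "norm (f (Suc N) t) \<le> norm (w * dir_deriv g (Suc N) L (y - t *\<^sub>R s) s)"
      unfolding f_def real_norm_def by (rule abs_Re_le_cmod)
    also have "\<dots> \<le> 1 * norm (dir_deriv g (Suc N) L (y - t *\<^sub>R s) s)"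
      unfolding norm_mult by (intro mult_right_mono nw) auto
    also have "\<dots> \<le> 1 * B" using that by (intro mult_left_mono B) auto
    finally show ?thesis by simp
  qed
  have "norm (f 0 \<tau> - (\<Sum>i\<le>N. f i 0 * (\<tau> - 0) ^ i / fact i)) \<le> B * norm (\<tau> - 0) ^ Suc N / fact N"
    by (rule field_Taylor[OF _ der bnd]) (auto simp: abs_if)
  moreover have "f 0 \<tau> - (\<Sum>i\<le>N. f i 0 * (\<tau> - 0) ^ i / fact i) = Re (w * R)"
  proof -
    have "Re (w * (of_real (\<tau> ^ j / fact j) * dir_deriv g j L y s)) = f j 0 * (\<tau> - 0) ^ j / fact j" for j
      unfolding f_def mult.left_commute[of w] scaleR_conv_of_real[symmetric] by simp
    then have "Re (w * (\<Sum>j\<le>N. of_real (\<tau> ^ j / fact j) * dir_deriv g j L y s)) = (\<Sum>i\<le>N. f i 0 * (\<tau> - 0) ^ i / fact i)"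
      by (simp only: sum_distrib_left Re_sum)
    then show ?thesis by (simp only: R_def right_diff_distrib minus_complex.sel f_def)
  qed
  moreover have "Re (w * R) = norm R"
  proof (cases "R = 0")
    case False
    have "w * R = R * cnj R / of_real (norm R)" by (simp add: w_def sgn_eq mult.commute)
    also have "\<dots> = of_real (norm R)"
      using False by (simp add: complex_norm_square[symmetric] power2_eq_square)
    finally show ?thesis by simp
  qed simp
  ultimately show ?thesis unfolding R_def[symmetric] by simp
qed

lemma power_div_fact_le_exp:
  fixes x :: real
  assumes "0 \<le> x"
  shows "x ^ n / fact n \<le> exp x"
proof -
  have "(\<Sum>m\<in>{n}. x ^ m / fact m) \<le> (\<Sum>m. x ^ m / fact m)"
    using assms summable_exp[of x] by (intro sum_le_suminf) (auto simp: divide_inverse mult.commute)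
  then show ?thesis by (simp add: exp_def divide_inverse mult.commute)
qed

text \<open>A crude Stirling estimate. The order N + 3 consists of N from the Taylor expansion, 1
  from the gradient and 2 from the C^2 norm, while the Taylor remainder divides by (N - 1)! only.
  The bound k^k \<le> 3^k k! gives a factor 3 per order. Writing (N + 3)! as 4! (N - 1)! times the
  binomial coefficient of N + 3 over 4, which is at most 2^(N + 3), gives a factor 2 per order and
  the constant 24 = 4!.\<close>

lemma power_self_fact_bound:
  assumes "1 \<le> N"
  shows "real (N + 3) ^ (N + 3) / fact (N - 1) \<le> 24 * 6 ^ (N + 3)"
proof -
  have k: "real k ^ k \<le> 3 ^ k * fact k" for k
  proof -
    have "real k ^ k / fact k \<le> exp (real k)" by (rule power_div_fact_le_exp) simp
    also have "exp (real k) = exp 1 ^ k" by (simp add: exp_of_nat_mult[symmetric])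
    also have "\<dots> \<le> 3 ^ k" by (intro power_mono exp_le) auto
    finally show ?thesis by (simp add: field_simps)
  qed
  have "real ((N + 3) choose 4) \<le> 2 ^ (N + 3)"
    using binomial_le_pow2[of "N + 3" 4] by (metis of_nat_le_iff of_nat_numeral of_nat_power)
  moreover have "fact (N + 3) = real ((N + 3) choose 4) * (24 * fact (N - 1))"
    using binomial_fact[of 4 "N + 3", where ?'a = real] assms by (simp add: fact_numeral field_simps Suc_diff_le)
  ultimately have "fact (N + 3) \<le> 2 ^ (N + 3) * (24 * fact (N - 1) :: real)"
    by (metis fact_ge_zero mult_nonneg_nonneg mult_right_mono zero_le_numeral)
  then have "(3::real) ^ (N + 3) * fact (N + 3) \<le> 3 ^ (N + 3) * (2 ^ (N + 3) * (24 * fact (N - 1)))"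
    by (rule mult_left_mono) simp
  with k[of "N + 3"] have "real (N + 3) ^ (N + 3) \<le> 3 ^ (N + 3) * (2 ^ (N + 3) * (24 * fact (N - 1)))"
    by linarith
  also have "\<dots> = 24 * 6 ^ (N + 3) * fact (N - 1)"
    by (simp add: power_mult_distrib[symmetric] mult_ac)
  finally show ?thesis by (simp add: divide_le_eq)
qed

definition shifted_region :: "(real^'n::finite) set \<Rightarrow> (real^'n) set \<Rightarrow> real^'n \<Rightarrow> real \<Rightarrow> (real^'n) set" where
  "shifted_region W S p t = {x. \<forall>s\<in>S. x - p - t *\<^sub>R s \<in> W}"

text \<open>
  \<open>layer_kernel g \<nu> p t j\<close> is \<open>1 / j!\<close> times the \<open>j\<close>-th derivative in \<open>t\<close> of the kernel
  \<open>- \<nu>(s) \<bullet> \<nabla>g(x - p - t s)\<close>, and the list \<open>L\<close> collects further derivatives in \<open>x\<close>.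
\<close>

definition layer_kernel ::
  "(real^'n::finite \<Rightarrow> complex) \<Rightarrow> (real^'n \<Rightarrow> real^'n) \<Rightarrow> real^'n \<Rightarrow> real \<Rightarrow> nat \<Rightarrow> 'n list \<Rightarrow> real^'n \<Rightarrow> real^'n \<Rightarrow> complex" where
  "layer_kernel g \<nu> p t j = (\<lambda>L x s. \<Sum>i\<in>UNIV. of_real (- (\<nu> s $ i) / fact j) * dir_deriv g j (L @ [i]) (x - p - t *\<^sub>R s) s)"

text \<open>The complement is the sum of the closed complement of \<open>W\<close> and the compact
  set of all p + t s, and the sum of a closed and a compact set is closed.\<close>

lemma open_shifted_region:
  assumes openW: "open W" and S: "compact S"
  shows "open (shifted_region W S p t)"
proof -
  have "shifted_region W S p t = - (\<Union>x\<in>- W. \<Union>y\<in>(\<lambda>s. p + t *\<^sub>R s) ` S. {x + y})"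
  proof -
    have eq: "x - p - t *\<^sub>R s \<notin> W \<longleftrightarrow> (\<exists>y\<in>- W. x = y + (p + t *\<^sub>R s))" for x s
    proof
      assume "x - p - t *\<^sub>R s \<notin> W"
      then show "\<exists>y\<in>- W. x = y + (p + t *\<^sub>R s)" by (intro bexI[of _ "x - p - t *\<^sub>R s"]) auto
    qed (auto simp: algebra_simps)
    have "x \<in> shifted_region W S p t \<longleftrightarrow> x \<in> - (\<Union>x\<in>- W. \<Union>y\<in>(\<lambda>s. p + t *\<^sub>R s) ` S. {x + y})" for x
    proof -
      have "x \<in> shifted_region W S p t \<longleftrightarrow> \<not> (\<exists>s\<in>S. x - p - t *\<^sub>R s \<notin> W)" by (simp add: shifted_region_def)
      also have "\<dots> \<longleftrightarrow> \<not> (\<exists>s\<in>S. \<exists>y\<in>- W. x = y + (p + t *\<^sub>R s))" by (simp only: eq)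
      also have "\<dots> \<longleftrightarrow> x \<in> - (\<Union>x\<in>- W. \<Union>y\<in>(\<lambda>s. p + t *\<^sub>R s) ` S. {x + y})"
        unfolding Compl_iff UN_iff bex_simps image_iff singleton_iff by blast
      finally show ?thesis .
    qed
    then show ?thesis by (rule set_eqI)
  qed
  moreover have "closed (\<Union>x\<in>- W. \<Union>y\<in>(\<lambda>s. p + t *\<^sub>R s) ` S. {x + y})"
    using openW S by (intro closed_compact_sums compact_continuous_image continuous_intros) auto
  ultimately show ?thesis by (simp only: open_Compl)
qed

text \<open>In \<open>layer_kernel\<close> the gradient index i stands at the end of the list, so
  that derivatives in x extend \<open>L\<close> at the front, as \<open>smooth_kernel\<close>
  requires.\<close>

lemma smooth_layer_kernel:
  assumes g: "analytic_region g W" and \<nu>: "continuous_on S \<nu>"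
  shows "smooth_kernel (shifted_region W S p t) S (layer_kernel g \<nu> p t j)"
  unfolding layer_kernel_def
proof (intro smooth_kernel_sum smooth_kernel_mult)
  show "continuous_on S (\<lambda>s. complex_of_real (- (\<nu> s $ i) / fact j))" for i
    by (intro continuous_on_of_real continuous_on_divide continuous_on_minus continuous_on_component \<nu> continuous_on_const) simp
  show "smooth_kernel (shifted_region W S p t) S (\<lambda>L x s. dir_deriv g j (L @ [i]) (x - p - t *\<^sub>R s) s)" for i
    unfolding smooth_kernel_def
  proof (intro conjI allI ballI)
    fix L s x assume "s \<in> S" "x \<in> shifted_region W S p t"
    then have W: "x - p - t *\<^sub>R s \<in> W" by (simp add: shifted_region_def)
    have "((\<lambda>x. x - p - t *\<^sub>R s) has_derivative (\<lambda>h. h)) (at x)"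
      by (auto intro!: derivative_eq_intros)
    from has_derivative_compose[OF this dir_deriv_has_derivative[OF g W, of j "L @ [i]" s]]
    show "((\<lambda>x. dir_deriv g j (L @ [i]) (x - p - t *\<^sub>R s) s) has_derivative
       (\<lambda>h. \<Sum>m\<in>UNIV. of_real (h $ m) * dir_deriv g j ((m # L) @ [i]) (x - p - t *\<^sub>R s) s)) (at x)"
      by simp
  next
    fix L
    have "continuous_on (shifted_region W S p t \<times> S) (\<lambda>z. (fst z - p - t *\<^sub>R snd z, snd z))"
      by (intro continuous_intros)
    moreover have "(\<lambda>z. (fst z - p - t *\<^sub>R snd z, snd z)) ` (shifted_region W S p t \<times> S) \<subseteq> W \<times> S"
      by (auto simp: shifted_region_def)
    ultimately show "continuous_on (shifted_region W S p t \<times> S) (\<lambda>(x, s). dir_deriv g j (L @ [i]) (x - p - t *\<^sub>R s) s)"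
      using continuous_on_compose2[OF dir_deriv_continuous[OF g, of S j "L @ [i]"]]
      by (fastforce simp: case_prod_beta)
  qed
qed

lemma kernel_integral_layer_kernel:
  "kernel_integral M S (layer_kernel g \<nu> p t 0 []) \<theta> x = - (LINT s:S|M. dot_grad (\<nu> s) g (x - p - t *\<^sub>R s) * \<theta> s)"
  unfolding kernel_integral_def set_lebesgue_integral_def Bochner_Integration.integral_minus[symmetric]
  by (intro Bochner_Integration.integral_cong refl) (simp add: layer_kernel_def dot_grad_def sum_negf)

context kernel_setup
begin

text \<open>The coefficient of order j at \<open>t0\<close> is the operator with kernel
  \<open>layer_kernel g \<nu> p t0 j\<close>. The remainder is again a kernel operator, so its norm
  is controlled by the supremum of its kernel and of the kernel's derivatives in x up to order
  two.\<close>

theorem real_analytic_ops_kernel: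
  fixes g :: "real^'n \<Rightarrow> complex" and \<nu> :: "real^'n \<Rightarrow> real^'n"
  assumes g: "analytic_region g W" and \<nu>: "continuous_on S \<nu>"
    and X: "\<And>\<theta>. \<theta> \<in> X \<Longrightarrow> continuous_on S \<theta>" "\<And>\<theta> s. \<theta> \<in> X \<Longrightarrow> s \<in> S \<Longrightarrow> norm (\<theta> s) \<le> nX \<theta>"
      "\<And>\<theta>. \<theta> \<in> X \<Longrightarrow> 0 \<le> nX \<theta>" "(\<lambda>_. 0) \<in> X" "nX (\<lambda>_. 0) = 0"
    and I: "open I" "\<And>t x s. t \<in> I \<Longrightarrow> x \<in> closure V \<Longrightarrow> s \<in> S \<Longrightarrow> x - p - t *\<^sub>R s \<in> W"
    and P: "P = (\<lambda>t \<theta> x. if x \<in> closure V then - (LINT s:S|M. dot_grad (\<nu> s) g (x - p - t *\<^sub>R s) * \<theta> s) else 0)"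
  shows "real_analytic_ops X nX (C2_closure V) (C2_norm V) I P"
proof -
  let ?kern = "layer_kernel g \<nu> p" and ?Wt = "shifted_region W S p"
  have openW: "open W" using g by (simp add: analytic_region_def)
  note open_Wt = open_shifted_region[OF openW S]
  note kern_smooth = smooth_layer_kernel[OF g \<nu>]
  have V_Wt: "closure V \<subseteq> ?Wt t" if "t \<in> I" for t
    using I(2)[OF that] unfolding shifted_region_def by blast
  have PK: "P t = kernel_operator M S V (?kern t 0)" for t
    by (intro ext) (simp add: P kernel_operator_def kernel_integral_layer_kernel)
  show ?thesis
    unfolding real_analytic_ops_def
  proof (intro conjI ballI)
    show "P t \<in> bounded_ops X nX (C2_closure V) (C2_norm V)" if "t \<in> I" for t
      unfolding PK by (rule kernel_operator_bounded[OF open_Wt V_Wt[OF that] kern_smooth X(1-3)])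
    fix t0 assume t0: "t0 \<in> I"
    obtain r1 where r1: "0 < r1" "cball t0 r1 \<subseteq> I" using I(1) t0 open_contains_cball by blast
    obtain c where c: "\<And>s. s \<in> S \<Longrightarrow> norm s \<le> c" "0 < c"
      using compact_imp_bounded[OF S] unfolding bounded_pos by blast
    obtain n0 where n0: "\<And>s. s \<in> S \<Longrightarrow> norm (\<nu> s) \<le> n0" "0 < n0"
      using compact_imp_bounded[OF compact_continuous_image[OF \<nu> S]] unfolding bounded_pos by blast
    \<comment> \<open>All points at which derivatives of g occur while t stays within
      \<open>r1\<close> of \<open>t0\<close>. The set is compact, so one pair of constants serves
      for all orders.\<close>
    define K where "K = (\<lambda>(x, s, t). x - p - t *\<^sub>R s) ` (closure V \<times> S \<times> cball t0 r1)"
    have "compact K" unfolding K_def case_prod_beta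
      using S V by (intro compact_continuous_image continuous_intros compact_Times) (auto simp: compact_closure)
    moreover have KW: "K \<subseteq> W" unfolding K_def using I(2) r1 by force
    ultimately have "\<exists>B\<ge>0. \<exists>R\<ge>0. \<forall>L. \<forall>y\<in>K. norm (iter_partial L g y) \<le> B * (R * real (length L)) ^ length L"
      using g by (simp add: analytic_region_def)
    then obtain B R where B: "0 \<le> B" "0 \<le> R"
        "\<And>L y. y \<in> K \<Longrightarrow> norm (iter_partial L g y) \<le> B * (R * real (length L)) ^ length L"
      by metis
    \<comment> \<open>At least 1, so that powers with an exponent below N + 3 may be replaced by the
      power N + 3.\<close>
    define R1 where "R1 = R + 1"
    have R1: "0 < R1" using B by (simp add: R1_def)
    \<comment> \<open>The geometric rate per Taylor order: \<open>6 * R1\<close> from the factorial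
      bound and \<open>real CARD('n) * c\<close> from a directional derivative along s. The radius r
      is chosen so that \<open>q * \<bar>\<tau>\<bar>\<close> is at most 1 / 2.\<close>
    define q where "q = 6 * R1 * (real CARD('n) * c)"
    have q: "0 < q" using R1 c by (simp add: q_def)
    define r where "r = min r1 (1 / (2 * q))"
    have r: "0 < r" using r1 q by (simp add: r_def)
    show "\<exists>r>0. \<exists>A. (\<forall>j. A j \<in> bounded_ops X nX (C2_closure V) (C2_norm V)) \<and>
       (\<forall>t\<in>I. \<bar>t - t0\<bar> < r \<longrightarrow>
         (\<lambda>N. op_norm X nX (C2_norm V) (\<lambda>f y. P t f y - (\<Sum>j<N. of_real ((t - t0) ^ j) * A j f y))) \<longlonglongrightarrow> 0)"
    proof (intro exI[of _ r] conjI exI[of _ "\<lambda>j. kernel_operator M S V (?kern t0 j)"] allI ballI impI r)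
      show "kernel_operator M S V (?kern t0 j) \<in> bounded_ops X nX (C2_closure V) (C2_norm V)" for j
        by (rule kernel_operator_bounded[OF open_Wt V_Wt[OF t0] kern_smooth X(1-3)])
      fix t assume t: "t \<in> I" "\<bar>t - t0\<bar> < r"
      define \<tau> where "\<tau> = t - t0"
      have \<tau>: "\<bar>\<tau>\<bar> \<le> r1" "q * \<bar>\<tau>\<bar> \<le> 1 / 2"
        using t(2) q by (auto simp: r_def \<tau>_def field_simps)
      define KN where "KN N = (\<lambda>L x s. ?kern t 0 L x s - (\<Sum>j<N. of_real (\<tau> ^ j) * ?kern t0 j L x s))" for N
      have KN_smooth: "smooth_kernel (?Wt t \<inter> ?Wt t0) S (KN N)" for N
        unfolding KN_def
        by (intro smooth_kernel_diff smooth_kernel_sum smooth_kernel_mult continuous_on_const)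
          (rule smooth_kernel_subset[OF kern_smooth], blast)+
      have Wtt: "open (?Wt t \<inter> ?Wt t0)" "closure V \<subseteq> ?Wt t \<inter> ?Wt t0"
        using open_Wt V_Wt t(1) t0 by auto
      have op_eq: "op_norm X nX (C2_norm V) (\<lambda>f y. P t f y - (\<Sum>j<N. of_real ((t - t0) ^ j) * kernel_operator M S V (?kern t0 j) f y))
         = op_norm X nX (C2_norm V) (kernel_operator M S V (KN N))" for N
      proof -
        have eq: "(\<lambda>y. P t f y - (\<Sum>j<N. of_real ((t - t0) ^ j) * kernel_operator M S V (?kern t0 j) f y))
            = kernel_operator M S V (KN N) f" if f: "f \<in> X" for f
        proof
          fix y
          show "P t f y - (\<Sum>j<N. of_real ((t - t0) ^ j) * kernel_operator M S V (?kern t0 j) f y)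
            = kernel_operator M S V (KN N) f y"
          proof (cases "y \<in> closure V")
            case True
            then have y: "y \<in> ?Wt t" "y \<in> ?Wt t0" using Wtt by auto
            have i1: "integrable M (\<lambda>s. indicator S s *\<^sub>R (?kern t 0 [] y s * f s))"
              using set_integrable_kernel[OF kern_smooth y(1) X(1)[OF f]] by (simp add: set_integrable_def)
            have i2: "integrable M (\<lambda>s. indicator S s *\<^sub>R (?kern t0 j [] y s * f s))" for j
              using set_integrable_kernel[OF kern_smooth y(2) X(1)[OF f]] by (simp add: set_integrable_def)
            have i3: "integrable M (\<lambda>s. of_real (\<tau> ^ j) * (indicator S s *\<^sub>R (?kern t0 j [] y s * f s)))" for j
              using i2 by (rule integrable_mult_right)
            have "(LINT s|M. indicator S s *\<^sub>R (KN N [] y s * f s))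
               = (LINT s|M. indicator S s *\<^sub>R (?kern t 0 [] y s * f s)
                    - (\<Sum>j<N. of_real (\<tau> ^ j) * (indicator S s *\<^sub>R (?kern t0 j [] y s * f s))))"
              by (intro Bochner_Integration.integral_cong refl)
                (simp add: KN_def left_diff_distrib sum_distrib_right mult.assoc indicator_def)
            also have "\<dots> = (LINT s|M. indicator S s *\<^sub>R (?kern t 0 [] y s * f s))
                - (\<Sum>j<N. of_real (\<tau> ^ j) * (LINT s|M. indicator S s *\<^sub>R (?kern t0 j [] y s * f s)))"
              unfolding Bochner_Integration.integral_diff[OF i1 Bochner_Integration.integrable_sum[OF i3]]
                Bochner_Integration.integral_sum[OF i3] integral_mult_right_zero ..
            finally show ?thesis
              using True by (simp add: PK kernel_operator_def kernel_integral_def set_lebesgue_integral_def \<tau>_def)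
          qed (simp add: PK kernel_operator_def)
        qed
        show ?thesis unfolding op_norm_def
          by (intro arg_cong[where f = Sup] image_cong refl arg_cong[where f = "C2_norm V"] eq) simp
      qed
      \<comment> \<open>The factors n and \<open>n0\<close> come from the sum over the components of
        the normal, 24 from \<open>power_self_fact_bound\<close>, and the cube from the three orders
        of differentiation beyond N.\<close>
      define C where "C = real CARD('n) * n0 * B * 24 * (6 * R1) ^ 3"
      have C: "0 \<le> C" using n0 B R1 by (simp add: C_def)
      \<comment> \<open>For N = 0 nothing has been subtracted and there is no Taylor remainder to
        estimate; only large N matter for the limit.\<close>
      have bnd: "norm (KN N L x s) \<le> C * (1 / 2) ^ N" if N: "N \<noteq> 0" and L: "length L \<le> 2" and x: "x \<in> V" and s: "s \<in> S" for N L x s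
      proof -
        obtain N' where N': "N = Suc N'" using N by (cases N) auto
        define y where "y = x - p - t0 *\<^sub>R s"
        have yt: "x - p - t *\<^sub>R s = y - \<tau> *\<^sub>R s" by (simp add: y_def \<tau>_def algebra_simps)
        have seg: "y - \<tau>' *\<^sub>R s \<in> K" if "\<bar>\<tau>'\<bar> \<le> \<bar>\<tau>\<bar>" for \<tau>'
        proof -
          have "(x, s, t0 + \<tau>') \<in> closure V \<times> S \<times> cball t0 r1"
            using closure_subset[of V] x s that \<tau>(1) by (auto simp: dist_norm)
          then show ?thesis unfolding K_def y_def by (rule rev_image_eqI) (simp add: algebra_simps)
        qed
        let ?D = "(real CARD('n) * c) ^ N * (B * (R1 * real (N + 3)) ^ (N + 3))"
        define E where "E i = dir_deriv g 0 (L @ [i]) (y - \<tau> *\<^sub>R s) s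
             - (\<Sum>j\<le>N'. of_real (\<tau> ^ j / fact j) * dir_deriv g j (L @ [i]) y s)" for i
        have E: "norm (E i) \<le> C / (real CARD('n) * n0) * (1 / 2) ^ N" for i
        proof -
          have "norm (E i) \<le> ?D * \<bar>\<tau>\<bar> ^ Suc N' / fact N'"
            unfolding E_def
          proof (rule dir_deriv_taylor[OF g])
            fix \<tau>' assume *: "\<bar>\<tau>'\<bar> \<le> \<bar>\<tau>\<bar>"
            show "y - \<tau>' *\<^sub>R s \<in> W" using seg[OF *] KW by (rule subsetD[rotated])
            let ?l = "length (L @ [i])"
            have "norm (dir_deriv g (Suc N') (L @ [i]) (y - \<tau>' *\<^sub>R s) s)
               \<le> (real CARD('n) * c) ^ Suc N' * (B * (R * real (Suc N' + ?l)) ^ (Suc N' + ?l))"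
              by (rule norm_dir_deriv_le[OF B(3)[OF seg[OF *]] c(1)[OF s]])
            also have "\<dots> \<le> (real CARD('n) * c) ^ Suc N' * (B * (R1 * real (N + 3)) ^ (N + 3))"
            proof (intro mult_left_mono)
              have "(R * real (Suc N' + ?l)) ^ (Suc N' + ?l) \<le> (R1 * real (N + 3)) ^ (Suc N' + ?l)"
                using L B(2) N' by (intro power_mono mult_mono) (auto simp: R1_def)
              also have "\<dots> \<le> (R1 * real (N + 3)) ^ (N + 3)"
              proof (rule power_increasing)
                show "1 \<le> R1 * real (N + 3)"
                  using mult_mono[of 1 R1 1 "real (N + 3)"] B(2) by (simp add: R1_def)
              qed (use L N' in auto)
              finally show "(R * real (Suc N' + ?l)) ^ (Suc N' + ?l) \<le> (R1 * real (N + 3)) ^ (N + 3)" .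
            qed (use B R1 c in auto)
            finally show "norm (dir_deriv g (Suc N') (L @ [i]) (y - \<tau>' *\<^sub>R s) s) \<le> ?D" by (simp only: N')
          qed
          also have "\<dots> = ((real CARD('n) * c) ^ N * \<bar>\<tau>\<bar> ^ N * R1 ^ (N + 3) * B) * (real (N + 3) ^ (N + 3) / fact (N - 1))"
            by (simp only: N' power_mult_distrib times_divide_eq_right times_divide_eq_left diff_Suc_1 mult_ac)
          also have "\<dots> \<le> ((real CARD('n) * c) ^ N * \<bar>\<tau>\<bar> ^ N * R1 ^ (N + 3) * B) * (24 * 6 ^ (N + 3))"
            using B R1 c N by (intro mult_left_mono power_self_fact_bound) auto
          also have "\<dots> = C / (real CARD('n) * n0) * (q * \<bar>\<tau>\<bar>) ^ N"
            using n0 by (simp add: C_def q_def power_mult_distrib power_add field_simps)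
          also have "\<dots> \<le> C / (real CARD('n) * n0) * (1 / 2) ^ N"
            using \<tau>(2) C n0 q by (intro mult_left_mono power_mono) auto
          finally show ?thesis .
        qed
        have "KN N L x s = (\<Sum>i\<in>UNIV. of_real (- (\<nu> s $ i)) * E i)"
        proof -
          have "(\<Sum>j<N. of_real (\<tau> ^ j) * ?kern t0 j L x s)
             = (\<Sum>j\<le>N'. \<Sum>i\<in>UNIV. of_real (- (\<nu> s $ i)) * (of_real (\<tau> ^ j / fact j) * dir_deriv g j (L @ [i]) y s))"
            unfolding N' lessThan_Suc_atMost layer_kernel_def sum_distrib_left y_def
            by (intro sum.cong refl) simp
          also have "\<dots> = (\<Sum>i\<in>UNIV. of_real (- (\<nu> s $ i)) * (\<Sum>j\<le>N'. of_real (\<tau> ^ j / fact j) * dir_deriv g j (L @ [i]) y s))"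
            by (subst sum.swap) (simp only: sum_distrib_left)
          finally show ?thesis
            unfolding KN_def E_def layer_kernel_def yt by (simp add: right_diff_distrib sum_subtractf sum_negf)
        qed
        also have "norm \<dots> \<le> (\<Sum>i\<in>UNIV. norm (of_real (- (\<nu> s $ i)) * E i))" by (rule norm_sum)
        also have "\<dots> \<le> (\<Sum>i\<in>(UNIV::'n set). n0 * (C / (real CARD('n) * n0) * (1 / 2) ^ N))"
        proof (rule sum_mono)
          fix i
          have "\<bar>\<nu> s $ i\<bar> \<le> n0" using component_le_norm_cart[of "\<nu> s" i] n0(1)[OF s] by linarith
          then show "norm (of_real (- (\<nu> s $ i)) * E i) \<le> n0 * (C / (real CARD('n) * n0) * (1 / 2) ^ N)"
            unfolding norm_mult norm_of_real using E n0 by (intro mult_mono) auto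
        qed
        also have "\<dots> = C * (1 / 2) ^ N" using n0 by simp
        finally show ?thesis .
      qed
      let ?m = "(1 + real CARD('n) + real CARD('n) * real CARD('n))"
      show "(\<lambda>N. op_norm X nX (C2_norm V) (\<lambda>f y. P t f y - (\<Sum>j<N. of_real ((t - t0) ^ j) * kernel_operator M S V (?kern t0 j) f y))) \<longlonglongrightarrow> 0"
        unfolding op_eq
      proof (rule tendsto_sandwich[where f = "\<lambda>_. 0"])
        have B0: "0 \<le> C * (1 / 2) ^ N" for N using C by simp
        show "\<forall>\<^sub>F N in sequentially. 0 \<le> op_norm X nX (C2_norm V) (kernel_operator M S V (KN N))"
          using eventually_gt_at_top[of 0]
        proof eventually_elim
          case (elim N)
          then show ?case
            by (intro kernel_operator_op_norm(2)[OF Wtt KN_smooth X(1,2,4,5) B0 bnd]) auto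
        qed
        show "\<forall>\<^sub>F N in sequentially. op_norm X nX (C2_norm V) (kernel_operator M S V (KN N)) \<le> ?m * (measure M S * (C * (1 / 2) ^ N))"
          using eventually_gt_at_top[of 0]
        proof eventually_elim
          case (elim N)
          then show ?case
            by (intro kernel_operator_op_norm(1)[OF Wtt KN_smooth X(1,2,4,5) B0 bnd]) auto
        qed
        have "(\<lambda>N. ?m * (measure M S * (C * (1 / 2) ^ N))) \<longlonglongrightarrow> ?m * (measure M S * (C * 0))"
          by (intro tendsto_mult tendsto_const LIMSEQ_realpow_zero) auto
        then show "(\<lambda>N. ?m * (measure M S * (C * (1 / 2) ^ N))) \<longlonglongrightarrow> 0" by simp
      qed simp
    qed
  qed
qed

end

section \<open>Normals, charts and the surface measure of a boundary\<close>

lemma has_derivative_grad: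
  fixes f :: "real^'n::finite \<Rightarrow> real"
  assumes "f differentiable (at x)"
  shows "(f has_derivative (\<lambda>h. grad f x \<bullet> h)) (at x)"
  using has_derivative_sum_partial_scaleR[OF assms]
  by (simp add: inner_vec_def grad_def mult.commute)

lemma grad_unique:
  fixes f :: "real^'n::finite \<Rightarrow> real"
  assumes "(f has_derivative (\<lambda>h. a \<bullet> h)) (at x)"
  shows "grad f x = a"
  by (simp add: grad_def partial_eq[OF assms] vec_eq_iff inner_axis)

lemma hoelder_on_imp_continuous_on:
  assumes "hoelder_on \<alpha> S f" "0 < \<alpha>"
  shows "continuous_on S f"
  unfolding continuous_on_def
proof
  fix x assume x: "x \<in> S"
  obtain C where C: "\<And>x y. x \<in> S \<Longrightarrow> y \<in> S \<Longrightarrow> norm (f x - f y) \<le> C * dist x y powr \<alpha>"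
    using assms(1) unfolding hoelder_on_def by blast
  show "(f \<longlongrightarrow> f x) (at x within S)"
  proof (rule LIM_zero_cancel, rule Lim_null_comparison)
    show "\<forall>\<^sub>F y in at x within S. norm (f y - f x) \<le> C * dist y x powr \<alpha>"
      using C x by (auto simp: eventually_at_filter)
    have "((\<lambda>y. C * dist y x powr \<alpha>) \<longlongrightarrow> C * 0 powr \<alpha>) (at x within S)"
      using assms(2) by (intro tendsto_mult tendsto_const tendsto_powr2[of "\<lambda>y. dist y x"])
        (auto intro!: tendsto_eq_intros)
    then show "((\<lambda>y. C * dist y x powr \<alpha>) \<longlongrightarrow> 0) (at x within S)" by simp
  qed
qed

lemma hoelder_on_imp_bounded:
  assumes f: "hoelder_on \<alpha> S f" and \<alpha>: "0 < \<alpha>" and S: "bounded S"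
  shows "\<exists>B\<ge>0. \<forall>x\<in>S. norm (f x) \<le> B"
proof (cases "S = {}")
  case False
  then obtain a where a: "a \<in> S" by blast
  obtain C where C: "\<And>x y. x \<in> S \<Longrightarrow> y \<in> S \<Longrightarrow> norm (f x - f y) \<le> C * dist x y powr \<alpha>"
    using f unfolding hoelder_on_def by blast
  have "norm (f x) \<le> norm (f a) + \<bar>C\<bar> * diameter S powr \<alpha>" if x: "x \<in> S" for x
  proof -
    have "norm (f x) \<le> norm (f a) + norm (f x - f a)" by (simp add: norm_triangle_sub)
    also have "norm (f x - f a) \<le> C * dist x a powr \<alpha>" by (rule C[OF x a])
    also have "\<dots> \<le> \<bar>C\<bar> * diameter S powr \<alpha>"
      using \<alpha> diameter_bounded_bound[OF S x a] by (intro mult_mono powr_mono2) auto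
    finally show ?thesis by simp
  qed
  then show ?thesis by (intro exI[of _ "norm (f a) + \<bar>C\<bar> * diameter S powr \<alpha>"]) simp
qed auto

lemma C1a_bounded_partial:
  fixes f :: "real^'n::finite \<Rightarrow> 'b::real_normed_vector"
  assumes "C1a \<alpha> U f" "0 < \<alpha>" "bounded U"
  obtains B where "0 \<le> B" "\<And>i x. x \<in> U \<Longrightarrow> norm (partial i f x) \<le> B"
proof -
  have "\<exists>B\<ge>0. \<forall>x\<in>U. norm (partial i f x) \<le> B" for i
    using assms hoelder_on_imp_bounded[of \<alpha> U "partial i f"] by (simp add: C1a_def)
  then obtain B where B: "\<And>i. 0 \<le> B i" "\<And>i x. x \<in> U \<Longrightarrow> norm (partial i f x) \<le> B i" by metis
  show ?thesis
  proof (rule that[of "\<Sum>i\<in>UNIV. B i"])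
    show "norm (partial i f x) \<le> (\<Sum>i\<in>UNIV. B i)" if "x \<in> U" for i x
      using B(2)[OF that, of i] member_le_sum[of i UNIV B] B(1) by fastforce
  qed (simp add: sum_nonneg B)
qed

text \<open>Hoelder continuous partial derivatives are bounded on a bounded set, and the mean value
  inequality on the convex set does the rest.\<close>

lemma C1a_lipschitz:
  fixes f :: "real^'n::finite \<Rightarrow> 'b::real_normed_vector"
  assumes f: "C1a \<alpha> U f" and \<alpha>: "0 < \<alpha>" and U: "bounded U" "convex U"
  obtains C where "0 \<le> C" "\<And>x y. x \<in> U \<Longrightarrow> y \<in> U \<Longrightarrow> norm (f x - f y) \<le> C * norm (x - y)"
proof -
  obtain B where B: "0 \<le> B" "\<And>i x. x \<in> U \<Longrightarrow> norm (partial i f x) \<le> B"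
    using C1a_bounded_partial[OF f \<alpha> U(1)] by blast
  let ?C = "real CARD('n) * B"
  show ?thesis
  proof (rule that[of ?C])
    fix x y assume xy: "x \<in> U" "y \<in> U"
    show "norm (f x - f y) \<le> ?C * norm (x - y)"
    proof (rule differentiable_bound[OF U(2) _ _ xy])
      fix z assume z: "z \<in> U"
      then have "f differentiable (at z)" using f by (simp add: C1a_def)
      from has_derivative_at_withinI[OF has_derivative_sum_partial_scaleR[OF this]]
      show "(f has_derivative (\<lambda>h. \<Sum>i\<in>UNIV. (h $ i) *\<^sub>R partial i f z)) (at z within U)" .
      show "onorm (\<lambda>h. \<Sum>i\<in>UNIV. (h $ i) *\<^sub>R partial i f z) \<le> ?C"
      proof (rule onorm_le)
        fix h :: "real^'n"
        have "norm (\<Sum>i\<in>UNIV. (h $ i) *\<^sub>R partial i f z) \<le> (\<Sum>i\<in>UNIV. norm ((h $ i) *\<^sub>R partial i f z))"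
          by (rule norm_sum)
        also have "\<dots> \<le> (\<Sum>i\<in>(UNIV::'n set). norm h * B)"
          unfolding norm_scaleR using z by (intro sum_mono mult_mono component_le_norm_cart B) auto
        finally show "norm (\<Sum>i\<in>UNIV. (h $ i) *\<^sub>R partial i f z) \<le> ?C * norm h"
          by (simp add: mult_ac)
      qed
    qed
  qed (simp add: B)
qed

section \<open>Uniqueness and continuity of the outward normal\<close>

text \<open>The condition under the description in \<open>outward_normal\<close>, named so that
  uniqueness of the normal can be proved.\<close>

definition local_defining_function ::
  "(real^'n::finite) set \<Rightarrow> real^'n \<Rightarrow> (real^'n \<Rightarrow> real) \<Rightarrow> real \<Rightarrow> bool" where
  "local_defining_function D x \<phi> r \<longleftrightarrow> r > 0
     \<and> (\<forall>y\<in>ball x r. \<phi> differentiable (at y)) \<and> continuous_on (ball x r) (grad \<phi>)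
     \<and> \<phi> x = 0 \<and> grad \<phi> x \<noteq> 0 \<and> (\<forall>y\<in>ball x r. y \<in> D \<longleftrightarrow> \<phi> y < 0)"

lemma has_derivative_pos_right:
  fixes \<phi> :: "real^'n::finite \<Rightarrow> real"
  assumes "\<phi> differentiable (at x)" "\<phi> x = 0"
  shows "((\<lambda>t. \<phi> (x + t *\<^sub>R w) / t) \<longlongrightarrow> grad \<phi> x \<bullet> w) (at_right 0)"
proof -
  have "((\<lambda>t. x + t *\<^sub>R w) has_derivative (\<lambda>h. h *\<^sub>R w)) (at 0)"
    by (auto intro!: derivative_eq_intros)
  from has_derivative_compose[OF this, of \<phi> "\<lambda>h. grad \<phi> x \<bullet> h"] has_derivative_grad[OF assms(1)]
  have "((\<lambda>t. \<phi> (x + t *\<^sub>R w)) has_derivative (\<lambda>h. (grad \<phi> x \<bullet> w) * h)) (at 0)"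
    by (simp add: mult.commute)
  then have "((\<lambda>t. \<phi> (x + t *\<^sub>R w)) has_field_derivative (grad \<phi> x \<bullet> w)) (at 0)"
    by (simp add: has_field_derivative_def)
  then have "((\<lambda>t. \<phi> (x + t *\<^sub>R w) / t) \<longlongrightarrow> grad \<phi> x \<bullet> w) (at 0)"
    by (simp add: DERIV_def assms(2))
  then show ?thesis by (rule filterlim_mono) (auto simp: at_le)
qed

text \<open>A short move from x along w makes the first function negative, hence leads into
  \<open>D\<close>. There the second function is negative as well, so its derivative along w cannot
  be positive.\<close>

lemma local_defining_function_direction:
  assumes 1: "local_defining_function D x \<phi>\<^sub>1 r\<^sub>1" and 2: "local_defining_function D x \<phi>\<^sub>2 r\<^sub>2"
    and w: "grad \<phi>\<^sub>1 x \<bullet> w < 0"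
  shows "grad \<phi>\<^sub>2 x \<bullet> w \<le> 0"
proof (rule ccontr)
  assume "\<not> grad \<phi>\<^sub>2 x \<bullet> w \<le> 0"
  then have w2: "grad \<phi>\<^sub>2 x \<bullet> w > 0" by simp
  have d: "\<phi>\<^sub>1 differentiable (at x)" "\<phi>\<^sub>1 x = 0" "\<phi>\<^sub>2 differentiable (at x)" "\<phi>\<^sub>2 x = 0"
    using 1 2 by (auto simp: local_defining_function_def)
  have "\<forall>\<^sub>F t in at_right 0. \<phi>\<^sub>1 (x + t *\<^sub>R w) / t < 0"
    by (rule order_tendstoD(2)[OF has_derivative_pos_right[OF d(1,2)] w])
  moreover have "\<forall>\<^sub>F t in at_right 0. \<phi>\<^sub>2 (x + t *\<^sub>R w) / t > 0"
    by (rule order_tendstoD(1)[OF has_derivative_pos_right[OF d(3,4)] w2])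
  moreover have lim: "((\<lambda>t. x + t *\<^sub>R w) \<longlongrightarrow> x) (at_right 0)"
    by (auto intro!: tendsto_eq_intros)
  have "\<forall>\<^sub>F t in at_right 0. x + t *\<^sub>R w \<in> ball x r\<^sub>1"
    by (rule topological_tendstoD[OF lim]) (use 1 in \<open>auto simp: local_defining_function_def\<close>)
  moreover have "\<forall>\<^sub>F t in at_right 0. x + t *\<^sub>R w \<in> ball x r\<^sub>2"
    by (rule topological_tendstoD[OF lim]) (use 2 in \<open>auto simp: local_defining_function_def\<close>)
  moreover have "\<forall>\<^sub>F t::real in at_right 0. 0 < t" by (rule eventually_at_right_less)
  ultimately have "\<forall>\<^sub>F t::real in at_right 0. False"
  proof eventually_elim
    case (elim t)
    then have "\<phi>\<^sub>1 (x + t *\<^sub>R w) < 0" "\<phi>\<^sub>2 (x + t *\<^sub>R w) > 0"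
      by (auto simp: divide_less_0_iff zero_less_divide_iff)
    with elim(3,4) 1 2 show ?case unfolding local_defining_function_def by (metis less_asym)
  qed
  then show False by simp
qed

text \<open>If the unit normals u and v differed, the direction v - u would lead strictly into
  \<open>D\<close> according to the first function and strictly out of it according to the
  second.\<close>

lemma local_defining_function_normal_unique:
  assumes 1: "local_defining_function D x \<phi>\<^sub>1 r\<^sub>1" and 2: "local_defining_function D x \<phi>\<^sub>2 r\<^sub>2"
  shows "grad \<phi>\<^sub>1 x /\<^sub>R norm (grad \<phi>\<^sub>1 x) = grad \<phi>\<^sub>2 x /\<^sub>R norm (grad \<phi>\<^sub>2 x)"
proof (rule ccontr)
  assume ne: "grad \<phi>\<^sub>1 x /\<^sub>R norm (grad \<phi>\<^sub>1 x) \<noteq> grad \<phi>\<^sub>2 x /\<^sub>R norm (grad \<phi>\<^sub>2 x)"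
  define a b where "a = grad \<phi>\<^sub>1 x" and "b = grad \<phi>\<^sub>2 x"
  have nz: "a \<noteq> 0" "b \<noteq> 0" using 1 2 by (auto simp: local_defining_function_def a_def b_def)
  define u v where "u = a /\<^sub>R norm a" and "v = b /\<^sub>R norm b"
  have uv: "u \<noteq> v" "norm u = 1" "norm v = 1" using ne nz by (auto simp: u_def v_def a_def b_def)
  have a: "a = norm a *\<^sub>R u" and b: "b = norm b *\<^sub>R v" using nz by (auto simp: u_def v_def)
  have uu: "u \<bullet> u = 1" "v \<bullet> v = 1" using uv by (simp_all add: dot_square_norm)
  have "0 < (u - v) \<bullet> (u - v)" using uv by simp
  also have "\<dots> = 2 - 2 * (u \<bullet> v)"
    by (simp add: inner_diff_left inner_diff_right uu inner_commute)
  finally have lt: "u \<bullet> v < 1" by simp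
  have "a \<bullet> (v - u) = norm a * (u \<bullet> v - 1)"
    by (subst a) (simp add: inner_diff_right uu algebra_simps)
  also have "\<dots> < 0" using lt nz by (simp add: mult_pos_neg)
  finally have "b \<bullet> (v - u) \<le> 0"
    unfolding a_def b_def by (rule local_defining_function_direction[OF 1 2])
  moreover have "b \<bullet> (v - u) = norm b * (1 - u \<bullet> v)"
    by (subst b) (simp add: inner_diff_right uu inner_commute algebra_simps)
  moreover have "0 < norm b * (1 - u \<bullet> v)" using lt nz by simp
  ultimately show False by simp
qed

lemma outward_normal_eq:
  assumes "local_defining_function D x \<phi> r"
  shows "outward_normal D x = grad \<phi> x /\<^sub>R norm (grad \<phi> x)"
proof -
  have "outward_normal D x = (THE \<nu>. \<exists>\<phi> r. local_defining_function D x \<phi> r \<and> \<nu> = grad \<phi> x /\<^sub>R norm (grad \<phi> x))"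
    unfolding outward_normal_def local_defining_function_def by (simp only: conj_assoc)
  also have "\<dots> = grad \<phi> x /\<^sub>R norm (grad \<phi> x)"
  proof (rule the_equality)
    show "\<exists>\<phi>' r. local_defining_function D x \<phi>' r \<and> grad \<phi> x /\<^sub>R norm (grad \<phi> x) = grad \<phi>' x /\<^sub>R norm (grad \<phi>' x)"
      using assms by blast
    fix \<nu> assume "\<exists>\<phi> r. local_defining_function D x \<phi> r \<and> \<nu> = grad \<phi> x /\<^sub>R norm (grad \<phi> x)"
    then obtain \<phi>' r' where "local_defining_function D x \<phi>' r'" "\<nu> = grad \<phi>' x /\<^sub>R norm (grad \<phi>' x)"
      by blast
    with local_defining_function_normal_unique[OF assms] show "\<nu> = grad \<phi> x /\<^sub>R norm (grad \<phi> x)"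
      by metis
  qed
  finally show ?thesis .
qed

text \<open>A defining function at x also defines \<open>D\<close> at nearby boundary points y.
  Since y is not in the open set \<open>D\<close>, \<phi> is nonnegative at y; if it were positive,
  a neighbourhood of y would miss \<open>D\<close>. So a single \<phi> gives the normals near x, and
  they inherit the continuity of its gradient.\<close>

lemma local_defining_function_move:
  assumes ldf: "local_defining_function D x \<phi> r" and D: "open D" and y: "y \<in> frontier D"
    and near: "y \<in> ball x r" "grad \<phi> y \<noteq> 0"
  shows "local_defining_function D y \<phi> (r - dist x y)"
proof -
  have sub: "ball y (r - dist x y) \<subseteq> ball x r"
  proof
    fix z assume "z \<in> ball y (r - dist x y)"
    then show "z \<in> ball x r" using dist_triangle[of x z y] by simp
  qed
  have cont: "continuous (at y) \<phi>"
    using ldf near differentiable_imp_continuous_within unfolding local_defining_function_def by blast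
  have "y \<notin> D" using y D by (simp add: frontier_def interior_open)
  then have "0 \<le> \<phi> y" using ldf near unfolding local_defining_function_def by auto
  moreover have "\<not> 0 < \<phi> y"
  proof
    assume "0 < \<phi> y"
    with cont have "\<forall>\<^sub>F z in at y. 0 < \<phi> z" unfolding continuous_within by (rule order_tendstoD)
    moreover have "\<forall>\<^sub>F z in at y. z \<in> ball x r"
      using near by (intro eventually_at_in_open') auto
    ultimately have "\<forall>\<^sub>F z in at y. z \<notin> D"
    proof eventually_elim
      case (elim z)
      then show ?case using ldf unfolding local_defining_function_def by force
    qed
    then have "\<not> y islimpt D" by (simp add: islimpt_iff_eventually)
    with y \<open>y \<notin> D\<close> show False by (simp add: frontier_def closure_def)
  qed
  ultimately have "\<phi> y = 0" by simp
  then show ?thesis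
    using ldf near sub continuous_on_subset[OF _ sub] unfolding local_defining_function_def by auto
qed

lemma is_chartD:
  fixes \<gamma> :: "real^'n::finite \<Rightarrow> real"
  assumes "is_chart \<alpha> D (x, e, r, \<gamma>)"
  shows "norm e = 1" and "0 < r" and "\<gamma> v = \<gamma> (hproj e v)" and "C1a \<alpha> (ball 0 r) \<gamma>" and "\<gamma> 0 = 0"
    and "\<exists>\<delta>>0. \<forall>v. norm (hproj e v) < r \<and> \<bar>v \<bullet> e\<bar> < \<delta> \<longrightarrow> (x + v \<in> D \<longleftrightarrow> v \<bullet> e < \<gamma> v)"
proof -
  note c = assms[unfolded is_chart_def prod.case]
  show "norm e = 1" by (rule c[THEN conjunct1])
  show "0 < r" by (rule c[THEN conjunct2, THEN conjunct1])
  show "\<gamma> v = \<gamma> (hproj e v)" by (rule c[THEN conjunct2, THEN conjunct2, THEN conjunct1, THEN spec])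
  show "C1a \<alpha> (ball 0 r) \<gamma>" by (rule c[THEN conjunct2, THEN conjunct2, THEN conjunct2, THEN conjunct1])
  show "\<gamma> 0 = 0" by (rule c[THEN conjunct2, THEN conjunct2, THEN conjunct2, THEN conjunct2, THEN conjunct1])
  show "\<exists>\<delta>>0. \<forall>v. norm (hproj e v) < r \<and> \<bar>v \<bullet> e\<bar> < \<delta> \<longrightarrow> (x + v \<in> D \<longleftrightarrow> v \<bullet> e < \<gamma> v)"
    using c[THEN conjunct2, THEN conjunct2, THEN conjunct2, THEN conjunct2, THEN conjunct2] by (elim exE conjE) (rule exI, rule conjI)
qed

lemma norm_hproj_le:
  assumes "norm e = 1"
  shows "norm (hproj e v) \<le> norm v"
proof -
  have ee: "e \<bullet> e = 1" using assms by (simp add: dot_square_norm)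
  have "norm v ^ 2 = norm (hproj e v) ^ 2 + (v \<bullet> e) ^ 2"
    unfolding power2_norm_eq_inner hproj_def
    by (simp add: inner_diff_left inner_diff_right ee inner_commute power2_eq_square)
  then have "norm (hproj e v) ^ 2 \<le> norm v ^ 2" by simp
  then show ?thesis by (rule power2_le_imp_le) simp
qed

text \<open>The function is the height above the graph. Its gradient at x is nonzero because
  \<gamma> is constant along e, so that the derivative along e is 1. The radius min r \<delta> keeps
  the ball inside the cylinder of the chart.\<close>

lemma is_chart_local_defining_function:
  fixes \<gamma> :: "real^'n::finite \<Rightarrow> real"
  assumes ch: "is_chart \<alpha> D (x, e, r, \<gamma>)" and \<alpha>: "0 < \<alpha>"
  obtains \<phi> \<rho> where "local_defining_function D x \<phi> \<rho>"
proof -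
  note e = is_chartD(1)[OF ch] and r = is_chartD(2)[OF ch] and hp = is_chartD(3)[OF ch]
    and C1 = is_chartD(4)[OF ch] and \<gamma>0 = is_chartD(5)[OF ch]
  obtain \<delta> where \<delta>: "\<delta> > 0" "\<And>v. norm (hproj e v) < r \<Longrightarrow> \<bar>v \<bullet> e\<bar> < \<delta> \<Longrightarrow> x + v \<in> D \<longleftrightarrow> v \<bullet> e < \<gamma> v"
    using is_chartD(6)[OF ch] by blast
  have ee: "e \<bullet> e = 1" using e by (simp add: dot_square_norm)
  define \<rho> where "\<rho> = min r \<delta>"
  define \<phi> where "\<phi> y = (y - x) \<bullet> e - \<gamma> (y - x)" for y
  have diff\<gamma>: "\<gamma> differentiable (at v)" if "v \<in> ball 0 r" for v
    using C1 that by (simp add: C1a_def)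
  have der: "(\<phi> has_derivative (\<lambda>h. (e - grad \<gamma> (y - x)) \<bullet> h)) (at y)" if y: "y \<in> ball x \<rho>" for y
  proof -
    have "y - x \<in> ball 0 r" using y by (simp add: \<rho>_def dist_norm norm_minus_commute)
    from has_derivative_grad[OF diff\<gamma>[OF this]]
    have "(\<gamma> has_derivative (\<lambda>h. grad \<gamma> (y - x) \<bullet> h)) (at (y - x))" .
    moreover have "((\<lambda>y. y - x) has_derivative (\<lambda>h. h)) (at y)"
      by (auto intro!: derivative_eq_intros)
    ultimately have "((\<lambda>y. \<gamma> (y - x)) has_derivative (\<lambda>h. grad \<gamma> (y - x) \<bullet> h)) (at y)"
      by (rule has_derivative_compose[rotated])
    moreover have "((\<lambda>y. (y - x) \<bullet> e) has_derivative (\<lambda>h. h \<bullet> e)) (at y)"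
      by (auto intro!: derivative_eq_intros)
    ultimately have "(\<phi> has_derivative (\<lambda>h. h \<bullet> e - grad \<gamma> (y - x) \<bullet> h)) (at y)"
      unfolding \<phi>_def by (intro has_derivative_diff)
    then show ?thesis by (simp add: inner_diff_left inner_diff_right inner_commute)
  qed
  have gr: "grad \<phi> y = e - grad \<gamma> (y - x)" if "y \<in> ball x \<rho>" for y
    by (rule grad_unique[OF der[OF that]])
  have xb: "x \<in> ball x \<rho>" using r \<delta> by (simp add: \<rho>_def)
  have "local_defining_function D x \<phi> \<rho>"
    unfolding local_defining_function_def
  proof (intro conjI ballI)
    show "\<rho> > 0" using r \<delta> by (simp add: \<rho>_def)
    show "\<phi> differentiable (at y)" if "y \<in> ball x \<rho>" for y
      using der[OF that] by (rule differentiableI)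
    have "continuous_on (ball 0 r) (partial i \<gamma>)" for i
      using C1 by (intro hoelder_on_imp_continuous_on[OF _ \<alpha>]) (simp add: C1a_def)
    then have "continuous_on (ball 0 r) (grad \<gamma>)"
      unfolding grad_def[abs_def] by (rule continuous_on_vec_lambda)
    moreover have "(\<lambda>y. y - x) ` ball x \<rho> \<subseteq> ball 0 r"
      by (auto simp: \<rho>_def dist_norm norm_minus_commute)
    ultimately have "continuous_on (ball x \<rho>) (\<lambda>y. grad \<gamma> (y - x))"
      by (rule continuous_on_compose2[OF _ continuous_on_diff[OF continuous_on_id continuous_on_const]])
    then have "continuous_on (ball x \<rho>) (\<lambda>y. e - grad \<gamma> (y - x))"
      by (intro continuous_intros)
    then show "continuous_on (ball x \<rho>) (grad \<phi>)"
      by (rule continuous_on_eq) (simp add: gr)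
    show "\<phi> x = 0" by (simp add: \<phi>_def \<gamma>0)
    have "\<phi> (x + t *\<^sub>R e) = t" for t
    proof -
      have "\<gamma> (t *\<^sub>R e) = \<gamma> 0" using hp[of "t *\<^sub>R e"] by (simp add: hproj_def ee)
      then show ?thesis by (simp add: \<phi>_def ee \<gamma>0)
    qed
    moreover have "\<phi> x = 0" by (simp add: \<phi>_def \<gamma>0)
    ultimately have "((\<lambda>t::real. t / t) \<longlongrightarrow> grad \<phi> x \<bullet> e) (at_right 0)"
      using has_derivative_pos_right[of \<phi> x e] differentiableI[OF der[OF xb]] by simp
    moreover have "((\<lambda>t::real. t / t) \<longlongrightarrow> 1) (at_right 0)"
      by (rule tendsto_eventually) (auto simp: eventually_at_filter)
    ultimately have "grad \<phi> x \<bullet> e = 1"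
      by (rule tendsto_unique[OF trivial_limit_at_right_real])
    then show "grad \<phi> x \<noteq> 0" by auto
    fix y assume y: "y \<in> ball x \<rho>"
    then have ny: "norm (y - x) < r" "norm (y - x) < \<delta>" by (auto simp: \<rho>_def dist_norm norm_minus_commute)
    have "\<bar>(y - x) \<bullet> e\<bar> \<le> norm (y - x)" using Cauchy_Schwarz_ineq2[of "y - x" e] e by simp
    with ny \<delta>(2)[of "y - x"] norm_hproj_le[OF e, of "y - x"]
    show "y \<in> D \<longleftrightarrow> \<phi> y < 0" by (simp add: \<phi>_def)
  qed
  then show ?thesis by (rule that)
qed

lemma of_class_C1a_local_defining_function:
  assumes "of_class_C1a \<alpha> D" "0 < \<alpha>" "x \<in> frontier D"
  obtains \<phi> \<rho> where "local_defining_function D x \<phi> \<rho>"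
proof -
  obtain c where "is_chart \<alpha> D c" "chart_base c = x" using assms unfolding of_class_C1a_def by blast
  then obtain e r \<gamma> where "is_chart \<alpha> D (x, e, r, \<gamma>)" by (cases c) (auto simp: chart_base_def)
  from is_chart_local_defining_function[OF this assms(2)] that show ?thesis by blast
qed

lemma continuous_on_outward_normal:
  assumes D: "of_class_C1a \<alpha> D" and \<alpha>: "0 < \<alpha>"
  shows "continuous_on (frontier D) (outward_normal D)"
  unfolding continuous_on_def
proof
  fix x assume x: "x \<in> frontier D"
  obtain \<phi> \<rho> where ldf: "local_defining_function D x \<phi> \<rho>"
    by (rule of_class_C1a_local_defining_function[OF D \<alpha> x])
  have \<rho>: "0 < \<rho>" and g0: "grad \<phi> x \<noteq> 0" and cont: "continuous_on (ball x \<rho>) (grad \<phi>)"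
    using ldf by (auto simp: local_defining_function_def)
  have "continuous (at x) (grad \<phi>)"
    using cont \<rho> by (simp add: continuous_on_eq_continuous_at)
  then have lim: "(grad \<phi> \<longlongrightarrow> grad \<phi> x) (at x within frontier D)"
    by (simp add: continuous_at_imp_continuous_at_within continuous_within[symmetric])
  have "\<forall>\<^sub>F y in at x within frontier D. grad \<phi> y \<noteq> 0"
    by (rule tendsto_imp_eventually_ne[OF lim g0])
  moreover have "\<forall>\<^sub>F y in at x within frontier D. y \<in> ball x \<rho>"
    using \<rho> by (intro eventually_at_in_open'[THEN filter_leD[OF at_le[OF subset_UNIV]]]) auto
  moreover have "\<forall>\<^sub>F y in at x within frontier D. y \<in> frontier D"
    by (simp add: eventually_at_filter)
  ultimately have "\<forall>\<^sub>F y in at x within frontier D. grad \<phi> y /\<^sub>R norm (grad \<phi> y) = outward_normal D y"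
  proof eventually_elim
    case (elim y)
    have "open D" using D by (simp add: of_class_C1a_def)
    from outward_normal_eq[OF local_defining_function_move[OF ldf this elim(3,2,1)]] show ?case by simp
  qed
  moreover have "((\<lambda>y. grad \<phi> y /\<^sub>R norm (grad \<phi> y)) \<longlongrightarrow> grad \<phi> x /\<^sub>R norm (grad \<phi> x)) (at x within frontier D)"
    using g0 by (intro tendsto_intros lim) auto
  ultimately show "(outward_normal D \<longlongrightarrow> outward_normal D x) (at x within frontier D)"
    unfolding outward_normal_eq[OF ldf] by (rule Lim_transform_eventually[rotated])
qed

section \<open>Hausdorff measure and its finiteness on a boundary\<close>

text \<open>The Hausdorff outer measure itself, with the supremum over all scales \<delta>, and not
  the content at one fixed scale.\<close>

definition hausdorff_content :: "(real^'n::finite) set \<Rightarrow> ennreal" where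
  "hausdorff_content A = (SUP \<delta>\<in>{0<..}. surface_premeasure \<delta> A)"

lemma space_surface_measure [simp]: "space surface_measure = UNIV"
  by (simp add: surface_measure_def space_measure_of_conv)

lemma sets_surface_measure [simp]: "sets surface_measure = sets borel"
  unfolding surface_measure_def
  by (subst sets_measure_of_conv) (simp add: sets.sigma_sets_eq[of borel, simplified])

text \<open>
  \<open>measure_of\<close> returns the zero measure unless the Hausdorff outer measure is countably additive on Borel
  sets. Finiteness and scaling hold in either case, so that additivity never has to be proved.
\<close>

lemma emeasure_surface_measure:
  fixes A :: "(real^'n::finite) set"
  shows
  "emeasure surface_measure A = (if A \<in> sets borel
     \<and> measure_space UNIV (sets borel) (hausdorff_content :: (real^'n::finite) set \<Rightarrow> ennreal)
   then hausdorff_content A else 0)"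
  unfolding surface_measure_def
  unfolding hausdorff_content_def[abs_def, symmetric] emeasure_measure_of_conv
  by (simp add: sets.sigma_sets_eq[of borel, simplified])

text \<open>A box-counting condition of dimension m: at every scale 1 / N there is a cover by O(N^m)
  pieces of diameter O(1 / N). It is stable under finite unions, and it implies finite m-dimensional
  Hausdorff measure.\<close>

definition small_covers :: "nat \<Rightarrow> (real^'n::finite) set \<Rightarrow> bool" where
  "small_covers m S \<longleftrightarrow> (\<exists>c\<ge>0. \<exists>d\<ge>0. \<forall>N\<ge>1. \<exists>\<C>. finite \<C> \<and> real (card \<C>) \<le> c * real N ^ m \<and> S \<subseteq> \<Union>\<C>
      \<and> (\<forall>X\<in>\<C>. bounded X \<and> diameter X \<le> d / real N))"

lemma small_coversI:
  assumes "0 \<le> c" "0 \<le> d"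
    and "\<And>N. N \<ge> 1 \<Longrightarrow> \<exists>\<C>. finite \<C> \<and> real (card \<C>) \<le> c * real N ^ m \<and> S \<subseteq> \<Union>\<C>
      \<and> (\<forall>X\<in>\<C>. bounded X \<and> diameter X \<le> d / real N)"
  shows "small_covers m S"
  using assms unfolding small_covers_def by blast

lemma small_covers_subset: "small_covers m S \<Longrightarrow> T \<subseteq> S \<Longrightarrow> small_covers m T"
  unfolding small_covers_def by (meson order_trans)

lemma small_covers_empty: "small_covers m {}"
  unfolding small_covers_def by (intro exI[of _ 0] conjI allI impI exI[of _ "{}"]) auto

lemma small_covers_Un:
  assumes "small_covers m S" "small_covers m T"
  shows "small_covers m (S \<union> T)"
proof -
  obtain c d where c: "0 \<le> c" "0 \<le> d" "\<And>N. N \<ge> 1 \<Longrightarrow> \<exists>\<C>. finite \<C> \<and> real (card \<C>) \<le> c * real N ^ m \<and> S \<subseteq> \<Union>\<C>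
      \<and> (\<forall>X\<in>\<C>. bounded X \<and> diameter X \<le> d / real N)"
    using assms(1) unfolding small_covers_def by metis
  obtain c' d' where c': "0 \<le> c'" "0 \<le> d'" "\<And>N. N \<ge> 1 \<Longrightarrow> \<exists>\<C>. finite \<C> \<and> real (card \<C>) \<le> c' * real N ^ m \<and> T \<subseteq> \<Union>\<C>
      \<and> (\<forall>X\<in>\<C>. bounded X \<and> diameter X \<le> d' / real N)"
    using assms(2) unfolding small_covers_def by metis
  show ?thesis
  proof (rule small_coversI[of "c + c'" "max d d'"])
    fix N :: nat assume N: "1 \<le> N"
    obtain \<C> where \<C>: "finite \<C>" "real (card \<C>) \<le> c * real N ^ m" "S \<subseteq> \<Union>\<C>" "\<forall>X\<in>\<C>. bounded X \<and> diameter X \<le> d / real N"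
      using c(3)[OF N] by blast
    obtain \<C>' where \<C>': "finite \<C>'" "real (card \<C>') \<le> c' * real N ^ m" "T \<subseteq> \<Union>\<C>'" "\<forall>X\<in>\<C>'. bounded X \<and> diameter X \<le> d' / real N"
      using c'(3)[OF N] by blast
    have dd: "d / real N \<le> max d d' / real N" "d' / real N \<le> max d d' / real N"
      by (intro divide_right_mono; simp)+
    show "\<exists>\<C>. finite \<C> \<and> real (card \<C>) \<le> (c + c') * real N ^ m \<and> S \<union> T \<subseteq> \<Union>\<C>
        \<and> (\<forall>X\<in>\<C>. bounded X \<and> diameter X \<le> max d d' / real N)"
    proof (intro exI[of _ "\<C> \<union> \<C>'"] conjI ballI)
      have "real (card (\<C> \<union> \<C>')) \<le> real (card \<C>) + real (card \<C>')"
        using card_Un_le[of \<C> \<C>'] by linarith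
      then show "real (card (\<C> \<union> \<C>')) \<le> (c + c') * real N ^ m"
        using \<C>(2) \<C>'(2) by (simp add: distrib_right)
      show "bounded X" "diameter X \<le> max d d' / real N" if "X \<in> \<C> \<union> \<C>'" for X
        using that \<C>(4) \<C>'(4) dd by (auto intro: order_trans)
    qed (use \<C> \<C>' in auto)
  qed (use c c' in auto)
qed

lemma small_covers_UN:
  assumes "finite A" "\<And>a. a \<in> A \<Longrightarrow> small_covers m (S a)"
  shows "small_covers m (\<Union>a\<in>A. S a)"
  using assms by (induction A rule: finite_induct) (auto intro: small_covers_empty small_covers_Un)

lemma surface_premeasure_le_cover:
  fixes A :: "(real^'n::finite) set"
  assumes n: "CARD('n) \<ge> 2" and fin: "finite \<C>" and cov: "A \<subseteq> \<Union>\<C>"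
    and X: "\<And>X. X \<in> \<C> \<Longrightarrow> bounded X" "\<And>X. X \<in> \<C> \<Longrightarrow> diameter X \<le> d" and d: "0 \<le> d" "d \<le> \<delta>"
  shows "surface_premeasure \<delta> A
     \<le> ennreal (real (card \<C>) * (unit_ball_vol (real (CARD('n) - 1)) * (d / 2) ^ (CARD('n) - 1)))"
proof -
  let ?v = "unit_ball_vol (real (CARD('n) - 1))" and ?m = "CARD('n) - 1"
  obtain xs where xs: "set xs = \<C>" "distinct xs" using finite_distinct_list[OF fin] by blast
  define C where "C i = (if i < length xs then xs ! i else {})" for i
  have CX: "bounded (C i)" "diameter (C i) \<le> d" for i
    using X xs(1) d by (auto simp: C_def)
  have "surface_premeasure \<delta> A \<le> (\<Sum>i. ennreal (?v * (diameter (C i) / 2) ^ ?m))"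
    unfolding surface_premeasure_def
  proof (rule INF_lower, intro CollectI conjI allI)
    show "A \<subseteq> (\<Union>i. C i)"
    proof
      fix a assume "a \<in> A"
      then obtain X where "X \<in> set xs" "a \<in> X" using cov xs by blast
      then obtain i where "i < length xs" "a \<in> xs ! i" by (metis in_set_conv_nth)
      then show "a \<in> (\<Union>i. C i)" by (auto simp: C_def)
    qed
    show "bounded (C i)" "diameter (C i) \<le> \<delta>" for i using CX[of i] d by auto
  qed
  \<comment> \<open>The sequence of sets is padded with empty sets of diameter 0; they contribute 0
    because the exponent n - 1 is positive.\<close>
  also have "\<dots> = (\<Sum>i<length xs. ennreal (?v * (diameter (C i) / 2) ^ ?m))"
    using n by (intro suminf_finite) (auto simp: C_def)
  also have "\<dots> \<le> (\<Sum>i<length xs. ennreal (?v * (d / 2) ^ ?m))"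
    using CX diameter_ge_0[OF CX(1)]
    by (intro sum_mono ennreal_leI mult_left_mono power_mono divide_right_mono) auto
  also have "\<dots> = ennreal (real (card \<C>) * (?v * (d / 2) ^ ?m))"
    using d xs by (simp add: distinct_card[symmetric] ennreal_mult[symmetric] ennreal_of_nat_eq_real_of_nat)
  finally show ?thesis .
qed

text \<open>In the product of the number of pieces, O(N^m), and the size of each, (d / N)^m, the
  powers of N cancel; the same bound holds at every scale.\<close>

lemma small_covers_finite_hausdorff:
  fixes S :: "(real^'n::finite) set"
  assumes n: "CARD('n) \<ge> 2" and S: "small_covers (CARD('n) - 1) S"
  shows "hausdorff_content S < \<infinity>"
proof -
  let ?v = "unit_ball_vol (real (CARD('n) - 1))" and ?m = "CARD('n) - 1"
  obtain c d where c: "0 \<le> c" "0 \<le> d" "\<And>N. N \<ge> 1 \<Longrightarrow> \<exists>\<C>. finite \<C> \<and> real (card \<C>) \<le> c * real N ^ ?m \<and> S \<subseteq> \<Union>\<C>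
      \<and> (\<forall>X\<in>\<C>. bounded X \<and> diameter X \<le> d / real N)"
    using S unfolding small_covers_def by metis
  have "hausdorff_content S \<le> ennreal (c * (?v * (d / 2) ^ ?m))"
    unfolding hausdorff_content_def
  proof (rule SUP_least)
    fix \<delta> :: real assume "\<delta> \<in> {0<..}"
    then have \<delta>: "0 < \<delta>" by simp
    obtain N0 where "d / \<delta> < real N0" using reals_Archimedean2 by blast
    then obtain N where N: "1 \<le> N" "d / \<delta> \<le> real N" by (meson le_cases less_imp_le of_nat_mono order_trans)
    then have dN: "d / real N \<le> \<delta>" using \<delta> by (simp add: field_simps)
    obtain \<C> where \<C>: "finite \<C>" "real (card \<C>) \<le> c * real N ^ ?m" "S \<subseteq> \<Union>\<C>" "\<forall>X\<in>\<C>. bounded X \<and> diameter X \<le> d / real N"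
      using c(3)[OF N(1)] by blast
    have "surface_premeasure \<delta> S \<le> ennreal (real (card \<C>) * (?v * (d / real N / 2) ^ ?m))"
      by (rule surface_premeasure_le_cover[OF n \<C>(1,3)]) (use \<C>(4) c dN in auto)
    also have "\<dots> \<le> ennreal (c * real N ^ ?m * (?v * (d / real N / 2) ^ ?m))"
      using \<C>(2) c by (intro ennreal_leI mult_right_mono) auto
    also have "c * real N ^ ?m * (?v * (d / real N / 2) ^ ?m) = c * (?v * (d / 2) ^ ?m)"
      using N by (simp add: power_divide)
    finally show "surface_premeasure \<delta> S \<le> ennreal (c * (?v * (d / 2) ^ ?m))" .
  qed
  then show ?thesis by (rule le_less_trans) simp
qed

lemma bounded_of_norm_diff:
  assumes "\<And>x y. x \<in> X \<Longrightarrow> y \<in> X \<Longrightarrow> norm (x - y) \<le> d"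
  shows "bounded X"
proof (cases "X = {}")
  case False
  then obtain a where "a \<in> X" by blast
  with assms have "X \<subseteq> cball a d" by (auto simp: dist_norm)
  then show ?thesis using bounded_cball bounded_subset by blast
qed simp

text \<open>The image of a chart is a Lipschitz graph over a disc in the hyperplane orthogonal to e,
  and a grid cuts the disc into N^(n-1) cells. The grid uses the standard coordinates except one
  index k for which e has a component that is not small; this avoids rotating e onto an
  axis.\<close>

lemma chart_small_covers:
  fixes c :: "'n::finite chart"
  assumes ch: "is_chart \<alpha> D c" and \<alpha>: "0 < \<alpha>"
  shows "small_covers (CARD('n) - 1) (chart_map c ` chart_ball c)"
proof -
  obtain x e r \<gamma> where c: "c = (x, e, r, \<gamma>)" by (cases c)
  note ch' = ch[unfolded c]
  note e = is_chartD(1)[OF ch'] and r = is_chartD(2)[OF ch'] and C1 = is_chartD(4)[OF ch']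
  have hp: "\<gamma> v = \<gamma> (hproj e v)" for v by (rule is_chartD(3)[OF ch'])
  have ee: "e \<bullet> e = 1" using e by (simp add: dot_square_norm)
  obtain G where G: "0 \<le> G" "\<And>u v. u \<in> ball 0 r \<Longrightarrow> v \<in> ball 0 r \<Longrightarrow> norm (\<gamma> u - \<gamma> v) \<le> G * norm (u - v)"
    using C1a_lipschitz[OF C1 \<alpha> bounded_ball convex_ball] by blast
  let ?n = "real CARD('n)"
  \<comment> \<open>Otherwise the l1 norm of e, which bounds its Euclidean norm, would be less than
    1.\<close>
  obtain k where k: "1 \<le> ?n * \<bar>e $ k\<bar>"
  proof (rule ccontr)
    assume "\<not> thesis"
    then have lt: "\<bar>e $ k\<bar> < 1 / ?n" for k using that[of k] by (force simp: field_simps)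
    have "norm e \<le> (\<Sum>k\<in>UNIV. \<bar>e $ k\<bar>)" by (rule norm_le_l1_cart)
    also have "\<dots> < (\<Sum>k\<in>(UNIV::'n set). 1 / ?n)" by (rule sum_strict_mono) (use lt in auto)
    finally show False using e by simp
  qed
  let ?f = "chart_map c"
  have fval: "?f v = x + hproj e v + \<gamma> v *\<^sub>R e" for v by (simp add: chart_map_def c)
  have hproj_orth: "hproj e v = v" if "v \<bullet> e = 0" for v using that by (simp add: hproj_def)
  have f_hproj: "?f v = ?f (hproj e v)" for v
    unfolding fval hp[symmetric] by (simp add: hproj_def inner_diff_left ee)
  have lip: "norm (?f u - ?f v) \<le> (1 + G) * norm (u - v)"
    if "u \<in> ball 0 r" "v \<in> ball 0 r" "u \<bullet> e = 0" "v \<bullet> e = 0" for u v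
  proof -
    have "?f u - ?f v = (u - v) + (\<gamma> u - \<gamma> v) *\<^sub>R e"
      by (simp add: fval hproj_orth that algebra_simps)
    then have "norm (?f u - ?f v) \<le> norm (u - v) + norm (\<gamma> u - \<gamma> v)"
      using norm_triangle_ineq[of "u - v" "(\<gamma> u - \<gamma> v) *\<^sub>R e"] e by simp
    then show ?thesis using G(2)[OF that(1,2)] by (simp add: distrib_right)
  qed
  \<comment> \<open>In the hyperplane the coordinate k is determined by the others through
    orthogonality to e; solving for it costs at most the factor n^2.\<close>
  have dist_bound: "norm (u - v) \<le> ?n * (?n * (?n * h) + h)"
    if orth: "u \<bullet> e = 0" "v \<bullet> e = 0" and coord: "\<And>j. j \<noteq> k \<Longrightarrow> \<bar>u $ j - v $ j\<bar> \<le> h" and h: "0 \<le> h" for u v h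
  proof -
    define w where "w = u - v"
    have wj: "\<bar>w $ j\<bar> \<le> h" if "j \<noteq> k" for j using coord[OF that] by (simp add: w_def)
    have "w \<bullet> e = 0" using orth by (simp add: w_def inner_diff_left)
    then have "w $ k * e $ k = - (\<Sum>j\<in>UNIV - {k}. w $ j * e $ j)"
      unfolding inner_vec_def by (subst (asm) sum.remove[of _ k]) (auto simp: eq_neg_iff_add_eq_0)
    then have "\<bar>w $ k\<bar> * \<bar>e $ k\<bar> = \<bar>\<Sum>j\<in>UNIV - {k}. w $ j * e $ j\<bar>"
      by (metis abs_minus_cancel abs_mult)
    also have "\<dots> \<le> (\<Sum>j\<in>UNIV - {k}. \<bar>w $ j * e $ j\<bar>)" by (rule sum_abs)
    also have "\<dots> \<le> (\<Sum>j\<in>UNIV - {k}. h * 1)"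
      unfolding abs_mult using wj h component_le_norm_cart[of e] e
      by (intro sum_mono mult_mono) auto
    also have "\<dots> \<le> ?n * h" using h by (simp add: mult_right_mono)
    finally have *: "\<bar>w $ k\<bar> * \<bar>e $ k\<bar> \<le> ?n * h" .
    have "\<bar>w $ k\<bar> \<le> \<bar>w $ k\<bar> * (?n * \<bar>e $ k\<bar>)" using mult_left_mono[OF k, of "\<bar>w $ k\<bar>"] by simp
    also have "\<dots> \<le> ?n * (?n * h)" using mult_left_mono[OF *, of ?n] by (simp add: mult_ac)
    finally have wk: "\<bar>w $ k\<bar> \<le> ?n * (?n * h)" .
    have "norm w \<le> (\<Sum>j\<in>UNIV. \<bar>w $ j\<bar>)" by (rule norm_le_l1_cart)
    also have "\<dots> \<le> (\<Sum>j\<in>(UNIV::'n set). ?n * (?n * h) + h)"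
    proof (rule sum_mono)
      fix j show "\<bar>w $ j\<bar> \<le> ?n * (?n * h) + h"
        using wk wj[of j] h by (cases "j = k") (auto intro: order_trans[OF _ le_add_same_cancel2[THEN iffD2]])
    qed
    finally show ?thesis by (simp add: w_def)
  qed
  define d where "d = (1 + G) * (?n * (?n * (?n * (2 * r)) + 2 * r))"
  have d0: "0 \<le> d" using G r by (simp add: d_def)
  show ?thesis
  proof (rule small_coversI[of 1 d, OF _ d0])
    fix N :: nat assume N: "1 \<le> N"
    \<comment> \<open>The entry k is pinned to 0, so there are N^(n-1) cells, and they do not
      restrict the coordinate k.\<close>
    define Idx where "Idx = (\<Pi>\<^sub>E j\<in>UNIV. if j = k then {0::nat} else {..<N})"
    define pc where "pc \<kappa> = {v \<in> ball 0 r. v \<bullet> e = 0 \<and> (\<forall>j. j \<noteq> k \<longrightarrow>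
        - r + 2 * r * real (\<kappa> j) / real N \<le> v $ j \<and> v $ j \<le> - r + 2 * r * (real (\<kappa> j) + 1) / real N)}" for \<kappa> :: "'n \<Rightarrow> nat"
    have finI: "finite Idx" unfolding Idx_def by (intro finite_PiE) auto
    have "card Idx = (\<Prod>j\<in>(UNIV::'n set). if j = k then 1 else N)"
      unfolding Idx_def by (subst card_PiE) (auto intro!: prod.cong)
    also have "\<dots> = (\<Prod>j\<in>UNIV - {k}. N)"
      by (subst prod.remove[of _ k]) (auto intro!: prod.cong)
    also have "\<dots> = N ^ (CARD('n) - 1)" by (simp add: card_Diff_singleton)
    finally have cardI: "card Idx = N ^ (CARD('n) - 1)" .
    show "\<exists>\<C>. finite \<C> \<and> real (card \<C>) \<le> 1 * real N ^ (CARD('n) - 1) \<and> ?f ` chart_ball c \<subseteq> \<Union>\<C>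
        \<and> (\<forall>X\<in>\<C>. bounded X \<and> diameter X \<le> d / real N)"
    proof (intro exI[of _ "(\<lambda>\<kappa>. ?f ` pc \<kappa>) ` Idx"] conjI ballI)
      show "finite ((\<lambda>\<kappa>. ?f ` pc \<kappa>) ` Idx)" using finI by simp
      have "card ((\<lambda>\<kappa>. ?f ` pc \<kappa>) ` Idx) \<le> N ^ (CARD('n) - 1)"
        using card_image_le[OF finI, of "\<lambda>\<kappa>. ?f ` pc \<kappa>"] cardI by simp
      then show "real (card ((\<lambda>\<kappa>. ?f ` pc \<kappa>) ` Idx)) \<le> 1 * real N ^ (CARD('n) - 1)"
        by (metis mult_1 of_nat_le_iff of_nat_power)
      show "?f ` chart_ball c \<subseteq> \<Union> ((\<lambda>\<kappa>. ?f ` pc \<kappa>) ` Idx)"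
      proof
        fix y assume "y \<in> ?f ` chart_ball c"
        then obtain v0 where v0: "norm v0 < r" "y = ?f v0" by (auto simp: chart_ball_def c)
        define v where "v = hproj e v0"
        have v: "norm v < r" "v \<bullet> e = 0" "y = ?f v"
          using v0 norm_hproj_le[OF e, of v0] f_hproj[of v0] by (auto simp: v_def hproj_def inner_diff_left ee)
        have vj: "\<bar>v $ j\<bar> < r" for j using component_le_norm_cart[of v j] v(1) by linarith
        define \<kappa> where "\<kappa> j = (if j = k then 0 else nat \<lfloor>(v $ j + r) * real N / (2 * r)\<rfloor>)" for j
        have fl: "0 \<le> \<lfloor>(v $ j + r) * real N / (2 * r)\<rfloor>" for j
          using vj[of j] r by (simp add: abs_less_iff)
        have kj: "real (\<kappa> j) \<le> (v $ j + r) * real N / (2 * r)" "(v $ j + r) * real N / (2 * r) < real (\<kappa> j) + 1" if "j \<noteq> k" for j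
          using that fl[of j] by (auto simp: \<kappa>_def)
        have "\<kappa> j < N" if "j \<noteq> k" for j
        proof -
          have "(v $ j + r) * real N < 2 * r * real N" using vj[of j] N by (intro mult_strict_right_mono) auto
          then have "(v $ j + r) * real N / (2 * r) < real N" using r by (simp add: field_simps)
          then show ?thesis using kj(1)[OF that] by linarith
        qed
        then have "\<kappa> \<in> Idx" by (auto simp: Idx_def \<kappa>_def)
        moreover have "v \<in> pc \<kappa>"
          using v kj r N unfolding pc_def by (auto simp: field_simps less_imp_le)
        ultimately show "y \<in> \<Union> ((\<lambda>\<kappa>. ?f ` pc \<kappa>) ` Idx)" using v(3) by blast
      qed
      fix X assume "X \<in> (\<lambda>\<kappa>. ?f ` pc \<kappa>) ` Idx"
      then obtain \<kappa> where X: "X = ?f ` pc \<kappa>" by blast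
      have nd: "norm (a - b) \<le> d / real N" if ab: "a \<in> X" "b \<in> X" for a b
      proof -
        obtain u v where u: "u \<in> pc \<kappa>" "a = ?f u" and v: "v \<in> pc \<kappa>" "b = ?f v" using ab X by blast
        have "norm (a - b) \<le> (1 + G) * norm (u - v)"
          using u v lip by (simp add: pc_def)
        also have "norm (u - v) \<le> ?n * (?n * (?n * (2 * r / real N)) + 2 * r / real N)"
        proof (rule dist_bound)
          fix j assume "j \<noteq> k"
          then have "- r + 2 * r * real (\<kappa> j) / real N \<le> u $ j" "u $ j \<le> - r + 2 * r * (real (\<kappa> j) + 1) / real N"
             "- r + 2 * r * real (\<kappa> j) / real N \<le> v $ j" "v $ j \<le> - r + 2 * r * (real (\<kappa> j) + 1) / real N"
            using u(1) v(1) by (auto simp: pc_def)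
          moreover have "2 * r * (real (\<kappa> j) + 1) / real N = 2 * r * real (\<kappa> j) / real N + 2 * r / real N"
            by (simp add: distrib_left add_divide_distrib)
          ultimately show "\<bar>u $ j - v $ j\<bar> \<le> 2 * r / real N" by linarith
        qed (use u v r in \<open>auto simp: pc_def\<close>)
        also have "(1 + G) * (?n * (?n * (?n * (2 * r / real N)) + 2 * r / real N)) = d / real N"
          unfolding d_def using N by (simp add: field_simps)
        finally show ?thesis using G by simp
      qed
      show "bounded X" by (rule bounded_of_norm_diff[OF nd])
      show "diameter X \<le> d / real N" using d0 nd by (intro diameter_le) auto
    qed
  qed auto
qed

section \<open>Schauder functions on the boundary of a bounded domain\<close>

lemma C1a_boundaryD:
  assumes "\<theta> \<in> C1a_boundary \<alpha> D" "is_chart \<alpha> D c"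
  shows "C1a \<alpha> (chart_ball c) (\<theta> \<circ> chart_map c)"
  using assms unfolding C1a_boundary_def by blast

context
  fixes D :: "(real^'n::finite) set" and \<alpha> :: real
  assumes D: "of_class_C1a \<alpha> D" and \<alpha>: "0 < \<alpha>" and bD: "bounded D"
begin

lemma compact_frontier_C1a: "compact (frontier D)"
  using bD compact_frontier_bounded by blast

text \<open>Points below the graph lie in \<open>D\<close>, and a point above it has a neighbourhood
  that misses \<open>D\<close>, so near x the frontier lies on the graph. There v = y - x satisfies
  \<open>v \<bullet> e = \<gamma> v\<close>, which makes v a preimage of y under the chart
  map.\<close>

lemma frontier_chart:
  assumes x: "x \<in> frontier D"
  obtains c \<rho> where "is_chart \<alpha> D c" "0 < \<rho>"
    "\<And>y. y \<in> frontier D \<Longrightarrow> y \<in> ball x \<rho> \<Longrightarrow> y - x \<in> chart_ball c \<and> y = chart_map c (y - x)"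
proof -
  obtain c where c: "is_chart \<alpha> D c" "chart_base c = x" using D x unfolding of_class_C1a_def by blast
  then obtain e r \<gamma> where ceq: "c = (x, e, r, \<gamma>)" by (cases c) (auto simp: chart_base_def)
  note ch = c(1)[unfolded ceq]
  note e = is_chartD(1)[OF ch] and r = is_chartD(2)[OF ch] and C1 = is_chartD(4)[OF ch]
  obtain \<delta> where \<delta>: "\<delta> > 0" "\<And>v. norm (hproj e v) < r \<Longrightarrow> \<bar>v \<bullet> e\<bar> < \<delta> \<Longrightarrow> x + v \<in> D \<longleftrightarrow> v \<bullet> e < \<gamma> v"
    using is_chartD(6)[OF ch] by blast
  have mem: "x + v \<in> D \<longleftrightarrow> v \<bullet> e < \<gamma> v" if "norm v < min r \<delta>" for v
  proof (rule \<delta>(2))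
    show "norm (hproj e v) < r" using norm_hproj_le[OF e, of v] that by simp
    show "\<bar>v \<bullet> e\<bar> < \<delta>" using Cauchy_Schwarz_ineq2[of v e] e that by simp
  qed
  have "y = chart_map c (y - x)" if y: "y \<in> frontier D" "y \<in> ball x (min r \<delta>)" for y
  proof -
    define v where "v = y - x"
    have v: "norm v < min r \<delta>" "y = x + v" using y by (auto simp: v_def dist_norm norm_minus_commute)
    have yD: "y \<notin> D" using y D by (simp add: frontier_def interior_open of_class_C1a_def)
    then have le: "\<gamma> v \<le> v \<bullet> e" using mem[OF v(1)] v(2) by simp
    have "\<not> \<gamma> v < v \<bullet> e"
    proof
      assume lt: "\<gamma> v < v \<bullet> e"
      have "\<gamma> differentiable (at v)" using C1 v by (simp add: C1a_def)
      then have "continuous (at v) \<gamma>" by (rule differentiable_imp_continuous_within)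
      then have "((\<lambda>w. w \<bullet> e - \<gamma> w) \<longlongrightarrow> v \<bullet> e - \<gamma> v) (at v)"
        by (intro tendsto_intros) (simp add: continuous_within)
      then have "\<forall>\<^sub>F w in at v. 0 < w \<bullet> e - \<gamma> w" using lt by (intro order_tendstoD(1)) auto
      moreover have "\<forall>\<^sub>F w in at v. w \<in> ball 0 (min r \<delta>)"
        using v by (intro eventually_at_in_open') auto
      ultimately have "\<forall>\<^sub>F w in at v. x + w \<notin> D"
      proof eventually_elim
        case (elim w)
        then show ?case using mem[of w] by simp
      qed
      then obtain d where d: "0 < d" "\<And>w. w \<noteq> v \<Longrightarrow> dist w v < d \<Longrightarrow> x + w \<notin> D"
        unfolding eventually_at by auto
      have "z \<notin> D" if "dist z y < d" for z
      proof (cases "z = y")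
        case False
        then show ?thesis using d(2)[of "z - x"] that v(2) by (simp add: dist_norm algebra_simps)
      qed (use yD in simp)
      moreover have "y \<in> closure D" using y by (simp add: frontier_def)
      ultimately show False using d(1) unfolding closure_approachable by blast
    qed
    with le have "v \<bullet> e = \<gamma> v" by simp
    then show ?thesis using v(2) by (simp add: v_def[symmetric] chart_map_def ceq hproj_def)
  qed
  moreover have "y - x \<in> chart_ball c" if "y \<in> ball x (min r \<delta>)" for y
    using that by (auto simp: chart_ball_def ceq dist_norm norm_minus_commute)
  ultimately show ?thesis using r \<delta>(1) by (intro that[OF c(1), of "min r \<delta>"]) auto
qed

text \<open>The charts based at the points of the compact frontier contain a finite atlas, so the
  choice in \<open>atlas\<close> is a choice among actual atlases.\<close>

lemma is_atlas_atlas: "is_atlas \<alpha> D (atlas \<alpha> D)"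
proof -
  have "\<exists>c \<rho>. is_chart \<alpha> D c \<and> 0 < \<rho> \<and> frontier D \<inter> ball x \<rho> \<subseteq> chart_map c ` chart_ball c" if x: "x \<in> frontier D" for x
  proof (rule frontier_chart[OF x])
    fix c \<rho>
    assume c: "is_chart \<alpha> D c" "0 < \<rho>"
      "\<And>y. y \<in> frontier D \<Longrightarrow> y \<in> ball x \<rho> \<Longrightarrow> y - x \<in> chart_ball c \<and> y = chart_map c (y - x)"
    have "frontier D \<inter> ball x \<rho> \<subseteq> chart_map c ` chart_ball c"
    proof
      fix y assume "y \<in> frontier D \<inter> ball x \<rho>"
      then have "y - x \<in> chart_ball c" "y = chart_map c (y - x)" using c(3)[of y] by simp_all
      then show "y \<in> chart_map c ` chart_ball c" by (rule rev_image_eqI)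
    qed
    with c(1,2) show "\<exists>c \<rho>. is_chart \<alpha> D c \<and> 0 < \<rho> \<and> frontier D \<inter> ball x \<rho> \<subseteq> chart_map c ` chart_ball c"
      by (intro exI[of _ c] exI[of _ \<rho>] conjI)
  qed
  then obtain c \<rho> where c: "\<And>x. x \<in> frontier D \<Longrightarrow> is_chart \<alpha> D (c x) \<and> 0 < \<rho> x \<and> frontier D \<inter> ball x (\<rho> x) \<subseteq> chart_map (c x) ` chart_ball (c x)"
    by metis
  have "frontier D \<subseteq> (\<Union>x\<in>frontier D. ball x (\<rho> x))" using c by force
  then obtain C where C: "C \<subseteq> frontier D" "finite C" "frontier D \<subseteq> (\<Union>x\<in>C. ball x (\<rho> x))"
    using compactE_image[OF compact_frontier_C1a, of "frontier D" "\<lambda>x. ball x (\<rho> x)"] open_ball by metis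
  have "is_atlas \<alpha> D (c ` C)"
    unfolding is_atlas_def
  proof (intro conjI ballI)
    show "finite (c ` C)" using C by simp
    show "is_chart \<alpha> D a" if "a \<in> c ` C" for a using that c C(1) by force
    show "frontier D \<subseteq> (\<Union>a\<in>c ` C. chart_map a ` chart_ball a)"
    proof
      fix y assume y: "y \<in> frontier D"
      then obtain x where x: "x \<in> C" "y \<in> ball x (\<rho> x)" using C(3) by blast
      then have "frontier D \<inter> ball x (\<rho> x) \<subseteq> chart_map (c x) ` chart_ball (c x)" using c C(1) by blast
      then have "y \<in> chart_map (c x) ` chart_ball (c x)" using y x(2) by blast
      then show "y \<in> (\<Union>a\<in>c ` C. chart_map a ` chart_ball a)" using x(1) by blast
    qed
  qed
  then show ?thesis unfolding atlas_def by (rule someI)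
qed

lemma surface_measure_frontier_finite:
  assumes n: "CARD('n) \<ge> 2"
  shows "emeasure surface_measure (frontier D) < \<infinity>"
proof -
  have at: "finite (atlas \<alpha> D)" "\<And>c. c \<in> atlas \<alpha> D \<Longrightarrow> is_chart \<alpha> D c"
      "frontier D \<subseteq> (\<Union>c\<in>atlas \<alpha> D. chart_map c ` chart_ball c)"
    using is_atlas_atlas unfolding is_atlas_def by blast+
  have "small_covers (CARD('n) - 1) (frontier D)"
    by (rule small_covers_subset[OF small_covers_UN[OF at(1) chart_small_covers[OF at(2) \<alpha>]] at(3)])
  then have "hausdorff_content (frontier D) < \<infinity>" by (rule small_covers_finite_hausdorff[OF n])
  then show ?thesis by (simp add: emeasure_surface_measure)
qed

text \<open>In the chart based at x, y - x is a preimage of y. So near x the function \<theta> on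
  the frontier is a differentiable function of y - x.\<close>

lemma C1a_boundary_continuous:
  assumes \<theta>: "\<theta> \<in> C1a_boundary \<alpha> D"
  shows "continuous_on (frontier D) \<theta>"
  unfolding continuous_on_def
proof
  fix x assume x: "x \<in> frontier D"
  obtain c \<rho> where c: "is_chart \<alpha> D c" "0 < \<rho>"
    "\<And>y. y \<in> frontier D \<Longrightarrow> y \<in> ball x \<rho> \<Longrightarrow> y - x \<in> chart_ball c \<and> y = chart_map c (y - x)"
    using frontier_chart[OF x] by blast
  have C1: "C1a \<alpha> (chart_ball c) (\<theta> \<circ> chart_map c)" by (rule C1a_boundaryD[OF \<theta> c(1)])
  have x0: "x - x \<in> chart_ball c" "x = chart_map c (x - x)" using c(3)[OF x] c(2) by auto
  have "(\<theta> \<circ> chart_map c) differentiable (at (x - x))" using C1 x0(1) by (simp add: C1a_def)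
  then have "continuous (at (x - x)) (\<theta> \<circ> chart_map c)" by (rule differentiable_imp_continuous_within)
  then have lim: "isCont (\<theta> \<circ> chart_map c) (x - x)" .
  have "((\<lambda>y. (\<theta> \<circ> chart_map c) (y - x)) \<longlongrightarrow> (\<theta> \<circ> chart_map c) (x - x)) (at x within frontier D)"
    by (rule isCont_tendsto_compose[OF lim], rule tendsto_diff[OF tendsto_ident_at tendsto_const])
  moreover have "\<forall>\<^sub>F y in at x within frontier D. (\<theta> \<circ> chart_map c) (y - x) = \<theta> y"
    using c(2,3) unfolding eventually_at by (intro exI[of _ \<rho>]) (auto simp: dist_commute)
  ultimately show "(\<theta> \<longlongrightarrow> \<theta> x) (at x within frontier D)"
    using x0(2) by (simp add: tendsto_cong)
qed

lemma chart_ball_bounded_convex: "bounded (chart_ball c)" "convex (chart_ball c)"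
  by (cases c; simp add: chart_ball_def)+

lemma sup_norm_upper:
  assumes "\<And>x. x \<in> U \<Longrightarrow> norm (f x) \<le> B"
  shows "x \<in> U \<Longrightarrow> norm (f x) \<le> sup_norm U f" and "0 \<le> sup_norm U f"
proof -
  have bdd: "bdd_above (insert 0 ((\<lambda>x. norm (f x)) ` U))"
    using assms by (intro bdd_aboveI[of _ "max 0 B"]) (auto simp: le_max_iff_disj)
  show "x \<in> U \<Longrightarrow> norm (f x) \<le> sup_norm U f" unfolding sup_norm_def using bdd by (intro cSup_upper) auto
  show "0 \<le> sup_norm U f" unfolding sup_norm_def using bdd by (intro cSup_upper) auto
qed

lemma C1a_norm_ge:
  fixes f :: "real^'n \<Rightarrow> complex"
  assumes f: "C1a \<alpha> U f" and U: "bounded U" "convex U"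
  shows "x \<in> U \<Longrightarrow> norm (f x) \<le> C1a_norm \<alpha> U f" and "0 \<le> C1a_norm \<alpha> U f"
proof -
  obtain B where B: "0 \<le> B" "\<And>i x. x \<in> U \<Longrightarrow> norm (partial i f x) \<le> B"
    using C1a_bounded_partial[OF f \<alpha> U(1)] by blast
  obtain C where C: "0 \<le> C" "\<And>x y. x \<in> U \<Longrightarrow> y \<in> U \<Longrightarrow> norm (f x - f y) \<le> C * norm (x - y)"
    using C1a_lipschitz[OF f \<alpha> U] by blast
  have "\<exists>B'. \<forall>x\<in>U. norm (f x) \<le> B'"
  proof (cases "U = {}")
    case False
    then obtain a where a: "a \<in> U" by blast
    have "norm (f x) \<le> norm (f a) + C * diameter U" if x: "x \<in> U" for x
    proof -
      have "norm (f x) \<le> norm (f a) + norm (f x - f a)" by (simp add: norm_triangle_sub)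
      also have "norm (f x - f a) \<le> C * norm (x - a)" by (rule C(2)[OF x a])
      also have "\<dots> \<le> C * diameter U"
        using diameter_bounded_bound[OF U(1) x a] C(1) by (intro mult_left_mono) (auto simp: dist_norm)
      finally show ?thesis by simp
    qed
    then show ?thesis by blast
  qed auto
  then obtain B' where B': "\<And>x. x \<in> U \<Longrightarrow> norm (f x) \<le> B'" by blast
  have 2: "0 \<le> sup_norm U (partial i f)" for i by (rule sup_norm_upper(2)[OF B(2)])
  have 3: "0 \<le> hoelder_seminorm \<alpha> U (partial i f)" for i
  proof -
    obtain K where K: "\<And>x y. x \<in> U \<Longrightarrow> y \<in> U \<Longrightarrow> norm (partial i f x - partial i f y) \<le> K * dist x y powr \<alpha>"
      using f unfolding C1a_def hoelder_on_def by blast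
    have "bdd_above (insert 0 {norm (partial i f x - partial i f y) / dist x y powr \<alpha> | x y. x \<in> U \<and> y \<in> U \<and> x \<noteq> y})"
      using K by (intro bdd_aboveI[of _ "max 0 K"]) (auto simp: le_max_iff_disj divide_le_eq)
    then show ?thesis unfolding hoelder_seminorm_def by (intro cSup_upper) auto
  qed
  have "0 \<le> (\<Sum>i\<in>UNIV. sup_norm U (partial i f))" "0 \<le> (\<Sum>i\<in>UNIV. hoelder_seminorm \<alpha> U (partial i f))"
    using 2 3 by (auto intro: sum_nonneg)
  then show "x \<in> U \<Longrightarrow> norm (f x) \<le> C1a_norm \<alpha> U f" "0 \<le> C1a_norm \<alpha> U f"
    using sup_norm_upper[OF B', of U] unfolding C1a_norm_def by fastforce+
qed

text \<open>The atlas covers the frontier, so this norm dominates the supremum norm; this is the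
  link between \<open>C1a_boundary_norm\<close> and the kernel estimates.\<close>

lemma C1a_boundary_norm_ge:
  assumes \<theta>: "\<theta> \<in> C1a_boundary \<alpha> D"
  shows "s \<in> frontier D \<Longrightarrow> norm (\<theta> s) \<le> C1a_boundary_norm \<alpha> D \<theta>" and "0 \<le> C1a_boundary_norm \<alpha> D \<theta>"
proof -
  have at: "finite (atlas \<alpha> D)" "\<And>c. c \<in> atlas \<alpha> D \<Longrightarrow> is_chart \<alpha> D c"
      "frontier D \<subseteq> (\<Union>c\<in>atlas \<alpha> D. chart_map c ` chart_ball c)"
    using is_atlas_atlas unfolding is_atlas_def by blast+
  show "0 \<le> C1a_boundary_norm \<alpha> D \<theta>"
    unfolding C1a_boundary_norm_def using at(1) by (intro Max_ge) auto
  assume "s \<in> frontier D"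
  then obtain c v where c: "c \<in> atlas \<alpha> D" "v \<in> chart_ball c" "s = chart_map c v" using at(3) by blast
  have "C1a \<alpha> (chart_ball c) (\<theta> \<circ> chart_map c)" by (rule C1a_boundaryD[OF \<theta> at(2)[OF c(1)]])
  from C1a_norm_ge(1)[OF this chart_ball_bounded_convex c(2)]
  have "norm (\<theta> s) \<le> C1a_norm \<alpha> (chart_ball c) (\<theta> \<circ> chart_map c)" by (simp add: c(3))
  also have "\<dots> \<le> C1a_boundary_norm \<alpha> D \<theta>"
    unfolding C1a_boundary_norm_def using at(1) c(1) by (intro Max_ge) auto
  finally show "norm (\<theta> s) \<le> C1a_boundary_norm \<alpha> D \<theta>" .
qed

lemma zero_C1a_boundary: "(\<lambda>_. 0) \<in> C1a_boundary \<alpha> D" "C1a_boundary_norm \<alpha> D (\<lambda>_. 0) = 0"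
proof -
  have p0: "partial i (\<lambda>_. 0::complex) x = 0" for i and x :: "real^'n"
    by (simp add: partial_def)
  show "(\<lambda>_. 0) \<in> C1a_boundary \<alpha> D"
    by (auto simp: C1a_boundary_def C1a_def comp_def p0[abs_def] hoelder_on_def intro!: exI[of _ 0])
  have s0: "sup_norm U (\<lambda>_. 0::complex) = 0" for U :: "(real^'n) set"
    using sup_norm_le[of 0 U "\<lambda>_. 0::complex"] by force
  have "{norm (0 - 0 :: complex) / dist x y powr \<alpha> | x y. x \<in> U \<and> y \<in> U \<and> x \<noteq> y} \<subseteq> {0}" for U :: "(real^'n) set"
    by auto
  then have "insert 0 {norm (0 - 0 :: complex) / dist x y powr \<alpha> | x y. x \<in> U \<and> y \<in> U \<and> x \<noteq> y} = {0}" for U :: "(real^'n) set"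
    by blast
  then have h0: "hoelder_seminorm \<alpha> U (\<lambda>_. 0::complex) = 0" for U :: "(real^'n) set"
    unfolding hoelder_seminorm_def by (simp only: cSup_singleton)
  have "C1a_norm \<alpha> U (\<lambda>_. 0::complex) = 0" for U :: "(real^'n) set"
    by (simp add: C1a_norm_def p0[abs_def] s0 h0)
  then have "insert 0 ((\<lambda>c. C1a_norm \<alpha> (chart_ball c) ((\<lambda>_. 0::complex) \<circ> chart_map c)) ` atlas \<alpha> D) = {0}"
    by (auto simp: comp_def)
  then show "C1a_boundary_norm \<alpha> D (\<lambda>_. 0) = 0" unfolding C1a_boundary_norm_def by (simp only: Max_singleton)
qed

end

section \<open>Rescaling of the boundary\<close>

text \<open>The dilation turns a cover at scale \<delta> into one at scale \<epsilon> \<delta>, with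
  each diameter multiplied by at most \<epsilon>.\<close>

lemma surface_premeasure_affine_le:
  fixes A :: "(real^'n::finite) set"
  assumes e: "0 < \<epsilon>" and d: "0 < \<delta>"
  shows "surface_premeasure (\<epsilon> * \<delta>) ((\<lambda>s. p + \<epsilon> *\<^sub>R s) ` A) \<le> ennreal (\<epsilon> ^ (CARD('n) - 1)) * surface_premeasure \<delta> A"
    (is "?lhs \<le> ennreal ?c * _")
proof -
  let ?v = "unit_ball_vol (real (CARD('n) - 1))" and ?m = "CARD('n) - 1" and ?f = "\<lambda>s. p + \<epsilon> *\<^sub>R s"
  have c: "0 < ?c" using e by simp
  \<comment> \<open>The factor is first moved to the left, so that the right-hand side is a bare
    infimum and can be bounded below cover by cover.\<close>
  have "ennreal (1 / ?c) * ?lhs \<le> surface_premeasure \<delta> A"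
    unfolding surface_premeasure_def[of \<delta>]
  proof (rule INF_greatest)
    fix C assume "C \<in> {C :: nat \<Rightarrow> (real^'n) set. A \<subseteq> (\<Union>i. C i) \<and> (\<forall>i. bounded (C i) \<and> diameter (C i) \<le> \<delta>)}"
    then have C: "A \<subseteq> (\<Union>i. C i)" "\<And>i. bounded (C i)" "\<And>i. diameter (C i) \<le> \<delta>" by auto
    have nd: "norm (a - b) \<le> \<epsilon> * diameter (C i)" if ab: "a \<in> ?f ` C i" "b \<in> ?f ` C i" for a b i
    proof -
      obtain u v where "u \<in> C i" "v \<in> C i" "a = ?f u" "b = ?f v" using ab by blast
      moreover from this have "norm (a - b) = \<epsilon> * dist u v"
        using e by (simp add: dist_norm scaleR_diff_right[symmetric])
      ultimately show ?thesis using diameter_bounded_bound[OF C(2)] e by simp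
    qed
    have dm: "diameter (?f ` C i) \<le> \<epsilon> * diameter (C i)" for i
      using nd diameter_ge_0[OF C(2), of i] e by (intro diameter_le) auto
    have bd: "bounded (?f ` C i)" for i by (rule bounded_of_norm_diff[OF nd])
    have "?lhs \<le> (\<Sum>i. ennreal (?v * (diameter (?f ` C i) / 2) ^ ?m))"
      unfolding surface_premeasure_def
    proof (rule INF_lower, intro CollectI conjI allI bd)
      show "?f ` A \<subseteq> (\<Union>i. ?f ` C i)" using C(1) by blast
      show "diameter (?f ` C i) \<le> \<epsilon> * \<delta>" for i
        using dm[of i] mult_left_mono[OF C(3)[of i], of \<epsilon>] e by linarith
    qed
    also have "\<dots> \<le> (\<Sum>i. ennreal ?c * ennreal (?v * (diameter (C i) / 2) ^ ?m))"
    proof (intro suminf_le summableI)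
      fix i
      have "?v * (diameter (?f ` C i) / 2) ^ ?m \<le> ?v * (\<epsilon> * diameter (C i) / 2) ^ ?m"
        using dm[of i] diameter_ge_0[OF bd, of i]
        by (intro mult_left_mono power_mono divide_right_mono) auto
      also have "\<dots> = ?c * (?v * (diameter (C i) / 2) ^ ?m)"
        by (simp add: power_mult_distrib power_divide)
      finally show "ennreal (?v * (diameter (?f ` C i) / 2) ^ ?m) \<le> ennreal ?c * ennreal (?v * (diameter (C i) / 2) ^ ?m)"
        using c diameter_ge_0[OF C(2), of i] by (subst ennreal_mult[symmetric]) (auto intro!: ennreal_leI)
    qed
    also have "\<dots> = ennreal ?c * (\<Sum>i. ennreal (?v * (diameter (C i) / 2) ^ ?m))"
      by (rule ennreal_suminf_cmult)
    finally have "ennreal (1 / ?c) * ?lhs \<le> ennreal (1 / ?c) * (ennreal ?c * (\<Sum>i. ennreal (?v * (diameter (C i) / 2) ^ ?m)))"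
      by (rule mult_left_mono) simp
    also have "\<dots> = (\<Sum>i. ennreal (?v * (diameter (C i) / 2) ^ ?m))"
      using c e by (simp add: mult.assoc[symmetric] ennreal_mult[symmetric])
    finally show "ennreal (1 / ?c) * ?lhs \<le> (\<Sum>i. ennreal (?v * (diameter (C i) / 2) ^ ?m))" .
  qed
  then have "ennreal ?c * (ennreal (1 / ?c) * ?lhs) \<le> ennreal ?c * surface_premeasure \<delta> A"
    by (rule mult_left_mono) simp
  moreover have "ennreal ?c * (ennreal (1 / ?c) * ?lhs) = ?lhs"
    using c e by (simp add: mult.assoc[symmetric] ennreal_mult[symmetric])
  ultimately show ?thesis by simp
qed

lemma hausdorff_content_affine_le:
  fixes A :: "(real^'n::finite) set"
  assumes e: "0 < \<epsilon>"
  shows "hausdorff_content ((\<lambda>s. p + \<epsilon> *\<^sub>R s) ` A) \<le> ennreal (\<epsilon> ^ (CARD('n) - 1)) * hausdorff_content A"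
  unfolding hausdorff_content_def
proof (rule SUP_least)
  fix \<delta> :: real assume "\<delta> \<in> {0<..}"
  then have d: "0 < \<delta> / \<epsilon>" using e by simp
  have "surface_premeasure \<delta> ((\<lambda>s. p + \<epsilon> *\<^sub>R s) ` A) \<le> ennreal (\<epsilon> ^ (CARD('n) - 1)) * surface_premeasure (\<delta> / \<epsilon>) A"
    using surface_premeasure_affine_le[OF e d, of p A] e by simp
  also have "\<dots> \<le> ennreal (\<epsilon> ^ (CARD('n) - 1)) * (SUP \<delta>\<in>{0<..}. surface_premeasure \<delta> A)"
    using d by (intro mult_left_mono SUP_upper) auto
  finally show "surface_premeasure \<delta> ((\<lambda>s. p + \<epsilon> *\<^sub>R s) ` A)
     \<le> ennreal (\<epsilon> ^ (CARD('n) - 1)) * (SUP \<delta>\<in>{0<..}. surface_premeasure \<delta> A)" .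
qed

text \<open>The reverse inequality is the same bound for the inverse dilation.\<close>

lemma hausdorff_content_affine:
  fixes A :: "(real^'n::finite) set"
  assumes e: "0 < \<epsilon>"
  shows "hausdorff_content ((\<lambda>s. p + \<epsilon> *\<^sub>R s) ` A) = ennreal (\<epsilon> ^ (CARD('n) - 1)) * hausdorff_content A"
proof (rule antisym[OF hausdorff_content_affine_le[OF e]])
  let ?f = "\<lambda>s. p + \<epsilon> *\<^sub>R s" and ?g = "\<lambda>y. (- (1 / \<epsilon>) *\<^sub>R p) + (1 / \<epsilon>) *\<^sub>R y" and ?c = "\<epsilon> ^ (CARD('n) - 1)"
  have "?g ` ?f ` A = (\<lambda>s. s) ` A"
    unfolding image_image using e by (intro image_cong refl) (simp add: scaleR_add_right)
  then have "hausdorff_content A \<le> ennreal ((1 / \<epsilon>) ^ (CARD('n) - 1)) * hausdorff_content (?f ` A)"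
    using hausdorff_content_affine_le[of "1 / \<epsilon>" "- (1 / \<epsilon>) *\<^sub>R p" "?f ` A"] e by simp
  then have "ennreal ?c * hausdorff_content A \<le> ennreal ?c * (ennreal ((1 / \<epsilon>) ^ (CARD('n) - 1)) * hausdorff_content (?f ` A))"
    by (rule mult_left_mono) simp
  also have "\<dots> = hausdorff_content (?f ` A)"
    using e by (simp add: mult.assoc[symmetric] ennreal_mult[symmetric] power_mult_distrib[symmetric])
  finally show "ennreal ?c * hausdorff_content A \<le> hausdorff_content (?f ` A)" .
qed

lemma affine_image_eq_vimage:
  fixes A :: "'a::real_vector set"
  assumes "\<epsilon> \<noteq> 0"
  shows "(\<lambda>s. p + \<epsilon> *\<^sub>R s) ` A = (\<lambda>y. (y - p) /\<^sub>R \<epsilon>) -` A"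
proof (intro set_eqI iffI)
  fix y assume "y \<in> (\<lambda>y. (y - p) /\<^sub>R \<epsilon>) -` A"
  then show "y \<in> (\<lambda>s. p + \<epsilon> *\<^sub>R s) ` A"
    using assms by (intro image_eqI[of _ _ "(y - p) /\<^sub>R \<epsilon>"]) auto
qed (use assms in auto)

lemma distr_surface_measure_affine:
  assumes e: "0 < \<epsilon>"
  shows "distr (surface_measure :: (real^'n::finite) measure) borel (\<lambda>y. (y - p) /\<^sub>R \<epsilon>)
     = density surface_measure (\<lambda>_. ennreal (\<epsilon> ^ (CARD('n) - 1)))"
proof (rule measure_eqI)
  let ?g = "\<lambda>y::real^'n. (y - p) /\<^sub>R \<epsilon>"
  have "continuous_on UNIV ?g" by (intro continuous_intros)
  then have gb: "?g \<in> borel_measurable borel" by (rule borel_measurable_continuous_onI)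
  then have gm: "?g \<in> measurable surface_measure borel"
    by (subst measurable_cong_sets[OF sets_surface_measure refl])
  fix A :: "(real^'n) set" assume "A \<in> sets (distr surface_measure borel ?g)"
  then have A: "A \<in> sets borel" by simp
  have vA: "?g -` A \<in> sets borel" using measurable_sets_borel[OF gb A] by simp
  have "emeasure (distr surface_measure borel ?g) A = emeasure surface_measure (?g -` A)"
    using emeasure_distr[OF gm A] by simp
  also have "\<dots> = ennreal (\<epsilon> ^ (CARD('n) - 1)) * emeasure surface_measure A"
    unfolding emeasure_surface_measure
    using A vA hausdorff_content_affine[OF e, of p A] e by (simp add: affine_image_eq_vimage)
  also have "\<dots> = emeasure (density surface_measure (\<lambda>_. ennreal (\<epsilon> ^ (CARD('n) - 1)))) A"
    using A by (subst emeasure_density_const) auto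
  finally show "emeasure (distr surface_measure borel ?g) A
      = emeasure (density surface_measure (\<lambda>_. ennreal (\<epsilon> ^ (CARD('n) - 1)))) A" .
qed simp

lemma surface_integral_affine:
  fixes h :: "real^'n::finite \<Rightarrow> complex"
  assumes e: "0 < \<epsilon>" and meas: "(\<lambda>s. indicator S s *\<^sub>R h (p + \<epsilon> *\<^sub>R s)) \<in> borel_measurable borel"
  shows "(LINT y:(\<lambda>s. p + \<epsilon> *\<^sub>R s) ` S|surface_measure. h y)
     = of_real (\<epsilon> ^ (CARD('n) - 1)) * (LINT s:S|surface_measure. h (p + \<epsilon> *\<^sub>R s))"
proof -
  let ?g = "\<lambda>y::real^'n. (y - p) /\<^sub>R \<epsilon>" and ?H = "\<lambda>s. indicator S s *\<^sub>R h (p + \<epsilon> *\<^sub>R s)"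
  have "continuous_on UNIV ?g" by (intro continuous_intros)
  then have gm: "?g \<in> measurable surface_measure borel"
    by (subst measurable_cong_sets[OF sets_surface_measure refl]) (rule borel_measurable_continuous_onI)
  have "(LINT y:(\<lambda>s. p + \<epsilon> *\<^sub>R s) ` S|surface_measure. h y) = (LINT y|surface_measure. ?H (?g y))"
    unfolding set_lebesgue_integral_def
    using e by (intro Bochner_Integration.integral_cong refl) (auto simp: affine_image_eq_vimage indicator_def)
  also have "\<dots> = (LINT s|distr surface_measure borel ?g. ?H s)"
    by (rule integral_distr[symmetric, OF gm meas])
  also have "\<dots> = (LINT s|surface_measure. (\<epsilon> ^ (CARD('n) - 1)) *\<^sub>R ?H s)"
    unfolding distr_surface_measure_affine[OF e]
  proof (rule integral_density)
    show "?H \<in> borel_measurable surface_measure"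
      using meas by (subst measurable_cong_sets[OF sets_surface_measure refl])
  qed (use e in auto)
  finally show ?thesis by (simp add: set_lebesgue_integral_def scaleR_conv_of_real)
qed

lemma frontier_rescaled:
  fixes D :: "(real^'n::finite) set"
  assumes "\<epsilon> \<noteq> 0"
  shows "frontier (rescaled D p \<epsilon>) = (\<lambda>s. p + \<epsilon> *\<^sub>R s) ` frontier D"
proof -
  have inj: "inj ((*\<^sub>R) \<epsilon> :: real^'n \<Rightarrow> real^'n)" using assms by (simp add: inj_on_def)
  have bij: "bij ((*\<^sub>R) \<epsilon> :: real^'n \<Rightarrow> real^'n)"
    using inj by (intro bijI surjI[of _ "\<lambda>y. y /\<^sub>R \<epsilon>"]) (use assms in auto)
  have "frontier ((*\<^sub>R) \<epsilon> ` D) = (*\<^sub>R) \<epsilon> ` frontier D"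
    unfolding frontier_closures bij_image_Compl_eq[OF bij, symmetric] closure_scaleR[symmetric]
    by (rule image_Int[OF inj, symmetric])
  then have fr: "frontier ((*\<^sub>R) \<epsilon> ` D) = (*\<^sub>R) \<epsilon> ` frontier D" .
  have "rescaled D p \<epsilon> = (+) p ` (*\<^sub>R) \<epsilon> ` D" by (auto simp: rescaled_def)
  then have "frontier (rescaled D p \<epsilon>) = frontier ((+) p ` (*\<^sub>R) \<epsilon> ` D)" by (rule arg_cong)
  also have "\<dots> = (+) p ` (*\<^sub>R) \<epsilon> ` frontier D" unfolding frontier_translation fr ..
  also have "\<dots> = (\<lambda>s. p + \<epsilon> *\<^sub>R s) ` frontier D" by (rule image_image)
  finally show ?thesis .
qed

text \<open>If \<phi> defines \<open>D\<close> near s, then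
  \<open>\<phi> ((y - p) /\<^sub>R \<epsilon>)\<close> defines the rescaled set near the image of s.
  Its gradient is divided by \<epsilon>, and normalisation removes this positive factor.\<close>

lemma outward_normal_rescaled:
  assumes D: "of_class_C1a \<alpha> D" and \<alpha>: "0 < \<alpha>" and e: "0 < \<epsilon>" and s: "s \<in> frontier D"
  shows "outward_normal (rescaled D p \<epsilon>) (p + \<epsilon> *\<^sub>R s) = outward_normal D s"
proof -
  obtain \<phi> r where ldf: "local_defining_function D s \<phi> r"
    by (rule of_class_C1a_local_defining_function[OF D \<alpha> s])
  let ?g = "\<lambda>y. (y - p) /\<^sub>R \<epsilon>" and ?x = "p + \<epsilon> *\<^sub>R s"
  define \<psi> where "\<psi> y = \<phi> (?g y)" for y
  have in_ball: "?g y \<in> ball s r" if "y \<in> ball ?x (\<epsilon> * r)" for y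
  proof -
    have "s - ?g y = (?x - y) /\<^sub>R \<epsilon>" using e by (simp add: algebra_simps)
    then have "dist s (?g y) = dist ?x y / \<epsilon>" using e by (simp add: dist_norm divide_inverse mult.commute)
    moreover have "dist ?x y / \<epsilon> < r" using that e by (simp add: pos_divide_less_eq mult.commute)
    ultimately show ?thesis by (simp only: mem_ball)
  qed
  have der: "(\<psi> has_derivative (\<lambda>h. (grad \<phi> (?g y) /\<^sub>R \<epsilon>) \<bullet> h)) (at y)" if "y \<in> ball ?x (\<epsilon> * r)" for y
  proof -
    have "\<phi> differentiable (at (?g y))" using ldf in_ball[OF that] by (simp add: local_defining_function_def)
    from has_derivative_grad[OF this]
    have 1: "(\<phi> has_derivative (\<lambda>h. grad \<phi> (?g y) \<bullet> h)) (at (?g y))" .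
    have "(?g has_derivative (\<lambda>h. h /\<^sub>R \<epsilon>)) (at y)" by (auto intro!: derivative_eq_intros)
    from has_derivative_compose[OF this 1]
    show ?thesis unfolding \<psi>_def by simp
  qed
  have gr: "grad \<psi> y = grad \<phi> (?g y) /\<^sub>R \<epsilon>" if "y \<in> ball ?x (\<epsilon> * r)" for y
    by (rule grad_unique[OF der[OF that]])
  have gx: "?g ?x = s" using e by simp
  have r: "0 < r" using ldf by (simp add: local_defining_function_def)
  have xb: "?x \<in> ball ?x (\<epsilon> * r)" using r e by simp
  have "local_defining_function (rescaled D p \<epsilon>) ?x \<psi> (\<epsilon> * r)"
    unfolding local_defining_function_def
  proof (intro conjI ballI)
    show "0 < \<epsilon> * r" using r e by simp
    show "\<psi> differentiable (at y)" if "y \<in> ball ?x (\<epsilon> * r)" for y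
      using der[OF that] by (rule differentiableI)
    have "continuous_on (ball s r) (grad \<phi>)" using ldf by (simp add: local_defining_function_def)
    moreover have "continuous_on (ball ?x (\<epsilon> * r)) ?g" by (intro continuous_intros)
    ultimately have "continuous_on (ball ?x (\<epsilon> * r)) (\<lambda>y. grad \<phi> (?g y))"
      by (rule continuous_on_compose2) (use in_ball in auto)
    then have "continuous_on (ball ?x (\<epsilon> * r)) (\<lambda>y. grad \<phi> (?g y) /\<^sub>R \<epsilon>)"
      by (rule continuous_on_scaleR[OF continuous_on_const])
    then show "continuous_on (ball ?x (\<epsilon> * r)) (grad \<psi>)"
      by (rule continuous_on_eq) (simp add: gr)
    show "\<psi> ?x = 0" using ldf unfolding \<psi>_def gx by (simp add: local_defining_function_def)
    show "grad \<psi> ?x \<noteq> 0"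
      unfolding gr[OF xb] gx using ldf e by (simp add: local_defining_function_def)
    fix y assume y: "y \<in> ball ?x (\<epsilon> * r)"
    have "y \<in> rescaled D p \<epsilon> \<longleftrightarrow> ?g y \<in> D"
      unfolding rescaled_def using e by (simp add: affine_image_eq_vimage)
    then show "y \<in> rescaled D p \<epsilon> \<longleftrightarrow> \<psi> y < 0"
      using ldf in_ball[OF y] by (simp add: \<psi>_def local_defining_function_def)
  qed
  from outward_normal_eq[OF this] outward_normal_eq[OF ldf] e
  show ?thesis unfolding gr[OF xb] gx by simp
qed

section \<open>The layer potential of a given fundamental solution\<close>

text \<open>If x - p - t s were a lattice point, then x would be a lattice translate of p + t s and
  so belong to the closure of the periodic union.\<close>

lemma periodic_exterior_avoids_lattice:
  assumes x: "x \<in> periodic_exterior q (rescaled D p t)" and s: "s \<in> closure D"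
  shows "x - p - t *\<^sub>R s \<notin> lattice q"
proof
  assume "x - p - t *\<^sub>R s \<in> lattice q"
  then obtain z where "x - p - t *\<^sub>R s = q *v of_int_vec z" by (auto simp: lattice_def)
  then have xeq: "x = q *v of_int_vec z + (p + t *\<^sub>R s)" by (simp add: algebra_simps)
  let ?h = "\<lambda>s. q *v of_int_vec z + (p + t *\<^sub>R s)"
  have "continuous_on (closure D) ?h" by (intro continuous_intros)
  then have "?h ` closure D \<subseteq> closure (?h ` D)" by (intro image_closure_subset closure_subset) auto
  moreover have "?h ` D \<subseteq> periodic_union q (rescaled D p t)"
    by (auto simp: periodic_union_def rescaled_def)
  ultimately have "x \<in> closure (periodic_union q (rescaled D p t))"
    using s xeq closure_mono by blast
  then show False using x by (simp add: periodic_exterior_def)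
qed

text \<open>On an open set around x, dilation of the surface measure identifies the double layer
  integral with \<epsilon>^(n-1) times a kernel integral that is continuous at x. So the limit from
  the exterior in \<open>double_layer_minus\<close> is the value at x.\<close>

lemma layer_potential_of_green:
  fixes \<alpha> \<epsilon>\<^sub>V :: real
    and q :: "real^'n::finite^'n"
    and \<eta> p :: "real^'n"
    and k :: complex
    and \<Omega> V :: "(real^'n) set"
    and P :: "real \<Rightarrow> (real^'n \<Rightarrow> complex) \<Rightarrow> (real^'n \<Rightarrow> complex)"
  assumes green: "is_green q \<eta> k (green q \<eta> k)"
    and n: "CARD('n) \<ge> 2"
    and \<alpha>: "0 < \<alpha>"
    and \<Omega>: "bounded \<Omega>" "of_class_C1a \<alpha> \<Omega>"
    and V: "bounded V" "open V"
    and ext: "\<And>\<epsilon>. \<epsilon> \<in> {-\<epsilon>\<^sub>V<..<\<epsilon>\<^sub>V} \<Longrightarrow> closure V \<subseteq> periodic_exterior q (rescaled \<Omega> p \<epsilon>)"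
    and P: "P = (\<lambda>\<epsilon> \<theta> x. if x \<in> closure V
               then - (LINT s:frontier \<Omega>|surface_measure.
                         dot_grad (outward_normal \<Omega> s) (green q \<eta> k) (x - p - \<epsilon> *\<^sub>R s) * \<theta> s)
               else 0)"
  shows "real_analytic_ops (C1a_boundary \<alpha> \<Omega>) (C1a_boundary_norm \<alpha> \<Omega>) (C2_closure V) (C2_norm V)
           {-\<epsilon>\<^sub>V<..<\<epsilon>\<^sub>V} P"
    and "\<And>\<theta> \<epsilon> x. \<theta> \<in> C1a_boundary \<alpha> \<Omega> \<Longrightarrow> \<epsilon> \<in> {0<..<\<epsilon>\<^sub>V} \<Longrightarrow> x \<in> closure V \<Longrightarrow>
           double_layer_minus q \<eta> k (rescaled \<Omega> p \<epsilon>) (\<lambda>y. \<theta> ((y - p) /\<^sub>R \<epsilon>)) x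
             = of_real (\<epsilon> ^ (CARD('n) - 1)) * P \<epsilon> \<theta> x"
proof -
  let ?S = "frontier \<Omega>" and ?g = "green q \<eta> k" and ?\<nu> = "outward_normal \<Omega>"
  let ?\<sigma> = "surface_measure :: (real^'n) measure"
  have S: "compact ?S" by (rule compact_frontier_C1a[OF \<Omega>(2) \<alpha> \<Omega>(1)])
  have fin: "emeasure ?\<sigma> ?S < \<infinity>" by (rule surface_measure_frontier_finite[OF \<Omega>(2) \<alpha> \<Omega>(1) n])
  interpret kernel_setup ?\<sigma> ?S V by (unfold_locales) (use S fin V in auto)
  obtain W where W: "- lattice q \<subseteq> W" "analytic_region ?g W"
    using real_analytic_on_region green unfolding is_green_def by blast
  have \<nu>: "continuous_on ?S ?\<nu>" by (rule continuous_on_outward_normal[OF \<Omega>(2) \<alpha>])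
  have avoid: "x - p - t *\<^sub>R s \<in> W" if "t \<in> {-\<epsilon>\<^sub>V<..<\<epsilon>\<^sub>V}" "x \<in> closure V" "s \<in> ?S" for t x s
  proof -
    have "x \<in> periodic_exterior q (rescaled \<Omega> p t)" using ext[OF that(1)] that(2) by blast
    moreover have "s \<in> closure \<Omega>" using that(3) by (simp add: frontier_def)
    ultimately have "x - p - t *\<^sub>R s \<notin> lattice q" by (rule periodic_exterior_avoids_lattice)
    then show ?thesis using W(1) by blast
  qed
  show "real_analytic_ops (C1a_boundary \<alpha> \<Omega>) (C1a_boundary_norm \<alpha> \<Omega>) (C2_closure V) (C2_norm V)
           {-\<epsilon>\<^sub>V<..<\<epsilon>\<^sub>V} P"
    by (rule real_analytic_ops_kernel[OF W(2) \<nu> C1a_boundary_continuous[OF \<Omega>(2) \<alpha> \<Omega>(1)]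
          C1a_boundary_norm_ge(1)[OF \<Omega>(2) \<alpha> \<Omega>(1)] C1a_boundary_norm_ge(2)[OF \<Omega>(2) \<alpha> \<Omega>(1)]
          zero_C1a_boundary[OF \<Omega>(2) \<alpha> \<Omega>(1)] _ avoid P]) auto
  fix \<theta> \<epsilon> x
  assume \<theta>: "\<theta> \<in> C1a_boundary \<alpha> \<Omega>" and \<epsilon>: "\<epsilon> \<in> {0<..<\<epsilon>\<^sub>V}" and x: "x \<in> closure V"
  have \<epsilon>I: "\<epsilon> \<in> {-\<epsilon>\<^sub>V<..<\<epsilon>\<^sub>V}" and e: "0 < \<epsilon>" using \<epsilon> by auto
  define R where "R = shifted_region W ?S p \<epsilon>"
  define J where "J = kernel_integral ?\<sigma> ?S (layer_kernel ?g ?\<nu> p \<epsilon> 0 []) \<theta>"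
  have R: "open R" unfolding R_def using W(2) S by (intro open_shifted_region) (auto simp: analytic_region_def)
  have xR: "x \<in> R" using avoid[OF \<epsilon>I x] by (simp add: R_def shifted_region_def)
  have smooth: "smooth_kernel R ?S (layer_kernel ?g ?\<nu> p \<epsilon> 0)"
    unfolding R_def by (rule smooth_layer_kernel[OF W(2) \<nu>])
  have c\<theta>: "continuous_on ?S \<theta>" by (rule C1a_boundary_continuous[OF \<Omega>(2) \<alpha> \<Omega>(1) \<theta>])
  have dl: "double_layer q \<eta> k (rescaled \<Omega> p \<epsilon>) (\<lambda>y. \<theta> ((y - p) /\<^sub>R \<epsilon>)) y = of_real (\<epsilon> ^ (CARD('n) - 1)) * J y"
    if y: "y \<in> R" for y
  proof -
    define h where "h z = dot_grad (outward_normal (rescaled \<Omega> p \<epsilon>) z) ?g (y - z) * \<theta> ((z - p) /\<^sub>R \<epsilon>)" for z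
    have h: "h (p + \<epsilon> *\<^sub>R s) = dot_grad (?\<nu> s) ?g (y - p - \<epsilon> *\<^sub>R s) * \<theta> s" if "s \<in> ?S" for s
      using e by (simp add: h_def outward_normal_rescaled[OF \<Omega>(2) \<alpha> e that] diff_diff_add)
    have "(\<lambda>s. indicator ?S s *\<^sub>R (layer_kernel ?g ?\<nu> p \<epsilon> 0 [] y s * \<theta> s)) \<in> borel_measurable ?\<sigma>"
      using set_integrable_kernel[OF smooth y c\<theta>, of "[]"] unfolding set_integrable_def
      by (rule borel_measurable_integrable)
    then have "(\<lambda>s. - (indicator ?S s *\<^sub>R (layer_kernel ?g ?\<nu> p \<epsilon> 0 [] y s * \<theta> s))) \<in> borel_measurable borel"
      unfolding measurable_cong_sets[OF sets_surface_measure refl] by (rule borel_measurable_uminus)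
    also have "(\<lambda>s. - (indicator ?S s *\<^sub>R (layer_kernel ?g ?\<nu> p \<epsilon> 0 [] y s * \<theta> s)))
        = (\<lambda>s. indicator ?S s *\<^sub>R h (p + \<epsilon> *\<^sub>R s))"
    proof
      fix s show "- (indicator ?S s *\<^sub>R (layer_kernel ?g ?\<nu> p \<epsilon> 0 [] y s * \<theta> s)) = indicator ?S s *\<^sub>R h (p + \<epsilon> *\<^sub>R s)"
        by (cases "s \<in> ?S") (simp_all add: h layer_kernel_def dot_grad_def sum_negf)
    qed
    finally have meas: "(\<lambda>s. indicator ?S s *\<^sub>R h (p + \<epsilon> *\<^sub>R s)) \<in> borel_measurable borel" .
    have "double_layer q \<eta> k (rescaled \<Omega> p \<epsilon>) (\<lambda>y. \<theta> ((y - p) /\<^sub>R \<epsilon>)) y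
        = - (LINT z:(\<lambda>s. p + \<epsilon> *\<^sub>R s) ` ?S|surface_measure. h z)"
      using e by (simp add: double_layer_def h_def frontier_rescaled)
    also have "\<dots> = of_real (\<epsilon> ^ (CARD('n) - 1)) * - (LINT s:?S|surface_measure. h (p + \<epsilon> *\<^sub>R s))"
      by (subst surface_integral_affine[OF e meas]) simp
    also have "(LINT s:?S|surface_measure. h (p + \<epsilon> *\<^sub>R s))
        = (LINT s:?S|surface_measure. dot_grad (?\<nu> s) ?g (y - p - \<epsilon> *\<^sub>R s) * \<theta> s)"
      unfolding set_lebesgue_integral_def
      by (intro Bochner_Integration.integral_cong refl) (auto simp: h indicator_def)
    also have "- \<dots> = J y" unfolding J_def kernel_integral_layer_kernel ..
    finally show ?thesis .
  qed
  have "isCont J x"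
    unfolding J_def by (rule has_derivative_continuous[OF kernel_integral_has_derivative[OF S _ fin R xR smooth c\<theta>]]) simp
  then have "(J \<longlongrightarrow> J x) (at x within periodic_exterior q (rescaled \<Omega> p \<epsilon>))"
    by (simp add: continuous_at_imp_continuous_at_within continuous_within[symmetric])
  then have "((\<lambda>y. of_real (\<epsilon> ^ (CARD('n) - 1)) * J y) \<longlongrightarrow> of_real (\<epsilon> ^ (CARD('n) - 1)) * J x)
      (at x within periodic_exterior q (rescaled \<Omega> p \<epsilon>))"
    by (intro tendsto_mult tendsto_const)
  moreover have "\<forall>\<^sub>F y in at x within periodic_exterior q (rescaled \<Omega> p \<epsilon>).
      of_real (\<epsilon> ^ (CARD('n) - 1)) * J y = double_layer q \<eta> k (rescaled \<Omega> p \<epsilon>) (\<lambda>y. \<theta> ((y - p) /\<^sub>R \<epsilon>)) y"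
  proof -
    have "\<forall>\<^sub>F y in at x within periodic_exterior q (rescaled \<Omega> p \<epsilon>). y \<in> R"
      by (rule eventually_at_in_open'[OF R xR, THEN filter_leD[OF at_le[OF subset_UNIV]]])
    then show ?thesis by eventually_elim (simp add: dl)
  qed
  ultimately have "(double_layer q \<eta> k (rescaled \<Omega> p \<epsilon>) (\<lambda>y. \<theta> ((y - p) /\<^sub>R \<epsilon>)) \<longlongrightarrow> of_real (\<epsilon> ^ (CARD('n) - 1)) * J x)
      (at x within periodic_exterior q (rescaled \<Omega> p \<epsilon>))"
    by (rule Lim_transform_eventually)
  \<comment> \<open>\<open>Lim\<close> is determined only along a nontrivial filter; here the
    exterior is open and contains x.\<close>
  moreover have "at x within periodic_exterior q (rescaled \<Omega> p \<epsilon>) \<noteq> bot"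
  proof -
    have "open (periodic_exterior q (rescaled \<Omega> p \<epsilon>))" by (simp add: periodic_exterior_def open_Compl)
    moreover have "x \<in> periodic_exterior q (rescaled \<Omega> p \<epsilon>)" using ext[OF \<epsilon>I] x by blast
    ultimately have "at x within periodic_exterior q (rescaled \<Omega> p \<epsilon>) = at x" by (rule at_within_open[rotated])
    then show ?thesis using trivial_limit_at[of x] by (simp only: not_False_eq_True)
  qed
  ultimately have "double_layer_minus q \<eta> k (rescaled \<Omega> p \<epsilon>) (\<lambda>y. \<theta> ((y - p) /\<^sub>R \<epsilon>)) x = of_real (\<epsilon> ^ (CARD('n) - 1)) * J x"
    unfolding double_layer_minus_def by (rule tendsto_Lim[rotated])
  also have "J x = P \<epsilon> \<theta> x" using x by (simp add: J_def kernel_integral_layer_kernel P)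
  finally show "double_layer_minus q \<eta> k (rescaled \<Omega> p \<epsilon>) (\<lambda>y. \<theta> ((y - p) /\<^sub>R \<epsilon>)) x
      = of_real (\<epsilon> ^ (CARD('n) - 1)) * P \<epsilon> \<theta> x" .
qed

section \<open>Poisson summation for heat kernels\<close>

lemma pair_sigma_finite_count_space:
  assumes "sigma_finite_measure N"
  shows "pair_sigma_finite (count_space (UNIV :: 'i::countable set)) N"
  using assms sigma_finite_measure_count_space_countable[of "UNIV :: 'i set"]
  by (simp add: pair_sigma_finite_def)

lemma sum_integral_swap:
  fixes f :: "'i::countable \<Rightarrow> 'w \<Rightarrow> 'b::{banach, second_countable_topology}"
  assumes N: "sigma_finite_measure N"
    and f: "integrable (count_space UNIV \<Otimes>\<^sub>M N) (\<lambda>z. f (fst z) (snd z))"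
  shows "integrable N (\<lambda>w. LINT i|count_space UNIV. f i w)"
    and "integrable (count_space UNIV) (\<lambda>i. LINT w|N. f i w)"
    and "(LINT w|N. LINT i|count_space UNIV. f i w) = (LINT i|count_space UNIV. LINT w|N. f i w)"
    and "AE w in N. integrable (count_space UNIV) (\<lambda>i. f i w)"
    and "integrable N (f i)"
    and "(LINT z|(count_space UNIV \<Otimes>\<^sub>M N). f (fst z) (snd z)) = (LINT w|N. LINT i|count_space UNIV. f i w)"
proof -
  interpret P: pair_sigma_finite "count_space (UNIV :: 'i set)" N
    by (rule pair_sigma_finite_count_space[OF N])
  interpret Q: pair_sigma_finite N "count_space (UNIV :: 'i set)" ..
  have f': "integrable (N \<Otimes>\<^sub>M count_space UNIV) (\<lambda>z. f (snd z) (fst z))"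
    using P.integrable_product_swap[OF f] by (simp add: split_beta')
  show "integrable N (\<lambda>w. LINT i|count_space UNIV. f i w)" using Q.integrable_fst'[OF f'] by simp
  show "integrable (count_space UNIV) (\<lambda>i. LINT w|N. f i w)" using P.integrable_fst'[OF f] by simp
  have 1: "(LINT i|count_space UNIV. LINT w|N. f i w) = (LINT z|(count_space UNIV \<Otimes>\<^sub>M N). f (fst z) (snd z))"
    using P.integral_fst'[OF f] by simp
  have "(LINT w|N. LINT i|count_space UNIV. f i w) = (LINT z|(N \<Otimes>\<^sub>M count_space UNIV). f (snd z) (fst z))"
    using Q.integral_fst'[OF f'] by simp
  also have "\<dots> = (LINT z|(count_space UNIV \<Otimes>\<^sub>M N). f (fst z) (snd z))"
    using P.integral_product_swap[OF borel_measurable_integrable[OF f]] by (simp add: split_beta')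
  finally have 2: "(LINT w|N. LINT i|count_space UNIV. f i w) = (LINT z|(count_space UNIV \<Otimes>\<^sub>M N). f (fst z) (snd z))" .
  show "(LINT w|N. LINT i|count_space UNIV. f i w) = (LINT i|count_space UNIV. LINT w|N. f i w)"
    using 1 2 by simp
  show "(LINT z|(count_space UNIV \<Otimes>\<^sub>M N). f (fst z) (snd z)) = (LINT w|N. LINT i|count_space UNIV. f i w)"
    using 2 by simp
  show "AE w in N. integrable (count_space UNIV) (\<lambda>i. f i w)" using Q.AE_integrable_fst'[OF f'] by simp
  show "integrable N (f i)" using P.AE_integrable_fst'[OF f] by (simp add: AE_count_space)
qed

lemma integrable_sum_prodI:
  fixes f :: "'i::countable \<Rightarrow> 'w \<Rightarrow> 'b::{banach, second_countable_topology}"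
  assumes N: "sigma_finite_measure N" and f: "\<And>i. integrable N (f i)"
    and s: "integrable (count_space UNIV) (\<lambda>i. LINT w|N. norm (f i w))"
  shows "integrable (count_space UNIV \<Otimes>\<^sub>M N) (\<lambda>z. f (fst z) (snd z))"
proof -
  interpret P: pair_sigma_finite "count_space (UNIV :: 'i set)" N
    by (rule pair_sigma_finite_count_space[OF N])
  show ?thesis
  proof (rule P.Fubini_integrable)
    show "(\<lambda>z. f (fst z) (snd z)) \<in> borel_measurable (count_space UNIV \<Otimes>\<^sub>M N)"
      by (rule measurable_pair_measure_countable1) (use borel_measurable_integrable[OF f] in auto)
  qed (use f s in auto)
qed

lemma integrable_prod_sumI:
  fixes f :: "'i::countable \<Rightarrow> 'w \<Rightarrow> 'b::{banach, second_countable_topology}"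
  assumes N: "sigma_finite_measure N" and f: "\<And>i. f i \<in> borel_measurable N"
    and s: "AE w in N. integrable (count_space UNIV) (\<lambda>i. f i w)"
    and int: "integrable N (\<lambda>w. LINT i|count_space UNIV. norm (f i w))"
  shows "integrable (count_space UNIV \<Otimes>\<^sub>M N) (\<lambda>z. f (fst z) (snd z))"
proof -
  interpret P: pair_sigma_finite "count_space (UNIV :: 'i set)" N
    by (rule pair_sigma_finite_count_space[OF N])
  interpret Q: pair_sigma_finite N "count_space (UNIV :: 'i set)" ..
  have m: "(\<lambda>z. f (fst z) (snd z)) \<in> borel_measurable (count_space UNIV \<Otimes>\<^sub>M N)"
    by (rule measurable_pair_measure_countable1) (use f in auto)
  have "integrable (N \<Otimes>\<^sub>M count_space UNIV) (\<lambda>z. f (snd z) (fst z))"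
  proof (rule Q.Fubini_integrable)
    show "(\<lambda>z. f (snd z) (fst z)) \<in> borel_measurable (N \<Otimes>\<^sub>M count_space UNIV)"
      using measurable_pair_swap[OF m] by (simp add: split_beta')
  qed (use s int in auto)
  from Q.integrable_product_swap[OF this] show ?thesis by (simp add: split_beta')
qed

lemma isCont_integral:
  fixes F :: "'a::metric_space \<Rightarrow> 'w \<Rightarrow> 'b::{banach, second_countable_topology}"
  assumes d: "0 < d"
    and meas: "\<And>x. x \<in> ball x0 d \<Longrightarrow> F x \<in> borel_measurable M"
    and cont: "\<And>w. w \<in> space M \<Longrightarrow> isCont (\<lambda>x. F x w) x0"
    and bnd: "\<And>w x. w \<in> space M \<Longrightarrow> x \<in> ball x0 d \<Longrightarrow> norm (F x w) \<le> B w"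
    and B: "integrable M B"
  shows "isCont (\<lambda>x. LINT w|M. F x w) x0"
  unfolding continuous_at_sequentially
proof (intro allI impI)
  fix X :: "nat \<Rightarrow> 'a" assume X: "X \<longlonglongrightarrow> x0"
  then have "\<forall>\<^sub>F i in sequentially. X i \<in> ball x0 d"
    using d by (auto simp: tendsto_iff dist_commute)
  then obtain N where N: "\<And>i. i \<ge> N \<Longrightarrow> X i \<in> ball x0 d"
    by (auto simp: eventually_sequentially)
  have "(\<lambda>i. LINT w|M. F (X (i + N)) w) \<longlonglongrightarrow> (LINT w|M. F x0 w)"
  proof (rule integral_dominated_convergence[OF _ _ B])
    show "F x0 \<in> borel_measurable M" by (rule meas) (use d in auto)
    show "F (X (i + N)) \<in> borel_measurable M" for i by (rule meas[OF N]) simp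
    show "AE w in M. (\<lambda>i. F (X (i + N)) w) \<longlonglongrightarrow> F x0 w"
    proof (rule AE_I2)
      fix w assume "w \<in> space M"
      from isCont_tendsto_compose[OF cont[OF this] LIMSEQ_ignore_initial_segment[OF X]]
      show "(\<lambda>i. F (X (i + N)) w) \<longlonglongrightarrow> F x0 w" .
    qed
    show "AE w in M. norm (F (X (i + N)) w) \<le> B w" for i
      by (intro AE_I2 bnd N) auto
  qed
  then show "((\<lambda>x. LINT w|M. F x w) \<circ> X) \<longlonglongrightarrow> (LINT w|M. F x0 w)"
    unfolding comp_def by (rule LIMSEQ_offset)
qed

lemma integrable_int_inverse_square:
  "integrable (count_space UNIV) (\<lambda>l::int. 1 / (1 + (real_of_int l)\<^sup>2))"
proof -
  have nat: "Infinite_Set_Sum.abs_summable_on (\<lambda>n::nat. 1 / (1 + (real n)\<^sup>2)) UNIV"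
    unfolding abs_summable_on_nat_iff'
  proof (rule summable_comparison_test')
    show "summable (\<lambda>n. inverse (real n ^ 2))" by (rule inverse_power_summable) simp
    show "norm (norm (1 / (1 + (real n)\<^sup>2))) \<le> inverse (real n ^ 2)" if "n \<ge> 1" for n
      using that by (simp add: divide_simps add_pos_nonneg)
  qed
  have "Infinite_Set_Sum.abs_summable_on (\<lambda>l::int. 1 / (1 + (real_of_int l)\<^sup>2)) (range int)"
    using nat Infinite_Set_Sum.abs_summable_on_reindex_iff[of int UNIV "\<lambda>l::int. 1 / (1 + (real_of_int l)\<^sup>2)"] by simp
  moreover have "Infinite_Set_Sum.abs_summable_on (\<lambda>l::int. 1 / (1 + (real_of_int l)\<^sup>2)) (range (\<lambda>n. - int n))"
    using nat Infinite_Set_Sum.abs_summable_on_reindex_iff[of "\<lambda>n. - int n" UNIV "\<lambda>l::int. 1 / (1 + (real_of_int l)\<^sup>2)"]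
    by (simp add: inj_on_def)
  ultimately have "Infinite_Set_Sum.abs_summable_on (\<lambda>l::int. 1 / (1 + (real_of_int l)\<^sup>2)) (range int \<union> range (\<lambda>n. - int n))"
    by (rule abs_summable_on_union)
  moreover have "range int \<union> range (\<lambda>n. - int n) = UNIV"
  proof -
    have "l \<in> range int \<union> range (\<lambda>n. - int n)" for l by (cases l rule: int_cases2) auto
    then show ?thesis by blast
  qed
  ultimately show ?thesis by (simp add: Infinite_Set_Sum.abs_summable_on_def)
qed

text \<open>Adding a multiple of q to y only renumbers the lattice, so y / q may be replaced by its
  fractional part. This makes the bound uniform in y.\<close>

lemma lattice_sum_bound:
  fixes q :: real
  assumes q: "q \<noteq> 0"
  obtains S where "0 \<le> S" "\<And>y. integrable (count_space UNIV) (\<lambda>l::int. 1 / (1 + (y + q * l)\<^sup>2))"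
    "\<And>y. (LINT l|count_space UNIV. 1 / (1 + (y + q * real_of_int l)\<^sup>2)) \<le> S"
proof -
  let ?M = "count_space (UNIV :: int set)" and ?b = "\<lambda>l::int. 1 / (1 + (real_of_int l)\<^sup>2)"
  \<comment> \<open>Chosen so that 1 + l^2 is at most C times 1 + (q (f + l))^2 for f between 0 and
    1: the summand 3 absorbs the constants, and 2 / q^2 the quadratic term.\<close>
  define C where "C = 3 + 2 / q\<^sup>2"
  have C: "0 < C" "2 \<le> C * q\<^sup>2" using q by (auto simp: C_def add_pos_nonneg algebra_simps)
  have base: "1 / (1 + (q * (f + real_of_int l))\<^sup>2) \<le> C * ?b l" if f: "0 \<le> f" "f \<le> 1" for f l
  proof -
    let ?x = "f + real_of_int l"
    have "(real_of_int l)\<^sup>2 = (?x - f)\<^sup>2" by simp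
    also have "\<dots> \<le> 2 * ?x\<^sup>2 + 2 * f\<^sup>2"
      using zero_le_power2[of "?x + f"] by (simp add: power2_eq_square algebra_simps)
    also have "f\<^sup>2 \<le> 1" using f by (simp add: power_le_one)
    finally have "1 + (real_of_int l)\<^sup>2 \<le> 3 + 2 * ?x\<^sup>2" by simp
    also have "\<dots> \<le> C + (C * q\<^sup>2) * ?x\<^sup>2" using C by (intro add_mono mult_right_mono) (auto simp: C_def)
    also have "\<dots> = C * (1 + (q * ?x)\<^sup>2)" 
      by (simp only: power_mult_distrib ring_distribs(1)[of C] mult_1_right mult.assoc)
    finally have le: "1 + (real_of_int l)\<^sup>2 \<le> C * (1 + (q * ?x)\<^sup>2)" .
    have pos: "0 < 1 + (real_of_int l)\<^sup>2" "0 < 1 + (q * ?x)\<^sup>2" by (simp_all add: add_pos_nonneg)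
    show ?thesis using le pos by (simp add: divide_simps mult.commute)
  qed
  have *: "integrable ?M (\<lambda>l. 1 / (1 + (y + q * real_of_int l)\<^sup>2)) \<and>
     (LINT l|?M. 1 / (1 + (y + q * real_of_int l)\<^sup>2)) \<le> C * (LINT l|?M. ?b l)" for y
  proof -
    define m where "m = \<lfloor>y / q\<rfloor>"
    define f where "f = y / q - real_of_int m"
    have f: "0 \<le> f" "f \<le> 1" unfolding f_def m_def by linarith+
    have y: "y + q * real_of_int l = q * (f + real_of_int (l + m))" for l
      using q by (simp add: f_def algebra_simps)
    let ?g = "\<lambda>l::int. 1 / (1 + (q * (f + real_of_int l))\<^sup>2)"
    have gi: "integrable ?M ?g"
    proof (rule Bochner_Integration.integrable_bound)
      show "integrable ?M (\<lambda>l. C * ?b l)" by (intro integrable_mult_right integrable_int_inverse_square)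
      show "AE l in ?M. norm (?g l) \<le> norm (C * ?b l)"
        using base[OF f] by (intro AE_I2) (smt (verit) real_norm_def zero_le_power2 divide_nonneg_nonneg)
    qed auto
    have inj: "inj (\<lambda>l::int. l + m)" by (simp add: inj_def)
    have "(LINT l|?M. ?g (l + m)) \<le> (LINT l|?M. ?g l)"
      by (rule integral_count_space_inj_le[OF inj gi]) simp
    also have "\<dots> \<le> (LINT l|?M. C * ?b l)"
      by (intro integral_mono gi base f integrable_mult_right integrable_int_inverse_square)
    also have "\<dots> = C * (LINT l|?M. ?b l)" by (rule integral_mult_right_zero)
    finally show ?thesis using integral_count_space_inj(1)[OF inj gi] by (simp only: y)
  qed
  show ?thesis
  proof (rule that[of "C * (LINT l|?M. ?b l)"])
    show "0 \<le> C * (LINT l|?M. ?b l)" using C by simp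
  qed (use * in auto)
qed

text \<open>The half-open period and its translates tile the line: every y has exactly one translate
  in it, so summation over l before integration returns f.\<close>

lemma integral_periodization:
  fixes f :: "real \<Rightarrow> 'b::{banach, second_countable_topology}"
  assumes q: "0 < q" and f: "integrable lborel f"
  shows "integrable (count_space UNIV \<Otimes>\<^sub>M lborel) (\<lambda>z. indicator {0..<q} (snd z) *\<^sub>R f (snd z - q * real_of_int (fst z)))"
    and "(LINT l|count_space UNIV. LINT y|lborel. indicator {0..<q} y *\<^sub>R f (y - q * real_of_int l)) = (LINT y|lborel. f y)"
proof -
  let ?M = "count_space (UNIV :: int set)"
  have shift: "integrable lborel (\<lambda>y. g (y - q * real_of_int l)) \<longleftrightarrow> integrable lborel g"
    "(LINT y|lborel. g (y - q * real_of_int l)) = (LINT y|lborel. g y)"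
    for g :: "real \<Rightarrow> 'c::{banach, second_countable_topology}" and l
    using lborel_integrable_real_affine_iff[of 1 g "- q * real_of_int l"] lborel_integral_real_affine[of 1 g "- q * real_of_int l"]
    by (simp_all add: algebra_simps)
  define F where "F l y = indicator {0..<q} (y + q * real_of_int l) *\<^sub>R f y" for l :: int and y
  have F: "integrable lborel (F l)" for l
  proof -
    have "F l = (\<lambda>y. indicator {y. 0 \<le> y + q * real_of_int l \<and> y + q * real_of_int l < q} y *\<^sub>R f y)"
      by (auto simp: F_def indicator_def)
    moreover have "integrable lborel \<dots>"
      by (rule integrable_mult_indicator[OF _ f]) auto
    ultimately show ?thesis by simp
  qed
  have mem: "y + q * real_of_int l \<in> {0..<q} \<longleftrightarrow> l = - \<lfloor>y / q\<rfloor>" for y l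
  proof -
    have "y + q * real_of_int l \<in> {0..<q} \<longleftrightarrow> 0 \<le> y / q + real_of_int l \<and> y / q + real_of_int l < 1"
      using q by (auto simp: field_simps)
    also have "\<dots> \<longleftrightarrow> l = - \<lfloor>y / q\<rfloor>" by linarith
    finally show ?thesis .
  qed
  have Fsum: "integrable ?M (\<lambda>l. F l y)" "(LINT l|?M. F l y) = f y" for y
  proof -
    have eq: "F l y = indicator {- \<lfloor>y / q\<rfloor>} l *\<^sub>R f y" for l
      by (simp only: F_def indicator_def mem singleton_iff)
    show "integrable ?M (\<lambda>l. F l y)" unfolding eq by (intro integrable_scaleR_left integrable_real_indicator) auto
    show "(LINT l|?M. F l y) = f y" unfolding eq by (subst integral_scaleR_left) auto
  qed
  have Fn: "(LINT l|?M. norm (F l y)) = norm (f y)" for y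
  proof -
    have eq: "norm (F l y) = indicator {- \<lfloor>y / q\<rfloor>} l *\<^sub>R norm (f y)" for l
      by (simp only: F_def indicator_def mem singleton_iff norm_scaleR) simp
    show ?thesis unfolding eq by (subst integral_scaleR_left) auto
  qed
  have prod: "integrable (?M \<Otimes>\<^sub>M lborel) (\<lambda>z. F (fst z) (snd z))"
  proof (rule integrable_prod_sumI[OF lborel.sigma_finite_measure_axioms])
    show "integrable lborel (\<lambda>w. LINT i|?M. norm (F i w))" using f by (simp add: Fn)
  qed (use F Fsum(1) in auto)
  note swap = sum_integral_swap[OF lborel.sigma_finite_measure_axioms prod]
  have FG: "F l (y - q * real_of_int l) = indicator {0..<q} y *\<^sub>R f (y - q * real_of_int l)" for l y
    by (simp add: F_def)
  show "(LINT l|?M. LINT y|lborel. indicator {0..<q} y *\<^sub>R f (y - q * real_of_int l)) = (LINT y|lborel. f y)"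
    using swap(3) by (simp only: FG[symmetric] shift(2)[of "F l" l for l] Fsum(2))
  show "integrable (?M \<Otimes>\<^sub>M lborel) (\<lambda>z. indicator {0..<q} (snd z) *\<^sub>R f (snd z - q * real_of_int (fst z)))"
  proof (rule integrable_sum_prodI[OF lborel.sigma_finite_measure_axioms])
    show "integrable lborel (\<lambda>y. indicator {0..<q} y *\<^sub>R f (y - q * real_of_int l))" for l
      using F by (simp only: FG[symmetric] shift(1)[of "F l"])
    have prodn: "integrable (?M \<Otimes>\<^sub>M lborel) (\<lambda>z. norm (F (fst z) (snd z)))"
      using prod by (rule integrable_norm)
    have "integrable ?M (\<lambda>l. LINT y|lborel. norm (F l (y - q * real_of_int l)))"
      using sum_integral_swap(2)[OF lborel.sigma_finite_measure_axioms prodn]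
      by (simp only: shift(2)[of "\<lambda>y. norm (F l y)" l for l])
    then show "integrable ?M (\<lambda>l. LINT y|lborel. norm (indicator {0..<q} y *\<^sub>R f (y - q * real_of_int l)))"
      by (simp only: FG)
  qed
qed

section \<open>Uniqueness of Fourier coefficients\<close>

lemma continuous_on_cis_linear: "continuous_on S (\<lambda>x. cis (a * x))"
  by (intro continuous_intros)

text \<open>Polynomials in the real and imaginary part of a point of the circle are trigonometric
  polynomials: a real linear function is A cis x + B cis (- x), which shifts the index m by one in
  either direction. D is kept general because the product case applies the hypothesis for g to D
  times f.\<close>

lemma zero_coefficients_mult_polynomial:
  assumes "real_polynomial_function p"
    and "continuous_on UNIV D"
    and "\<And>m::int. integral {0..2*pi} (\<lambda>x. D x * cis (of_int m * x)) = 0"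
  shows "continuous_on UNIV (\<lambda>x. D x * of_real (p (cis x)))
     \<and> (\<forall>m::int. integral {0..2*pi} (\<lambda>x. D x * of_real (p (cis x)) * cis (of_int m * x)) = 0)"
  using assms
proof (induction p arbitrary: D rule: real_polynomial_function.induct)
  case (linear f)
  have cD: "continuous_on {0..2*pi} (\<lambda>x. D x * cis (a * x) * c)" for a c
    by (intro continuous_intros continuous_on_subset[OF linear(2)]) auto
  then have iD: "(\<lambda>x. D x * cis (a * x) * c) integrable_on {0..2*pi}" for a c
    by (rule integrable_continuous_real)
  define A B where "A = complex_of_real (f 1) / 2 + complex_of_real (f \<i>) / (2 * \<i>)"
    and "B = complex_of_real (f 1) / 2 - complex_of_real (f \<i>) / (2 * \<i>)"
  have fc: "of_real (f (cis x)) = A * cis x + B * cis (- x)" for x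
  proof -
    have "cis x = cos x *\<^sub>R 1 + sin x *\<^sub>R \<i>" by (simp add: complex_eq_iff)
    then have "f (cis x) = cos x * f 1 + sin x * f \<i>"
      using linear_add[OF bounded_linear.linear[OF linear(1)]] linear_scale[OF bounded_linear.linear[OF linear(1)]] by simp
    then show ?thesis by (simp add: A_def B_def complex_eq_iff)
  qed
  have step: "D x * of_real (f (cis x)) * cis (of_int m * x)
      = D x * cis (of_int (m + 1) * x) * A + D x * cis (of_int (m - 1) * x) * B" for x and m :: int
  proof -
    have "cis x * cis (of_int m * x) = cis (of_int (m + 1) * x)" "cis (- x) * cis (of_int m * x) = cis (of_int (m - 1) * x)"
      unfolding cis_mult by (simp_all add: algebra_simps)
    moreover have "D x * of_real (f (cis x)) * cis (of_int m * x)
      = D x * (cis x * cis (of_int m * x)) * A + D x * (cis (- x) * cis (of_int m * x)) * B"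
      unfolding fc by (simp add: algebra_simps)
    ultimately show ?thesis by simp
  qed
  have "integral {0..2*pi} (\<lambda>x. D x * of_real (f (cis x)) * cis (of_int m * x)) = 0" for m :: int
    unfolding step using iD
    by (subst Henstock_Kurzweil_Integration.integral_add) (auto simp: linear(3) simp del: of_int_add of_int_diff)
  moreover have "continuous_on UNIV (\<lambda>x. D x * of_real (f (cis x)))"
    unfolding fc by (intro continuous_intros linear(2))
  ultimately show ?case by simp
next
  case (const c)
  have "integral {0..2*pi} (\<lambda>x. D x * of_real c * cis (of_int m * x)) = 0" for m :: int
  proof -
    have "(\<lambda>x. D x * of_real c * cis (of_int m * x)) = (\<lambda>x. of_real c * (D x * cis (of_int m * x)))"
      by (simp add: mult_ac)
    then show ?thesis by (simp add: const(2))
  qed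
  then show ?case using const(1) by (auto intro!: continuous_intros)
next
  case (add f g)
  have f: "continuous_on UNIV (\<lambda>x. D x * of_real (f (cis x)))"
    "integral {0..2*pi} (\<lambda>x. D x * of_real (f (cis x)) * cis (of_int m * x)) = 0" for m :: int
    using add.IH(1)[OF add.prems] by auto
  have g: "continuous_on UNIV (\<lambda>x. D x * of_real (g (cis x)))"
    "integral {0..2*pi} (\<lambda>x. D x * of_real (g (cis x)) * cis (of_int m * x)) = 0" for m :: int
    using add.IH(2)[OF add.prems] by auto
  have i: "(\<lambda>x. h x * cis (a * x)) integrable_on {0..2*pi}" if "continuous_on UNIV h" for h a
    by (intro integrable_continuous_real continuous_intros continuous_on_subset[OF that]) auto
  have "integral {0..2*pi} (\<lambda>x. D x * of_real (f (cis x) + g (cis x)) * cis (of_int m * x)) = 0" for m :: int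
    using Henstock_Kurzweil_Integration.integral_add[OF i[OF f(1)] i[OF g(1)], of "of_int m" "of_int m"] f(2)[of m] g(2)[of m]
    by (simp add: algebra_simps)
  moreover have "continuous_on UNIV (\<lambda>x. D x * of_real (f (cis x) + g (cis x)))"
    using continuous_on_add[OF f(1) g(1)] by (simp add: algebra_simps)
  ultimately show ?case by simp
next
  case (mult f g)
  have "continuous_on UNIV (\<lambda>x. D x * of_real (f (cis x)))"
    "integral {0..2*pi} (\<lambda>x. D x * of_real (f (cis x)) * cis (of_int m * x)) = 0" for m :: int
    using mult.IH(1)[OF mult.prems] by auto
  from mult.IH(2)[OF this] show ?case by (simp add: mult.assoc)
qed

text \<open>By Stone-Weierstrass on the circle the conjugate of D is a uniform limit of polynomials,
  and D integrates to 0 against each of them. So the integral of the squared modulus of D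
  vanishes.\<close>

lemma fourier_uniqueness_2pi:
  assumes cont: "continuous_on UNIV D" and per: "D 0 = D (2 * pi)"
    and coeff: "\<And>m::int. integral {0..2*pi} (\<lambda>x. D x * cis (of_int m * x)) = 0"
    and x: "x \<in> {0..2*pi}"
  shows "D x = 0"
proof -
  let ?I = "{0..2*pi}" and ?T = "cis ` {0..2*pi}"
  \<comment> \<open>The conjugate of D as a function on the circle. At the right end point
    \<open>Arg2pi\<close> returns 0 instead of 2 pi, and the equality of D at both ends repairs
    this.\<close>
  define h where "h z = cnj (D (Arg2pi z))" for z
  have hc: "h (cis x) = cnj (D x)" if "x \<in> ?I" for x
  proof (cases "x = 2 * pi")
    case True
    have "Arg2pi 1 = 0" by (rule Arg2pi_unique[of 1]) auto
    then show ?thesis using True per by (simp add: h_def)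
  next
    case False
    have "Arg2pi (cis x) = x"
      by (rule Arg2pi_unique[of 1]) (use that False in \<open>auto simp: cis_conv_exp\<close>)
    then show ?thesis by (simp add: h_def)
  qed
  have cI: "continuous_on S D" for S using continuous_on_subset[OF cont] by simp
  have compT: "compact ?T" by (intro compact_continuous_image continuous_intros compact_Icc)
  have "continuous_on ?T h"
  \<comment> \<open>On the compact interval \<open>cis\<close> maps closed sets to closed sets, so
    continuity passes to the circle in spite of the jump of \<open>Arg2pi\<close>.\<close>
  proof (subst continuous_on_closed_vimage[OF compact_imp_closed[OF compT]], intro allI impI)
    fix B :: "complex set" assume B: "closed B"
    have "h -` B \<inter> ?T = cis ` ((\<lambda>x. cnj (D x)) -` B \<inter> ?I)" using hc by (auto simp: image_iff)
    moreover have "closed ((\<lambda>x. cnj (D x)) -` B \<inter> ?I)"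
      using B by (intro continuous_on_closed_vimage[THEN iffD1, rule_format] continuous_intros cI) auto
    then have "compact ((\<lambda>x. cnj (D x)) -` B \<inter> ?I)"
      using compact_Int_closed[OF compact_Icc[of 0 "2*pi"]] by (metis Int_commute inf.right_idem)
    then have "compact (cis ` ((\<lambda>x. cnj (D x)) -` B \<inter> ?I))"
      by (intro compact_continuous_image continuous_intros)
    ultimately show "closed (h -` B \<inter> ?T)" by (simp add: compact_imp_closed)
  qed
  note SW = Stone_Weierstrass_polynomial_function[OF compT this]
  have iD: "(\<lambda>x. norm (D x)) integrable_on ?I" "(\<lambda>x. D x * cnj (D x)) integrable_on ?I"
    by (intro integrable_continuous_real continuous_intros cI)+
  define J where "J = integral ?I (\<lambda>x. D x * cnj (D x))"
  have le: "norm J \<le> e * integral ?I (\<lambda>x. norm (D x))" if e: "0 < e" for e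
  proof -
    obtain g where g: "polynomial_function g" "\<And>z. z \<in> ?T \<Longrightarrow> norm (h z - g z) < e"
      using SW[OF e] by blast
    have re: "real_polynomial_function (\<lambda>z. Re (g z))" and im: "real_polynomial_function (\<lambda>z. Im (g z))"
      using g(1) bounded_linear_Re bounded_linear_Im unfolding polynomial_function_def comp_def by blast+
    note R = zero_coefficients_mult_polynomial[OF re cont coeff]
    note Im = zero_coefficients_mult_polynomial[OF im cont coeff]
    have eq: "D x * g (cis x) = D x * of_real (Re (g (cis x))) + \<i> * (D x * of_real (Im (g (cis x))))" for x
      by (subst complex_eq[of "g (cis x)"]) (simp add: algebra_simps)
    have cR: "continuous_on ?I (\<lambda>x. D x * of_real (Re (g (cis x))))" "continuous_on ?I (\<lambda>x. D x * of_real (Im (g (cis x))))"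
      using continuous_on_subset[OF conjunct1[OF R]] continuous_on_subset[OF conjunct1[OF Im]] by auto
    note iR = integrable_continuous_real[OF cR(1)]
      and iI = integrable_continuous_real[OF continuous_on_mult_left[OF cR(2), of \<i>]]
    have R0: "integral ?I (\<lambda>x. D x * of_real (Re (g (cis x)))) = 0"
      using R[THEN conjunct2, THEN spec, of 0] by simp
    have I0: "integral ?I (\<lambda>x. D x * of_real (Im (g (cis x)))) = 0"
      using Im[THEN conjunct2, THEN spec, of 0] by simp
    have "integral ?I (\<lambda>x. \<i> * (D x * of_real (Im (g (cis x))))) = 0"
      using I0 by simp
    then have g0: "integral ?I (\<lambda>x. D x * g (cis x)) = 0"
      unfolding eq Henstock_Kurzweil_Integration.integral_add[OF iR iI] using R0 by simp
    have ig: "(\<lambda>x. D x * g (cis x)) integrable_on ?I"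
      unfolding eq by (rule Henstock_Kurzweil_Integration.integrable_add[OF iR iI])
    have "J = integral ?I (\<lambda>x. D x * cnj (D x) - D x * g (cis x))"
      using Henstock_Kurzweil_Integration.integral_diff[OF iD(2) ig] g0 by (simp add: J_def)
    also have "norm \<dots> \<le> integral ?I (\<lambda>x. e * norm (D x))"
    proof (rule integral_norm_bound_integral)
      show "(\<lambda>x. D x * cnj (D x) - D x * g (cis x)) integrable_on ?I" by (intro Henstock_Kurzweil_Integration.integrable_diff iD ig)
      show "(\<lambda>x. e * norm (D x)) integrable_on ?I" by (intro integrable_continuous_real continuous_intros cI)
      fix x assume x: "x \<in> ?I"
      have "norm (cnj (D x) - g (cis x)) \<le> e" using g(2)[of "cis x"] hc[OF x] x by (force intro: less_imp_le)
      then have "norm (D x) * norm (cnj (D x) - g (cis x)) \<le> norm (D x) * e" by (rule mult_left_mono) simp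
      then show "norm (D x * cnj (D x) - D x * g (cis x)) \<le> e * norm (D x)"
        by (simp add: right_diff_distrib[symmetric] norm_mult mult.commute)
    qed
    finally show ?thesis by simp
  qed
  have "norm J \<le> 0"
  proof (rule field_le_epsilon)
    fix e :: real assume e: "0 < e"
    let ?N = "integral ?I (\<lambda>x. norm (D x))"
    have N: "0 \<le> ?N" by (rule Henstock_Kurzweil_Integration.integral_nonneg[OF iD(1)]) simp
    have "norm J \<le> e / (?N + 1) * ?N" using e N by (intro le) simp
    also have "\<dots> \<le> e" using e N by (simp add: field_simps)
    finally show "norm J \<le> 0 + e" by simp
  qed
  then have "J = 0" by simp
  moreover have "J = of_real (integral ?I (\<lambda>x. (norm (D x))\<^sup>2))"
  proof -
    have "J = integral ?I (\<lambda>x. of_real ((norm (D x))\<^sup>2))" unfolding J_def complex_norm_square ..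
    also have "\<dots> = of_real (integral ?I (\<lambda>x. (norm (D x))\<^sup>2))"
      by (rule integral_linear[OF _ bounded_linear_of_real, unfolded comp_def])
        (intro integrable_continuous_real continuous_intros cI)
    finally show ?thesis .
  qed
  ultimately have "integral (cbox 0 (2*pi)) (\<lambda>x. (norm (D x))\<^sup>2) = 0" by simp
  then have "\<forall>x\<in>cbox 0 (2*pi). (norm (D x))\<^sup>2 = 0"
    using pi_gt_zero by (subst (asm) integral_cbox_eq_0_iff) (auto intro!: continuous_intros cI simp: not_le)
  then show ?thesis using x by auto
qed

lemma fourier_uniqueness:
  assumes q: "0 < q" and cont: "continuous_on UNIV D" and per: "\<And>x. D (x + q) = D x"
    and coeff: "\<And>m::int. integral {0..q} (\<lambda>x. D x * cis (2 * pi * of_int m / q * x)) = 0"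
  shows "D x = 0"
proof -
  define c where "c = q / (2 * pi)"
  have c: "0 < c" "c * (2 * pi) = q" using q by (auto simp: c_def)
  have cD: "continuous_on S (\<lambda>u. D (c * u))" for S
    by (rule continuous_on_compose2[OF cont]) (auto intro!: continuous_intros)
  have base: "D x = 0" if x: "x \<in> {0..q}" for x
  proof -
    have "D (c * (x / c)) = 0"
    proof (rule fourier_uniqueness_2pi[of "\<lambda>u. D (c * u)"])
      show "D (c * 0) = D (c * (2 * pi))" using per[of 0] c by simp
      show "x / c \<in> {0..2*pi}" using x c by (auto simp: field_simps)
      fix m :: int
      have "((\<lambda>x. D x * cis (2 * pi * of_int m / q * x)) has_integral 0) (cbox 0 q)"
        unfolding cbox_interval coeff[of m, symmetric]
        by (intro integrable_integral integrable_continuous_real continuous_intros continuous_on_subset[OF cont]) auto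
      from has_integral_affinity[OF this, of c 0] c
      have "((\<lambda>u. D (c * u) * cis (2 * pi * of_int m / q * (c * u))) has_integral 0) ((\<lambda>x. x / c) ` {0..q})"
        by (simp add: divide_inverse mult.commute)
      moreover have "(\<lambda>x. x / c) ` {0..q} = {0..2*pi}"
        using c by (auto simp: image_iff field_simps intro!: bexI[of _ "c * _"])
      moreover have "2 * pi * of_int m / q * (c * u) = of_int m * u" for u
        using q by (simp add: c_def)
      ultimately show "integral {0..2*pi} (\<lambda>u. D (c * u) * cis (of_int m * u)) = 0"
        by (simp add: integral_unique)
    qed (rule cD)
    then show ?thesis using c by simp
  qed
  have shift: "D (x + q * of_nat n) = D x" for x n
  proof (induction n)
    case (Suc n)
    have "D (x + q * of_nat (Suc n)) = D ((x + q * of_nat n) + q)" by (simp add: algebra_simps)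
    then show ?case using per Suc by simp
  qed simp
  define m where "m = \<lfloor>x / q\<rfloor>"
  have "D (x - q * of_int m) = D x"
  proof (cases "0 \<le> m")
    case True
    then show ?thesis using shift[of "x - q * of_int m" "nat m"] by simp
  next
    case False
    then show ?thesis using shift[of x "nat (- m)"] by simp
  qed
  moreover have "x - q * of_int m \<in> {0..q}"
  proof -
    have "of_int m \<le> x / q" "x / q < of_int m + 1" unfolding m_def by linarith+
    then show ?thesis using q by (auto simp: field_simps)
  qed
  ultimately show ?thesis using base by metis
qed

section \<open>The heat kernel on the line and the theta identity\<close>

definition heat :: "real \<Rightarrow> real \<Rightarrow> real" where
  "heat t x = exp (- (x\<^sup>2 / (4 * t))) / sqrt (4 * pi * t)"

lemma heat_nonneg [simp]: "0 \<le> t \<Longrightarrow> 0 \<le> heat t x"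
  by (simp add: heat_def)

lemma heat_eq_normal_density: "0 < t \<Longrightarrow> heat t = normal_density 0 (sqrt (2 * t))"
  by (rule ext) (simp add: heat_def normal_density_def mult_ac)

lemma integrable_heat: "0 < t \<Longrightarrow> integrable lborel (heat t)"
  and integral_heat: "0 < t \<Longrightarrow> (LINT x|lborel. heat t x) = 1"
  by (simp_all add: heat_eq_normal_density)

text \<open>Scaled by the standard deviation, this is the characteristic function of the standard
  normal distribution.\<close>

lemma heat_fourier:
  assumes t: "0 < t"
  shows "(LINT y|lborel. of_real (heat t y) * cis (\<xi> * y)) = of_real (exp (- (t * \<xi>\<^sup>2)))"
proof -
  define \<sigma> where "\<sigma> = sqrt (2 * t)"
  have \<sigma>: "0 < \<sigma>" "\<sigma>\<^sup>2 = 2 * t" using t by (auto simp: \<sigma>_def)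
  have hs: "\<sigma> * heat t (\<sigma> * x) = std_normal_density x" for x
  proof -
    have "sqrt (4 * pi * t) = \<sigma> * sqrt (2 * pi)" using t by (simp add: \<sigma>_def real_sqrt_mult[symmetric] mult_ac)
    moreover have "(\<sigma> * x)\<^sup>2 / (4 * t) = x\<^sup>2 / 2" using t by (simp add: power_mult_distrib \<sigma>(2))
    ultimately show ?thesis using \<sigma> by (simp add: heat_def std_normal_density_def)
  qed
  have "(LINT y|lborel. of_real (heat t y) * cis (\<xi> * y))
     = \<bar>\<sigma>\<bar> *\<^sub>R (LINT x|lborel. of_real (heat t (0 + \<sigma> * x)) * cis (\<xi> * (0 + \<sigma> * x)))"
    by (rule lborel_integral_real_affine) (use \<sigma> in simp)
  also have "\<dots> = (LINT x|lborel. std_normal_density x *\<^sub>R iexp (\<xi> * \<sigma> * x))"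
    unfolding integral_scaleR_right[symmetric]
    by (intro Bochner_Integration.integral_cong refl)
      (use \<sigma> in \<open>simp add: hs[symmetric] scaleR_conv_of_real cis_conv_exp mult_ac\<close>)
  also have "\<dots> = (LINT x|density lborel std_normal_density. iexp (\<xi> * \<sigma> * x))"
    by (subst integral_density) (auto intro!: borel_measurable_continuous_onI continuous_intros)
  also have "\<dots> = char std_normal_distribution (\<xi> * \<sigma>)"
    by (simp add: char_def)
  also have "\<dots> = of_real (exp (- (t * \<xi>\<^sup>2)))"
    by (simp add: char_std_normal_distribution power_mult_distrib \<sigma>(2) mult_ac)
  finally show ?thesis .
qed

lemma exp_neg_square_decay:
  fixes c x :: real
  assumes c: "0 < c"
  shows "exp (- (c * x\<^sup>2)) \<le> max 1 (1 / c) / (1 + x\<^sup>2)"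
proof -
  let ?m = "max 1 (1 / c)"
  have u: "0 \<le> c * x\<^sup>2" using c by simp
  have "exp (- (c * x\<^sup>2)) = 1 / exp (c * x\<^sup>2)" by (simp add: exp_minus divide_inverse)
  also have "\<dots> \<le> 1 / (1 + c * x\<^sup>2)"
    using exp_ge_add_one_self[of "c * x\<^sup>2"] u by (intro divide_left_mono mult_pos_pos) auto
  also have "\<dots> \<le> ?m / (1 + x\<^sup>2)"
  proof -
    have "1 \<le> ?m * c" if "1 / c \<ge> 1" using that c by (simp add: max_def)
    moreover have "1 / c * c \<le> ?m * c" using c by (intro mult_right_mono) auto
    ultimately have "1 \<le> ?m * c" using c by simp
    then have "x\<^sup>2 \<le> ?m * c * x\<^sup>2" using mult_right_mono[of 1 "?m * c" "x\<^sup>2"] by simp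
    then have "1 + x\<^sup>2 \<le> ?m * (1 + c * x\<^sup>2)" by (simp add: distrib_left mult.assoc)
    moreover have "0 < 1 + x\<^sup>2" "0 < 1 + c * x\<^sup>2" using u by (simp_all add: add_pos_nonneg)
    ultimately show ?thesis by (simp add: divide_simps mult.commute)
  qed
  finally show ?thesis .
qed

lemma heat_decay:
  assumes t: "0 < t"
  shows "heat t x \<le> (max 1 (4 * t) / sqrt (4 * pi * t)) * (1 / (1 + x\<^sup>2))"
proof -
  have "exp (- (x\<^sup>2 / (4 * t))) \<le> max 1 (4 * t) / (1 + x\<^sup>2)"
    using exp_neg_square_decay[of "1 / (4 * t)" x] t by simp
  then have "heat t x \<le> (max 1 (4 * t) / (1 + x\<^sup>2)) / sqrt (4 * pi * t)"
    unfolding heat_def using t by (intro divide_right_mono) auto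
  then show ?thesis by (simp add: mult.commute)
qed

lemma integrable_gauss_lattice:
  fixes y q :: real
  assumes q: "q \<noteq> 0" and c: "0 < c"
  shows "integrable (count_space UNIV) (\<lambda>l::int. exp (- (c * (y + q * of_int l)\<^sup>2)))"
proof -
  obtain S where S: "\<And>y. integrable (count_space UNIV) (\<lambda>l::int. 1 / (1 + (y + q * l)\<^sup>2))"
    using lattice_sum_bound[OF q] by metis
  show ?thesis
  proof (rule Bochner_Integration.integrable_bound)
    show "integrable (count_space UNIV) (\<lambda>l::int. max 1 (1 / c) * (1 / (1 + (y + q * l)\<^sup>2)))"
      by (intro integrable_mult_right S)
    show "AE l in count_space UNIV. norm (exp (- (c * (y + q * of_int l)\<^sup>2)))
        \<le> norm (max 1 (1 / c) * (1 / (1 + (y + q * real_of_int l)\<^sup>2)))"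
    proof (rule AE_I2)
      fix l :: int
      have "0 \<le> max 1 (1 / c) * (1 / (1 + (y + q * real_of_int l)\<^sup>2))" by (intro mult_nonneg_nonneg) auto
      then show "norm (exp (- (c * (y + q * of_int l)\<^sup>2))) \<le> norm (max 1 (1 / c) * (1 / (1 + (y + q * real_of_int l)\<^sup>2)))"
        using exp_neg_square_decay[OF c, of "y + q * of_int l"] by simp
    qed
  qed auto
qed

lemma integrable_heat_lattice:
  assumes q: "q \<noteq> 0" and t: "0 < t"
  shows "integrable (count_space UNIV) (\<lambda>l::int. heat t (x - q * of_int l))"
  using integrable_gauss_lattice[of "- q" "1 / (4 * t)" x] q t
  by (simp add: heat_def)

lemma integral_cis_period:
  fixes k :: int
  assumes q: "0 < q"
  shows "integral {0..q} (\<lambda>y. cis (2 * pi * of_int k / q * y)) = (if k = 0 then of_real q else 0)"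
proof (cases "k = 0")
  case False
  define c where "c = \<i> * of_real (2 * pi * of_int k / q)"
  have c: "c \<noteq> 0" using False q by (simp add: c_def)
  have eq: "cis (2 * pi * of_int k / q * y) = exp (c * of_real y)" for y
    by (simp add: c_def cis_conv_exp mult_ac)
  have "((\<lambda>y. exp (c * of_real y)) has_integral (exp (c * of_real q) / c - exp (c * of_real 0) / c)) {0..q}"
  proof (rule fundamental_theorem_of_calculus)
    fix x assume "x \<in> {0..q}"
    have "((\<lambda>z. exp (c * z) / c) has_field_derivative exp (c * of_real x)) (at (of_real x))"
      using c by (auto intro!: derivative_eq_intros)
    then show "((\<lambda>y. exp (c * of_real y) / c) has_vector_derivative exp (c * of_real x)) (at x within {0..q})"
      by (rule has_vector_derivative_real_field)
  qed (use q in simp)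
  moreover have "exp (c * of_real q) = 1"
  proof -
    have "exp (c * of_real q) = cis (2 * pi * of_int k)" using q by (simp add: c_def cis_conv_exp)
    then show ?thesis by (simp add: cis_multiple_2pi)
  qed
  ultimately have "integral {0..q} (\<lambda>y. exp (c * of_real y)) = 0" by (simp add: integral_unique)
  then show ?thesis unfolding eq using False by simp
qed (use q in \<open>simp add: content_real scaleR_conv_of_real\<close>)

text \<open>Half-open periods tile the line, while the uniqueness argument integrates over closed
  ones; the end point is a null set.\<close>

lemma integral_Ico_eq:
  fixes f :: "real \<Rightarrow> complex"
  assumes f: "continuous_on {0..q} f"
  shows "(LINT y|lborel. indicator {0..<q} y *\<^sub>R f y) = integral {0..q} f"
    and "integrable lborel (\<lambda>y. indicator {0..<q} y *\<^sub>R f y)"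
proof -
  have i: "set_integrable lborel {0..q} f" by (rule borel_integrable_atLeastAtMost'[OF f])
  then have i': "integrable lborel (\<lambda>y. indicator {0..q} y *\<^sub>R f y)" by (simp add: set_integrable_def)
  have "(\<lambda>y. indicator {0..<q} y *\<^sub>R f y) = (\<lambda>y. indicator {0..<q} y *\<^sub>R (indicator {0..q} y *\<^sub>R f y))"
    by (auto simp: indicator_def)
  moreover have "integrable lborel \<dots>" by (rule integrable_mult_indicator[OF _ i']) simp
  ultimately show i2: "integrable lborel (\<lambda>y. indicator {0..<q} y *\<^sub>R f y)" by simp
  have "(LINT y|lborel. indicator {0..<q} y *\<^sub>R f y) = (LINT y|lborel. indicator {0..q} y *\<^sub>R f y)"
  proof (rule integral_cong_AE)
    show "AE y in lborel. indicator {0..<q} y *\<^sub>R f y = indicator {0..q} y *\<^sub>R f y"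
      using AE_lborel_singleton[of q] by eventually_elim (auto simp: indicator_def)
  qed (use i' i2 in \<open>auto intro: borel_measurable_integrable\<close>)
  also have "\<dots> = integral {0..q} f"
    using set_borel_integral_eq_integral(2)[OF i] by (simp add: set_lebesgue_integral_def)
  finally show "(LINT y|lborel. indicator {0..<q} y *\<^sub>R f y) = integral {0..q} f" .
qed

text \<open>Moving by less than 1 changes the weight 1 / (1 + v^2) by a factor of at most 3, so its
  value at one point dominates on a neighbourhood.\<close>

lemma one_plus_square_le:
  fixes v w :: real
  assumes "\<bar>w - v\<bar> < 1"
  shows "1 + w\<^sup>2 \<le> 3 * (1 + v\<^sup>2)"
proof -
  define d where "d = w - v"
  have "d\<^sup>2 \<le> 1" using assms abs_square_le_1[of d] by (simp add: d_def)
  moreover have "w\<^sup>2 \<le> 2 * v\<^sup>2 + 2 * d\<^sup>2"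
    using zero_le_power2[of "v - d"] by (simp add: d_def power2_eq_square algebra_simps)
  ultimately show ?thesis using zero_le_power2[of v] by (simp only: distrib_left mult_1_right)
qed

text \<open>
  Multiplied by \<open>cis (- \<eta> x)\<close>, both sides are continuous \<open>q\<close>-periodic functions of \<open>x\<close> with the same
  Fourier coefficients.
\<close>

lemma theta_transformation:
  assumes q: "0 < q" and t: "0 < t"
  shows "(LINT l|count_space UNIV. cis (\<eta> * (q * of_int l)) * of_real (heat t (x - q * of_int l)))
     = of_real (1 / q) * (LINT m|count_space UNIV. of_real (exp (- (t * (\<eta> + 2 * pi / q * of_int m)\<^sup>2))) * cis (x * (\<eta> + 2 * pi / q * of_int m)))"
proof -
  let ?M = "count_space (UNIV :: int set)"
  define a where "a m = 2 * pi * of_int m / q" for m :: int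
  define e where "e m = exp (- (t * (\<eta> + 2 * pi / q * of_int m)\<^sup>2))" for m :: int
  have ea: "e m = exp (- (t * (\<eta> + a m)\<^sup>2))" for m by (simp add: e_def a_def)
  have e: "integrable ?M e" unfolding e_def using q t by (intro integrable_gauss_lattice) auto
  define g where "g y = cis (- \<eta> * y) * of_real (heat t y)" for y
  define G where "G y = (LINT l|?M. g (y - q * of_int l))" for y
  define R where "R y = of_real (1 / q) * (LINT m|?M. of_real (e m) * cis (a m * y))" for y
  have ng: "norm (g y) = heat t y" for y using t by (simp add: g_def norm_mult)
  obtain S where S: "\<And>y. integrable ?M (\<lambda>l::int. 1 / (1 + (y + - q * l)\<^sup>2))"
    using lattice_sum_bound[of "- q"] q by (metis neg_equal_0_iff_equal less_irrefl)
  have cg: "continuous_on UNIV g" unfolding g_def heat_def using t by (intro continuous_intros) auto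
  have contG: "continuous_on UNIV G"
  proof (rule continuous_at_imp_continuous_on, rule ballI)
    fix y0
    let ?K = "max 1 (4 * t) / sqrt (4 * pi * t)"
    show "isCont G y0" unfolding G_def
    proof (rule isCont_integral[where d = 1 and B = "\<lambda>l. 3 * ?K * (1 / (1 + (y0 + - q * of_int l)\<^sup>2))"])
      show "isCont (\<lambda>y. g (y - q * of_int l)) y0" for l
        using continuous_on_compose2[OF cg, of UNIV "\<lambda>y. y - q * of_int l"]
        by (simp add: continuous_on_eq_continuous_at continuous_on_diff)
      show "norm (g (y - q * of_int l)) \<le> 3 * ?K * (1 / (1 + (y0 + - q * of_int l)\<^sup>2))" if y: "y \<in> ball y0 1" for l :: int and y
      proof -
        let ?v = "y - q * of_int l" and ?w = "y0 + - q * of_int l"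
        have d: "\<bar>?w - ?v\<bar> < 1" using y by (simp add: dist_real_def)
        have le: "1 + ?w\<^sup>2 \<le> 3 * (1 + ?v\<^sup>2)" by (rule one_plus_square_le[OF d])
        have pos: "0 < 1 + ?w\<^sup>2" "0 < 1 + ?v\<^sup>2" by (simp_all add: add_pos_nonneg)
        have "1 / (1 + ?v\<^sup>2) \<le> 3 * (1 / (1 + ?w\<^sup>2))" using le pos by (simp add: divide_simps)
        then have "?K * (1 / (1 + ?v\<^sup>2)) \<le> ?K * (3 * (1 / (1 + ?w\<^sup>2)))" using t by (intro mult_left_mono) auto
        then show ?thesis using heat_decay[OF t, of ?v] unfolding ng by (simp only: mult_ac)
      qed
      show "integrable ?M (\<lambda>l. 3 * ?K * (1 / (1 + (y0 + - q * of_int l)\<^sup>2)))" by (intro integrable_mult_right S)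
    qed auto
  qed
  have contR: "continuous_on UNIV R"
  proof (rule continuous_at_imp_continuous_on, rule ballI)
    fix y0
    have "isCont (\<lambda>y. LINT m|?M. of_real (e m) * cis (a m * y)) y0"
    proof (rule isCont_integral[where d = 1 and B = e])
      show "isCont (\<lambda>y. of_real (e m) * cis (a m * y)) y0" for m
        using continuous_on_cis_linear[of UNIV "a m"]
        by (intro continuous_mult continuous_const) (simp add: continuous_on_eq_continuous_at)
      show "norm (of_real (e m) * cis (a m * y)) \<le> e m" for m y by (simp add: norm_mult e_def)
    qed (use e in auto)
    then show "isCont R y0" unfolding R_def by (intro continuous_intros)
  qed
  have per_cis: "cis (a m * (y + q * of_int l)) = cis (a m * y)" for m l :: int and y
  proof -
    have "a m * (y + q * of_int l) = a m * y + 2 * pi * of_int (m * l)" using q by (simp add: a_def field_simps)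
    then show ?thesis by (simp add: cis_mult[symmetric] cis_multiple_2pi)
  qed
  have gi: "integrable ?M (\<lambda>l. g (y - q * of_int l))" for y
  proof (rule Bochner_Integration.integrable_bound[OF integrable_heat_lattice[of q t y]])
    show "AE l in ?M. norm (g (y - q * of_int l)) \<le> norm (heat t (y - q * of_int l))"
      using t by (intro AE_I2) (simp add: ng)
  qed (use q t in auto)
  have perG: "G (y + q) = G y" for y
  proof -
    have "inj (\<lambda>l::int. l - 1)" by (simp add: inj_def)
    moreover have "range (\<lambda>l::int. l - 1) = UNIV" by (rule surjI[of _ "\<lambda>l. l + 1"]) simp
    ultimately have "(LINT l|?M. g (y - q * of_int (l - 1))) = G y"
      using integral_count_space_inj(2)[OF _ gi, of "\<lambda>l. l - 1" y] by (simp add: G_def)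
    then show ?thesis by (simp add: G_def algebra_simps)
  qed
  have perR: "R (y + q) = R y" for y using per_cis[of _ y 1] by (simp add: R_def)
  \<comment> \<open>Unfolding the sum over translates turns the coefficient over one period into the
    Fourier transform of the heat kernel on the whole line.\<close>
  have coefG: "integral {0..q} (\<lambda>y. G y * cis (a j * y)) = of_real (e (- j))" for j
  proof -
    define f where "f y = g y * cis (a j * y)" for y
    have feq: "f y = of_real (heat t y) * cis ((a j - \<eta>) * y)" for y
    proof -
      have "cis (- \<eta> * y) * cis (a j * y) = cis ((a j - \<eta>) * y)" unfolding cis_mult by (simp add: algebra_simps)
      then show ?thesis by (simp add: f_def g_def mult_ac)
    qed
    have fi: "integrable lborel f"
    proof (rule Bochner_Integration.integrable_bound[OF integrable_heat[OF t]])
      show "f \<in> borel_measurable lborel"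
        unfolding f_def using cg by (auto intro!: borel_measurable_continuous_onI continuous_intros)
      show "AE y in lborel. norm (f y) \<le> norm (heat t y)" using t by (simp add: feq norm_mult)
    qed
    have fs: "f (y - q * of_int l) = g (y - q * of_int l) * cis (a j * y)" for y l
      using per_cis[of j y "- l"] by (simp add: f_def)
    note per = integral_periodization[OF q fi]
    have "integral {0..q} (\<lambda>y. G y * cis (a j * y)) = (LINT y|lborel. indicator {0..<q} y *\<^sub>R (G y * cis (a j * y)))"
      by (rule integral_Ico_eq(1)[symmetric]) (intro continuous_intros continuous_on_subset[OF contG], auto)
    also have "\<dots> = (LINT y|lborel. LINT l|?M. indicator {0..<q} y *\<^sub>R f (y - q * of_int l))"
      unfolding fs G_def integral_scaleR_right by simp
    also have "\<dots> = (LINT l|?M. LINT y|lborel. indicator {0..<q} y *\<^sub>R f (y - q * of_int l))"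
      by (rule sum_integral_swap(3)[OF lborel.sigma_finite_measure_axioms per(1)])
    also have "\<dots> = (LINT y|lborel. f y)" by (rule per(2))
    also have "\<dots> = of_real (exp (- (t * (a j - \<eta>)\<^sup>2)))" unfolding feq by (rule heat_fourier[OF t])
    also have "(a j - \<eta>)\<^sup>2 = (\<eta> + a (- j))\<^sup>2" by (simp add: a_def power2_commute)
    finally show ?thesis by (simp only: ea)
  qed
  \<comment> \<open>Orthogonality over one period leaves the single term m = - j, and the factor 1 /
    q cancels the length of the period.\<close>
  have coefR: "integral {0..q} (\<lambda>y. R y * cis (a j * y)) = of_real (e (- j))" for j
  proof -
    define F where "F m y = indicator {0..<q} y *\<^sub>R (of_real (e m) * cis (a (m + j) * y))" for m :: int and y
    have cisadd: "cis (a m * y) * cis (a j * y) = cis (a (m + j) * y)" for m y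
    proof -
      have "a m * y + a j * y = a (m + j) * y" using q by (simp add: a_def field_simps)
      then show ?thesis by (simp add: cis_mult)
    qed
    have Fi: "integrable lborel (F m)" for m
      unfolding F_def by (rule integral_Ico_eq(2)) (intro continuous_intros)
    have FI: "(LINT y|lborel. F m y) = of_real (e m) * (if m + j = 0 then of_real q else 0)" for m
    proof -
      have "(LINT y|lborel. F m y) = integral {0..q} (\<lambda>y. of_real (e m) * cis (a (m + j) * y))"
        unfolding F_def by (rule integral_Ico_eq(1)) (intro continuous_intros)
      also have "\<dots> = of_real (e m) * integral {0..q} (\<lambda>y. cis (a (m + j) * y))" by simp
      finally show ?thesis unfolding a_def integral_cis_period[OF q] .
    qed
    have nF: "(LINT y|lborel. norm (F m y)) = e m * q" for m
    proof -
      have "norm (F m y) = indicator {0..<q} y * e m" for y by (simp add: F_def norm_mult e_def)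
      then show ?thesis using q by simp
    qed
    have prod: "integrable (?M \<Otimes>\<^sub>M lborel) (\<lambda>z. F (fst z) (snd z))"
      by (rule integrable_sum_prodI[OF lborel.sigma_finite_measure_axioms Fi]) (use e in \<open>simp add: nF\<close>)
    have "integral {0..q} (\<lambda>y. R y * cis (a j * y)) = (LINT y|lborel. indicator {0..<q} y *\<^sub>R (R y * cis (a j * y)))"
      by (rule integral_Ico_eq(1)[symmetric]) (intro continuous_intros continuous_on_subset[OF contR], auto)
    also have "\<dots> = (LINT y|lborel. of_real (1 / q) * (LINT m|?M. F m y))"
      unfolding F_def integral_scaleR_right R_def cisadd[symmetric] mult.assoc[symmetric]
      by simp
    also have "\<dots> = of_real (1 / q) * (LINT m|?M. LINT y|lborel. F m y)"
      using sum_integral_swap(3)[OF lborel.sigma_finite_measure_axioms prod] by simp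
    also have "(LINT m|?M. LINT y|lborel. F m y) = (LINT m|?M. indicator {- j} m *\<^sub>R (of_real (e (- j)) * of_real q))"
      unfolding FI by (intro Bochner_Integration.integral_cong refl) (auto simp: indicator_def add_eq_0_iff2)
    also have "\<dots> = of_real (e (- j)) * of_real q" by (subst integral_scaleR_left) auto
    finally show ?thesis using q by simp
  qed
  have "G x - R x = 0"
  proof (rule fourier_uniqueness[OF q, of "\<lambda>y. G y - R y"])
    show "continuous_on UNIV (\<lambda>y. G y - R y)" by (intro continuous_intros contG contR)
    show "G (y + q) - R (y + q) = G y - R y" for y by (simp add: perG perR)
    fix j :: int
    have "integral {0..q} (\<lambda>y. G y * cis (a j * y) - R y * cis (a j * y)) = 0"
    proof (subst Henstock_Kurzweil_Integration.integral_diff)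
      show "(\<lambda>y. G y * cis (a j * y)) integrable_on {0..q}" "(\<lambda>y. R y * cis (a j * y)) integrable_on {0..q}"
        by (intro integrable_continuous_real continuous_intros continuous_on_subset[OF contG] continuous_on_subset[OF contR]; simp)+
    qed (simp add: coefG coefR)
    then show "integral {0..q} (\<lambda>y. (G y - R y) * cis (2 * pi * of_int j / q * y)) = 0"
      by (simp add: left_diff_distrib a_def)
  qed
  then have GR: "cis (\<eta> * x) * G x = cis (\<eta> * x) * R x" by simp
  have "cis (\<eta> * x) * G x = (LINT l|?M. cis (\<eta> * x) * g (x - q * of_int l))"
    by (simp add: G_def)
  also have "(\<lambda>l::int. cis (\<eta> * x) * g (x - q * of_int l)) = (\<lambda>l. cis (\<eta> * (q * of_int l)) * of_real (heat t (x - q * of_int l)))"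
  proof
    fix l :: int
    have "cis (\<eta> * x) * cis (- \<eta> * (x - q * of_int l)) = cis (\<eta> * (q * of_int l))"
      unfolding cis_mult by (simp add: algebra_simps)
    then show "cis (\<eta> * x) * g (x - q * of_int l) = cis (\<eta> * (q * of_int l)) * of_real (heat t (x - q * of_int l))"
      by (simp add: g_def mult.assoc[symmetric])
  qed
  finally have L: "(LINT l|?M. cis (\<eta> * (q * of_int l)) * of_real (heat t (x - q * of_int l))) = cis (\<eta> * x) * G x" by simp
  have "cis (\<eta> * x) * R x = of_real (1 / q) * (LINT m|?M. cis (\<eta> * x) * (of_real (e m) * cis (a m * x)))"
    unfolding R_def integral_mult_right_zero by (rule mult.left_commute)
  also have "(\<lambda>m. cis (\<eta> * x) * (of_real (e m) * cis (a m * x))) = (\<lambda>m. of_real (e m) * cis (x * (\<eta> + 2 * pi / q * of_int m)))"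
  proof
    fix m
    have "cis (\<eta> * x) * cis (a m * x) = cis (x * (\<eta> + 2 * pi / q * of_int m))"
      unfolding cis_mult by (simp add: a_def algebra_simps)
    then show "cis (\<eta> * x) * (of_real (e m) * cis (a m * x)) = of_real (e m) * cis (x * (\<eta> + 2 * pi / q * of_int m))"
      by (metis mult.left_commute)
  qed
  finally show ?thesis unfolding L GR e_def .
qed

section \<open>Products over coordinates and the theta identity on the lattice\<close>

lemma integral_count_space_prod_fun:
  fixes f :: "'n::finite \<Rightarrow> 'k::countable \<Rightarrow> 'c :: {real_normed_field, banach, second_countable_topology}"
  assumes f: "\<And>j. integrable (count_space UNIV) (f j)"
  shows "integrable (count_space UNIV) (\<lambda>g. \<Prod>j\<in>UNIV. f j (g j))"
    and "(LINT g|count_space UNIV. (\<Prod>j\<in>UNIV. f j (g j))) = (\<Prod>j\<in>UNIV. (LINT k|count_space UNIV. f j k))"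
proof -
  have s: "Infinite_Set_Sum.abs_summable_on (f j) UNIV" for j
    using f by (simp add: Infinite_Set_Sum.abs_summable_on_def)
  show "integrable (count_space UNIV) (\<lambda>g. \<Prod>j\<in>UNIV. f j (g j))"
    using abs_summable_on_prod_PiE[of UNIV "\<lambda>_. UNIV" f] s by (simp add: PiE_UNIV Infinite_Set_Sum.abs_summable_on_def)
  show "(LINT g|count_space UNIV. (\<Prod>j\<in>UNIV. f j (g j))) = (\<Prod>j\<in>UNIV. (LINT k|count_space UNIV. f j k))"
    using infsetsum_prod_PiE[of UNIV "\<lambda>_. UNIV" f] s by (simp add: PiE_UNIV infsetsum_def)
qed

lemma integral_count_space_prod_vec:
  fixes f :: "'n::finite \<Rightarrow> 'k::countable \<Rightarrow> 'c :: {real_normed_field, banach, second_countable_topology}"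
  assumes f: "\<And>j. integrable (count_space UNIV) (f j)"
  shows "integrable (count_space UNIV) (\<lambda>v. \<Prod>j\<in>UNIV. f j (v $ j))"
    and "(LINT v|count_space UNIV. (\<Prod>j\<in>UNIV. f j (v $ j))) = (\<Prod>j\<in>UNIV. (LINT k|count_space UNIV. f j k))"
proof -
  let ?h = "vec_nth :: 'k^'n \<Rightarrow> 'n \<Rightarrow> 'k"
  have inj: "inj ?h" by (rule injI) (simp add: vec_eq_iff fun_eq_iff)
  have "range ?h = UNIV" by (rule surjI[of _ vec_lambda]) (simp add: fun_eq_iff)
  then show "(LINT v|count_space UNIV. (\<Prod>j\<in>UNIV. f j (v $ j))) = (\<Prod>j\<in>UNIV. (LINT k|count_space UNIV. f j k))"
    using integral_count_space_inj(2)[OF inj integral_count_space_prod_fun(1)[OF f]] integral_count_space_prod_fun(2)[OF f]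
    by simp
  show "integrable (count_space UNIV) (\<lambda>v. \<Prod>j\<in>UNIV. f j (v $ j))"
    by (rule integral_count_space_inj(1)[OF inj integral_count_space_prod_fun(1)[OF f]])
qed

lemma cis_sum: "cis (\<Sum>j\<in>A. f j) = (\<Prod>j\<in>A. cis (f j))"
  by (induction A rule: infinite_finite_induct) (auto simp: cis_mult[symmetric])

lemma pos_diagonal_matrix_vector_mult:
  assumes "q \<in> pos_diagonal"
  shows "(q *v v) $ j = q $ j $ j * v $ j"
proof -
  have "(q *v v) $ j = (\<Sum>i\<in>UNIV. q $ j $ i * v $ i)" by (simp add: matrix_vector_mult_def)
  also have "\<dots> = (\<Sum>i\<in>UNIV. if i = j then q $ j $ j * v $ j else 0)"
    using assms by (intro sum.cong) (auto simp: pos_diagonal_def)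
  finally show ?thesis by simp
qed

lemma frequency_component:
  assumes q: "q \<in> pos_diagonal"
  shows "frequency q \<eta> z $ j = \<eta> $ j + 2 * pi / q $ j $ j * of_int (z $ j)"
proof -
  let ?B = "(\<chi> i j. if i = j then 1 / q $ i $ i else 0) :: real^'a^'a"
  have pos: "q $ i $ i > 0" "i \<noteq> j \<Longrightarrow> q $ i $ j = 0" for i j using q by (auto simp: pos_diagonal_def)
  have "(\<Sum>k\<in>UNIV. q $ i $ k * ?B $ k $ j) = (\<Sum>k\<in>UNIV. if k = i then (if i = j then 1 else 0) else 0)" for i j
    using pos by (intro sum.cong) (auto simp: less_imp_neq[OF pos(1), symmetric])
  then have 1: "q ** ?B = mat 1" by (simp add: matrix_matrix_mult_def mat_def vec_eq_iff)
  have "(\<Sum>k\<in>UNIV. ?B $ i $ k * q $ k $ j) = (\<Sum>k\<in>UNIV. if k = i then (if i = j then 1 else 0) else 0)" for i j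
    using pos by (intro sum.cong) (auto simp: less_imp_neq[OF pos(1), symmetric])
  then have 2: "?B ** q = mat 1" by (simp add: matrix_matrix_mult_def mat_def vec_eq_iff)
  have "q ** matrix_inv q = mat 1"
    unfolding matrix_inv_def by (rule someI2[of _ ?B]) (use 1 2 in auto)
  then have "q *v (matrix_inv q *v of_int_vec z) = of_int_vec z"
    by (simp add: matrix_vector_mul_assoc)
  then have "q $ j $ j * (matrix_inv q *v of_int_vec z) $ j = of_int (z $ j)"
    using pos_diagonal_matrix_vector_mult[OF q, of "matrix_inv q *v of_int_vec z" j] by (simp add: of_int_vec_def)
  then have "(matrix_inv q *v of_int_vec z) $ j = of_int (z $ j) / q $ j $ j"
    using pos(1)[of j] by (simp add: field_simps)
  then show ?thesis by (simp add: frequency_def)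
qed

definition cell_volume :: "real^'n::finite^'n \<Rightarrow> real" where
  "cell_volume q = (\<Prod>j\<in>UNIV. q $ j $ j)"

lemma measure_cell:
  assumes q: "q \<in> pos_diagonal"
  shows "measure lborel (cell q) = cell_volume q"
proof -
  let ?b = "(\<chi> j. q $ j $ j) :: real^'a"
  have pos: "q $ i $ i > 0" for i using q by (auto simp: pos_diagonal_def)
  have "cell q = box 0 ?b" by (auto simp: cell_def mem_box_cart)
  then have "measure lborel (cell q) = measure lborel (box 0 ?b)" by simp
  also have "\<dots> = measure lborel (cbox 0 ?b)"
    by (simp add: measure_def emeasure_lborel_box_eq emeasure_lborel_cbox_eq)
  also have "\<dots> = (\<Prod>j\<in>UNIV. ?b $ j - (0::real^'a) $ j)"
  proof (rule content_cbox_cart)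
    have "(0::real^'a) \<in> cbox 0 ?b" using pos by (auto simp: mem_box_cart less_imp_le)
    then show "cbox 0 ?b \<noteq> {}" by blast
  qed
  finally show ?thesis by (simp add: cell_volume_def)
qed

lemma cell_volume_pos: "q \<in> pos_diagonal \<Longrightarrow> 0 < cell_volume q"
  unfolding cell_volume_def by (rule prod_pos) (auto simp: pos_diagonal_def)

definition heat_kernel :: "real \<Rightarrow> real^'n::finite \<Rightarrow> real" where
  "heat_kernel t x = (\<Prod>j\<in>UNIV. heat t (x $ j))"

lemma heat_kernel_nonneg: "0 \<le> t \<Longrightarrow> 0 \<le> heat_kernel t x"
  by (simp add: heat_kernel_def prod_nonneg)

lemma heat_kernel_eq:
  fixes x :: "real^'n::finite"
  shows "heat_kernel t x = (1 / sqrt (4 * pi * t)) ^ CARD('n) * exp (- ((norm x)\<^sup>2 / (4 * t)))"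
proof -
  have "heat_kernel t x = (\<Prod>j\<in>(UNIV::'n set). 1 / sqrt (4 * pi * t)) * (\<Prod>j\<in>UNIV. exp (- ((x $ j)\<^sup>2 / (4 * t))))"
    by (simp add: heat_kernel_def heat_def prod_dividef power_divide)
  also have "(\<Prod>j\<in>UNIV. exp (- ((x $ j)\<^sup>2 / (4 * t)))) = exp (\<Sum>j\<in>UNIV. - ((x $ j)\<^sup>2 / (4 * t)))"
    by (rule exp_sum[symmetric]) simp
  also have "(\<Sum>j\<in>UNIV. - ((x $ j)\<^sup>2 / (4 * t))) = - ((norm x)\<^sup>2 / (4 * t))"
    by (simp add: norm_vec_def L2_set_def sum_nonneg sum_negf sum_divide_distrib)
  finally show ?thesis by simp
qed

abbreviation lattice_point :: "real^'n::finite^'n \<Rightarrow> int^'n \<Rightarrow> real^'n" where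
  "lattice_point q l \<equiv> q *v of_int_vec l"

context
  fixes q :: "real^'n::finite^'n"
  assumes q: "q \<in> pos_diagonal"
begin

lemma q_pos: "q $ i $ i > 0" and q_nz: "q $ i $ i \<noteq> 0"
  using q by (auto simp: pos_diagonal_def less_imp_neq[symmetric])

lemma lattice_point_component: "lattice_point q l $ j = q $ j $ j * of_int (l $ j)"
  by (simp add: pos_diagonal_matrix_vector_mult[OF q] of_int_vec_def)

lemma integrable_gauss_lattice_vec:
  assumes c: "0 < c"
  shows "integrable (count_space UNIV) (\<lambda>l. exp (- (c * (norm (x - lattice_point q l))\<^sup>2)))"
proof -
  have "exp (- (c * (norm (x - lattice_point q l))\<^sup>2)) = (\<Prod>j\<in>UNIV. exp (- (c * (x $ j + - (q $ j $ j) * of_int (l $ j))\<^sup>2)))" for l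
    by (subst exp_sum[symmetric])
      (simp_all add: norm_vec_def L2_set_def sum_nonneg sum_negf sum_distrib_left lattice_point_component)
  moreover have "integrable (count_space UNIV) (\<lambda>l. exp (- (c * (x $ j + - (q $ j $ j) * of_int l)\<^sup>2)))" for j
    by (rule integrable_gauss_lattice) (use q_nz c in auto)
  ultimately show ?thesis
    using integral_count_space_prod_vec(1)[of "\<lambda>j l. exp (- (c * (x $ j + - (q $ j $ j) * of_int l)\<^sup>2))"] by simp
qed

lemma exp_norm_frequency:
  "exp (- (t * (norm (frequency q \<eta> z))\<^sup>2)) = (\<Prod>j\<in>UNIV. exp (- (t * (\<eta> $ j + 2 * pi / q $ j $ j * of_int (z $ j))\<^sup>2)))"
  by (subst exp_sum[symmetric])
    (simp_all add: norm_vec_def L2_set_def sum_nonneg sum_negf sum_distrib_left frequency_component[OF q])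

lemma integrable_gauss_frequency:
  assumes t: "0 < t"
  shows "integrable (count_space UNIV) (\<lambda>z. exp (- (t * (norm (frequency q \<eta> z))\<^sup>2)))"
proof -
  have "integrable (count_space UNIV) (\<lambda>m. exp (- (t * (\<eta> $ j + 2 * pi / q $ j $ j * of_int m)\<^sup>2)))" for j
    by (rule integrable_gauss_lattice) (use q_nz t in auto)
  then show ?thesis unfolding exp_norm_frequency by (rule integral_count_space_prod_vec(1))
qed

text \<open>Since q is diagonal, both sides factor over the coordinates, and the identity is a
  product of one-dimensional ones.\<close>

theorem theta_transformation_vec:
  assumes t: "0 < t"
  shows "(LINT l|count_space UNIV. cis (\<eta> \<bullet> lattice_point q l) * of_real (heat_kernel t (x - lattice_point q l)))
     = of_real (1 / cell_volume q) * (LINT z|count_space UNIV.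
         of_real (exp (- (t * (norm (frequency q \<eta> z))\<^sup>2))) * cis (x \<bullet> frequency q \<eta> z))"
proof -
  let ?f = "\<lambda>j l. cis (\<eta> $ j * (q $ j $ j * of_int l)) * of_real (heat t (x $ j - q $ j $ j * of_int l))"
  let ?g = "\<lambda>j m. of_real (exp (- (t * (\<eta> $ j + 2 * pi / q $ j $ j * of_int m)\<^sup>2))) * cis (x $ j * (\<eta> $ j + 2 * pi / q $ j $ j * of_int m))"
  have fi: "integrable (count_space UNIV) (\<lambda>l. ?f j l)" for j
  proof (rule Bochner_Integration.integrable_bound[OF integrable_heat_lattice[OF q_nz[of j] t, of "x $ j"]])
    show "AE l in count_space UNIV. norm (?f j l) \<le> norm (heat t (x $ j - q $ j $ j * of_int l))"
      by (intro AE_I2) (simp add: norm_mult)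
  qed auto
  have gi: "integrable (count_space UNIV) (\<lambda>m. ?g j m)" for j
  proof (rule Bochner_Integration.integrable_bound)
    show "integrable (count_space UNIV) (\<lambda>m. exp (- (t * (\<eta> $ j + 2 * pi / q $ j $ j * of_int m)\<^sup>2)))"
      by (rule integrable_gauss_lattice) (use q_nz t in auto)
    show "AE m in count_space UNIV. norm (?g j m) \<le> norm (exp (- (t * (\<eta> $ j + 2 * pi / q $ j $ j * of_int m)\<^sup>2)))"
      by (intro AE_I2) (simp add: norm_mult)
  qed auto
  have L: "cis (\<eta> \<bullet> lattice_point q l) * of_real (heat_kernel t (x - lattice_point q l)) = (\<Prod>j\<in>UNIV. ?f j (l $ j))" for l
    by (simp add: inner_vec_def cis_sum heat_kernel_def lattice_point_component prod.distrib)
  have R: "of_real (exp (- (t * (norm (frequency q \<eta> z))\<^sup>2))) * cis (x \<bullet> frequency q \<eta> z) = (\<Prod>j\<in>UNIV. ?g j (z $ j))" for z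
    unfolding exp_norm_frequency
    by (simp only: inner_vec_def cis_sum frequency_component[OF q] prod.distrib of_real_prod inner_real_def)
  have "(LINT l|count_space UNIV. cis (\<eta> \<bullet> lattice_point q l) * of_real (heat_kernel t (x - lattice_point q l)))
      = (\<Prod>j\<in>UNIV. (LINT l|count_space UNIV. ?f j l))"
    unfolding L by (rule integral_count_space_prod_vec(2)[OF fi])
  also have "\<dots> = (\<Prod>j\<in>UNIV. of_real (1 / q $ j $ j) * (LINT m|count_space UNIV. ?g j m))"
    by (intro prod.cong refl theta_transformation q_pos t)
  also have "\<dots> = of_real (1 / cell_volume q) * (\<Prod>j\<in>UNIV. (LINT m|count_space UNIV. ?g j m))"
    by (simp add: prod.distrib cell_volume_def prod_dividef)
  also have "(\<Prod>j\<in>UNIV. (LINT m|count_space UNIV. ?g j m))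
      = (LINT z|count_space UNIV. of_real (exp (- (t * (norm (frequency q \<eta> z))\<^sup>2))) * cis (x \<bullet> frequency q \<eta> z))"
    unfolding R by (rule integral_count_space_prod_vec(2)[OF gi, symmetric])
  finally show ?thesis .
qed

end

section \<open>Gaussian integrals as power series\<close>

lemma exp_series_count_space:
  fixes x :: "'a :: {real_normed_field, banach, second_countable_topology}"
  shows "integrable (count_space UNIV) (\<lambda>n::nat. x ^ n / fact n)"
    and "(LINT n|count_space UNIV. x ^ n / fact n) = exp x"
proof -
  have s: "summable (\<lambda>n. norm (x ^ n / fact n))"
    using summable_norm_exp[of x] by (simp add: divide_inverse scaleR_conv_of_real mult.commute norm_mult norm_inverse)
  then show i: "integrable (count_space UNIV) (\<lambda>n::nat. x ^ n / fact n)"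
    by (simp add: integrable_count_space_nat_iff)
  have "(LINT n|count_space UNIV. x ^ n / fact n) = (\<Sum>n. x ^ n / fact n)"
    using integral_count_space_nat[OF i] .
  also have "\<dots> = exp x" by (simp add: exp_def divide_inverse scaleR_conv_of_real mult.commute)
  finally show "(LINT n|count_space UNIV. x ^ n / fact n) = exp x" .
qed

lemma exp_quadratic_series:
  fixes b c u :: "'a :: {real_normed_field, banach, second_countable_topology}"
  defines "f \<equiv> \<lambda>\<kappa>. (b ^ fst \<kappa> / fact (fst \<kappa>)) * (c ^ snd \<kappa> / fact (snd \<kappa>)) * u ^ (fst \<kappa> + 2 * snd \<kappa>)"
  shows "integrable (count_space UNIV) f"
    and "(LINT \<kappa>|count_space UNIV. f \<kappa>) = exp (b * u + c * u\<^sup>2)"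
proof -
  have f: "f = (\<lambda>(i, k). ((b * u) ^ i / fact i) * ((c * u\<^sup>2) ^ k / fact k))"
    unfolding f_def by (rule ext) (simp add: case_prod_beta power_mult_distrib power_add power_mult)
  have s: "Infinite_Set_Sum.abs_summable_on (\<lambda>n::nat. x ^ n / fact n) UNIV" for x :: 'a
    using exp_series_count_space(1)[of x] by (simp add: Infinite_Set_Sum.abs_summable_on_def)
  show "integrable (count_space UNIV) f"
    using abs_summable_on_product[OF countableI_type countableI_type s[of "b * u"] s[of "c * u\<^sup>2"]] unfolding f
    by (simp add: Infinite_Set_Sum.abs_summable_on_def)
  have "(LINT \<kappa>|count_space UNIV. f \<kappa>) = infsetsum f (UNIV \<times> UNIV)" by (simp add: infsetsum_def)
  also have "\<dots> = infsetsum (\<lambda>n. (b * u) ^ n / fact n) UNIV * infsetsum (\<lambda>n. (c * u\<^sup>2) ^ n / fact n) UNIV"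
    unfolding f by (rule infsetsum_product[OF countableI_type countableI_type s s])
  also have "\<dots> = exp (b * u) * exp (c * u\<^sup>2)" by (simp add: infsetsum_def exp_series_count_space(2))
  finally show "(LINT \<kappa>|count_space UNIV. f \<kappa>) = exp (b * u + c * u\<^sup>2)" by (simp add: exp_add)
qed

text \<open>The pair \<open>\<kappa> j\<close> records the orders of the terms taken from the series of \<open>exp (B u)\<close> and \<open>exp (C u\<^sup>2)\<close>.\<close>

definition quadratic_degree :: "('n \<Rightarrow> nat \<times> nat) \<Rightarrow> 'n \<Rightarrow> nat" where
  "quadratic_degree \<kappa> j = fst (\<kappa> j) + 2 * snd (\<kappa> j)"

lemma finite_quadratic_degree: "finite {\<kappa> :: 'n::finite \<Rightarrow> nat \<times> nat. quadratic_degree \<kappa> = \<beta>}"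
proof (rule finite_subset)
  show "{\<kappa>. quadratic_degree \<kappa> = \<beta>} \<subseteq> (\<Pi>\<^sub>E j\<in>UNIV. {..\<beta> j} \<times> {..\<beta> j})"
    by (auto simp: quadratic_degree_def PiE_def extensional_def mem_Times_iff)
  show "finite (\<Pi>\<^sub>E j\<in>(UNIV::'n set). {..\<beta> j} \<times> {..\<beta> j})" by (intro finite_PiE) auto
qed

text \<open>The exponentials are expanded, the sum is exchanged with the integral, and the terms are
  grouped by their exponent in u, finitely many for each. Absolute convergence is needed at the
  corner where all coordinates of u equal r, which is what \<open>int\<close> provides. The measure
  \<open>N\<close> is time times lattice in one application and counts frequencies in the
  other.\<close>

lemma gaussian_integral_power_series:
  fixes A :: "'w \<Rightarrow> complex" and B :: "'w \<Rightarrow> 'n::finite \<Rightarrow> complex" and C :: "'w \<Rightarrow> complex"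
  assumes N: "sigma_finite_measure N" and r: "0 < r"
    and meas: "A \<in> borel_measurable N" "\<And>j. (\<lambda>w. B w j) \<in> borel_measurable N" "C \<in> borel_measurable N"
    and int: "integrable N (\<lambda>w. norm (A w) * (\<Prod>j\<in>UNIV. exp (norm (B w j) * r + norm (C w) * r\<^sup>2)))"
  obtains c where "\<And>u :: real^'n. (\<And>j. \<bar>u $ j\<bar> \<le> r) \<Longrightarrow>
      ((\<lambda>\<beta>. c \<beta> * of_real (monomial_at \<beta> u)) has_sum
         (LINT w|N. A w * (\<Prod>j\<in>UNIV. exp (B w j * of_real (u $ j) + C w * (of_real (u $ j))\<^sup>2)))) UNIV"
proof -
  let ?K = "count_space (UNIV :: ('n \<Rightarrow> nat \<times> nat) set)"
  define T where "T \<kappa> w = A w * (\<Prod>j\<in>UNIV. (B w j ^ fst (\<kappa> j) / fact (fst (\<kappa> j))) * (C w ^ snd (\<kappa> j) / fact (snd (\<kappa> j))))" for \<kappa> w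
  define d where "d \<kappa> = (LINT w|N. T \<kappa> w)" for \<kappa>
  define c where "c \<beta> = (\<Sum>\<kappa> | quadratic_degree \<kappa> = \<beta>. d \<kappa>)" for \<beta>
  have Tm: "T \<kappa> \<in> borel_measurable N" for \<kappa>
    unfolding T_def
    by (intro borel_measurable_times borel_measurable_prod borel_measurable_divide borel_measurable_power
        borel_measurable_const meas)
  show ?thesis
  proof (rule that[of c])
    fix u :: "real^'n" assume u: "\<And>j. \<bar>u $ j\<bar> \<le> r"
    define f where "f \<kappa> w = T \<kappa> w * of_real (monomial_at (quadratic_degree \<kappa>) u)" for \<kappa> w
    let ?t = "\<lambda>w j \<kappa>. (B w j ^ fst \<kappa> / fact (fst \<kappa>)) * (C w ^ snd \<kappa> / fact (snd \<kappa>)) * of_real (u $ j) ^ (fst \<kappa> + 2 * snd \<kappa>)"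
    let ?s = "\<lambda>w j \<kappa>. (norm (B w j) ^ fst \<kappa> / fact (fst \<kappa>)) * (norm (C w) ^ snd \<kappa> / fact (snd \<kappa>)) * \<bar>u $ j\<bar> ^ (fst \<kappa> + 2 * snd \<kappa>)"
    have fprod: "f \<kappa> w = A w * (\<Prod>j\<in>UNIV. ?t w j (\<kappa> j))" for \<kappa> w
      unfolding f_def T_def monomial_at_def quadratic_degree_def
      by (simp only: of_real_prod of_real_power prod.distrib mult.assoc)
    have fnorm: "norm (f \<kappa> w) = norm (A w) * (\<Prod>j\<in>UNIV. ?s w j (\<kappa> j))" for \<kappa> w
      by (simp add: fprod norm_mult norm_divide norm_power prod_norm[symmetric])
    have fint: "integrable ?K (\<lambda>\<kappa>. f \<kappa> w)" for w
      unfolding fprod by (intro integrable_mult_right integral_count_space_prod_fun(1) exp_quadratic_series(1))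
    have fsum: "(LINT \<kappa>|?K. f \<kappa> w) = A w * (\<Prod>j\<in>UNIV. exp (B w j * of_real (u $ j) + C w * (of_real (u $ j))\<^sup>2))" for w
      unfolding fprod integral_mult_right_zero
      by (subst integral_count_space_prod_fun(2)) (simp_all only: exp_quadratic_series)
    have fnsum: "(LINT \<kappa>|?K. norm (f \<kappa> w)) = norm (A w) * (\<Prod>j\<in>UNIV. exp (norm (B w j) * \<bar>u $ j\<bar> + norm (C w) * \<bar>u $ j\<bar>\<^sup>2))" for w
      unfolding fnorm integral_mult_right_zero
      by (subst integral_count_space_prod_fun(2)) (simp_all only: exp_quadratic_series)
    have fm: "f \<kappa> \<in> borel_measurable N" for \<kappa>
      unfolding f_def by (intro borel_measurable_times Tm borel_measurable_const)
    have prod: "integrable (?K \<Otimes>\<^sub>M N) (\<lambda>z. f (fst z) (snd z))"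
    proof (rule integrable_prod_sumI[OF N fm])
      show "integrable N (\<lambda>w. LINT \<kappa>|?K. norm (f \<kappa> w))"
        unfolding fnsum
      proof (rule Bochner_Integration.integrable_bound[OF int])
        show "(\<lambda>w. norm (A w) * (\<Prod>j\<in>UNIV. exp (norm (B w j) * \<bar>u $ j\<bar> + norm (C w) * \<bar>u $ j\<bar>\<^sup>2))) \<in> borel_measurable N"
          by (intro borel_measurable_times borel_measurable_prod borel_measurable_add borel_measurable_const
              measurable_compose[OF _ borel_measurable_exp] measurable_compose[OF _ borel_measurable_norm] meas)
        show "AE w in N. norm (norm (A w) * (\<Prod>j\<in>UNIV. exp (norm (B w j) * \<bar>u $ j\<bar> + norm (C w) * \<bar>u $ j\<bar>\<^sup>2)))
            \<le> norm (norm (A w) * (\<Prod>j\<in>UNIV. exp (norm (B w j) * r + norm (C w) * r\<^sup>2)))"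
        proof (rule AE_I2)
          fix w
          have "(\<Prod>j\<in>UNIV. exp (norm (B w j) * \<bar>u $ j\<bar> + norm (C w) * \<bar>u $ j\<bar>\<^sup>2)) \<le> (\<Prod>j\<in>UNIV. exp (norm (B w j) * r + norm (C w) * r\<^sup>2))"
            by (intro prod_mono conjI exp_ge_zero iffD2[OF exp_le_cancel_iff] add_mono mult_left_mono power_mono u
                norm_ge_zero abs_ge_zero)
          then have "norm (A w) * (\<Prod>j\<in>UNIV. exp (norm (B w j) * \<bar>u $ j\<bar> + norm (C w) * \<bar>u $ j\<bar>\<^sup>2))
            \<le> norm (A w) * (\<Prod>j\<in>UNIV. exp (norm (B w j) * r + norm (C w) * r\<^sup>2))" by (rule mult_left_mono) simp
          moreover have "0 \<le> norm (A w) * (\<Prod>j\<in>UNIV. exp (norm (B w j) * \<bar>u $ j\<bar> + norm (C w) * \<bar>u $ j\<bar>\<^sup>2))"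
            by (simp add: prod_nonneg)
          ultimately show "norm (norm (A w) * (\<Prod>j\<in>UNIV. exp (norm (B w j) * \<bar>u $ j\<bar> + norm (C w) * \<bar>u $ j\<bar>\<^sup>2)))
            \<le> norm (norm (A w) * (\<Prod>j\<in>UNIV. exp (norm (B w j) * r + norm (C w) * r\<^sup>2)))"
            unfolding real_norm_def by linarith
        qed
      qed
    qed (use fint in auto)
    note swap = sum_integral_swap[OF N prod]
    let ?F = "LINT w|N. A w * (\<Prod>j\<in>UNIV. exp (B w j * of_real (u $ j) + C w * (of_real (u $ j))\<^sup>2))"
    have fd: "(LINT w|N. f \<kappa> w) = d \<kappa> * of_real (monomial_at (quadratic_degree \<kappa>) u)" for \<kappa>
      by (simp add: f_def d_def)
    have "((\<lambda>\<kappa>. LINT w|N. f \<kappa> w) has_sum (LINT \<kappa>|?K. LINT w|N. f \<kappa> w)) UNIV"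
      by (rule integral_count_space_has_sum[OF swap(2)])
    also have "(LINT \<kappa>|?K. LINT w|N. f \<kappa> w) = ?F"
      unfolding swap(3)[symmetric] fsum ..
    finally have "((\<lambda>\<kappa>. d \<kappa> * of_real (monomial_at (quadratic_degree \<kappa>) u)) has_sum ?F) UNIV"
      unfolding fd .
    \<comment> \<open>The index set is fibred over the exponents \<beta>, so that
      \<open>has_sum_SigmaD\<close> can sum each finite fibre first.\<close>
    moreover have "bij_betw (\<lambda>\<kappa>. (quadratic_degree \<kappa>, \<kappa>)) UNIV (Sigma UNIV (\<lambda>\<beta>. {\<kappa> :: 'n \<Rightarrow> nat \<times> nat. quadratic_degree \<kappa> = \<beta>}))"
      by (rule bij_betwI[of _ _ _ snd]) auto
    ultimately have "((\<lambda>(\<beta>, \<kappa>). d \<kappa> * of_real (monomial_at \<beta> u)) has_sum ?F) (Sigma UNIV (\<lambda>\<beta>. {\<kappa>. quadratic_degree \<kappa> = \<beta>}))"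
      using has_sum_reindex_bij_betw[of "\<lambda>\<kappa>. (quadratic_degree \<kappa>, \<kappa>)" UNIV
          "Sigma UNIV (\<lambda>\<beta>. {\<kappa> :: 'n \<Rightarrow> nat \<times> nat. quadratic_degree \<kappa> = \<beta>})" "\<lambda>(\<beta>, \<kappa>). d \<kappa> * of_real (monomial_at \<beta> u)" ?F]
      by simp
    then show "((\<lambda>\<beta>. c \<beta> * of_real (monomial_at \<beta> u)) has_sum ?F) UNIV"
    proof (rule has_sum_SigmaD)
      fix \<beta>
      show "((\<lambda>\<kappa>. case (\<beta>, \<kappa>) of (\<beta>, \<kappa>) \<Rightarrow> d \<kappa> * of_real (monomial_at \<beta> u)) has_sum c \<beta> * of_real (monomial_at \<beta> u))
          {\<kappa>. quadratic_degree \<kappa> = \<beta>}"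
        using has_sum_finite[OF finite_quadratic_degree, of "\<lambda>\<kappa>. d \<kappa> * of_real (monomial_at \<beta> u)" \<beta>]
        by (simp add: c_def sum_distrib_right)
    qed
  qed
qed

lemma real_analytic_onI:
  fixes F :: "real^'n::finite \<Rightarrow> complex"
  assumes "\<And>a. a \<in> U \<Longrightarrow> \<exists>r>0. \<exists>c. \<forall>u. (\<forall>j. \<bar>u $ j\<bar> \<le> r) \<longrightarrow> ((\<lambda>\<beta>. c \<beta> * of_real (monomial_at \<beta> u)) has_sum F (a + u)) UNIV"
  shows "real_analytic_on F U"
  unfolding real_analytic_on_def
proof
  fix a assume "a \<in> U"
  from assms[OF this] obtain r c where r: "0 < r" and c: "\<And>u. (\<And>j. \<bar>u $ j\<bar> \<le> r) \<Longrightarrow> ((\<lambda>\<beta>. c \<beta> * of_real (monomial_at \<beta> u)) has_sum F (a + u)) UNIV"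
    by blast
  show "\<exists>r>0. \<exists>c. \<forall>x\<in>ball a r. ((\<lambda>\<beta>. c \<beta> * of_real (\<Prod>i\<in>UNIV. (x $ i - a $ i) ^ \<beta> i)) has_sum F x) UNIV"
  proof (intro exI[of _ r] conjI exI[of _ c] ballI r)
    fix x assume "x \<in> ball a r"
    then have n: "norm (x - a) < r" by (simp add: dist_norm norm_minus_commute)
    have "\<bar>(x - a) $ j\<bar> \<le> r" for j using component_le_norm_cart[of "x - a" j] n by linarith
    from c[OF this] show "((\<lambda>\<beta>. c \<beta> * of_real (\<Prod>i\<in>UNIV. (x $ i - a $ i) ^ \<beta> i)) has_sum F x) UNIV"
      by (simp add: monomial_at_def)
  qed
qed

lemma real_analytic_on_diff:
  assumes "real_analytic_on f U" "real_analytic_on g U"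
  shows "real_analytic_on (\<lambda>x. f x - g x) U"
  unfolding real_analytic_on_def
proof
  fix a assume a: "a \<in> U"
  obtain r c where 1: "0 < r" "\<And>x. x \<in> ball a r \<Longrightarrow> ((\<lambda>\<beta>. c \<beta> * of_real (\<Prod>i\<in>UNIV. (x $ i - a $ i) ^ \<beta> i)) has_sum f x) UNIV"
    using bspec[OF assms(1)[unfolded real_analytic_on_def] a] by blast
  obtain r' c' where 2: "0 < r'" "\<And>x. x \<in> ball a r' \<Longrightarrow> ((\<lambda>\<beta>. c' \<beta> * of_real (\<Prod>i\<in>UNIV. (x $ i - a $ i) ^ \<beta> i)) has_sum g x) UNIV"
    using bspec[OF assms(2)[unfolded real_analytic_on_def] a] by blast
  show "\<exists>r>0. \<exists>c. \<forall>x\<in>ball a r. ((\<lambda>\<beta>. c \<beta> * of_real (\<Prod>i\<in>UNIV. (x $ i - a $ i) ^ \<beta> i)) has_sum f x - g x) UNIV"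
  proof (intro exI[of _ "min r r'"] conjI exI[of _ "\<lambda>\<beta>. c \<beta> - c' \<beta>"] ballI)
    fix x assume "x \<in> ball a (min r r')"
    then have x: "x \<in> ball a r" "x \<in> ball a r'" by auto
    have "((\<lambda>\<beta>. - (c' \<beta> * of_real (\<Prod>i\<in>UNIV. (x $ i - a $ i) ^ \<beta> i))) has_sum - g x) UNIV"
      unfolding has_sum_uminus minus_minus by (rule 2(2)[OF x(2)])
    from has_sum_add[OF 1(2)[OF x(1)] this]
    have "((\<lambda>\<beta>. c \<beta> * of_real (\<Prod>i\<in>UNIV. (x $ i - a $ i) ^ \<beta> i) + - (c' \<beta> * of_real (\<Prod>i\<in>UNIV. (x $ i - a $ i) ^ \<beta> i)))
        has_sum f x + - g x) UNIV" .
    then show "((\<lambda>\<beta>. (c \<beta> - c' \<beta>) * of_real (\<Prod>i\<in>UNIV. (x $ i - a $ i) ^ \<beta> i)) has_sum f x - g x) UNIV"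
      by (simp add: left_diff_distrib)
  qed (use 1 2 in auto)
qed

section \<open>Fourier transforms of Schwartz functions\<close>

text \<open>A product instead of a power of the norm: integrals and lattice sums of
  \<open>decay\<close> factor into one-dimensional ones, which converge in every dimension.\<close>

definition decay :: "real^'n::finite \<Rightarrow> real" where
  "decay x = (\<Prod>j\<in>UNIV. 1 / (1 + (x $ j)\<^sup>2))"

lemma one_plus_square_pos: "0 < 1 + (x::real)\<^sup>2"
  by (simp add: add_pos_nonneg)

lemma decay_pos: "0 < decay x"
  unfolding decay_def by (intro prod_pos ballI divide_pos_pos one_plus_square_pos) auto

lemma borel_measurable_decay [measurable]: "decay \<in> borel_measurable borel"
  unfolding decay_def
  by (intro borel_measurable_continuous_onI continuous_intros) (use one_plus_square_pos in \<open>auto simp: less_imp_neq[symmetric]\<close>)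

lemma integrable_inverse_one_plus_square: "integrable lborel (\<lambda>x::real. 1 / (1 + x\<^sup>2))"
proof -
  have "set_integrable lborel (einterval (-\<infinity>) \<infinity>) (\<lambda>x::real. inverse (1 + x\<^sup>2))"
    by (rule integrable_inverse_1_plus_square)
  then show ?thesis by (simp add: set_integrable_def divide_inverse)
qed

lemma prod_Basis_cart:
  fixes g :: "real \<Rightarrow> 'c::comm_monoid_mult" and x :: "real^'n::finite"
  shows "(\<Prod>b\<in>Basis. g (x \<bullet> b)) = (\<Prod>j\<in>UNIV. g (x $ j))"
proof -
  have inj: "inj (\<lambda>j::'n. axis j (1::real))" by (simp add: inj_on_def axis_eq_axis)
  have "(Basis :: (real^'n) set) = range (\<lambda>j. axis j 1)" by (auto simp: Basis_vec_def)
  then have "(\<Prod>b\<in>Basis. g (x \<bullet> b)) = (\<Prod>b\<in>range (\<lambda>j. axis j 1). g (x \<bullet> b))" by (simp only:)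
  also have "\<dots> = prod ((\<lambda>b. g (x \<bullet> b)) \<circ> (\<lambda>j. axis j 1)) UNIV" by (rule prod.reindex[OF inj])
  finally show ?thesis by (simp add: inner_axis comp_def)
qed

lemma integrable_decay: "integrable lborel (decay :: real^'n::finite \<Rightarrow> real)"
proof (rule integrableI_bounded)
  show "(decay :: real^'n \<Rightarrow> real) \<in> borel_measurable lborel" by simp
  let ?f = "\<lambda>x::real. 1 / (1 + x\<^sup>2)"
  have "(\<integral>\<^sup>+x. ennreal (norm (decay (x :: real^'n))) \<partial>lborel) = (\<integral>\<^sup>+x. (\<Prod>b\<in>Basis. ennreal (?f (x \<bullet> b))) \<partial>(lborel :: (real^'n) measure))"
  proof (rule nn_integral_cong)
    fix x :: "real^'n"
    have "ennreal (norm (decay x)) = (\<Prod>j\<in>UNIV. ennreal (?f (x $ j)))"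
      using decay_pos[of x] by (simp add: decay_def prod_ennreal)
    then show "ennreal (norm (decay x)) = (\<Prod>b\<in>Basis. ennreal (?f (x \<bullet> b)))"
      unfolding prod_Basis_cart[of "\<lambda>v. ennreal (?f v)" x] .
  qed
  also have "\<dots> = (\<Prod>b\<in>(Basis :: (real^'n) set). (\<integral>\<^sup>+x. ennreal (?f x) \<partial>lborel))"
    by (rule nn_integral_lborel_prod) auto
  also have "\<dots> < \<infinity>"
  proof -
    have "(\<integral>\<^sup>+x. ennreal (?f x) \<partial>lborel) = ennreal (LINT x|lborel. ?f x)"
      by (rule nn_integral_eq_integral[OF integrable_inverse_one_plus_square]) simp
    then show ?thesis by (simp add: ennreal_power)
  qed
  finally show "(\<integral>\<^sup>+x. ennreal (norm (decay (x :: real^'n))) \<partial>lborel) < \<infinity>" .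
qed

lemma decay_lattice_sum:
  assumes q: "\<And>j::'n::finite. q j \<noteq> (0::real)"
  obtains S where "0 \<le> S" "\<And>y. integrable (count_space UNIV) (\<lambda>l::int^'n. decay (y + (\<chi> j. q j * of_int (l $ j))))"
    "\<And>y. (LINT l|count_space UNIV. decay (y + (\<chi> j. q j * of_int (l $ j)))) \<le> S"
proof -
  have "\<forall>j. \<exists>S\<ge>0. \<forall>y. integrable (count_space UNIV) (\<lambda>l::int. 1 / (1 + (y + q j * l)\<^sup>2)) \<and>
    (LINT l|count_space UNIV. 1 / (1 + (y + q j * real_of_int l)\<^sup>2)) \<le> S"
    using lattice_sum_bound[OF q] by metis
  then obtain S where S: "\<And>j. 0 \<le> S j" "\<And>j y. integrable (count_space UNIV) (\<lambda>l::int. 1 / (1 + (y + q j * l)\<^sup>2))"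
    "\<And>j y. (LINT l|count_space UNIV. 1 / (1 + (y + q j * real_of_int l)\<^sup>2)) \<le> S j"
    by metis
  have eq: "decay (y + (\<chi> j. q j * of_int (l $ j))) = (\<Prod>j\<in>UNIV. 1 / (1 + (y $ j + q j * of_int (l $ j))\<^sup>2))" for y and l :: "int^'n"
    by (simp add: decay_def)
  show ?thesis
  proof (rule that[of "\<Prod>j\<in>UNIV. S j"])
    show "0 \<le> (\<Prod>j\<in>UNIV. S j)" by (intro prod_nonneg ballI S)
    fix y :: "real^'n"
    note p = integral_count_space_prod_vec[of "\<lambda>j l. 1 / (1 + (y $ j + q j * of_int l)\<^sup>2)", OF S(2)]
    show "integrable (count_space UNIV) (\<lambda>l::int^'n. decay (y + (\<chi> j. q j * of_int (l $ j))))"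
      unfolding eq by (rule p(1))
    show "(LINT l|count_space UNIV. decay (y + (\<chi> j. q j * of_int (l $ j)))) \<le> (\<Prod>j\<in>UNIV. S j)"
      unfolding eq p(2) using S by (intro prod_mono conjI Bochner_Integration.integral_nonneg) auto
  qed
qed

lemma decay_shift_le:
  assumes "\<bar>s\<bar> < 1"
  shows "decay (x + s *\<^sub>R axis j 1) \<le> 3 * decay x"
proof -
  let ?f = "\<lambda>y::real. 1 / (1 + y\<^sup>2)"
  have "decay (x + s *\<^sub>R axis j 1) = ?f (x $ j + s) * (\<Prod>i\<in>UNIV - {j}. ?f ((x + s *\<^sub>R axis j 1) $ i))"
    unfolding decay_def by (subst prod.remove[of _ j]) (auto simp: axis_def)
  also have "(\<Prod>i\<in>UNIV - {j}. ?f ((x + s *\<^sub>R axis j 1) $ i)) = (\<Prod>i\<in>UNIV - {j}. ?f (x $ i))"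
    by (intro prod.cong) (auto simp: axis_def)
  also have "?f (x $ j + s) * \<dots> \<le> (3 * ?f (x $ j)) * \<dots>"
  proof (rule mult_right_mono)
    have "1 + (x $ j)\<^sup>2 \<le> 3 * (1 + (x $ j + s)\<^sup>2)" using assms by (intro one_plus_square_le) simp
    then show "?f (x $ j + s) \<le> 3 * ?f (x $ j)"
      using one_plus_square_pos[of "x $ j"] one_plus_square_pos[of "x $ j + s"] by (simp add: divide_simps)
  qed (intro prod_nonneg, auto)
  also have "(3 * ?f (x $ j)) * (\<Prod>i\<in>UNIV - {j}. ?f (x $ i)) = 3 * decay x"
    unfolding decay_def by (subst (2) prod.remove[of _ j]) auto
  finally show ?thesis .
qed

text \<open>The comparison with the powers of the norm in \<open>schwartz\<close>: each of the n
  factors 1 + (x $ j)^2 is at most the square of 1 + norm x.\<close>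

lemma norm_power_decay:
  fixes x :: "real^'n::finite"
  shows "1 \<le> (1 + norm x) ^ (2 * CARD('n)) * decay x"
proof -
  have "(\<Prod>j\<in>UNIV. 1 + (x $ j)\<^sup>2) \<le> (\<Prod>j\<in>(UNIV::'n set). (1 + norm x)\<^sup>2)"
  proof (intro prod_mono conjI)
    fix j
    have "(x $ j)\<^sup>2 \<le> (norm x)\<^sup>2" using component_le_norm_cart[of x j] abs_le_square_iff[of "x $ j" "norm x"] by simp
    moreover have "(1 + norm x)\<^sup>2 = 1 + 2 * norm x + (norm x)\<^sup>2" by (simp add: power2_sum)
    ultimately show "1 + (x $ j)\<^sup>2 \<le> (1 + norm x)\<^sup>2" using norm_ge_zero[of x] by linarith
  qed (simp add: add_nonneg_nonneg)
  also have "\<dots> = (1 + norm x) ^ (2 * CARD('n))" by (simp add: power_mult)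
  finally have le: "(\<Prod>j\<in>UNIV. 1 + (x $ j)\<^sup>2) \<le> (1 + norm x) ^ (2 * CARD('n))" .
  have "1 = (\<Prod>j\<in>UNIV. 1 + (x $ j)\<^sup>2) * decay x"
    unfolding decay_def prod.distrib[symmetric] using one_plus_square_pos
    by (intro prod.neutral[symmetric]) (simp add: less_imp_neq[symmetric])
  also have "\<dots> \<le> (1 + norm x) ^ (2 * CARD('n)) * decay x"
    using le decay_pos[of x] by (intro mult_right_mono) auto
  finally show ?thesis .
qed

lemma schwartz_decay:
  fixes \<phi> :: "real^'n::finite \<Rightarrow> complex"
  assumes "schwartz \<phi>"
  obtains C where "0 \<le> C" "\<And>x. norm (iter_partial L \<phi> x) \<le> C * decay x"
proof -
  obtain C where C: "\<And>x. (1 + norm x) ^ (2 * CARD('n)) * norm (iter_partial L \<phi> x) \<le> C"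
    using assms unfolding schwartz_def by blast
  have C0: "0 \<le> C" by (rule order.trans[OF _ C[of 0]]) simp
  have "norm (iter_partial L \<phi> x) \<le> C * decay x" for x
  proof -
    have "norm (iter_partial L \<phi> x) * 1 \<le> norm (iter_partial L \<phi> x) * ((1 + norm x) ^ (2 * CARD('n)) * decay x)"
      by (intro mult_left_mono norm_power_decay) simp
    also have "\<dots> = ((1 + norm x) ^ (2 * CARD('n)) * norm (iter_partial L \<phi> x)) * decay x" by (simp add: mult_ac)
    also have "\<dots> \<le> C * decay x" using decay_pos[of x] by (intro mult_right_mono C) auto
    finally show ?thesis by simp
  qed
  then show ?thesis using C0 that by blast
qed

lemma schwartz_differentiable: "schwartz \<phi> \<Longrightarrow> iter_partial L \<phi> differentiable (at x)"
  by (simp add: schwartz_def)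

lemma schwartz_continuous: "schwartz \<phi> \<Longrightarrow> continuous_on S (iter_partial L \<phi>)"
  by (intro continuous_at_imp_continuous_on ballI differentiable_imp_continuous_within schwartz_differentiable)

lemma continuous_on_cis_inner: "continuous_on S (\<lambda>x. cis (x \<bullet> \<xi>))"
  by (intro continuous_intros)

lemma integrable_cis_times:
  fixes \<psi> :: "real^'n::finite \<Rightarrow> complex"
  assumes m: "\<psi> \<in> borel_measurable borel" and b: "\<And>x. norm (\<psi> x) \<le> C * decay x"
  shows "integrable lborel (\<lambda>x. cis (x \<bullet> \<xi>) * \<psi> x)"
proof (rule Bochner_Integration.integrable_bound)
  show "integrable lborel (\<lambda>x. C * decay (x :: real^'n))" by (intro integrable_mult_right integrable_decay)
  have [measurable]: "(\<lambda>x. cis (x \<bullet> \<xi>)) \<in> borel_measurable borel"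
    by (rule borel_measurable_continuous_onI[OF continuous_on_cis_inner])
  show "(\<lambda>x. cis (x \<bullet> \<xi>) * \<psi> x) \<in> borel_measurable lborel" using m by simp
  show "AE x in lborel. norm (cis (x \<bullet> \<xi>) * \<psi> x) \<le> norm (C * decay x)"
    by (intro AE_I2) (simp add: norm_mult order.trans[OF b abs_ge_self])
qed

lemma lborel_integral_translation:
  fixes f :: "'a::euclidean_space \<Rightarrow> 'b::{banach, second_countable_topology}"
  assumes "f \<in> borel_measurable borel"
  shows "(LINT x|lborel. f (c + x)) = (LINT x|lborel. f x)"
proof -
  have "(LINT x|lborel. f x) = (LINT x|distr lborel borel ((+) c). f x)"
    by (simp add: lborel_distr_plus)
  also have "\<dots> = (LINT x|lborel. f (c + x))" using assms by (subst integral_distr) auto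
  finally show ?thesis by simp
qed

section \<open>Integration by parts and decay of the transform\<close>

text \<open>By translation invariance the integral of every difference quotient is 0, and dominated
  convergence passes this on to the derivative, so that no boundary terms arise.\<close>

lemma integral_partial_eq_0:
  fixes G :: "real^'n::finite \<Rightarrow> complex"
  assumes der: "\<And>x s. ((\<lambda>s. G (x + s *\<^sub>R axis j 1)) has_vector_derivative G' (x + s *\<^sub>R axis j 1)) (at s)"
    and G: "continuous_on UNIV G" "\<And>x. norm (G x) \<le> C * decay x"
    and G': "\<And>x. norm (G' x) \<le> C * decay x" "G' \<in> borel_measurable borel"
  shows "(LINT x|lborel. G' x) = 0"
proof -
  \<comment> \<open>The shift by 2 keeps the step sizes below 1, as \<open>decay_shift_le\<close>
    requires.\<close>
  define h where "h n = inverse (real (n + 2))" for n :: nat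
  have h: "0 < h n" "h n < 1" for n by (auto simp: h_def inverse_less_1_iff)
  have C0: "0 \<le> C"
  proof -
    have "0 \<le> C * decay (0 :: real^'n)" by (rule order.trans[OF norm_ge_zero G(2)])
    then show ?thesis using decay_pos[of "0 :: real^'n"] by (simp add: zero_le_mult_iff)
  qed
  define Q where "Q n x = (G (x + h n *\<^sub>R axis j 1) - G x) /\<^sub>R h n" for n x
  have Gm: "G \<in> borel_measurable borel" by (rule borel_measurable_continuous_onI[OF G(1)])
  have Gsm: "(\<lambda>x. G (x + h n *\<^sub>R axis j 1)) \<in> borel_measurable borel" for n
    by (rule borel_measurable_continuous_onI, rule continuous_on_compose2[OF G(1)]) (auto intro!: continuous_intros)
  have Gi: "integrable lborel G"
  proof (rule Bochner_Integration.integrable_bound[OF integrable_mult_right[OF integrable_decay, of C]])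
    show "AE x in lborel. norm (G x) \<le> norm (C * decay x)" by (intro AE_I2) (simp add: order.trans[OF G(2) abs_ge_self])
  qed (use Gm in auto)
  have Gsi: "integrable lborel (\<lambda>x. G (x + h n *\<^sub>R axis j 1))" for n
  proof (rule Bochner_Integration.integrable_bound[OF integrable_mult_right[OF integrable_decay, of "C * 3"]])
    show "AE x in lborel. norm (G (x + h n *\<^sub>R axis j 1)) \<le> norm (C * 3 * decay x)"
    proof (rule AE_I2)
      fix x
      have "norm (G (x + h n *\<^sub>R axis j 1)) \<le> C * decay (x + h n *\<^sub>R axis j 1)" by (rule G(2))
      also have "\<dots> \<le> C * (3 * decay x)" using h[of n] C0 by (intro mult_left_mono decay_shift_le) auto
      finally show "norm (G (x + h n *\<^sub>R axis j 1)) \<le> norm (C * 3 * decay x)" by simp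
    qed
  qed (use Gsm in auto)
  have Q0: "(LINT x|lborel. Q n x) = 0" for n
  proof -
    have "(LINT x|lborel. G (x + h n *\<^sub>R axis j 1)) = (LINT x|lborel. G x)"
      using lborel_integral_translation[OF Gm, of "h n *\<^sub>R axis j 1"] by (simp add: add.commute)
    then show ?thesis unfolding Q_def using Gi Gsi by simp
  qed
  have "(\<lambda>n. LINT x|lborel. Q n x) \<longlonglongrightarrow> (LINT x|lborel. G' x)"
  proof (rule integral_dominated_convergence[where w = "\<lambda>x. 3 * C * decay x"])
    show "integrable lborel (\<lambda>x. 3 * C * decay (x :: real^'n))" by (intro integrable_mult_right integrable_decay)
    show "Q n \<in> borel_measurable lborel" for n unfolding Q_def using Gm Gsm by simp
    show "AE x in lborel. (\<lambda>n. Q n x) \<longlonglongrightarrow> G' x"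
    proof (rule AE_I2)
      fix x
      have "((\<lambda>s. (G (x + s *\<^sub>R axis j 1) - G (x + 0 *\<^sub>R axis j 1)) /\<^sub>R (s - 0)) \<longlongrightarrow> G' x) (at 0)"
      proof (rule LIM_zero_cancel, rule tendsto_norm_zero_cancel, rule Lim_transform_eventually)
        show "((\<lambda>s. norm (G (x + s *\<^sub>R axis j 1) - G (x + 0 *\<^sub>R axis j 1) - (s - 0) *\<^sub>R G' x) / norm (s - 0)) \<longlongrightarrow> 0) (at 0)"
          using der[of x 0] unfolding has_vector_derivative_def has_derivative_iff_norm by simp
        have "norm (G (x + s *\<^sub>R axis j 1) - G (x + 0 *\<^sub>R axis j 1) - (s - 0) *\<^sub>R G' x) / norm (s - 0)
            = norm ((G (x + s *\<^sub>R axis j 1) - G (x + 0 *\<^sub>R axis j 1)) /\<^sub>R (s - 0) - G' x)" if "s \<noteq> 0" for s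
        proof -
          have "(G (x + s *\<^sub>R axis j 1) - G (x + 0 *\<^sub>R axis j 1)) /\<^sub>R (s - 0) - G' x
             = (G (x + s *\<^sub>R axis j 1) - G (x + 0 *\<^sub>R axis j 1) - (s - 0) *\<^sub>R G' x) /\<^sub>R (s - 0)"
            using that by (simp add: scaleR_diff_right)
          then show ?thesis by (simp add: divide_inverse mult.commute)
        qed
        then show "\<forall>\<^sub>F s in at 0. norm (G (x + s *\<^sub>R axis j 1) - G (x + 0 *\<^sub>R axis j 1) - (s - 0) *\<^sub>R G' x) / norm (s - 0)
            = norm ((G (x + s *\<^sub>R axis j 1) - G (x + 0 *\<^sub>R axis j 1)) /\<^sub>R (s - 0) - G' x)"
          by (auto simp: eventually_at_filter)
      qed
      moreover have "filterlim h (at 0) sequentially"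
        unfolding filterlim_at h_def
        using LIMSEQ_ignore_initial_segment[OF LIMSEQ_inverse_real_of_nat, of 1] by (auto simp: add.commute)
      ultimately show "(\<lambda>n. Q n x) \<longlonglongrightarrow> G' x"
        unfolding Q_def using filterlim_compose by fastforce
    qed
    show "AE x in lborel. norm (Q n x) \<le> 3 * C * decay x" for n
    proof (rule AE_I2)
      fix x
      have "norm (G (x + h n *\<^sub>R axis j 1) - G (x + 0 *\<^sub>R axis j 1)) \<le> (3 * C * decay x) * norm (h n - 0)"
      proof (rule differentiable_bound[where S = "{0..h n}" and f' = "\<lambda>s k. k *\<^sub>R G' (x + s *\<^sub>R axis j 1)"])
        fix s assume s: "s \<in> {0..h n}"
        show "((\<lambda>s. G (x + s *\<^sub>R axis j 1)) has_derivative (\<lambda>k. k *\<^sub>R G' (x + s *\<^sub>R axis j 1))) (at s within {0..h n})"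
          using der[of x s] unfolding has_vector_derivative_def by (rule has_derivative_at_withinI)
        have "norm (G' (x + s *\<^sub>R axis j 1)) \<le> C * decay (x + s *\<^sub>R axis j 1)" by (rule G'(1))
        also have "\<dots> \<le> C * (3 * decay x)" using s h[of n] C0 by (intro mult_left_mono decay_shift_le) auto
        finally have b: "norm (G' (x + s *\<^sub>R axis j 1)) \<le> C * (3 * decay x)" .
        show "onorm (\<lambda>k. k *\<^sub>R G' (x + s *\<^sub>R axis j 1)) \<le> 3 * C * decay x"
        proof (rule onorm_le)
          fix k :: real
          show "norm (k *\<^sub>R G' (x + s *\<^sub>R axis j 1)) \<le> 3 * C * decay x * norm k"
            using mult_left_mono[OF b, of "\<bar>k\<bar>"] by (simp add: mult_ac)
        qed
      qed (use h[of n] in auto)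
      then show "norm (Q n x) \<le> 3 * C * decay x" using h[of n] by (simp add: Q_def divide_simps mult_ac)
    qed
  qed (use G'(2) in auto)
  then show ?thesis using Q0 LIMSEQ_unique[of "\<lambda>n. 0" 0] by simp
qed

definition fourier :: "(real^'n::finite \<Rightarrow> complex) \<Rightarrow> real^'n \<Rightarrow> complex" where
  "fourier \<phi> \<xi> = (LINT x|lborel. cis (x \<bullet> \<xi>) * \<phi> x)"

text \<open>Integration by parts: the derivative of the product of the exponential with the
  \<open>L\<close>-th derivative of \<phi> has integral 0.\<close>

lemma fourier_partial:
  assumes \<phi>: "schwartz \<phi>"
  shows "fourier (iter_partial (j # L) \<phi>) \<xi> = - \<i> * of_real (\<xi> $ j) * fourier (iter_partial L \<phi>) \<xi>"
proof -
  let ?f = "iter_partial L \<phi>" and ?f' = "iter_partial (j # L) \<phi>"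
  define G where "G x = cis (x \<bullet> \<xi>) * ?f x" for x
  define G' where "G' x = \<i> * of_real (\<xi> $ j) * (cis (x \<bullet> \<xi>) * ?f x) + cis (x \<bullet> \<xi>) * ?f' x" for x
  obtain C1 where C1: "0 \<le> C1" "\<And>x. norm (?f x) \<le> C1 * decay x" using schwartz_decay[OF \<phi>, of L] by blast
  obtain C2 where C2: "0 \<le> C2" "\<And>x. norm (?f' x) \<le> C2 * decay x" using schwartz_decay[OF \<phi>, of "j # L"] by blast
  let ?C = "C1 + \<bar>\<xi> $ j\<bar> * C1 + C2"
  note cf = schwartz_continuous[OF \<phi>, of UNIV]
  note i1 = integrable_cis_times[OF borel_measurable_continuous_onI[OF cf] C1(2), of \<xi>] and i2 = integrable_cis_times[OF borel_measurable_continuous_onI[OF cf] C2(2), of \<xi>]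
  have "(LINT x|lborel. G' x) = 0"
  proof (rule integral_partial_eq_0[of G j G' ?C])
    fix x :: "real^'a" and s
    have "((\<lambda>s. x + s *\<^sub>R axis j 1) has_derivative (\<lambda>k. k *\<^sub>R axis j 1)) (at s)"
      by (auto intro!: derivative_eq_intros)
    from has_derivative_compose[OF this has_derivative_sum_partial[OF schwartz_differentiable[OF \<phi>, of L]]]
    have "((\<lambda>s. ?f (x + s *\<^sub>R axis j 1)) has_derivative
       (\<lambda>k. \<Sum>i\<in>UNIV. of_real ((k *\<^sub>R axis j 1 :: real^'a) $ i) * partial i ?f (x + s *\<^sub>R axis j 1))) (at s)" .
    moreover have "(\<Sum>i\<in>UNIV. of_real ((k *\<^sub>R axis j 1 :: real^'a) $ i) * partial i ?f y) = k *\<^sub>R ?f' y" for k :: real and y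
    proof -
      have "(\<Sum>i\<in>UNIV. of_real ((k *\<^sub>R axis j 1 :: real^'a) $ i) * partial i ?f y) = (\<Sum>i\<in>UNIV. if i = j then k *\<^sub>R partial j ?f y else 0)"
        by (intro sum.cong) (auto simp: axis_def scaleR_conv_of_real[where 'a = complex])
      then show ?thesis by simp
    qed
    ultimately have 1: "((\<lambda>s. ?f (x + s *\<^sub>R axis j 1)) has_vector_derivative ?f' (x + s *\<^sub>R axis j 1)) (at s)"
      by (simp add: has_vector_derivative_def)
    have 2: "((\<lambda>s. cis ((x + s *\<^sub>R axis j 1) \<bullet> \<xi>)) has_vector_derivative \<i> * of_real (\<xi> $ j) * cis ((x + s *\<^sub>R axis j 1) \<bullet> \<xi>)) (at s)"
    proof -
      have e: "cis ((x + s *\<^sub>R axis j 1) \<bullet> \<xi>) = cis (x \<bullet> \<xi>) * exp (\<i> * of_real (\<xi> $ j) * of_real s)" for s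
        by (simp add: inner_add_left inner_axis' cis_mult[symmetric] cis_conv_exp[of "s * _"] mult_ac)
      have "((\<lambda>z. cis (x \<bullet> \<xi>) * exp (\<i> * of_real (\<xi> $ j) * z)) has_field_derivative
          \<i> * of_real (\<xi> $ j) * (cis (x \<bullet> \<xi>) * exp (\<i> * of_real (\<xi> $ j) * of_real s))) (at (of_real s))"
        by (auto intro!: derivative_eq_intros)
      from has_vector_derivative_real_field[OF this] show ?thesis unfolding e .
    qed
    from has_vector_derivative_mult[OF 2 1]
    show "((\<lambda>s. G (x + s *\<^sub>R axis j 1)) has_vector_derivative G' (x + s *\<^sub>R axis j 1)) (at s)"
      unfolding G_def G'_def by (simp add: algebra_simps)
  next
    show "continuous_on UNIV G" unfolding G_def by (intro continuous_on_mult continuous_on_cis_inner cf)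
    fix x :: "real^'a"
    have d: "0 < decay x" by (rule decay_pos)
    have "norm (G x) \<le> C1 * decay x" using C1(2) by (simp add: G_def norm_mult)
    also have "\<dots> \<le> ?C * decay x" using d C1(1) C2(1) by (intro mult_right_mono) auto
    finally show "norm (G x) \<le> ?C * decay x" .
    have "norm (G' x) \<le> \<bar>\<xi> $ j\<bar> * norm (?f x) + norm (?f' x)"
      unfolding G'_def by (rule order.trans[OF norm_triangle_ineq]) (simp add: norm_mult)
    also have "\<dots> \<le> \<bar>\<xi> $ j\<bar> * (C1 * decay x) + C2 * decay x"
      by (intro add_mono mult_left_mono C1 C2) auto
    also have "\<dots> = (\<bar>\<xi> $ j\<bar> * C1 + C2) * decay x" by (simp add: algebra_simps)
    also have "\<dots> \<le> ?C * decay x" using d C1(1) by (intro mult_right_mono) auto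
    finally show "norm (G' x) \<le> ?C * decay x" .
  next
    show "G' \<in> borel_measurable borel"
      unfolding G'_def
      by (intro borel_measurable_continuous_onI continuous_on_add continuous_on_mult continuous_on_const continuous_on_cis_inner cf)
  qed
  moreover have "(LINT x|lborel. G' x) = \<i> * of_real (\<xi> $ j) * fourier ?f \<xi> + fourier ?f' \<xi>"
    unfolding G'_def fourier_def using i1 i2 by simp
  ultimately show ?thesis by (simp add: add_eq_0_iff)
qed

lemma fourier_bounded:
  assumes \<phi>: "schwartz \<phi>"
  obtains C where "0 \<le> C" "\<And>\<xi>. norm (fourier (iter_partial L \<phi>) \<xi>) \<le> C"
proof -
  obtain C where C: "0 \<le> C" "\<And>x. norm (iter_partial L \<phi> x) \<le> C * decay x" using schwartz_decay[OF \<phi>, of L] by blast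
  note i = integrable_cis_times[OF borel_measurable_continuous_onI[OF schwartz_continuous[OF \<phi>, of UNIV]] C(2)]
  have "norm (fourier (iter_partial L \<phi>) \<xi>) \<le> (LINT x|lborel. C * decay (x :: real^'a))" for \<xi>
  proof -
    have "norm (fourier (iter_partial L \<phi>) \<xi>) \<le> (LINT x|lborel. norm (cis (x \<bullet> \<xi>) * iter_partial L \<phi> x))"
      unfolding fourier_def by (rule integral_norm_bound)
    also have "\<dots> \<le> (LINT x|lborel. C * decay (x :: real^'a))"
      by (intro integral_mono integrable_norm i integrable_mult_right integrable_decay) (simp add: norm_mult C)
    finally show ?thesis .
  qed
  moreover have "0 \<le> (LINT x|lborel. C * decay (x :: real^'a))"
    using C(1) decay_pos by (intro Bochner_Integration.integral_nonneg mult_nonneg_nonneg) (auto intro: less_imp_le)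
  ultimately show ?thesis using that by blast
qed

lemma fourier_replicate:
  assumes "schwartz \<phi>"
  shows "fourier (iter_partial (replicate m j) \<phi>) \<xi> = (- \<i> * of_real (\<xi> $ j)) ^ m * fourier \<phi> \<xi>"
proof (induction m)
  case (Suc m)
  then show ?case using fourier_partial[OF assms, of j "replicate m j" \<xi>] by simp
qed simp

text \<open>Let m be the largest modulus of a component of \<xi>. The 2n-th derivative in the
  direction of that component controls m^(2n). This suffices, since the product of all 1 + (\<xi> $
  i)^2 is at most (1 + m^2)^n, hence at most 2^n (1 + m^(2n)).\<close>

lemma fourier_decay:
  fixes \<phi> :: "real^'n::finite \<Rightarrow> complex"
  assumes \<phi>: "schwartz \<phi>"
  obtains C where "0 \<le> C" "\<And>\<xi>. norm (fourier \<phi> \<xi>) \<le> C * decay \<xi>"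
proof -
  let ?n = "CARD('n)"
  obtain C0 where C0: "0 \<le> C0" "\<And>\<xi>. norm (fourier \<phi> \<xi>) \<le> C0"
    using fourier_bounded[OF \<phi>, of "[]"] by auto
  have "\<forall>j. \<exists>C\<ge>0. \<forall>\<xi>. norm (fourier (iter_partial (replicate (2 * ?n) j) \<phi>) \<xi>) \<le> C"
    using fourier_bounded[OF \<phi>] by metis
  then obtain C where C: "\<And>j. 0 \<le> C j" "\<And>j \<xi>. norm (fourier (iter_partial (replicate (2 * ?n) j) \<phi>) \<xi>) \<le> C j" by metis
  define K where "K = 2 ^ ?n * (C0 + (\<Sum>j\<in>UNIV. C j))"
  have K: "0 \<le> K" using C0 C by (simp add: K_def sum_nonneg)
  have "norm (fourier \<phi> \<xi>) \<le> K * decay \<xi>" for \<xi>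
  proof -
    define m where "m = Max (range (\<lambda>j. \<bar>\<xi> $ j\<bar>))"
    have mj: "\<bar>\<xi> $ j\<bar> \<le> m" for j unfolding m_def by (rule Max_ge) auto
    have "m \<in> range (\<lambda>j. \<bar>\<xi> $ j\<bar>)" unfolding m_def by (rule Max_in) auto
    then obtain j where j: "m = \<bar>\<xi> $ j\<bar>" by blast
    have m0: "0 \<le> m" by (simp add: j)
    have "(\<Prod>i\<in>UNIV. 1 + (\<xi> $ i)\<^sup>2) \<le> (\<Prod>i\<in>(UNIV::'n set). 1 + m\<^sup>2)"
    proof (intro prod_mono conjI)
      show "1 + (\<xi> $ i)\<^sup>2 \<le> 1 + m\<^sup>2" for i using mj[of i] abs_le_square_iff[of "\<xi> $ i" m] m0 by simp
    qed (simp add: add_nonneg_nonneg)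
    also have "\<dots> = (1 + m\<^sup>2) ^ ?n" by simp
    also have "\<dots> \<le> 2 ^ ?n * (1 + m ^ (2 * ?n))"
    proof (cases "m \<le> 1")
      case True
      then have "m\<^sup>2 \<le> 1" using m0 by (simp add: power_le_one)
      then have "(1 + m\<^sup>2) ^ ?n \<le> 2 ^ ?n" by (intro power_mono) auto
      also have "\<dots> \<le> 2 ^ ?n * (1 + m ^ (2 * ?n))" using m0 by simp
      finally show ?thesis .
    next
      case False
      then have "1 \<le> m\<^sup>2" by (simp add: one_le_power)
      then have "(1 + m\<^sup>2) ^ ?n \<le> (2 * m\<^sup>2) ^ ?n" by (intro power_mono) auto
      also have "\<dots> = 2 ^ ?n * m ^ (2 * ?n)" by (simp add: power_mult_distrib power_mult)
      also have "\<dots> \<le> 2 ^ ?n * (1 + m ^ (2 * ?n))" by simp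
      finally show ?thesis .
    qed
    finally have le: "(\<Prod>i\<in>UNIV. 1 + (\<xi> $ i)\<^sup>2) \<le> 2 ^ ?n * (1 + m ^ (2 * ?n))" .
    have "m ^ (2 * ?n) * norm (fourier \<phi> \<xi>) = norm (fourier (iter_partial (replicate (2 * ?n) j) \<phi>) \<xi>)"
      by (simp add: fourier_replicate[OF \<phi>] norm_mult norm_power j)
    also have "\<dots> \<le> (\<Sum>j\<in>UNIV. C j)" using C(2)[of j \<xi>] member_le_sum[of j UNIV C] C(1) by fastforce
    finally have mm: "m ^ (2 * ?n) * norm (fourier \<phi> \<xi>) \<le> (\<Sum>j\<in>UNIV. C j)" .
    have "(\<Prod>i\<in>UNIV. 1 + (\<xi> $ i)\<^sup>2) * norm (fourier \<phi> \<xi>) \<le> 2 ^ ?n * (1 + m ^ (2 * ?n)) * norm (fourier \<phi> \<xi>)"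
      by (rule mult_right_mono[OF le]) simp
    also have "\<dots> = 2 ^ ?n * (norm (fourier \<phi> \<xi>) + m ^ (2 * ?n) * norm (fourier \<phi> \<xi>))" by (simp add: algebra_simps)
    also have "\<dots> \<le> K" unfolding K_def using C0(2)[of \<xi>] mm by (intro mult_left_mono) auto
    finally have *: "(\<Prod>i\<in>UNIV. 1 + (\<xi> $ i)\<^sup>2) * norm (fourier \<phi> \<xi>) \<le> K" .
    have one: "(\<Prod>i\<in>UNIV. 1 + (\<xi> $ i)\<^sup>2) * decay \<xi> = 1"
      unfolding decay_def prod.distrib[symmetric] using one_plus_square_pos
      by (intro prod.neutral) (simp add: less_imp_neq[symmetric])
    have "norm (fourier \<phi> \<xi>) = ((\<Prod>i\<in>UNIV. 1 + (\<xi> $ i)\<^sup>2) * decay \<xi>) * norm (fourier \<phi> \<xi>)" by (simp add: one)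
    also have "\<dots> = ((\<Prod>i\<in>UNIV. 1 + (\<xi> $ i)\<^sup>2) * norm (fourier \<phi> \<xi>)) * decay \<xi>" by (simp add: mult_ac)
    also have "\<dots> \<le> K * decay \<xi>" using * decay_pos[of \<xi>] by (intro mult_right_mono) auto
    finally show ?thesis .
  qed
  then show ?thesis using K that by blast
qed

section \<open>Existence of the fundamental solution\<close>

lemma measurable_heat [measurable (raw)]:
  assumes "f \<in> borel_measurable M" "g \<in> borel_measurable M"
  shows "(\<lambda>w. heat (f w) (g w)) \<in> borel_measurable M"
  unfolding heat_def using assms by measurable

lemma measurable_vec_nth [measurable (raw)]:
  assumes "g \<in> borel_measurable M"
  shows "(\<lambda>w. (g w :: real^'n) $ j) \<in> borel_measurable M"
  by (rule measurable_compose[OF assms]) (intro borel_measurable_continuous_onI continuous_intros)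

lemma measurable_heat_kernel [measurable (raw)]:
  assumes "f \<in> borel_measurable M" "g \<in> borel_measurable M"
  shows "(\<lambda>w. heat_kernel (f w) (g w)) \<in> borel_measurable M"
  unfolding heat_kernel_def using assms by measurable

lemma nn_integral_heat_kernel:
  assumes t: "0 < t"
  shows "(\<integral>\<^sup>+x. ennreal (heat_kernel t (x :: real^'n::finite)) \<partial>lborel) = 1"
proof -
  have "(\<integral>\<^sup>+x. ennreal (heat_kernel t (x :: real^'n)) \<partial>lborel)
      = (\<integral>\<^sup>+x. (\<Prod>b\<in>Basis. ennreal (heat t (x \<bullet> b))) \<partial>(lborel :: (real^'n) measure))"
    unfolding heat_kernel_def prod_Basis_cart[of "\<lambda>y. ennreal (heat t y)"]
    by (intro nn_integral_cong prod_ennreal[symmetric] heat_nonneg) (use t in auto)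
  also have "\<dots> = (\<Prod>b\<in>(Basis :: (real^'n) set). (\<integral>\<^sup>+x. ennreal (heat t x) \<partial>lborel))"
    by (rule nn_integral_lborel_prod) auto
  also have "(\<integral>\<^sup>+x. ennreal (heat t x) \<partial>lborel) = 1"
    using nn_integral_eq_integral[OF integrable_heat[OF t]] integral_heat[OF t] heat_nonneg t by auto
  finally show ?thesis by simp
qed

lemma nn_integral_lborel_translation:
  fixes f :: "'a::euclidean_space \<Rightarrow> ennreal"
  assumes "f \<in> borel_measurable borel"
  shows "(\<integral>\<^sup>+x. f (c + x) \<partial>lborel) = (\<integral>\<^sup>+x. f x \<partial>lborel)"
proof -
  have "(\<integral>\<^sup>+x. f x \<partial>lborel) = (\<integral>\<^sup>+x. f x \<partial>distr lborel borel ((+) c))"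
    by (simp add: lborel_distr_plus)
  also have "\<dots> = (\<integral>\<^sup>+x. f (c + x) \<partial>lborel)" using assms by (subst nn_integral_distr) auto
  finally show ?thesis by simp
qed

lemma measurable_lattice_vector [measurable]:
  "(\<lambda>l. lattice_point q l) \<in> borel_measurable (count_space UNIV)"
  by simp

abbreviation time_lattice :: "(real \<times> (int^'n::finite)) measure" where
  "time_lattice \<equiv> lborel \<Otimes>\<^sub>M count_space UNIV"

lemma sigma_finite_time_lattice: "sigma_finite_measure (time_lattice :: (real \<times> (int^'n::finite)) measure)"
proof -
  interpret pair_sigma_finite "count_space (UNIV :: (int^'n) set)" "lborel :: real measure"
    by (rule pair_sigma_finite_count_space) (rule sigma_finite_lborel)
  interpret Q: pair_sigma_finite "lborel :: real measure" "count_space (UNIV :: (int^'n) set)" ..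
  show ?thesis by (rule Q.sigma_finite_measure_axioms)
qed

context
  fixes q :: "real^'n::finite^'n"
  assumes q: "q \<in> pos_diagonal"
begin

text \<open>A translation moves the lattice shift from the heat kernel to the weight. The lattice
  sum of the weight is bounded uniformly in x, and the heat kernel then contributes its mass 1. So
  the bound is independent of t in spite of the concentration as t tends to 0.\<close>

lemma heat_kernel_lattice_decay:
  obtains S where "0 \<le> S" "\<And>t. 0 < t \<Longrightarrow>
    (\<integral>\<^sup>+l. \<integral>\<^sup>+x. ennreal (heat_kernel t (x - lattice_point q l) * decay x) \<partial>lborel \<partial>count_space UNIV) \<le> ennreal S"
proof -
  obtain S where S: "0 \<le> S" "\<And>y. integrable (count_space UNIV) (\<lambda>l::int^'n. decay (y + (\<chi> j. q $ j $ j * of_int (l $ j))))"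
    "\<And>y. (LINT l|count_space UNIV. decay (y + (\<chi> j. q $ j $ j * of_int (l $ j)))) \<le> S"
    by (rule decay_lattice_sum[of "\<lambda>j. q $ j $ j"]) (use q_nz[OF q] in auto)
  have latt: "(\<chi> j. q $ j $ j * of_int (l $ j)) = lattice_point q l" for l
    by (simp add: vec_eq_iff lattice_point_component[OF q])
  have "(\<integral>\<^sup>+l. \<integral>\<^sup>+x. ennreal (heat_kernel t (x - lattice_point q l) * decay x) \<partial>lborel \<partial>count_space UNIV) \<le> ennreal S"
    if t: "0 < t" for t
  proof -
    interpret pair_sigma_finite "count_space (UNIV :: (int^'n) set)" "lborel :: (real^'n) measure"
      by (rule pair_sigma_finite_count_space) (rule sigma_finite_lborel)
    have "(\<integral>\<^sup>+l. \<integral>\<^sup>+x. ennreal (heat_kernel t (x - lattice_point q l) * decay x) \<partial>lborel \<partial>count_space UNIV)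
       = (\<integral>\<^sup>+l. \<integral>\<^sup>+x. ennreal (heat_kernel t x * decay (x + lattice_point q l)) \<partial>lborel \<partial>count_space UNIV)"
    proof (rule nn_integral_cong)
      fix l :: "int^'n"
      show "(\<integral>\<^sup>+x. ennreal (heat_kernel t (x - lattice_point q l) * decay x) \<partial>lborel)
          = (\<integral>\<^sup>+x. ennreal (heat_kernel t x * decay (x + lattice_point q l)) \<partial>lborel)"
        using nn_integral_lborel_translation[of "\<lambda>x. ennreal (heat_kernel t (x - lattice_point q l) * decay x)" "lattice_point q l"]
        by (simp add: add.commute)
    qed
    also have "\<dots> = (\<integral>\<^sup>+x. \<integral>\<^sup>+l. ennreal (heat_kernel t x * decay (x + lattice_point q l)) \<partial>count_space UNIV \<partial>lborel)"
      by (rule Fubini'[symmetric]) measurable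
    also have "\<dots> \<le> (\<integral>\<^sup>+x. ennreal (heat_kernel t (x :: real^'n)) * ennreal S \<partial>lborel)"
    proof (rule nn_integral_mono)
      fix x :: "real^'n"
      have "(\<integral>\<^sup>+l. ennreal (decay (x + lattice_point q l)) \<partial>count_space UNIV) = ennreal (LINT l|count_space UNIV. decay (x + lattice_point q l))"
        by (rule nn_integral_eq_integral[OF S(2)[of x, unfolded latt]]) (simp add: decay_pos less_imp_le)
      also have "\<dots> \<le> ennreal S" using S(3)[of x] by (simp add: latt ennreal_leI)
      finally show "(\<integral>\<^sup>+l. ennreal (heat_kernel t x * decay (x + lattice_point q l)) \<partial>count_space UNIV) \<le> ennreal (heat_kernel t x) * ennreal S"
        using heat_kernel_nonneg[of t x] t
        by (simp add: ennreal_mult' nn_integral_cmult mult_left_mono)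
    qed
    also have "\<dots> = ennreal S"
      using nn_integral_heat_kernel[OF t, where 'n = 'n] by (simp add: nn_integral_multc)
    finally show ?thesis .
  qed
  then show ?thesis using S(1) that by blast
qed

text \<open>The integrand of the singular part, over time and lattice. The factor exp (t k^2) is the
  part of exp (t \<lambda>) that does not depend on the frequency, and the \<open>cis\<close> factor
  is the quasi-periodic phase of the source at a lattice point.\<close>

definition heat_sum_term :: "real^'n \<Rightarrow> complex \<Rightarrow> real^'n \<Rightarrow> real \<times> (int^'n) \<Rightarrow> complex" where
  "heat_sum_term \<eta> k x w = indicator {0<..1} (fst w) *\<^sub>R
     (exp (of_real (fst w) * k\<^sup>2) * cis (\<eta> \<bullet> lattice_point q (snd w)) * of_real (heat_kernel (fst w) (x - lattice_point q (snd w))))"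

lemma measurable_heat_sum_term [measurable (raw)]:
  assumes "g \<in> borel_measurable M" "h \<in> measurable M time_lattice"
  shows "(\<lambda>z. heat_sum_term \<eta> k (g z) (h z)) \<in> borel_measurable M"
proof -
  have [measurable]: "(\<lambda>z. fst (h z)) \<in> borel_measurable M" "(\<lambda>z. snd (h z)) \<in> measurable M (count_space UNIV)"
    using measurable_compose[OF assms(2) measurable_fst] measurable_compose[OF assms(2) measurable_snd] by auto
  note [measurable] = assms(1)
  show ?thesis unfolding heat_sum_term_def by measurable
qed

lemma norm_heat_sum_term:
  "norm (heat_sum_term \<eta> k x (t, l)) \<le> indicator {0<..1} t * (exp (norm k ^ 2) * heat_kernel t (x - lattice_point q l))"
proof (cases "t \<in> {0<..1}")
  case True
  have "Re (of_real t * k\<^sup>2) \<le> norm (of_real t * k\<^sup>2)" by (rule complex_Re_le_cmod)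
  also have "\<dots> \<le> 1 * norm k ^ 2" using True by (simp add: norm_mult norm_power mult_left_le_one_le)
  finally have "norm (exp (of_real t * k\<^sup>2)) \<le> exp (norm k ^ 2)" by simp
  then show ?thesis using True heat_kernel_nonneg[of t "x - lattice_point q l"]
    by (simp add: heat_sum_term_def norm_mult mult_right_mono)
qed (simp add: heat_sum_term_def)

text \<open>The modulus is integrated in x first and then summed over l, which by
  \<open>heat_kernel_lattice_decay\<close> is bounded by a constant for each t. The time interval
  has length 1.\<close>

lemma integrable_heat_sum_term:
  assumes m: "\<psi> \<in> borel_measurable lborel" and b: "\<And>x. norm (\<psi> x) \<le> C * decay x"
  shows "integrable (lborel \<Otimes>\<^sub>M time_lattice) (\<lambda>z. heat_sum_term \<eta> k (fst z) (snd z) * \<psi> (fst z))"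
proof (rule integrableI_bounded)
  interpret T: sigma_finite_measure "time_lattice :: (real \<times> (int^'n)) measure" by (rule sigma_finite_time_lattice)
  interpret pair_sigma_finite "lborel :: (real^'n) measure" "time_lattice :: (real \<times> (int^'n)) measure" ..
  interpret Z: sigma_finite_measure "count_space (UNIV :: (int^'n) set)"
    by (rule sigma_finite_measure_count_space_countable) simp
  note [measurable] = m
  have m': "(\<lambda>z. heat_sum_term \<eta> k (fst z) (snd z) * \<psi> (fst z)) \<in> borel_measurable (lborel \<Otimes>\<^sub>M time_lattice)"
    by measurable
  then show "(\<lambda>z. heat_sum_term \<eta> k (fst z) (snd z) * \<psi> (fst z)) \<in> borel_measurable (lborel \<Otimes>\<^sub>M time_lattice)" .
  obtain S where S: "0 \<le> S" "\<And>t. 0 < t \<Longrightarrow>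
    (\<integral>\<^sup>+l. \<integral>\<^sup>+x. ennreal (heat_kernel t (x - lattice_point q l) * decay x) \<partial>lborel \<partial>count_space UNIV) \<le> ennreal S"
    by (rule heat_kernel_lattice_decay) blast
  have C0: "0 \<le> C"
  proof -
    have "0 \<le> C * decay (0 :: real^'n)" by (rule order.trans[OF norm_ge_zero b])
    then show ?thesis using decay_pos[of "0 :: real^'n"] by (simp add: zero_le_mult_iff)
  qed
  define K where "K = exp (norm k ^ 2) * C"
  have K: "0 \<le> K" using C0 by (simp add: K_def)
  let ?f = "\<lambda>x t l. ennreal (indicator {0<..1} t * (K * (heat_kernel t (x - lattice_point q l) * decay x)))"
  have le: "ennreal (norm (heat_sum_term \<eta> k x (t, l) * \<psi> x)) \<le> ?f x t l" for x t l
  proof (rule ennreal_leI)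
    have "norm (heat_sum_term \<eta> k x (t, l) * \<psi> x)
        \<le> (indicator {0<..1} t * (exp (norm k ^ 2) * heat_kernel t (x - lattice_point q l))) * (C * decay x)"
      unfolding norm_mult using norm_heat_sum_term b by (intro mult_mono order.trans[OF norm_ge_zero norm_heat_sum_term]) auto
    then show "norm (heat_sum_term \<eta> k x (t, l) * \<psi> x) \<le> indicator {0<..1} t * (K * (heat_kernel t (x - lattice_point q l) * decay x))"
      by (simp add: K_def mult_ac)
  qed
  have "(\<integral>\<^sup>+z. ennreal (norm (heat_sum_term \<eta> k (fst z) (snd z) * \<psi> (fst z))) \<partial>(lborel \<Otimes>\<^sub>M time_lattice))
      = (\<integral>\<^sup>+w. \<integral>\<^sup>+x. ennreal (norm (heat_sum_term \<eta> k x w * \<psi> x)) \<partial>lborel \<partial>time_lattice)"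
    by (subst nn_integral_snd[symmetric]) (simp_all add: split_beta')
  also have "\<dots> = (\<integral>\<^sup>+t. \<integral>\<^sup>+l. \<integral>\<^sup>+x. ennreal (norm (heat_sum_term \<eta> k x (t, l) * \<psi> x)) \<partial>lborel \<partial>count_space UNIV \<partial>lborel)"
    by (subst Z.nn_integral_fst[symmetric]) measurable
  also have "\<dots> \<le> (\<integral>\<^sup>+t. \<integral>\<^sup>+l. \<integral>\<^sup>+x. ?f x t l \<partial>lborel \<partial>count_space UNIV \<partial>lborel)"
    by (intro nn_integral_mono le)
  also have "\<dots> \<le> (\<integral>\<^sup>+t. ennreal (K * S) * indicator {0<..(1::real)} t \<partial>lborel)"
  proof (rule nn_integral_mono)
    fix t :: real
    show "(\<integral>\<^sup>+l. \<integral>\<^sup>+x. ?f x t l \<partial>lborel \<partial>count_space UNIV) \<le> ennreal (K * S) * indicator {0<..1} t"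
    proof (cases "t \<in> {0<..1}")
      case True
      then have "(\<integral>\<^sup>+l. \<integral>\<^sup>+x. ?f x t l \<partial>lborel \<partial>count_space UNIV)
         = ennreal K * (\<integral>\<^sup>+l. \<integral>\<^sup>+x. ennreal (heat_kernel t (x - lattice_point q l) * decay x) \<partial>lborel \<partial>count_space UNIV)"
        using K by (simp add: ennreal_mult' nn_integral_cmult)
      also have "\<dots> \<le> ennreal K * ennreal S" using True by (intro mult_left_mono S) auto
      finally show ?thesis using True K S(1) by (simp add: ennreal_mult)
    qed simp
  qed
  also have "\<dots> < \<infinity>" by (simp add: nn_integral_cmult_indicator ennreal_mult_less_top)
  finally show "(\<integral>\<^sup>+z. ennreal (norm (heat_sum_term \<eta> k (fst z) (snd z) * \<psi> (fst z))) \<partial>(lborel \<Otimes>\<^sub>M time_lattice)) < \<infinity>" .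
qed

lemma integrable_heat_lattice_fixed_time:
  assumes m: "\<psi> \<in> borel_measurable lborel" and b: "\<And>x. norm (\<psi> x) \<le> C * decay x" and t: "0 < t"
  shows "integrable (count_space UNIV \<Otimes>\<^sub>M lborel)
    (\<lambda>z. cis (\<eta> \<bullet> lattice_point q (fst z)) * of_real (heat_kernel t (snd z - lattice_point q (fst z))) * \<psi> (snd z))"
proof (rule integrableI_bounded)
  interpret pair_sigma_finite "count_space (UNIV :: (int^'n) set)" "lborel :: (real^'n) measure"
    by (rule pair_sigma_finite_count_space) (rule sigma_finite_lborel)
  note [measurable] = m
  show "(\<lambda>z. cis (\<eta> \<bullet> lattice_point q (fst z)) * of_real (heat_kernel t (snd z - lattice_point q (fst z))) * \<psi> (snd z))
     \<in> borel_measurable (count_space UNIV \<Otimes>\<^sub>M lborel)" by measurable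
  obtain S where S: "0 \<le> S" "\<And>t. 0 < t \<Longrightarrow>
    (\<integral>\<^sup>+l. \<integral>\<^sup>+x. ennreal (heat_kernel t (x - lattice_point q l) * decay x) \<partial>lborel \<partial>count_space UNIV) \<le> ennreal S"
    by (rule heat_kernel_lattice_decay) blast
  have C0: "0 \<le> C"
  proof -
    have "0 \<le> C * decay (0 :: real^'n)" by (rule order.trans[OF norm_ge_zero b])
    then show ?thesis using decay_pos[of "0 :: real^'n"] by (simp add: zero_le_mult_iff)
  qed
  have "(\<integral>\<^sup>+z. ennreal (norm (cis (\<eta> \<bullet> lattice_point q (fst z)) * of_real (heat_kernel t (snd z - lattice_point q (fst z))) * \<psi> (snd z)))
           \<partial>(count_space UNIV \<Otimes>\<^sub>M lborel))
     = (\<integral>\<^sup>+l. \<integral>\<^sup>+x. ennreal (norm (cis (\<eta> \<bullet> lattice_point q l) * of_real (heat_kernel t (x - lattice_point q l)) * \<psi> x)) \<partial>lborel \<partial>count_space UNIV)"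
    by (subst lborel.nn_integral_fst[symmetric]) auto
  also have "\<dots> \<le> (\<integral>\<^sup>+l. \<integral>\<^sup>+x. ennreal C * ennreal (heat_kernel t (x - lattice_point q l) * decay x) \<partial>lborel \<partial>count_space UNIV)"
  proof (intro nn_integral_mono)
    fix l x
    have "norm (cis (\<eta> \<bullet> lattice_point q l) * of_real (heat_kernel t (x - lattice_point q l)) * \<psi> x) \<le> heat_kernel t (x - lattice_point q l) * (C * decay x)"
      using heat_kernel_nonneg[of t "x - lattice_point q l"] t by (simp add: norm_mult mult_left_mono[OF b])
    then show "ennreal (norm (cis (\<eta> \<bullet> lattice_point q l) * of_real (heat_kernel t (x - lattice_point q l)) * \<psi> x))
       \<le> ennreal C * ennreal (heat_kernel t (x - lattice_point q l) * decay x)"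
      using C0 by (simp add: ennreal_mult'[symmetric] mult_ac ennreal_leI)
  qed
  also have "\<dots> = ennreal C * (\<integral>\<^sup>+l. \<integral>\<^sup>+x. ennreal (heat_kernel t (x - lattice_point q l) * decay x) \<partial>lborel \<partial>count_space UNIV)"
    by (simp add: nn_integral_cmult)
  also have "\<dots> \<le> ennreal C * ennreal S" using t by (intro mult_left_mono S) auto
  also have "\<dots> < \<infinity>" by (simp add: ennreal_mult_less_top)
  finally show "(\<integral>\<^sup>+z. ennreal (norm (cis (\<eta> \<bullet> lattice_point q (fst z)) * of_real (heat_kernel t (snd z - lattice_point q (fst z))) * \<psi> (snd z)))
           \<partial>(count_space UNIV \<Otimes>\<^sub>M lborel)) < \<infinity>" .
qed

end

section \<open>Analyticity of the lattice part\<close>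

text \<open>The form that \<open>gaussian_integral_power_series\<close> expects: around a base point
  b the increment u enters through one linear and one quadratic exponent per coordinate.\<close>

lemma heat_kernel_add:
  assumes t: "0 < t"
  shows "heat_kernel t (b + u) = heat_kernel t b * (\<Prod>j\<in>UNIV. exp (- (b $ j / (2 * t)) * u $ j + - (1 / (4 * t)) * (u $ j)\<^sup>2))"
proof -
  have "heat t (x + y) = heat t x * exp (- (x / (2 * t)) * y + - (1 / (4 * t)) * y\<^sup>2)" for x y
  proof -
    have e: "- ((x + y)\<^sup>2 / (4 * t)) = - (x\<^sup>2 / (4 * t)) + (- (x / (2 * t)) * y + - (1 / (4 * t)) * y\<^sup>2)"
      using t by (simp add: power2_eq_square field_simps)
    show ?thesis unfolding heat_def e exp_add[of "- (x\<^sup>2 / (4 * t))"] by simp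
  qed
  then show ?thesis by (simp add: heat_kernel_def prod.distrib)
qed

text \<open>
  At distance \<open>d\<close> from the source, part of the Gaussian pays for the increment of \<open>x\<close>, a
  part \<open>exp (- d\<^sup>2 / (16 t))\<close> for the singular factor \<open>t\<close> to the power \<open>- n / 2\<close>, and what is left is still
  summable over the lattice.
\<close>

lemma heat_kernel_gauss_bound:
  fixes b :: "real^'n::finite"
  assumes t: "0 < t" "t \<le> 1" and d: "0 < d" "d \<le> norm b" and r: "r = d / (8 * CARD('n))"
  shows "heat_kernel t b * (\<Prod>j\<in>UNIV. exp (\<bar>b $ j\<bar> / (2 * t) * r + 1 / (4 * t) * r\<^sup>2))
    \<le> fact CARD('n) / (d\<^sup>2 / 16) ^ CARD('n) * exp (- (1 / 16 * (norm b)\<^sup>2))"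
proof -
  let ?n = "CARD('n)" and ?B = "norm b"
  define s where "s = 1 / t"
  have s: "1 \<le> s" using t by (simp add: s_def)
  have n1: "1 \<le> real ?n" by (simp add: Suc_leI)
  have r0: "0 < r" and rn: "real ?n * r = d / 8" using d(1) by (simp_all add: r)
  have "(\<Sum>j\<in>UNIV. \<bar>b $ j\<bar>) \<le> real ?n * ?B"
    using sum_bounded_above[of UNIV "\<lambda>j. \<bar>b $ j\<bar>" ?B] component_le_norm_cart[of b] by simp
  then have "r * (\<Sum>j\<in>UNIV. \<bar>b $ j\<bar>) \<le> r * (real ?n * ?B)" using r0 by simp
  also have "r * (real ?n * ?B) = d / 8 * ?B" by (simp add: rn[symmetric] mult_ac)
  also have "d / 8 * ?B \<le> ?B\<^sup>2 / 8" using d by (simp add: power2_eq_square mult_right_mono)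
  finally have i1: "r * (\<Sum>j\<in>UNIV. \<bar>b $ j\<bar>) \<le> ?B\<^sup>2 / 8" .
  have dB: "d\<^sup>2 \<le> ?B\<^sup>2" using d by (intro power_mono) auto
  have "real ?n * r\<^sup>2 \<le> (real ?n * r)\<^sup>2"
    using n1 r0 by (simp add: power_mult_distrib power2_eq_square mult_right_mono)
  also have "\<dots> \<le> ?B\<^sup>2 / 64" using dB by (simp add: rn power_divide)
  finally have i2: "real ?n * r\<^sup>2 \<le> ?B\<^sup>2 / 64" .
  have sB: "?B\<^sup>2 \<le> s * ?B\<^sup>2" "s * d\<^sup>2 \<le> s * ?B\<^sup>2" using s dB by (auto simp: mult_right_mono[of 1 s "?B\<^sup>2", simplified])
  have j1: "s * (r * (\<Sum>j\<in>UNIV. \<bar>b $ j\<bar>)) \<le> s * ?B\<^sup>2 / 8" and j2: "s * (real ?n * r\<^sup>2) \<le> s * ?B\<^sup>2 / 64"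
    using mult_left_mono[OF i1, of s] mult_left_mono[OF i2, of s] s by simp_all
  have pe: "(\<Prod>j\<in>UNIV. exp (\<bar>b $ j\<bar> / (2 * t) * r + 1 / (4 * t) * r\<^sup>2))
     = exp (s * (r * (\<Sum>j\<in>UNIV. \<bar>b $ j\<bar>)) / 2 + s * (real ?n * r\<^sup>2) / 4)"
    by (subst exp_sum[symmetric]) (simp_all add: s_def sum.distrib sum_distrib_left sum_divide_distrib mult_ac)
  have he: "heat_kernel t b = (1 / sqrt (4 * pi * t)) ^ ?n * exp (- (s * ?B\<^sup>2 / 4))"
    by (simp add: heat_kernel_eq s_def)
  have "heat_kernel t b * (\<Prod>j\<in>UNIV. exp (\<bar>b $ j\<bar> / (2 * t) * r + 1 / (4 * t) * r\<^sup>2))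
     = (1 / sqrt (4 * pi * t)) ^ ?n * exp (- (s * ?B\<^sup>2 / 4) + (s * (r * (\<Sum>j\<in>UNIV. \<bar>b $ j\<bar>)) / 2 + s * (real ?n * r\<^sup>2) / 4))"
    unfolding pe he by (simp only: exp_add mult_ac)
  \<comment> \<open>With B the norm of b, the two increments cost at most s B^2 / 16 and s B^2 / 256
    of the available s B^2 / 4, which leaves more than s B^2 / 8. Half of this covers s d^2 / 16, as
    d \<le> B, and the other half covers B^2 / 16, as s \<ge> 1.\<close>
  also have "\<dots> \<le> s ^ ?n * exp (- (d\<^sup>2 / 16 * s) + - (1 / 16 * ?B\<^sup>2))"
  proof (intro mult_mono power_mono)
    have "t * t \<le> 1 * t" using t by (intro mult_right_mono) auto
    also have "1 * t \<le> 4 * pi * t" using t pi_gt3 by (intro mult_right_mono) auto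
    finally have "t \<le> sqrt (4 * pi * t)" by (intro real_le_rsqrt) (simp add: power2_eq_square)
    then show "1 / sqrt (4 * pi * t) \<le> s" unfolding s_def using t by (intro divide_left_mono) auto
    show "exp (- (s * ?B\<^sup>2 / 4) + (s * (r * (\<Sum>j\<in>UNIV. \<bar>b $ j\<bar>)) / 2 + s * (real ?n * r\<^sup>2) / 4))
      \<le> exp (- (d\<^sup>2 / 16 * s) + - (1 / 16 * ?B\<^sup>2))"
      unfolding exp_le_cancel_iff times_divide_eq_left mult.commute[of "d\<^sup>2"] mult_1 using j1 j2 sB zero_le_power2[of ?B] by linarith
  qed (use t s in auto)
  also have "\<dots> = (s ^ ?n * exp (- (d\<^sup>2 / 16 * s))) * exp (- (1 / 16 * ?B\<^sup>2))" by (simp only: exp_add mult.assoc)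
  \<comment> \<open>The n-th term of the exponential series at d^2 s / 16 absorbs the singular power
    of s.\<close>
  also have "\<dots> \<le> (fact ?n / (d\<^sup>2 / 16) ^ ?n) * exp (- (1 / 16 * ?B\<^sup>2))"
  proof (rule mult_right_mono)
    have "(d\<^sup>2 / 16 * s) ^ ?n / fact ?n \<le> exp (d\<^sup>2 / 16 * s)" using s by (intro power_div_fact_le_exp) auto
    then have "(d\<^sup>2 / 16) ^ ?n * s ^ ?n \<le> fact ?n * exp (d\<^sup>2 / 16 * s)"
      by (simp only: power_mult_distrib) (simp add: field_simps)
    moreover have "0 < (d\<^sup>2 / 16) ^ ?n" using d by simp
    ultimately show "s ^ ?n * exp (- (d\<^sup>2 / 16 * s)) \<le> fact ?n / (d\<^sup>2 / 16) ^ ?n"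
      by (simp only: exp_minus pos_le_divide_eq) (simp add: field_simps)
  qed simp
  finally show ?thesis .
qed

text \<open>Off the lattice some coordinate of a, divided by the period, is not an integer. The
  integers are closed, so this coordinate alone keeps a positive distance from all lattice
  points.\<close>

lemma lattice_distance:
  fixes q :: "real^'n::finite^'n"
  assumes q: "q \<in> pos_diagonal" and a: "a \<notin> lattice q"
  obtains d where "0 < d" "\<And>l. d \<le> norm (a - q *v of_int_vec l)"
proof -
  have "\<exists>j. a $ j / q $ j $ j \<notin> \<int>"
  proof (rule ccontr)
    assume "\<not> ?thesis"
    then have "\<forall>j. \<exists>m::int. a $ j / q $ j $ j = of_int m" by (auto elim: Ints_cases)
    then obtain m :: "'n \<Rightarrow> int" where m: "\<And>j. a $ j / q $ j $ j = of_int (m j)" by metis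
    have "a = q *v of_int_vec (\<chi> j. m j)"
      using q_nz[OF q] m by (simp add: vec_eq_iff lattice_point_component[OF q] field_simps)
    with a show False unfolding lattice_def by blast
  qed
  then obtain j where j: "a $ j / q $ j $ j \<in> - \<int>" by blast
  have "open (- \<int> :: real set)" using closed_Ints by (rule open_Compl)
  then obtain e where e: "0 < e" "ball (a $ j / q $ j $ j) e \<subseteq> - \<int>" using j open_contains_ball by blast
  show ?thesis
  proof (rule that[of "q $ j $ j * e"])
    show "0 < q $ j $ j * e" using e q_pos[OF q] by simp
    fix l
    have "of_int (l $ j) \<notin> ball (a $ j / q $ j $ j) e" using e(2) by auto
    then have "e \<le> \<bar>a $ j / q $ j $ j - of_int (l $ j)\<bar>" by (simp add: dist_real_def)
    then have "q $ j $ j * e \<le> q $ j $ j * \<bar>a $ j / q $ j $ j - of_int (l $ j)\<bar>"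
      using q_pos[OF q, of j] by simp
    also have "\<dots> = \<bar>(a - q *v of_int_vec l) $ j\<bar>"
    proof -
      have "a $ j / q $ j $ j - of_int (l $ j) = (a - q *v of_int_vec l) $ j / q $ j $ j"
        using q_nz[OF q, of j] by (simp add: lattice_point_component[OF q] diff_divide_distrib)
      then show ?thesis using q_pos[OF q, of j] by simp
    qed
    also have "\<dots> \<le> norm (a - q *v of_int_vec l)" by (rule component_le_norm_cart)
    finally show "q $ j $ j * e \<le> norm (a - q *v of_int_vec l)" .
  qed
qed

context
  fixes q :: "real^'n::finite^'n"
  assumes q: "q \<in> pos_diagonal"
begin

definition lattice_part :: "real^'n \<Rightarrow> complex \<Rightarrow> real^'n \<Rightarrow> complex" where
  "lattice_part \<eta> k x = (LINT w|time_lattice. heat_sum_term q \<eta> k x w)"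

lemma heat_sum_term_add:
  "heat_sum_term q \<eta> k a w * (\<Prod>j\<in>UNIV. exp (of_real (- ((a - lattice_point q (snd w)) $ j / (2 * fst w))) * of_real (u $ j)
      + of_real (- (1 / (4 * fst w))) * (of_real (u $ j))\<^sup>2)) = heat_sum_term q \<eta> k (a + u) w"
proof (cases "fst w \<in> {0<..1}")
  case True
  let ?t = "fst w" and ?b = "a - lattice_point q (snd w)"
  have "(\<Prod>j\<in>UNIV. exp (of_real (- (?b $ j / (2 * ?t))) * of_real (u $ j) + of_real (- (1 / (4 * ?t))) * (of_real (u $ j))\<^sup>2))
     = complex_of_real (\<Prod>j\<in>UNIV. exp (- (?b $ j / (2 * ?t)) * u $ j + - (1 / (4 * ?t)) * (u $ j)\<^sup>2))"
    unfolding of_real_prod exp_of_real[symmetric] by (simp only: of_real_add of_real_mult of_real_power)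
  moreover have "a + u - lattice_point q (snd w) = ?b + u" by simp
  moreover have "heat_kernel ?t (?b + u) = heat_kernel ?t ?b * (\<Prod>j\<in>UNIV. exp (- (?b $ j / (2 * ?t)) * u $ j + - (1 / (4 * ?t)) * (u $ j)\<^sup>2))"
    by (rule heat_kernel_add) (use True in simp)
  ultimately show ?thesis
    by (simp only: heat_sum_term_def[OF q] of_real_mult mult_scaleR_left mult.assoc)
qed (simp add: heat_sum_term_def[OF q])

text \<open>With d a lower bound for the distance to the lattice,
  \<open>heat_kernel_gauss_bound\<close> dominates the integrand, at the corner of the cube, by a
  Gaussian in l that does not depend on t; this is integrable over the unit time interval times the
  lattice.\<close>

lemma lattice_part_analytic: "real_analytic_on (lattice_part \<eta> k) (- lattice q)"
proof (rule real_analytic_onI)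
  fix a assume "a \<in> - lattice q"
  then obtain d where d: "0 < d" "\<And>l. d \<le> norm (a - lattice_point q l)"
    using lattice_distance[OF q, of a] by auto
  let ?n = "CARD('n)"
  define r where "r = d / (8 * ?n)"
  have r: "0 < r" using d by (simp add: r_def)
  interpret P: pair_sigma_finite "count_space (UNIV :: (int^'n) set)" "lborel :: real measure"
    by (rule pair_sigma_finite_count_space) (rule sigma_finite_lborel)
  interpret Q: pair_sigma_finite "lborel :: real measure" "count_space (UNIV :: (int^'n) set)" ..
  let ?A = "heat_sum_term q \<eta> k a"
  let ?B = "\<lambda>w j. complex_of_real (- ((a - lattice_point q (snd w)) $ j / (2 * fst w)))"
  let ?C = "\<lambda>w::real \<times> (int^'n). complex_of_real (- (1 / (4 * fst w)))"
  let ?F = "\<lambda>w::real \<times> (int^'n). norm (?A w) * (\<Prod>j\<in>UNIV. exp (norm (?B w j) * r + norm (?C w) * r\<^sup>2))"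
  define K where "K = exp (norm k ^ 2) * (fact ?n / (d\<^sup>2 / 16) ^ ?n)"
  let ?G = "\<lambda>w::real \<times> (int^'n). indicator {0<..1} (fst w) * (K * exp (- (1 / 16 * (norm (a - lattice_point q (snd w)))\<^sup>2)))"
  have Gi: "integrable time_lattice ?G"
  proof (rule Q.Fubini_integrable)
    show "?G \<in> borel_measurable time_lattice" by measurable
    have gi: "integrable (count_space UNIV) (\<lambda>l. exp (- (1 / 16 * (norm (a - lattice_point q l))\<^sup>2)))"
      by (rule integrable_gauss_lattice_vec[OF q]) simp
    show "AE t in lborel. integrable (count_space UNIV) (\<lambda>l. ?G (t, l))"
      unfolding fst_conv snd_conv by (intro AE_I2 integrable_mult_right gi)
    have "integrable lborel (\<lambda>t::real. indicator {0<..1} t * (LINT l|count_space UNIV. norm (K * exp (- (1 / 16 * (norm (a - lattice_point q l))\<^sup>2)))))"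
      by (intro integrable_mult_left integrable_real_indicator) auto
    then show "integrable lborel (\<lambda>t. LINT l|count_space UNIV. norm (?G (t, l)))"
      by (simp add: abs_mult)
  qed
  have mA: "?A \<in> borel_measurable time_lattice" using measurable_heat_sum_term[OF q, of "\<lambda>_. a" _ "\<lambda>w. w"] by simp
  have Fi: "integrable time_lattice ?F"
  proof (rule Bochner_Integration.integrable_bound[OF Gi])
    show "?F \<in> borel_measurable time_lattice" using mA by measurable
    show "AE w in time_lattice. norm (?F w) \<le> norm (?G w)"
    proof (rule AE_I2)
      fix w
      show "norm (?F w) \<le> norm (?G w)"
      proof (cases "fst w \<in> {0<..1}")
        case True
        let ?t = "fst w" and ?b = "a - lattice_point q (snd w)"
        let ?p = "\<Prod>j\<in>UNIV. exp (\<bar>?b $ j\<bar> / (2 * ?t) * r + 1 / (4 * ?t) * r\<^sup>2)"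
        have p: "0 \<le> ?p" by (intro prod_nonneg) auto
        have e: "norm (?B w j) * r + norm (?C w) * r\<^sup>2 = \<bar>?b $ j\<bar> / (2 * ?t) * r + 1 / (4 * ?t) * r\<^sup>2" for j
          using True by (simp only: norm_of_real abs_minus_cancel abs_divide) simp
        have "norm (?A w) \<le> exp (norm k ^ 2) * heat_kernel ?t ?b"
          using norm_heat_sum_term[OF q, of \<eta> k a ?t "snd w"] True by simp
        then have "?F w \<le> (exp (norm k ^ 2) * heat_kernel ?t ?b) * ?p"
          unfolding e by (rule mult_right_mono[OF _ p])
        also have "\<dots> = exp (norm k ^ 2) * (heat_kernel ?t ?b * ?p)" by simp
        also have "\<dots> \<le> exp (norm k ^ 2) * (fact ?n / (d\<^sup>2 / 16) ^ ?n * exp (- (1 / 16 * (norm ?b)\<^sup>2)))"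
          using True d r_def by (intro mult_left_mono heat_kernel_gauss_bound) auto
        also have "\<dots> = ?G w" using True by (simp add: K_def)
        finally have "?F w \<le> ?G w" .
        moreover have "0 \<le> ?F w" by (intro mult_nonneg_nonneg prod_nonneg) auto
        ultimately show ?thesis by simp
      qed (simp add: heat_sum_term_def[OF q])
    qed
  qed
  show "\<exists>r>0. \<exists>c. \<forall>u. (\<forall>j. \<bar>u $ j\<bar> \<le> r) \<longrightarrow>
      ((\<lambda>\<beta>. c \<beta> * of_real (monomial_at \<beta> u)) has_sum lattice_part \<eta> k (a + u)) UNIV"
  proof (rule gaussian_integral_power_series[OF sigma_finite_time_lattice r mA, where B = ?B and C = ?C])
    fix c assume c: "\<And>u :: real^'n. (\<And>j. \<bar>u $ j\<bar> \<le> r) \<Longrightarrow>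
      ((\<lambda>\<beta>. c \<beta> * of_real (monomial_at \<beta> u)) has_sum
         (LINT w|time_lattice. ?A w * (\<Prod>j\<in>UNIV. exp (?B w j * of_real (u $ j) + ?C w * (of_real (u $ j))\<^sup>2)))) UNIV"
    then show ?thesis unfolding heat_sum_term_add lattice_part_def[symmetric] using r by blast
  qed (use Fi in \<open>simp_all add: q\<close>)
qed

end

section \<open>Both parts tested against Schwartz functions\<close>

lemma integrable_exp_unit_interval:
    "integrable lborel (\<lambda>t. indicator {0<..1} t *\<^sub>R exp (of_real t * (c :: complex)))"
  and integral_exp_unit_interval:
    "(LINT t|lborel. indicator {0<..1} t *\<^sub>R exp (of_real t * c)) = (if c = 0 then 1 else (exp c - 1) / c)"
proof -
  let ?f = "\<lambda>t. exp (of_real t * c)"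
  have cont: "continuous_on {0..1} ?f" by (intro continuous_intros)
  have ae: "AE t in lborel. indicator {0..1} t *\<^sub>R ?f t = indicator {0<..1} t *\<^sub>R ?f t"
  proof (rule AE_mp[OF AE_lborel_singleton[of "0::real"]], rule AE_I2, rule impI)
    fix t :: real
    assume "t \<noteq> 0"
    then show "indicator {0..1} t *\<^sub>R ?f t = indicator {0<..1} t *\<^sub>R ?f t" by (auto simp: indicator_def)
  qed
  have m: "(\<lambda>t. indicator {0..1} t *\<^sub>R ?f t) \<in> borel_measurable lborel" "(\<lambda>t. indicator {0<..1} t *\<^sub>R ?f t) \<in> borel_measurable lborel"
    by measurable
  have i: "integrable lborel (\<lambda>t. indicator {0..1} t *\<^sub>R ?f t)"
    by (rule borel_integrable_compact[OF compact_Icc cont])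
  then show "integrable lborel (\<lambda>t. indicator {0<..1} t *\<^sub>R ?f t)"
    using integrable_cong_AE[OF m ae] by simp
  have "(LINT t|lborel. indicator {0<..1} t *\<^sub>R ?f t) = (LINT t|lborel. indicator {0..1} t *\<^sub>R ?f t)"
    by (rule integral_cong_AE[OF m ae, symmetric])
  also have "\<dots> = (if c = 0 then 1 else (exp c - 1) / c)"
  proof (cases "c = 0")
    case False
    have "(LINT t|lborel. indicator {0..1} t *\<^sub>R ?f t) = exp (of_real 1 * c) / c - exp (of_real 0 * c) / c"
    proof (rule integral_FTC_Icc)
      show "((\<lambda>t. exp (of_real t * c) / c) has_vector_derivative ?f x) (at x within {0..1})" for x
        by (rule has_vector_derivative_real_field[where f = "\<lambda>z. exp (z * c) / c"])
          (use False in \<open>auto intro!: derivative_eq_intros\<close>)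
    qed (use cont in auto)
    then show ?thesis using False by (simp add: diff_divide_distrib)
  qed simp
  finally show "(LINT t|lborel. indicator {0<..1} t *\<^sub>R ?f t) = (if c = 0 then 1 else (exp c - 1) / c)" .
qed

lemma frequency_sum_integral_swap:
  fixes \<psi> :: "real^'n::finite \<Rightarrow> complex" and e :: "int^'n \<Rightarrow> complex"
  assumes \<psi>: "\<psi> \<in> borel_measurable lborel" "\<And>x. norm (\<psi> x) \<le> C * decay x" and e: "integrable (count_space UNIV) e"
  shows "integrable lborel (\<lambda>x. (LINT z|count_space UNIV. e z * cis (x \<bullet> \<xi> z)) * \<psi> x)"
    and "integrable (count_space UNIV) (\<lambda>z. e z * fourier \<psi> (\<xi> z))"
    and "(LINT x|lborel. (LINT z|count_space UNIV. e z * cis (x \<bullet> \<xi> z)) * \<psi> x) = (LINT z|count_space UNIV. e z * fourier \<psi> (\<xi> z))"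
proof -
  let ?f = "\<lambda>z x. e z * (cis (x \<bullet> \<xi> z) * \<psi> x)"
  have i: "integrable (count_space UNIV \<Otimes>\<^sub>M lborel) (\<lambda>z. ?f (fst z) (snd z))"
  proof (rule integrable_sum_prodI[OF sigma_finite_lborel])
    show "integrable lborel (?f z)" for z by (intro integrable_mult_right integrable_cis_times[OF _ \<psi>(2)]) (use \<psi>(1) in simp)
    have "(LINT x|lborel. norm (?f z x)) = norm (e z) * (LINT x|lborel. norm (\<psi> x))" for z
      by (simp add: norm_mult)
    then show "integrable (count_space UNIV) (\<lambda>z. LINT x|lborel. norm (?f z x))"
      using e by (simp add: integrable_norm)
  qed
  note s = sum_integral_swap[OF sigma_finite_lborel i]
  have 1: "(LINT z|count_space UNIV. ?f z x) = (LINT z|count_space UNIV. e z * cis (x \<bullet> \<xi> z)) * \<psi> x" for x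
    by (simp add: mult.assoc[symmetric])
  have 2: "(LINT x|lborel. ?f z x) = e z * fourier \<psi> (\<xi> z)" for z by (simp add: fourier_def)
  show "integrable lborel (\<lambda>x. (LINT z|count_space UNIV. e z * cis (x \<bullet> \<xi> z)) * \<psi> x)"
    using s(1) unfolding 1 .
  show "integrable (count_space UNIV) (\<lambda>z. e z * fourier \<psi> (\<xi> z))" using s(2) unfolding 2 .
  show "(LINT x|lborel. (LINT z|count_space UNIV. e z * cis (x \<bullet> \<xi> z)) * \<psi> x) = (LINT z|count_space UNIV. e z * fourier \<psi> (\<xi> z))"
    using s(3) unfolding 1 2 .
qed

context
  fixes q :: "real^'n::finite^'n"
  assumes q: "q \<in> pos_diagonal"
begin

text \<open>The factor by which \<Delta> + k^2 acts on the exponential with the frequency of index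
  z.\<close>

definition symbol :: "real^'n \<Rightarrow> complex \<Rightarrow> int^'n \<Rightarrow> complex" where
  "symbol \<eta> k z = k\<^sup>2 - of_real ((norm (frequency q \<eta> z))\<^sup>2)"

definition frequency_coeff :: "real^'n \<Rightarrow> complex \<Rightarrow> int^'n \<Rightarrow> complex" where
  "frequency_coeff \<eta> k z = (if symbol \<eta> k z = 0 then 1 else exp (symbol \<eta> k z) / symbol \<eta> k z) / of_real (cell_volume q)"

definition frequency_part :: "real^'n \<Rightarrow> complex \<Rightarrow> real^'n \<Rightarrow> complex" where
  "frequency_part \<eta> k x = (LINT z|count_space UNIV. frequency_coeff \<eta> k z * cis (x \<bullet> frequency q \<eta> z))"

text \<open>Markov's inequality for the counting measure: a set on which a summable Gaussian stays
  above a positive constant is finite.\<close>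

lemma finite_frequency_ball: "finite {z. (norm (frequency q \<eta> z))\<^sup>2 \<le> R}"
proof -
  let ?u = "\<lambda>z. exp (- (1 * (norm (frequency q \<eta> z))\<^sup>2))"
  have "emeasure (count_space UNIV) {z \<in> space (count_space UNIV). ?u z \<ge> exp (- R)}
      \<le> (1 / exp (- R)) * (LINT z|count_space UNIV. ?u z)"
    by (rule integral_Markov_inequality[OF integrable_gauss_frequency[OF q]]) auto
  also have "\<dots> < \<infinity>" by simp
  finally have "emeasure (count_space UNIV) {z. (norm (frequency q \<eta> z))\<^sup>2 \<le> R} < \<infinity>" by simp
  then show ?thesis using emeasure_count_space_infinite[of "{z. (norm (frequency q \<eta> z))\<^sup>2 \<le> R}" UNIV] by fastforce
qed

text \<open>Outside a finite set of indices the symbol has modulus at least 1, and its exponential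
  is bounded by a multiple of the Gaussian. The finite set contains all zeros and small values of
  the symbol; there the sum of the finitely many ratios serves as the constant.\<close>

lemma frequency_coeff_bound:
  obtains K where "0 \<le> K" "\<And>z. norm (frequency_coeff \<eta> k z) \<le> K * exp (- (norm (frequency q \<eta> z))\<^sup>2)"
proof -
  let ?N = "\<lambda>z. (norm (frequency q \<eta> z))\<^sup>2" and ?e = "frequency_coeff \<eta> k"
  define F where "F = {z. ?N z \<le> norm k ^ 2 + 1}"
  have F: "finite F" unfolding F_def by (rule finite_frequency_ball)
  define K1 where "K1 = exp (norm k ^ 2) / cell_volume q"
  define K2 where "K2 = (\<Sum>z\<in>F. norm (?e z) * exp (?N z))"
  note v = cell_volume_pos[OF q]
  have K: "0 \<le> K1" "0 \<le> K2" using v by (auto simp: K1_def K2_def sum_nonneg)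
  have "norm (?e z) \<le> (K1 + K2) * exp (- ?N z)" for z
  proof (cases "z \<in> F")
    case True
    have "norm (?e z) = (norm (?e z) * exp (?N z)) * exp (- ?N z)" by (simp add: exp_minus)
    also have "norm (?e z) * exp (?N z) \<le> K2"
      unfolding K2_def by (rule member_le_sum[OF True]) (use F in auto)
    also have "K2 \<le> K1 + K2" using K by simp
    finally show ?thesis by (simp add: mult_right_mono)
  next
    case False
    then have n: "norm k ^ 2 + 1 < ?N z" by (simp add: F_def)
    have "?N z - norm (k\<^sup>2) \<le> norm (symbol \<eta> k z)"
      using norm_triangle_ineq2[of "of_real (?N z)" "k\<^sup>2"] by (simp add: symbol_def norm_minus_commute norm_power)
    then have s: "1 \<le> norm (symbol \<eta> k z)" using n by (simp add: norm_power)
    have "Re (symbol \<eta> k z) \<le> norm k ^ 2 - ?N z"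
      using complex_Re_le_cmod[of "k\<^sup>2"] by (simp add: symbol_def norm_power)
    then have "norm (exp (symbol \<eta> k z)) \<le> exp (norm k ^ 2) * exp (- ?N z)" by (simp add: exp_add[symmetric])
    moreover have "norm (exp (symbol \<eta> k z)) / norm (symbol \<eta> k z) \<le> norm (exp (symbol \<eta> k z)) / 1"
      using s by (intro divide_left_mono) (auto intro: mult_pos_pos)
    ultimately have "norm (exp (symbol \<eta> k z)) / norm (symbol \<eta> k z) \<le> exp (norm k ^ 2) * exp (- ?N z)" by simp
    then have "norm (exp (symbol \<eta> k z)) / norm (symbol \<eta> k z) / cell_volume q
        \<le> exp (norm k ^ 2) * exp (- ?N z) / cell_volume q"
      using v by (intro divide_right_mono) auto
    then have "norm (?e z) \<le> K1 * exp (- ?N z)"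
      using s v by (auto simp: frequency_coeff_def K1_def norm_divide)
    also have "\<dots> \<le> (K1 + K2) * exp (- ?N z)" using K by (intro mult_right_mono) auto
    finally show ?thesis .
  qed
  then show ?thesis using K that[of "K1 + K2"] by simp
qed

lemma integrable_frequency_coeff: "integrable (count_space UNIV) (frequency_coeff \<eta> k)"
proof -
  obtain K where K: "0 \<le> K" "\<And>z. norm (frequency_coeff \<eta> k z) \<le> K * exp (- (norm (frequency q \<eta> z))\<^sup>2)"
    by (rule frequency_coeff_bound) blast
  show ?thesis
  proof (rule Bochner_Integration.integrable_bound)
    show "integrable (count_space UNIV) (\<lambda>z. K * exp (- (1 * (norm (frequency q \<eta> z))\<^sup>2)))"
      by (intro integrable_mult_right integrable_gauss_frequency[OF q]) simp
    show "AE z in count_space UNIV. norm (frequency_coeff \<eta> k z) \<le> norm (K * exp (- (1 * (norm (frequency q \<eta> z))\<^sup>2)))"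
      using K by (intro AE_I2) simp
  qed simp
qed

text \<open>The inequality \<bar>y\<bar> \<le> 1 / 2 + y^2 / 2 lets half of the Gaussian decay of
  the coefficients pay for the exponentials at radius 1, around an arbitrary centre. The quadratic
  exponent is 0 here.\<close>

lemma frequency_part_analytic: "real_analytic_on (frequency_part \<eta> k) U"
proof (rule real_analytic_onI)
  fix a
  let ?n = "CARD('n)" and ?\<xi> = "frequency q \<eta>"
  obtain K where K: "0 \<le> K" "\<And>z. norm (frequency_coeff \<eta> k z) \<le> K * exp (- (norm (?\<xi> z))\<^sup>2)"
    by (rule frequency_coeff_bound) blast
  let ?A = "\<lambda>z. frequency_coeff \<eta> k z * cis (a \<bullet> ?\<xi> z)" and ?B = "\<lambda>z j. \<i> * complex_of_real (?\<xi> z $ j)"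
  let ?F = "\<lambda>z. norm (?A z) * (\<Prod>j\<in>UNIV. exp (norm (?B z j) * 1 + norm (0::complex) * 1\<^sup>2))"
  have sf: "sigma_finite_measure (count_space (UNIV :: (int^'n) set))"
    by (rule sigma_finite_measure_count_space_countable) simp
  have F: "integrable (count_space UNIV) ?F"
  proof (rule Bochner_Integration.integrable_bound)
    show "integrable (count_space UNIV) (\<lambda>z. K * exp (?n / 2) * exp (- (1 / 2 * (norm (?\<xi> z))\<^sup>2)))"
      by (intro integrable_mult_right integrable_gauss_frequency[OF q]) simp
    show "AE z in count_space UNIV. norm (?F z) \<le> norm (K * exp (?n / 2) * exp (- (1 / 2 * (norm (?\<xi> z))\<^sup>2)))"
    proof (rule AE_I2)
      fix z
      have y: "\<bar>y\<bar> \<le> 1 / 2 + 1 / 2 * y\<^sup>2" for y :: real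
        using zero_le_power2[of "\<bar>y\<bar> - 1"] by (simp add: power2_diff)
      have "(\<Prod>j\<in>UNIV. exp (norm (?B z j) * 1 + norm (0::complex) * 1\<^sup>2)) = exp (\<Sum>j\<in>UNIV. \<bar>?\<xi> z $ j\<bar>)"
        by (simp add: exp_sum norm_mult)
      also have "\<dots> \<le> exp (\<Sum>j\<in>(UNIV::'n set). 1 / 2 + 1 / 2 * (?\<xi> z $ j)\<^sup>2)"
        unfolding exp_le_cancel_iff by (intro sum_mono y)
      also have "(\<Sum>j\<in>(UNIV::'n set). 1 / 2 + 1 / 2 * (?\<xi> z $ j)\<^sup>2) = ?n / 2 + 1 / 2 * (norm (?\<xi> z))\<^sup>2"
        by (simp add: sum.distrib sum_distrib_left[symmetric] norm_vec_def L2_set_def sum_nonneg sum_divide_distrib[symmetric])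
      finally have p: "(\<Prod>j\<in>UNIV. exp (norm (?B z j) * 1 + norm (0::complex) * 1\<^sup>2)) \<le> exp (?n / 2 + 1 / 2 * (norm (?\<xi> z))\<^sup>2)" .
      have "?F z \<le> (K * exp (- (norm (?\<xi> z))\<^sup>2)) * exp (?n / 2 + 1 / 2 * (norm (?\<xi> z))\<^sup>2)"
        using K p by (intro mult_mono) (auto simp: norm_mult prod_nonneg)
      also have "\<dots> = K * exp (?n / 2) * exp (- (1 / 2 * (norm (?\<xi> z))\<^sup>2))"
        by (simp only: mult.assoc exp_add[symmetric]) (simp add: field_simps)
      finally have "?F z \<le> K * exp (?n / 2) * exp (- (1 / 2 * (norm (?\<xi> z))\<^sup>2))" .
      moreover have "0 \<le> ?F z" by (intro mult_nonneg_nonneg prod_nonneg) auto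
      ultimately show "norm (?F z) \<le> norm (K * exp (?n / 2) * exp (- (1 / 2 * (norm (?\<xi> z))\<^sup>2)))" by simp
    qed
  qed simp
  have eq: "?A z * (\<Prod>j\<in>UNIV. exp (?B z j * of_real (u $ j) + 0 * (of_real (u $ j))\<^sup>2))
      = frequency_coeff \<eta> k z * cis ((a + u) \<bullet> ?\<xi> z)" for z u
  proof -
    have "cis (u \<bullet> ?\<xi> z) = (\<Prod>j\<in>UNIV. cis (u $ j * ?\<xi> z $ j))"
      by (simp only: inner_vec_def inner_real_def cis_sum)
    also have "\<dots> = (\<Prod>j\<in>UNIV. exp (?B z j * of_real (u $ j) + 0 * (of_real (u $ j))\<^sup>2))"
      by (intro prod.cong) (simp_all add: cis_conv_exp mult_ac)
    finally have "cis (u \<bullet> ?\<xi> z) = (\<Prod>j\<in>UNIV. exp (?B z j * of_real (u $ j) + 0 * (of_real (u $ j))\<^sup>2))" .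
    then show ?thesis by (simp add: inner_add_left cis_mult[symmetric])
  qed
  show "\<exists>r>0. \<exists>c. \<forall>u. (\<forall>j. \<bar>u $ j\<bar> \<le> r) \<longrightarrow>
      ((\<lambda>\<beta>. c \<beta> * of_real (monomial_at \<beta> u)) has_sum frequency_part \<eta> k (a + u)) UNIV"
  proof (rule gaussian_integral_power_series[where N = "count_space (UNIV :: (int^'n) set)" and A = ?A and B = ?B and C = "\<lambda>_. 0" and r = 1])
    fix c assume c: "\<And>u :: real^'n. (\<And>j. \<bar>u $ j\<bar> \<le> 1) \<Longrightarrow>
      ((\<lambda>\<beta>. c \<beta> * of_real (monomial_at \<beta> u)) has_sum
         (LINT z|count_space UNIV. ?A z * (\<Prod>j\<in>UNIV. exp (?B z j * of_real (u $ j) + 0 * (of_real (u $ j))\<^sup>2)))) UNIV"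
    have "(0::real) < 1" by simp
    then show ?thesis using c unfolding eq frequency_part_def[symmetric] by blast
  qed (use F sf in simp_all)
qed

text \<open>The theta identity at a fixed time, tested against \<psi>: the lattice sum and the
  frequency sum are both exchanged with the integral in x.\<close>

lemma heat_pairing:
  assumes \<psi>: "\<psi> \<in> borel_measurable lborel" "\<And>x. norm (\<psi> x) \<le> C * decay x" and t: "0 < t"
  shows "(LINT l|count_space UNIV. LINT x|lborel. cis (\<eta> \<bullet> lattice_point q l) * of_real (heat_kernel t (x - lattice_point q l)) * \<psi> x)
    = of_real (1 / cell_volume q) * (LINT z|count_space UNIV. of_real (exp (- (t * (norm (frequency q \<eta> z))\<^sup>2))) * fourier \<psi> (frequency q \<eta> z))"
proof -
  have e: "integrable (count_space UNIV) (\<lambda>z. complex_of_real (exp (- (t * (norm (frequency q \<eta> z))\<^sup>2))))"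
    by (intro integrable_of_real integrable_gauss_frequency[OF q] t)
  have "(LINT l|count_space UNIV. LINT x|lborel. cis (\<eta> \<bullet> lattice_point q l) * of_real (heat_kernel t (x - lattice_point q l)) * \<psi> x)
     = (LINT x|lborel. LINT l|count_space UNIV. cis (\<eta> \<bullet> lattice_point q l) * of_real (heat_kernel t (x - lattice_point q l)) * \<psi> x)"
    by (rule sum_integral_swap(3)[OF sigma_finite_lborel integrable_heat_lattice_fixed_time[OF q \<psi> t], symmetric])
  also have "\<dots> = (LINT x|lborel. of_real (1 / cell_volume q) * ((LINT z|count_space UNIV.
         of_real (exp (- (t * (norm (frequency q \<eta> z))\<^sup>2))) * cis (x \<bullet> frequency q \<eta> z)) * \<psi> x))"
  proof (rule Bochner_Integration.integral_cong[OF refl])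
    fix x
    have "(LINT l|count_space UNIV. cis (\<eta> \<bullet> lattice_point q l) * of_real (heat_kernel t (x - lattice_point q l)) * \<psi> x)
      = (LINT l|count_space UNIV. cis (\<eta> \<bullet> lattice_point q l) * of_real (heat_kernel t (x - lattice_point q l))) * \<psi> x"
      by (rule integral_mult_left_zero)
    then show "(LINT l|count_space UNIV. cis (\<eta> \<bullet> lattice_point q l) * of_real (heat_kernel t (x - lattice_point q l)) * \<psi> x)
      = of_real (1 / cell_volume q) * ((LINT z|count_space UNIV.
         of_real (exp (- (t * (norm (frequency q \<eta> z))\<^sup>2))) * cis (x \<bullet> frequency q \<eta> z)) * \<psi> x)"
      unfolding theta_transformation_vec[OF q t] mult.assoc .
  qed
  also have "\<dots> = of_real (1 / cell_volume q) * (LINT z|count_space UNIV. of_real (exp (- (t * (norm (frequency q \<eta> z))\<^sup>2))) * fourier \<psi> (frequency q \<eta> z))"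
    by (simp only: integral_mult_right_zero frequency_sum_integral_swap(3)[OF \<psi> e])
  finally show ?thesis .
qed

text \<open>Time is left outermost, so that \<open>heat_pairing\<close> can be applied to the inner
  sum and integral at each fixed t.\<close>

lemma lattice_part_pairing:
  assumes \<psi>: "\<psi> \<in> borel_measurable lborel" "\<And>x. norm (\<psi> x) \<le> C * decay x"
  shows "integrable lborel (\<lambda>x. lattice_part q \<eta> k x * \<psi> x)"
    and "(LINT x|lborel. lattice_part q \<eta> k x * \<psi> x)
       = (LINT t|lborel. LINT l|count_space UNIV. LINT x|lborel. heat_sum_term q \<eta> k x (t, l) * \<psi> x)"
proof -
  interpret T: sigma_finite_measure "time_lattice :: (real \<times> (int^'n)) measure" by (rule sigma_finite_time_lattice)
  interpret pair_sigma_finite "lborel :: (real^'n) measure" "time_lattice :: (real \<times> (int^'n)) measure" ..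
  interpret Z: sigma_finite_measure "count_space (UNIV :: (int^'n) set)"
    by (rule sigma_finite_measure_count_space_countable) simp
  interpret L: pair_sigma_finite "lborel :: real measure" "count_space (UNIV :: (int^'n) set)" ..
  have i: "integrable (lborel \<Otimes>\<^sub>M time_lattice) (\<lambda>(x, w). heat_sum_term q \<eta> k x w * \<psi> x)"
    using integrable_heat_sum_term[OF q \<psi>] by (simp add: split_beta')
  show "integrable lborel (\<lambda>x. lattice_part q \<eta> k x * \<psi> x)"
    using integrable_fst[OF i] by (simp add: lattice_part_def[OF q])
  have "(LINT x|lborel. lattice_part q \<eta> k x * \<psi> x) = (LINT x|lborel. LINT w|time_lattice. heat_sum_term q \<eta> k x w * \<psi> x)"
    by (simp add: lattice_part_def[OF q])
  also have "\<dots> = (LINT w|time_lattice. LINT x|lborel. heat_sum_term q \<eta> k x w * \<psi> x)"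
    by (rule Fubini_integral[OF i, symmetric])
  also have "\<dots> = (LINT t|lborel. LINT l|count_space UNIV. LINT x|lborel. heat_sum_term q \<eta> k x (t, l) * \<psi> x)"
    using L.integral_fst'[OF integrable_snd[OF i]] by simp
  finally show "(LINT x|lborel. lattice_part q \<eta> k x * \<psi> x)
       = (LINT t|lborel. LINT l|count_space UNIV. LINT x|lborel. heat_sum_term q \<eta> k x (t, l) * \<psi> x)" .
qed

lemma integrable_fourier_frequency:
  assumes "schwartz \<phi>"
  shows "integrable (count_space UNIV) (\<lambda>z. fourier \<phi> (frequency q \<eta> z))"
proof -
  obtain C where C: "0 \<le> C" "\<And>\<xi>. norm (fourier \<phi> \<xi>) \<le> C * decay \<xi>" using fourier_decay[OF assms] by blast
  obtain S where S: "\<And>y. integrable (count_space UNIV) (\<lambda>l::int^'n. decay (y + (\<chi> j. (2 * pi / q $ j $ j) * of_int (l $ j))))"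
    by (rule decay_lattice_sum[of "\<lambda>j. 2 * pi / q $ j $ j"]) (use q_nz[OF q] in auto)
  have f: "\<eta> + (\<chi> j. (2 * pi / q $ j $ j) * of_int (l $ j)) = frequency q \<eta> l" for l
    by (simp add: vec_eq_iff frequency_component[OF q])
  show ?thesis
  proof (rule Bochner_Integration.integrable_bound)
    show "integrable (count_space UNIV) (\<lambda>z. C * decay (frequency q \<eta> z))"
      using S[of \<eta>] unfolding f by (rule integrable_mult_right)
    show "AE z in count_space UNIV. norm (fourier \<phi> (frequency q \<eta> z)) \<le> norm (C * decay (frequency q \<eta> z))"
      by (intro AE_I2) (simp only: real_norm_def order.trans[OF C(2) abs_ge_self])
  qed simp
qed

text \<open>Since exp (t k^2) times the Gaussian in the frequency is exp (t \<lambda>), integration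
  over the time interval gives (exp \<lambda> - 1) / \<lambda>, or 1 at a resonance. As t tends to 0
  the Gaussian stops damping the high frequencies; the exchange of time integral and frequency sum
  rests on the summable Fourier transform of the Schwartz function.\<close>

lemma lattice_part_fourier_series:
  fixes \<eta> :: "real^'n" and k :: complex
  assumes \<phi>: "schwartz \<phi>"
  defines "I \<equiv> \<lambda>z. (if symbol \<eta> k z = 0 then 1 else (exp (symbol \<eta> k z) - 1) / symbol \<eta> k z)"
  shows "integrable (count_space UNIV) (\<lambda>z. I z / of_real (cell_volume q) * fourier \<phi> (frequency q \<eta> z))"
    and "(LINT x|lborel. lattice_part q \<eta> k x * \<phi> x)
      = (LINT z|count_space UNIV. I z / of_real (cell_volume q) * fourier \<phi> (frequency q \<eta> z))"
proof -
  obtain C where b: "\<And>x. norm (\<phi> x) \<le> C * decay x" using schwartz_decay[OF \<phi>, of "[]"] by auto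
  have m: "\<phi> \<in> borel_measurable lborel"
    using borel_measurable_continuous_onI[OF schwartz_continuous[OF \<phi>, of UNIV "[]"]] by simp
  let ?v = "complex_of_real (cell_volume q)" and ?F = "\<lambda>z. fourier \<phi> (frequency q \<eta> z)"
  let ?g = "\<lambda>z t. indicator {0<..1} t *\<^sub>R exp (of_real t * symbol \<eta> k z)"
  let ?f = "\<lambda>z t. (?F z / ?v) * ?g z t"
  have time: "(LINT l|count_space UNIV. LINT x|lborel. heat_sum_term q \<eta> k x (t, l) * \<phi> x) = (LINT z|count_space UNIV. ?f z t)" for t
  proof (cases "t \<in> {0<..1}")
    case True
    have e: "of_real (exp (- (t * (norm (frequency q \<eta> z))\<^sup>2))) * ?F z
        = exp (- (of_real t * k\<^sup>2)) * (exp (of_real t * symbol \<eta> k z) * ?F z)" for z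
    proof -
      have "complex_of_real (exp (- (t * (norm (frequency q \<eta> z))\<^sup>2)))
          = exp (- (of_real t * k\<^sup>2)) * exp (of_real t * symbol \<eta> k z)"
        by (simp only: exp_of_real[symmetric] exp_add[symmetric] symbol_def) (simp add: algebra_simps)
      then show ?thesis by (simp only: mult.assoc)
    qed
    have "(LINT l|count_space UNIV. LINT x|lborel. heat_sum_term q \<eta> k x (t, l) * \<phi> x)
        = (LINT l|count_space UNIV. LINT x|lborel. exp (of_real t * k\<^sup>2) * (cis (\<eta> \<bullet> lattice_point q l) * of_real (heat_kernel t (x - lattice_point q l)) * \<phi> x))"
      using True by (simp add: heat_sum_term_def[OF q] mult.assoc)
    also have "\<dots> = exp (of_real t * k\<^sup>2) * (of_real (1 / cell_volume q) *
        (LINT z|count_space UNIV. of_real (exp (- (t * (norm (frequency q \<eta> z))\<^sup>2))) * ?F z))"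
      using heat_pairing[OF m b, of t \<eta>] True by (simp only: integral_mult_right_zero) simp
    also have "\<dots> = (LINT z|count_space UNIV. ?f z t)"
    proof -
      have f: "?f z t = of_real (1 / cell_volume q) * (exp (of_real t * symbol \<eta> k z) * ?F z)" for z
        using True by (simp add: field_simps)
      have "exp (of_real t * k\<^sup>2) * (w * (exp (- (of_real t * k\<^sup>2)) * y)) = w * y" for w y
        by (simp add: exp_minus)
      then show ?thesis unfolding e f integral_mult_right_zero .
    qed
    finally show ?thesis .
  qed (simp add: heat_sum_term_def[OF q])
  have gi: "integrable lborel (?g z)" for z by (rule integrable_exp_unit_interval)
  have fi: "integrable lborel (?f z)" for z by (intro integrable_mult_right gi)
  have i: "integrable (count_space UNIV \<Otimes>\<^sub>M lborel) (\<lambda>z. ?f (fst z) (snd z))"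
  proof (rule integrable_sum_prodI[OF sigma_finite_lborel fi])
    show "integrable (count_space UNIV) (\<lambda>z. LINT t|lborel. norm (?f z t))"
    proof (rule Bochner_Integration.integrable_bound)
      show "integrable (count_space UNIV) (\<lambda>z. norm (?F z / ?v) * exp (norm k ^ 2))"
        by (intro integrable_mult_left integrable_norm integrable_divide integrable_fourier_frequency \<phi>)
      show "AE z in count_space UNIV. norm (LINT t|lborel. norm (?f z t)) \<le> norm (norm (?F z / ?v) * exp (norm k ^ 2))"
      proof (rule AE_I2)
        fix z
        have "(LINT t|lborel. norm (?g z t)) \<le> (LINT t|lborel. indicator {0<..(1::real)} t * exp (norm k ^ 2))"
        proof (rule integral_mono)
          show "integrable lborel (\<lambda>t::real. indicator {0<..1} t * exp (norm k ^ 2))"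
            by (intro integrable_mult_left integrable_real_indicator) auto
          fix t :: real
          \<comment> \<open>The squared frequency only lowers the real part of the symbol, so the
            growth is bounded by that of k alone, uniformly in z and t.\<close>
          have "norm (exp (of_real t * symbol \<eta> k z)) \<le> exp (norm k ^ 2)" if t: "0 < t" "t \<le> 1"
          proof -
            have "Re (symbol \<eta> k z) \<le> Re (k\<^sup>2)" by (simp add: symbol_def)
            also have "\<dots> \<le> norm k ^ 2" using complex_Re_le_cmod[of "k\<^sup>2"] by (simp add: norm_power)
            finally have "t * Re (symbol \<eta> k z) \<le> t * norm k ^ 2" using t by simp
            also have "\<dots> \<le> norm k ^ 2" using t by (simp add: mult_left_le_one_le)
            finally show ?thesis by simp
          qed
          then show "norm (?g z t) \<le> indicator {0<..1} t * exp (norm k ^ 2)" by (auto simp: indicator_def)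
        qed (use integrable_norm[OF gi] in simp)
        also have "\<dots> = exp (norm k ^ 2)" by simp
        finally have "(LINT t|lborel. norm (?g z t)) \<le> exp (norm k ^ 2)" .
        then have "norm (?F z / ?v) * (LINT t|lborel. norm (?g z t)) \<le> norm (?F z / ?v) * exp (norm k ^ 2)"
          by (rule mult_left_mono) simp
        moreover have "(LINT t|lborel. norm (?f z t)) = norm (?F z / ?v) * (LINT t|lborel. norm (?g z t))"
          by (simp only: norm_mult integral_mult_right_zero)
        moreover have "0 \<le> (LINT t|lborel. norm (?f z t))" by (rule Bochner_Integration.integral_nonneg) simp
        ultimately show "norm (LINT t|lborel. norm (?f z t)) \<le> norm (norm (?F z / ?v) * exp (norm k ^ 2))" by simp
      qed
    qed simp
  qed
  have I: "(LINT t|lborel. ?f z t) = I z / ?v * ?F z" for z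
    unfolding I_def integral_mult_right_zero integral_exp_unit_interval by simp
  show "integrable (count_space UNIV) (\<lambda>z. I z / ?v * ?F z)"
    using sum_integral_swap(2)[OF sigma_finite_lborel i] unfolding I .
  have "(LINT x|lborel. lattice_part q \<eta> k x * \<phi> x) = (LINT t|lborel. LINT z|count_space UNIV. ?f z t)"
    unfolding lattice_part_pairing(2)[OF m b] time ..
  also have "\<dots> = (LINT z|count_space UNIV. I z / ?v * ?F z)"
    using sum_integral_swap(3)[OF sigma_finite_lborel i] unfolding I .
  finally show "(LINT x|lborel. lattice_part q \<eta> k x * \<phi> x) = (LINT z|count_space UNIV. I z / ?v * ?F z)" .
qed

theorem is_green_split: "is_green q \<eta> k (\<lambda>x. frequency_part \<eta> k x - lattice_part q \<eta> k x)"
  unfolding is_green_def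
proof (intro conjI allI impI)
  let ?g = "\<lambda>x. frequency_part \<eta> k x - lattice_part q \<eta> k x"
  have int: "integrable lborel (\<lambda>x. ?g x * \<psi> x)"
    if "\<psi> \<in> borel_measurable lborel" "\<And>x. norm (\<psi> x) \<le> C * decay x" for \<psi> C
    using frequency_sum_integral_swap(1)[OF that integrable_frequency_coeff, of \<eta> k "frequency q \<eta>", folded frequency_part_def]
      lattice_part_pairing(1)[OF that, of \<eta> k]
    by (simp add: left_diff_distrib)
  fix K :: "(real^'n) set" assume K: "compact K"
  then obtain R where R: "\<And>x. x \<in> K \<Longrightarrow> norm x \<le> R" using compact_imp_bounded bounded_iff by metis
  \<comment> \<open>Local integrability is the pairing with the indicator of K, which is at most a
    multiple of \<open>decay\<close> because K is bounded.\<close>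
  let ?\<psi> = "\<lambda>x. complex_of_real (indicator K x)"
  have "norm (?\<psi> x) \<le> (1 + \<bar>R\<bar>) ^ (2 * CARD('n)) * decay x" for x
  proof (cases "x \<in> K")
    case True
    have "1 \<le> (1 + norm x) ^ (2 * CARD('n)) * decay x" by (rule norm_power_decay)
    also have "\<dots> \<le> (1 + \<bar>R\<bar>) ^ (2 * CARD('n)) * decay x"
      using R[OF True] decay_pos[of x] by (intro mult_right_mono power_mono) auto
    finally show ?thesis using True by simp
  qed (simp add: decay_pos less_imp_le)
  moreover have "?\<psi> \<in> borel_measurable lborel" using borel_compact[OF K] by simp
  ultimately have "integrable lborel (\<lambda>x. ?g x * ?\<psi> x)" by (intro int)
  then show "set_integrable lborel K ?g" by (simp add: set_integrable_def scaleR_conv_of_real mult.commute)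
next
  show "real_analytic_on (\<lambda>x. frequency_part \<eta> k x - lattice_part q \<eta> k x) (- lattice q)"
    by (intro real_analytic_on_diff frequency_part_analytic lattice_part_analytic[OF q])
next
  fix \<phi> :: "real^'n \<Rightarrow> complex" assume \<phi>: "schwartz \<phi>"
  obtain C where b: "\<And>x. norm (\<phi> x) \<le> C * decay x" using schwartz_decay[OF \<phi>, of "[]"] by auto
  have m: "\<phi> \<in> borel_measurable lborel"
    using borel_measurable_continuous_onI[OF schwartz_continuous[OF \<phi>, of UNIV "[]"]] by simp
  let ?v = "complex_of_real (cell_volume q)" and ?F = "\<lambda>z. fourier \<phi> (frequency q \<eta> z)" and ?s = "symbol \<eta> k"
  note E = frequency_sum_integral_swap[OF m b integrable_frequency_coeff, of \<eta> k "frequency q \<eta>", folded frequency_part_def]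
  note H = lattice_part_pairing(1)[OF m b, of \<eta> k] lattice_part_fourier_series[OF \<phi>, of \<eta> k]
  show "integrable lborel (\<lambda>x. (frequency_part \<eta> k x - lattice_part q \<eta> k x) * \<phi> x)"
    using E(1) H(1) by (simp add: left_diff_distrib)
  have "(LINT x|lborel. (frequency_part \<eta> k x - lattice_part q \<eta> k x) * \<phi> x)
     = (LINT z|count_space UNIV. frequency_coeff \<eta> k z * ?F z
          - (if ?s z = 0 then 1 else (exp (?s z) - 1) / ?s z) / ?v * ?F z)"
    using E H by (simp add: left_diff_distrib)
  \<comment> \<open>The exponentials cancel and leave the reciprocal of the symbol; at a resonance
    both coefficients are the reciprocal of the cell volume and cancel entirely.\<close>
  moreover have "frequency_coeff \<eta> k z * ?F z - (if ?s z = 0 then 1 else (exp (?s z) - 1) / ?s z) / ?v * ?F z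
     = (if ?s z = 0 then 0 else ?F z / (?v * ?s z))" for z
    by (simp add: frequency_coeff_def diff_divide_distrib left_diff_distrib)
  moreover have "integrable (count_space UNIV) (\<lambda>z. frequency_coeff \<eta> k z * ?F z
          - (if ?s z = 0 then 1 else (exp (?s z) - 1) / ?s z) / ?v * ?F z)"
    by (intro Bochner_Integration.integrable_diff E(2) H(2))
  ultimately have "((\<lambda>z. if ?s z = 0 then 0 else ?F z / (?v * ?s z)) has_sum
      (LINT x|lborel. (frequency_part \<eta> k x - lattice_part q \<eta> k x) * \<phi> x)) UNIV"
    using integral_count_space_has_sum[of "\<lambda>z. if ?s z = 0 then 0 else ?F z / (?v * ?s z)"] by simp
  \<comment> \<open>Resonant indices contribute 0, so the sum over all indices equals the sum over
    the nonresonant ones.\<close>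
  moreover have "((\<lambda>z. if ?s z = 0 then 0 else ?F z / (?v * ?s z)) has_sum y) UNIV \<longleftrightarrow>
      ((\<lambda>z. (LINT x|lborel. exp (\<i> * of_real (x \<bullet> frequency q \<eta> z)) * \<phi> x)
          / (of_real (measure lborel (cell q)) * (k\<^sup>2 - of_real ((norm (frequency q \<eta> z))\<^sup>2)))) has_sum y) (UNIV - resonant q \<eta> k)" for y
    by (rule has_sum_cong_neutral) (auto simp: resonant_def symbol_def fourier_def measure_cell[OF q] cis_conv_exp)
  ultimately show "((\<lambda>z. (LINT x|lborel. exp (\<i> * of_real (x \<bullet> frequency q \<eta> z)) * \<phi> x)
          / (of_real (measure lborel (cell q)) * (k\<^sup>2 - of_real ((norm (frequency q \<eta> z))\<^sup>2)))) has_sum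
      (LINT x|lborel. (frequency_part \<eta> k x - lattice_part q \<eta> k x) * \<phi> x)) (UNIV - resonant q \<eta> k)" by simp
qed

end

theorem proposition5p8:
  fixes \<alpha> \<epsilon>\<^sub>0 \<epsilon>\<^sub>V :: real
    and q :: "real^'n::finite^'n"
    and \<eta> p :: "real^'n"
    and k :: complex
    and \<Omega> V :: "(real^'n) set"
    and P :: "real \<Rightarrow> (real^'n \<Rightarrow> complex) \<Rightarrow> (real^'n \<Rightarrow> complex)"
  assumes "CARD('n) \<ge> 2"
    and "0 < \<alpha>" and "\<alpha> < 1"
    and "q \<in> pos_diagonal"
    and "bounded \<Omega>" and "connected \<Omega>" and "of_class_C1a \<alpha> \<Omega>"
    and "connected (- closure \<Omega>)"
    and "p \<in> cell q"
    and "0 < \<epsilon>\<^sub>0"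
    and "\<And>\<epsilon>. \<epsilon> \<in> {-\<epsilon>\<^sub>0<..<\<epsilon>\<^sub>0} \<Longrightarrow> rescaled (closure \<Omega>) p \<epsilon> \<subseteq> cell q"
    and "bounded V" and "open V"
    and "closure V \<inter> {p + l | l. l \<in> lattice q} = {}"
    and "0 < \<epsilon>\<^sub>V" and "\<epsilon>\<^sub>V < \<epsilon>\<^sub>0"
    and "\<And>\<epsilon>. \<epsilon> \<in> {-\<epsilon>\<^sub>V<..<\<epsilon>\<^sub>V} \<Longrightarrow> closure V \<subseteq> periodic_exterior q (rescaled \<Omega> p \<epsilon>)"
    and "P = (\<lambda>\<epsilon> \<theta> x. if x \<in> closure V
               then - (LINT s:frontier \<Omega>|surface_measure.
                         dot_grad (outward_normal \<Omega> s) (green q \<eta> k) (x - p - \<epsilon> *\<^sub>R s) * \<theta> s)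
               else 0)"
  shows "real_analytic_ops (C1a_boundary \<alpha> \<Omega>) (C1a_boundary_norm \<alpha> \<Omega>) (C2_closure V) (C2_norm V)
           {-\<epsilon>\<^sub>V<..<\<epsilon>\<^sub>V} P
         \<and> (\<forall>\<theta> \<in> C1a_boundary \<alpha> \<Omega>. \<forall>\<epsilon> \<in> {0<..<\<epsilon>\<^sub>V}. \<forall>x \<in> closure V.
           double_layer_minus q \<eta> k (rescaled \<Omega> p \<epsilon>) (\<lambda>y. \<theta> ((y - p) /\<^sub>R \<epsilon>)) x
             = of_real (\<epsilon> ^ (CARD('n) - 1)) * P \<epsilon> \<theta> x)"
proof -
  have "is_green q \<eta> k (green q \<eta> k)"
    unfolding green_def by (rule someI[of "is_green q \<eta> k", OF is_green_split[OF \<open>q \<in> pos_diagonal\<close>]])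
  from layer_potential_of_green[OF this assms(1,2,5,7,12,13,17,18)] show ?thesis by blast
qed

end
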